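(* Consider the $MAP_K|G_K|\infty$ model with random resources in a semi-Markov environment with finite state space $S$ and initial distribution $\{p_i^0,i\in S\}$, subject to catastrophes and repairs. Let $\tilde P(n,m,s_1,s_2,t,i)$ and $\tilde{\bar P}(n,m,s_1,s_2,t,i)$ denote the transforms for the model with catastrophes (environment started in $i$) and without catastrophes (environment state fixed at $i$), and let $\tilde P(z_1,z_2,s_1,s_2,t,i)$ and $\tilde{\bar P}(z_1,z_2,s_1,s_2,t,i)$ be their generating functions in $(n,m)$, $|z_{1r}|\le 1$, $|z_{2r}|\le1$. Then the limiting distributions have the form $$\tilde P(n,m,s_1,s_2)=\lim_{t\to\infty}\sum_{i\in S}p_i^0\tilde P(n,m,s_1,s_2,t,i)=\sum_{j\in S}\frac{q_j}{\bar\eta_j}\int_0^\infty(1-F_j(u))\,\tilde{\bar P}(n,m,s_1,s_2,u,j)\,du,$$ $$\tilde P(z_1,z_2,s_1,s_2)=\lim_{t\to\infty}\sum_{i\in S}p_i^0\tilde P(z_1,z_2,s_1,s_2,t,i)=\sum_{j\in S}\frac{q_j}{\bar\eta_j}\int_0^\infty(1-F_j(u))\,\tilde{\bar P}(z_1,z_2,s_1,s_2,u,j)\,du,$$ where $F_j(t)=\sum_{k\in S}T_{jk}(t)$, $$\bar\eta_i=\int_0^\infty\Big(1-\sum_{j\in S}Q_{ij}(u)\Big)du,\qquad q_i=\frac{\bar\eta_i\rho_i}{\sum_{r\in S}\bar\eta_r\rho_r},\qquad \sum_{r\in S} q_r=1,$$ $$\rho_i=\sum_{r\in S}p_{ri}\rho_r,\qquad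 \sum_{r\in S}\rho_r=1,\qquad p_{ri}=Q_{ri}(\infty),\quad r,i\in S.$$
   Context: Environment: an irreducible semi-Markov process with finite state space $S$, initial distribution $\{p_i^0\}$ and semi-Markov matrix $T(t)=\|T_{ij}(t)\|$; i.e. on entering state $i$, $T_{ij}(t)$ is the probability that the sojourn in $i$ lasts at most $t$ and the next state is $j$. At each transition of the environment a catastrophe occurs: all customers are removed and the model goes into a failed state. If the new environment state is $j$, the repair time has distribution function $U_j$ with finite mean, independent of everything else. On completion of the repair the model starts anew from the empty state with the parameters of environment state $j$. $Q_{ij}=T_{ij}*U_j$ (Stieltjes convolution). Model without catastrophes in environment state $i$: $K$ types of customers arrive according to the superposition of $K$ independent Markov arrival processes with parameters depending on $i$; there are infinitely many servers, service starts on arrival, type-$r$ service times are i.i.d. with distribution function $B_{ri}$; each type-$r$ customer has an i.i.d. resource vector in $[0,\infty)^d$ with distribution $C_{ri}$ while in the model and an i.i.d. departure resource vector in $[0,\infty)^d$ with distribution $G_{ri}$; arrivals, service times and resource vectors are mutually independent; the model is empty at time $0$. $N_s(t)$ and $M(t)$ (in $\mathbb Z_{\ge0}^K$) are the numbers of customers of each type in service at time $t$ and served in $[0,t)$; $\alpha(t)$ is the sum of the resource vectors of the customers in service at $t$; $\beta(t)$ the sum of the departure resource vectors of the customers served in $[0,t)$; $J(t)$ is the phase of the superposed arrival process. For $n,m\in\mathbb Z_{\ge0}^K$ and $s_1,s_2\in[0,\infty)^d$, $\tilde{\bar P}(n,m,s_1,s_2,t,i)$ is the matrix with entries (row $k$,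 column $l$) $$\mathbb E\big[\mathbf 1\{N_s(t)=n,\,M(t)=m,\,J(t)=l\}\,e^{-s_1\cdot\alpha(t)-s_2\cdot\beta(t)}\,\big|\,J(0)=k\big].$$ Model with catastrophes: at time $0$ the environment enters state $i$ and the model is empty and operating with phase $k$; after each completed repair into environment state $j$ an independent fresh copy of the model without catastrophes for state $j$ is started, from the empty state, with all counters $N_s,M,\alpha,\beta$ equal to $0$ and with the phase process again in its initial phase $k$, and runs until the next environment transition. $\tilde P(n,m,s_1,s_2,t,i)$ is the matrix with entries (row $k$, column $l$) equal to the same expectation at time $t$, restricted to the event that the model is operating (not under repair) at time $t$. Generating functions: $\tilde P(z_1,z_2,s_1,s_2,t,i)=\sum_{n,m}z_1^nz_2^m\tilde P(n,m,s_1,s_2,t,i)$, and likewise for $\tilde{\bar P}$, with $z^n=\prod_rz_r^{n_r}$.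
   Formalization: Two assumptions are added: the integrals defining η̄_i converge (finite mean sojourn plus repair), else q_i is undefined; and return times of the Markov renewal process with kernel Q are non-lattice, else the limit may fail to exist (e.g. one state, sojourn and repair both equal to 1). *)

theory Defs
  imports "HOL-Probability.Probability"
begin

section \<open>Distribution functions and semi-Markov matrices\<close>

definition sub_distribution_function :: "(real \<Rightarrow> real) \<Rightarrow> bool" where
  "sub_distribution_function A \<longleftrightarrow>
     mono A \<and> (\<forall>t. continuous (at_right t) A) \<and> (\<forall>t<0. A t = 0)"

text \<open>All distribution functions here are those of non-negative proper random variables;
  an atom at \<open>0\<close> is allowed.\<close>
definition distribution_function :: "(real \<Rightarrow> real) \<Rightarrow> bool" where
  "distribution_function A \<longleftrightarrow> sub_distribution_function A \<and> (A \<longlongrightarrow> 1) at_top"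

definition stieltjes_conv :: "(real \<Rightarrow> real) \<Rightarrow> (real \<Rightarrow> real) \<Rightarrow> real \<Rightarrow> real" where
  "stieltjes_conv A B t = (\<integral>x. B (t - x) \<partial>(interval_measure A))"

text \<open>\<open>prob_space.indep_var\<close> needs both random elements to have the same value type; this is
  independence of the generated \<open>\<sigma>\<close>-algebras.\<close>
definition indep_elements ::
  "'w measure \<Rightarrow> 'a measure \<Rightarrow> ('w \<Rightarrow> 'a) \<Rightarrow> 'b measure \<Rightarrow> ('w \<Rightarrow> 'b) \<Rightarrow> bool" where
  "indep_elements M N X N' Y \<longleftrightarrow>
     X \<in> measurable M N \<and> Y \<in> measurable M N' \<and>
     prob_space.indep_set M (sets (vimage_algebra (space M) X N))
       (sets (vimage_algebra (space M) Y N'))"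

definition semi_markov_matrix :: "('s::finite \<Rightarrow> 's \<Rightarrow> real \<Rightarrow> real) \<Rightarrow> bool" where
  "semi_markov_matrix T \<longleftrightarrow>
     (\<forall>i j. sub_distribution_function (T i j)) \<and>
     (\<forall>i. ((\<lambda>t. \<Sum>j\<in>UNIV. T i j t) \<longlongrightarrow> 1) at_top)"

text \<open>Irreducibility of the embedded chain; \<open>\<exists>t. T a b t > 0\<close> says that the transition
  probability \<open>T a b \<infinity>\<close> is positive.\<close>
definition irreducible_semi_markov :: "('s::finite \<Rightarrow> 's \<Rightarrow> real \<Rightarrow> real) \<Rightarrow> bool" where
  "irreducible_semi_markov T \<longleftrightarrow> (\<forall>i j. (i, j) \<in> {(a, b). \<exists>t. T a b t > 0}\<^sup>*)"

definition sojourn_df :: "('s::finite \<Rightarrow> 's \<Rightarrow> real \<Rightarrow> real) \<Rightarrow> 's \<Rightarrow> real \<Rightarrow> real" where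
  "sojourn_df T j t = (\<Sum>k\<in>UNIV. T j k t)"

definition repair_kernel ::
  "('s::finite \<Rightarrow> 's \<Rightarrow> real \<Rightarrow> real) \<Rightarrow> ('s \<Rightarrow> real \<Rightarrow> real) \<Rightarrow> 's \<Rightarrow> 's \<Rightarrow> real \<Rightarrow> real" where
  "repair_kernel T U i j = stieltjes_conv (T i j) (U j)"

primrec kernel_power ::
  "('s::finite \<Rightarrow> 's \<Rightarrow> real \<Rightarrow> real) \<Rightarrow> nat \<Rightarrow> 's \<Rightarrow> 's \<Rightarrow> real \<Rightarrow> real" where
  "kernel_power Q 0 i j t = (if i = j \<and> 0 \<le> t then 1 else 0)"
| "kernel_power Q (Suc n) i j t =
     (\<Sum>k\<in>UNIV. stieltjes_conv (kernel_power Q n i k) (Q k j) t)"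

text \<open>The times of return to \<open>i\<close> of the Markov renewal process with kernel \<open>Q\<close> lie on a
  lattice \<open>d\<int>\<close> iff all the measures \<open>Q\<^sup>(\<^sup>n\<^sup>)\<^sub>i\<^sub>i\<close> are concentrated on it. In particular
  a kernel without any positive return times is not non-lattice.\<close>
definition nonlattice_kernel :: "('s::finite \<Rightarrow> 's \<Rightarrow> real \<Rightarrow> real) \<Rightarrow> bool" where
  "nonlattice_kernel Q \<longleftrightarrow>
     (\<forall>i. \<not> (\<exists>d>0. \<forall>n. AE x in interval_measure (kernel_power Q n i i).
                         \<exists>a::int. x = d * of_int a))"


section \<open>Markov arrival processes\<close>

text \<open>\<open>D0\<close> and \<open>D1\<close> hold the rates of phase transitions without and with an arrival;
  the phases are \<open>{..<m}\<close>.\<close>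
definition MAP_parameters :: "nat \<Rightarrow> (nat \<Rightarrow> nat \<Rightarrow> real) \<Rightarrow> (nat \<Rightarrow> nat \<Rightarrow> real) \<Rightarrow> bool" where
  "MAP_parameters m D0 D1 \<longleftrightarrow>
     (\<forall>x<m. D0 x x < 0) \<and>
     (\<forall>x<m. \<forall>y<m. x \<noteq> y \<longrightarrow> 0 \<le> D0 x y) \<and>
     (\<forall>x<m. \<forall>y<m. 0 \<le> D1 x y) \<and>
     (\<forall>x<m. (\<Sum>y<m. D0 x y + D1 x y) = 0)"

text \<open>A path of a MAP: entry \<open>n\<close> is \<open>(x, h, e)\<close>, where \<open>x\<close> is the phase entered at the
  \<open>n\<close>-th transition, \<open>h\<close> the time spent in it, and \<open>e\<close> tells whether the transition that ends
  this stay is accompanied by an arrival.\<close>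
type_synonym map_path = "nat \<Rightarrow> nat \<times> real \<times> bool"

definition map_space :: "map_path measure" where
  "map_space = PiM UNIV (\<lambda>_. count_space UNIV \<Otimes>\<^sub>M borel \<Otimes>\<^sub>M count_space UNIV)"

definition holding :: "map_path \<Rightarrow> nat \<Rightarrow> real" where
  "holding \<xi> n = fst (snd (\<xi> n))"

definition arrival_at :: "map_path \<Rightarrow> nat \<Rightarrow> bool" where
  "arrival_at \<xi> n = snd (snd (\<xi> n))"

definition epoch :: "map_path \<Rightarrow> nat \<Rightarrow> real" where
  "epoch \<xi> n = (\<Sum>l<n. holding \<xi> l)"

definition map_phase :: "map_path \<Rightarrow> real \<Rightarrow> nat" where
  "map_phase \<xi> t = fst (\<xi> (LEAST n. t < epoch \<xi> (Suc n)))"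

definition MAP_jump_prob ::
  "(nat \<Rightarrow> nat \<Rightarrow> real) \<Rightarrow> (nat \<Rightarrow> nat \<Rightarrow> real) \<Rightarrow> nat \<Rightarrow> bool \<Rightarrow> nat \<Rightarrow> real" where
  "MAP_jump_prob D0 D1 x e y =
     (if e then D1 x y else if x = y then 0 else D0 x y) / (- D0 x x)"

text \<open>In phase \<open>x\<close> the process stays for an exponential time with rate \<open>- D0 x x\<close>, and then
  jumps, independently of that time, according to the probabilities above.\<close>
definition MAP_started_in ::
  "'w measure \<Rightarrow> nat \<Rightarrow> (nat \<Rightarrow> nat \<Rightarrow> real) \<Rightarrow> (nat \<Rightarrow> nat \<Rightarrow> real) \<Rightarrow> nat
     \<Rightarrow> ('w \<Rightarrow> map_path) \<Rightarrow> bool" where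
  "MAP_started_in M m D0 D1 x0 \<xi> \<longleftrightarrow>
     \<xi> \<in> measurable M map_space \<and>
     (\<forall>N x e h. (\<forall>l\<le>N. x l < m) \<longrightarrow> (\<forall>l<N. 0 \<le> h l) \<longrightarrow>
        measure M {\<omega> \<in> space M. (\<forall>l\<le>N. fst (\<xi> \<omega> l) = x l) \<and>
                     (\<forall>l<N. h l < holding (\<xi> \<omega>) l \<and> arrival_at (\<xi> \<omega>) l = e l)}
        = (if x 0 = x0
           then \<Prod>l<N. exp (D0 (x l) (x l) * h l) * MAP_jump_prob D0 D1 (x l) (e l) (x (Suc l))
           else 0))"


section \<open>The model without catastrophes\<close>

text \<open>Parameters in one environment state, for customer types \<open>'r\<close> and resource vectors
  in \<open>real ^ 'd\<close>.\<close>
record ('r, 'd) queue_model =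
  rate0 :: "'r \<Rightarrow> nat \<Rightarrow> nat \<Rightarrow> real"
  rate1 :: "'r \<Rightarrow> nat \<Rightarrow> nat \<Rightarrow> real"
  service_df :: "'r \<Rightarrow> real \<Rightarrow> real"
  resource_law :: "'r \<Rightarrow> (real ^ 'd) measure"
  departure_law :: "'r \<Rightarrow> (real ^ 'd) measure"

definition resource_distribution :: "(real ^ 'd::finite) measure \<Rightarrow> bool" where
  "resource_distribution C \<longleftrightarrow>
     prob_space C \<and> sets C = sets borel \<and> (AE x in C. \<forall>a. 0 \<le> x $ a)"

text \<open>\<open>m r\<close> is the number of phases of the MAP of type \<open>r\<close>.\<close>
definition valid_queue_model ::
  "('r::finite \<Rightarrow> nat) \<Rightarrow> ('r, 'd::finite) queue_model \<Rightarrow> bool" where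
  "valid_queue_model m A \<longleftrightarrow>
     (\<forall>r. MAP_parameters (m r) (rate0 A r) (rate1 A r) \<and>
          distribution_function (service_df A r) \<and>
          resource_distribution (resource_law A r) \<and>
          resource_distribution (departure_law A r))"

text \<open>Phases of the superposition are tuples of phases of the individual MAPs.\<close>
definition phases :: "('r::finite \<Rightarrow> nat) \<Rightarrow> ('r \<Rightarrow> nat) set" where
  "phases m = {k. \<forall>r. k r < m r}"

text \<open>The first component holds the MAP paths of all types. The second one holds the marks
  (service time, resource vector, departure resource vector): entry \<open>(r, n)\<close> belongs to the
  customer, if any, that arrives at the end of the \<open>n\<close>-th phase sojourn of the MAP of type \<open>r\<close>.
  As the marks are i.i.d. and independent of the MAPs, numbering them by transitions instead of
  by arrivals makes no difference.\<close>
type_synonym ('r, 'd) queue_path =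
  "('r \<Rightarrow> map_path) \<times> ('r \<times> nat \<Rightarrow> real \<times> (real ^ 'd) \<times> (real ^ 'd))"

definition maps_space :: "('r::finite \<Rightarrow> map_path) measure" where
  "maps_space = PiM UNIV (\<lambda>_. map_space)"

definition mark_space :: "(real \<times> (real ^ 'd::finite) \<times> (real ^ 'd)) measure" where
  "mark_space = borel \<Otimes>\<^sub>M borel \<Otimes>\<^sub>M borel"

definition marks_space ::
  "('r::finite \<times> nat \<Rightarrow> real \<times> (real ^ 'd::finite) \<times> (real ^ 'd)) measure" where
  "marks_space = PiM UNIV (\<lambda>_. mark_space)"

definition queue_space :: "('r::finite, 'd::finite) queue_path measure" where
  "queue_space = maps_space \<Otimes>\<^sub>M marks_space"

definition queue_without_catastrophes ::
  "'w measure \<Rightarrow> ('r::finite \<Rightarrow> nat) \<Rightarrow> ('r, 'd::finite) queue_model \<Rightarrow> ('r \<Rightarrow> nat)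
     \<Rightarrow> ('w \<Rightarrow> ('r, 'd) queue_path) \<Rightarrow> bool" where
  "queue_without_catastrophes M m A k Z \<longleftrightarrow>
     prob_space M \<and>
     (\<forall>r. MAP_started_in M (m r) (rate0 A r) (rate1 A r) (k r) (\<lambda>\<omega>. fst (Z \<omega>) r)) \<and>
     prob_space.indep_vars M (\<lambda>_. map_space) (\<lambda>r \<omega>. fst (Z \<omega>) r) UNIV \<and>
     (\<forall>r n. distr M mark_space (\<lambda>\<omega>. snd (Z \<omega>) (r, n)) =
        interval_measure (service_df A r) \<Otimes>\<^sub>M resource_law A r \<Otimes>\<^sub>M departure_law A r) \<and>
     prob_space.indep_vars M (\<lambda>_. mark_space) (\<lambda>c \<omega>. snd (Z \<omega>) c) UNIV \<and>
     indep_elements M maps_space (\<lambda>\<omega>. fst (Z \<omega>)) marks_space (\<lambda>\<omega>. snd (Z \<omega>))"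

definition arrival_time :: "('r, 'd) queue_path \<Rightarrow> 'r \<Rightarrow> nat \<Rightarrow> real" where
  "arrival_time z r n = epoch (fst z r) (Suc n)"

definition departure_time :: "('r, 'd) queue_path \<Rightarrow> 'r \<Rightarrow> nat \<Rightarrow> real" where
  "departure_time z r n = arrival_time z r n + fst (snd z (r, n))"

definition in_service :: "('r, 'd) queue_path \<Rightarrow> real \<Rightarrow> 'r \<Rightarrow> nat set" where
  "in_service z t r =
     {n. arrival_at (fst z r) n \<and> arrival_time z r n \<le> t \<and> t \<le> departure_time z r n}"

definition served :: "('r, 'd) queue_path \<Rightarrow> real \<Rightarrow> 'r \<Rightarrow> nat set" where
  "served z t r = {n. arrival_at (fst z r) n \<and> departure_time z r n < t}"

definition in_service_count :: "('r, 'd) queue_path \<Rightarrow> real \<Rightarrow> 'r \<Rightarrow> nat" where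
  "in_service_count z t r = card (in_service z t r)"

definition served_count :: "('r, 'd) queue_path \<Rightarrow> real \<Rightarrow> 'r \<Rightarrow> nat" where
  "served_count z t r = card (served z t r)"

definition resources_in_service ::
  "('r::finite, 'd::finite) queue_path \<Rightarrow> real \<Rightarrow> real ^ 'd" where
  "resources_in_service z t = (\<Sum>r\<in>UNIV. \<Sum>n\<in>in_service z t r. fst (snd (snd z (r, n))))"

definition resources_served ::
  "('r::finite, 'd::finite) queue_path \<Rightarrow> real \<Rightarrow> real ^ 'd" where
  "resources_served z t = (\<Sum>r\<in>UNIV. \<Sum>n\<in>served z t r. snd (snd (snd z (r, n))))"

definition queue_phase :: "('r, 'd) queue_path \<Rightarrow> real \<Rightarrow> 'r \<Rightarrow> nat" where
  "queue_phase z t r = map_phase (fst z r) t"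

definition queue_observable ::
  "('r::finite \<Rightarrow> nat) \<Rightarrow> ('r \<Rightarrow> nat) \<Rightarrow> real ^ 'd::finite \<Rightarrow> real ^ 'd \<Rightarrow> ('r \<Rightarrow> nat)
     \<Rightarrow> ('r, 'd) queue_path \<Rightarrow> real \<Rightarrow> real" where
  "queue_observable n m s1 s2 l z t =
     (if in_service_count z t = n \<and> served_count z t = m \<and> queue_phase z t = l
      then exp (- (s1 \<bullet> resources_in_service z t) - s2 \<bullet> resources_served z t) else 0)"

text \<open>Entry in column \<open>l\<close>; the row is determined by the initial phase under \<open>M\<close>.\<close>
definition transform_without_catastrophes ::
  "'w measure \<Rightarrow> ('w \<Rightarrow> ('r::finite, 'd::finite) queue_path)
     \<Rightarrow> ('r \<Rightarrow> nat) \<Rightarrow> ('r \<Rightarrow> nat) \<Rightarrow> real ^ 'd \<Rightarrow> real ^ 'd \<Rightarrow> real \<Rightarrow> ('r \<Rightarrow> nat) \<Rightarrow> real" where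
  "transform_without_catastrophes M Z n m s1 s2 t l =
     (\<integral>\<omega>. queue_observable n m s1 s2 l (Z \<omega>) t \<partial>M)"


section \<open>The model with catastrophes and repairs\<close>

text \<open>The environment: \<open>E n\<close> is the state entered at the \<open>n\<close>-th transition and
  \<open>\<tau> n\<close> the time it lasts.\<close>
definition semi_markov_started_in ::
  "'w measure \<Rightarrow> ('s::finite \<Rightarrow> 's \<Rightarrow> real \<Rightarrow> real) \<Rightarrow> 's
     \<Rightarrow> (nat \<Rightarrow> 'w \<Rightarrow> 's) \<Rightarrow> (nat \<Rightarrow> 'w \<Rightarrow> real) \<Rightarrow> bool" where
  "semi_markov_started_in M T i E \<tau> \<longleftrightarrow>
     (\<forall>n. E n \<in> measurable M (count_space UNIV)) \<and>
     (\<forall>n. \<tau> n \<in> borel_measurable M) \<and>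
     (\<forall>N x t. measure M {\<omega> \<in> space M. (\<forall>l\<le>N. E l \<omega> = x l) \<and> (\<forall>l<N. \<tau> l \<omega> \<le> t l)}
        = (if x 0 = i then \<Prod>l<N. T (x l) (x (Suc l)) (t l) else 0))"

text \<open>\<open>V (n, j)\<close> is the repair time after the \<open>n\<close>-th operating period if the new environment
  state is \<open>j\<close>, and \<open>Z (n, j)\<close> the copy of the model without catastrophes that runs during the
  \<open>n\<close>-th operating period if the environment state is \<open>j\<close>; only those for the states that
  actually occur are used below. Every copy starts in phase \<open>k\<close>.\<close>
definition queue_with_catastrophes ::
  "'w measure \<Rightarrow> ('s::finite \<Rightarrow> 's \<Rightarrow> real \<Rightarrow> real) \<Rightarrow> ('s \<Rightarrow> real \<Rightarrow> real)
     \<Rightarrow> ('r::finite \<Rightarrow> nat) \<Rightarrow> ('s \<Rightarrow> ('r, 'd::finite) queue_model) \<Rightarrow> 's \<Rightarrow> ('r \<Rightarrow> nat)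
     \<Rightarrow> (nat \<Rightarrow> 'w \<Rightarrow> 's) \<Rightarrow> (nat \<Rightarrow> 'w \<Rightarrow> real)
     \<Rightarrow> (nat \<times> 's \<Rightarrow> 'w \<Rightarrow> real) \<Rightarrow> (nat \<times> 's \<Rightarrow> 'w \<Rightarrow> ('r, 'd) queue_path) \<Rightarrow> bool" where
  "queue_with_catastrophes M T U m A i k E \<tau> V Z \<longleftrightarrow>
     prob_space M \<and>
     semi_markov_started_in M T i E \<tau> \<and>
     (\<forall>n j. distr M borel (V (n, j)) = interval_measure (U j)) \<and>
     prob_space.indep_vars M (\<lambda>_. borel) V UNIV \<and>
     (\<forall>n j. queue_without_catastrophes M m (A j) k (Z (n, j))) \<and>
     prob_space.indep_vars M (\<lambda>_. queue_space) Z UNIV \<and>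
     indep_elements M
       (PiM UNIV (\<lambda>_. borel)) (\<lambda>\<omega> c. V c \<omega>)
       (PiM UNIV (\<lambda>_. queue_space)) (\<lambda>\<omega> c. Z c \<omega>) \<and>
     indep_elements M
       (PiM UNIV (\<lambda>_. count_space UNIV \<Otimes>\<^sub>M borel)) (\<lambda>\<omega> n. (E n \<omega>, \<tau> n \<omega>))
       (PiM UNIV (\<lambda>_. borel) \<Otimes>\<^sub>M PiM UNIV (\<lambda>_. queue_space))
       (\<lambda>\<omega>. (\<lambda>c. V c \<omega>, \<lambda>c. Z c \<omega>))"

text \<open>The beginning of the \<open>n\<close>-th operating period. The sojourn of the environment in a new
  state begins when the repair is completed, which is what makes \<open>T * U\<close> the kernel of the
  times between beginnings of operating periods.\<close>
primrec operation_start ::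
  "(nat \<Rightarrow> 'w \<Rightarrow> 's) \<Rightarrow> (nat \<Rightarrow> 'w \<Rightarrow> real) \<Rightarrow> (nat \<times> 's \<Rightarrow> 'w \<Rightarrow> real)
     \<Rightarrow> nat \<Rightarrow> 'w \<Rightarrow> real" where
  "operation_start E \<tau> V 0 \<omega> = 0"
| "operation_start E \<tau> V (Suc n) \<omega> =
     operation_start E \<tau> V n \<omega> + \<tau> n \<omega> + V (n, E (Suc n) \<omega>) \<omega>"

definition operating ::
  "(nat \<Rightarrow> 'w \<Rightarrow> 's) \<Rightarrow> (nat \<Rightarrow> 'w \<Rightarrow> real) \<Rightarrow> (nat \<times> 's \<Rightarrow> 'w \<Rightarrow> real)
     \<Rightarrow> real \<Rightarrow> 'w \<Rightarrow> nat \<Rightarrow> bool" where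
  "operating E \<tau> V t \<omega> n \<longleftrightarrow>
     operation_start E \<tau> V n \<omega> \<le> t \<and> t < operation_start E \<tau> V n \<omega> + \<tau> n \<omega>"

definition catastrophe_observable ::
  "(nat \<Rightarrow> 'w \<Rightarrow> 's) \<Rightarrow> (nat \<Rightarrow> 'w \<Rightarrow> real) \<Rightarrow> (nat \<times> 's \<Rightarrow> 'w \<Rightarrow> real)
     \<Rightarrow> (nat \<times> 's \<Rightarrow> 'w \<Rightarrow> ('r::finite, 'd::finite) queue_path)
     \<Rightarrow> ('r \<Rightarrow> nat) \<Rightarrow> ('r \<Rightarrow> nat) \<Rightarrow> real ^ 'd \<Rightarrow> real ^ 'd \<Rightarrow> ('r \<Rightarrow> nat)
     \<Rightarrow> real \<Rightarrow> 'w \<Rightarrow> real" where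
  "catastrophe_observable E \<tau> V Z n m s1 s2 l t \<omega> =
     (if \<exists>\<nu>. operating E \<tau> V t \<omega> \<nu>
      then let \<nu> = (LEAST \<nu>. operating E \<tau> V t \<omega> \<nu>) in
        queue_observable n m s1 s2 l (Z (\<nu>, E \<nu> \<omega>) \<omega>) (t - operation_start E \<tau> V \<nu> \<omega>)
      else 0)"

definition transform_with_catastrophes ::
  "'w measure \<Rightarrow> (nat \<Rightarrow> 'w \<Rightarrow> 's) \<Rightarrow> (nat \<Rightarrow> 'w \<Rightarrow> real) \<Rightarrow> (nat \<times> 's \<Rightarrow> 'w \<Rightarrow> real)
     \<Rightarrow> (nat \<times> 's \<Rightarrow> 'w \<Rightarrow> ('r::finite, 'd::finite) queue_path)
     \<Rightarrow> ('r \<Rightarrow> nat) \<Rightarrow> ('r \<Rightarrow> nat) \<Rightarrow> real ^ 'd \<Rightarrow> real ^ 'd \<Rightarrow> real \<Rightarrow> ('r \<Rightarrow> nat) \<Rightarrow> real" where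
  "transform_with_catastrophes M E \<tau> V Z n m s1 s2 t l =
     (\<integral>\<omega>. catastrophe_observable E \<tau> V Z n m s1 s2 l t \<omega> \<partial>M)"


section \<open>Generating functions\<close>

definition multi_power :: "('r::finite \<Rightarrow> complex) \<Rightarrow> ('r \<Rightarrow> nat) \<Rightarrow> complex" where
  "multi_power z n = (\<Prod>r\<in>UNIV. z r ^ n r)"

definition generating_function ::
  "(('r::finite \<Rightarrow> nat) \<Rightarrow> ('r \<Rightarrow> nat) \<Rightarrow> real) \<Rightarrow> ('r \<Rightarrow> complex) \<Rightarrow> ('r \<Rightarrow> complex) \<Rightarrow> complex" where
  "generating_function a z1 z2 =
     (\<Sum>\<^sub>\<infinity>(n, m)\<in>UNIV. multi_power z1 n * multi_power z2 m * complex_of_real (a n m))"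

end

theory Submission
  imports Defs
begin

text \<open>The beginnings of the operating periods form a Markov renewal process with kernel
  \<open>Q = T * U\<close>. Conditioning on the last of them before \<open>t\<close> writes the transform at time \<open>t\<close> as
  \<open>V f i t\<close>, where \<open>V\<close> is the renewal operator and \<open>f j u\<close> is \<open>1 - F j u\<close> times the transform
  without catastrophes at time \<open>u\<close>. Both the single transforms and the generating functions are
  linear combinations of expectations weighted with some \<open>c n m\<close> between \<open>0\<close> and \<open>1\<close>, so that the
  claim is the key renewal theorem for these \<open>f\<close>.

  The renewal theorem is proved by smoothing. The difference \<open>D\<close> of a smoothed renewal function and
  its translate is asymptotically harmonic. If \<open>D\<close> is close to its upper limit along a sequence of
  times, then so it is at all times shifted back by points of the supports of the kernel powers. Since
  the kernel is non-lattice, these points become dense far out, and a positive upper limit would make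
  the renewal function unbounded along an arithmetic progression. Hence \<open>D\<close> tends to \<open>0\<close>, and the
  renewal functions are asymptotically constant and proportional to the stationary distribution
  \<open>\<rho>\<close>. The identity \<open>V w = 1\<close> for the tails \<open>w j u = 1 - (\<Sum>k. Q j k u)\<close> determines the
  constant; applied to \<open>w - f\<close>, it turns upper bounds into lower ones. The functions \<open>f\<close> are
  dominated by the integrable monotone \<open>w\<close> and continuous almost everywhere, because almost every
  time is almost surely not a jump time of the queue.\<close>

section \<open>Non-lattice sets of reals\<close>

text \<open>No limit of the smoothed renewal functions is ever computed. Smoothing only shows that
  all of them follow one unknown amplitude, \<open>A i t\<close>, up to explicit factors. Comparing
  a function with the tails \<open>w\<close>, on which \<open>V\<close> is exactly 1, eliminates the
  amplitude. Two obstacles shape the rest. Sojourns may have an atom at 0, so local finiteness of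
  \<open>V\<close> is not automatic; it is extracted from \<open>V w \<le> 1\<close> and
  irreducibility. And the copies inside the operating periods and the reference queue live on
  different probability spaces. They are linked only through the probabilities that the definitions
  prescribe, so their laws are identified on path cylinders; the same cylinders yield non-explosion
  of the arrivals, without which counts and resources would be sums over infinite sets. The
  non-lattice condition speaks of kernel powers, whereas the propagation argument moves along sums
  of support points. The link is that the closure of these sums carries the powers.\<close>

lemma nonlattice_subgroup_small_element:
  fixes G :: "real set"
  assumes zero: "0 \<in> G" and diff: "\<And>x y. x \<in> G \<Longrightarrow> y \<in> G \<Longrightarrow> x - y \<in> G"
    and nonlattice: "\<And>d. 0 < d \<Longrightarrow> \<exists>x\<in>G. \<forall>a::int. x \<noteq> d * of_int a" and e: "0 < e"
  shows "\<exists>g\<in>G. 0 < g \<and> g < e"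
proof (rule ccontr)
  assume "\<not> ?thesis"
  then have large: "\<And>g. g \<in> G \<Longrightarrow> 0 < g \<Longrightarrow> e \<le> g" by force
  have neg: "- x \<in> G" if "x \<in> G" for x
    using diff[OF zero that] by simp
  have add: "x + y \<in> G" if "x \<in> G" "y \<in> G" for x y
    using diff[OF that(1) neg[OF that(2)]] by simp
  have nat_mult: "of_nat n * x \<in> G" if "x \<in> G" for n x
    by (induction n) (auto simp: zero algebra_simps intro: add that)
  have int_mult: "of_int a * x \<in> G" if "x \<in> G" for a x
  proof (cases "0 \<le> a")
    case True
    then show ?thesis using nat_mult[OF that, of "nat a"] by simp
  next
    case False
    then show ?thesis using neg[OF nat_mult[OF that, of "nat (- a)"]] by simp
  qed
  let ?P = "{g \<in> G. 0 < g}"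
  obtain x where x: "x \<in> G" "x \<noteq> 0"
    using nonlattice[of 1] by (metis mult.commute mult_1 of_int_0 zero_less_one)
  then have ne: "?P \<noteq> {}"
    using neg[of x] by (metis (mono_tags, lifting) empty_Collect_eq linorder_neqE_linordered_idom neg_0_less_iff_less)
  have bdd: "bdd_below ?P"
    by (rule bdd_belowI[of _ 0]) auto
  define s where "s = Inf ?P"
  have s_le: "s \<le> g" if "g \<in> G" "0 < g" for g
    unfolding s_def by (rule cInf_lower) (use that bdd in auto)
  have es: "e \<le> s"
    unfolding s_def by (rule cInf_greatest) (use ne large in auto)
  have approx: "\<exists>g\<in>G. 0 < g \<and> g < y" if "s < y" for y
    using cInf_lessD[OF ne, of y] that unfolding s_def by auto
  \<comment> \<open>If the infimum were not attained, two distinct elements of \<open>G\<close>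
    would lie in \<open>[s, s + e)\<close>, and their difference would be a positive element below
    \<open>e\<close>.\<close>
  have sG: "s \<in> G"
  proof -
    obtain g where g: "g \<in> G" "0 < g" "g < s + e" using approx[of "s + e"] e by auto
    show ?thesis
    proof (cases "g = s")
      case False
      then have "s < g" using s_le[OF g(1,2)] by simp
      then obtain g' where g': "g' \<in> G" "0 < g'" "g' < g" using approx by blast
      have "e \<le> g - g'" using large[OF diff[OF g(1) g'(1)]] g'(3) by simp
      moreover have "s \<le> g'" using s_le g' by blast
      ultimately show ?thesis using g(3) by linarith
    qed (use g in auto)
  qed
  have spos: "0 < s" using es e by linarith
  obtain y where y: "y \<in> G" "\<forall>a::int. y \<noteq> s * of_int a" using nonlattice[OF spos] by blast
  \<comment> \<open>The remainder of \<open>y\<close> modulo \<open>s\<close> lies in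
    \<open>G\<close> and in \<open>[0, s)\<close>. It is nonzero because \<open>y\<close> is no
    multiple of \<open>s\<close>, which contradicts the minimality of \<open>s\<close>.\<close>
  define z where "z = y - of_int \<lfloor>y / s\<rfloor> * s"
  have zG: "z \<in> G" unfolding z_def by (intro diff y int_mult sG)
  have "of_int \<lfloor>y / s\<rfloor> * s \<le> y" "y < (of_int \<lfloor>y / s\<rfloor> + 1) * s"
    using spos by (simp_all add: floor_divide_lower floor_divide_upper)
  then have "0 \<le> z" "z < s" unfolding z_def by (auto simp: algebra_simps)
  moreover have "z \<noteq> 0" using y(2) unfolding z_def by (auto simp: algebra_simps)
  ultimately show False using s_le[OF zG] by linarith
qed

text \<open>Differences of elements form a non-lattice group, so some \<open>a - b\<close> is
  positive and below \<open>e\<close>. Trading \<open>b\<close> for \<open>a\<close> one summand at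
  a time moves from \<open>n * b\<close> to \<open>n * a\<close> inside \<open>S\<close> in steps
  shorter than \<open>e\<close>, and for large \<open>n\<close> these stretches overlap.\<close>

lemma nonlattice_semigroup_asymptotically_dense:
  fixes S :: "real set"
  assumes nonneg: "\<And>x. x \<in> S \<Longrightarrow> 0 \<le> x" and zero: "0 \<in> S"
    and add: "\<And>x y. x \<in> S \<Longrightarrow> y \<in> S \<Longrightarrow> x + y \<in> S"
    and nonlattice: "\<And>d. 0 < d \<Longrightarrow> \<exists>x\<in>S. \<forall>a::int. x \<noteq> d * of_int a" and e: "0 < e"
  shows "\<exists>A. \<forall>x\<ge>A. \<exists>y\<in>S. \<bar>y - x\<bar> < e"
proof -
  have "\<exists>g\<in>{a - b | a b. a \<in> S \<and> b \<in> S}. 0 < g \<and> g < e"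
  proof (rule nonlattice_subgroup_small_element[OF _ _ _ e])
    show "0 \<in> {a - b | a b. a \<in> S \<and> b \<in> S}" using zero by force
    show "x - y \<in> {a - b | a b. a \<in> S \<and> b \<in> S}"
      if "x \<in> {a - b | a b. a \<in> S \<and> b \<in> S}" "y \<in> {a - b | a b. a \<in> S \<and> b \<in> S}" for x y
    proof -
      from that obtain a b c d where *: "x = a - b" "y = c - d" "a \<in> S" "b \<in> S" "c \<in> S" "d \<in> S"
        by blast
      then have "x - y = (a + d) - (b + c)" by simp
      then show ?thesis using add[of a d] add[of b c] * by blast
    qed
    show "\<exists>x\<in>{a - b | a b. a \<in> S \<and> b \<in> S}. \<forall>n::int. x \<noteq> d * of_int n" if d: "0 < d" for d
    proof -
      obtain x where "x \<in> S" "\<forall>a::int. x \<noteq> d * of_int a" using nonlattice[OF d] by blast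
      then show ?thesis using zero by (intro bexI[of _ x]) force+
    qed
  qed
  then obtain a b where ab: "a \<in> S" "b \<in> S" "0 < a - b" "a - b < e" by auto
  have mult: "of_nat n * x \<in> S" if "x \<in> S" for n x
    by (induction n) (auto simp: zero algebra_simps intro: add that)
  define g where "g = a - b"
  have g: "0 < g" "g < e" using ab by (auto simp: g_def)
  have b0: "0 \<le> b" using nonneg ab by blast
  \<comment> \<open>With \<open>g = a - b\<close>, the point \<open>n * b + k * g\<close> is
    \<open>(n - k) * b + k * a\<close> and hence belongs to \<open>S\<close> for
    \<open>k \<le> n\<close>; the floor selects the last such point not beyond
    \<open>x\<close>.\<close>
  have step: "\<exists>y\<in>S. \<bar>y - x\<bar> < e" if "of_nat n * b \<le> x" "x \<le> of_nat n * a" for n x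
  proof -
    define k where "k = nat \<lfloor>(x - of_nat n * b) / g\<rfloor>"
    have k0: "0 \<le> (x - of_nat n * b) / g" using that g by simp
    then have rk: "real k = of_int \<lfloor>(x - of_nat n * b) / g\<rfloor>"
      unfolding k_def by simp
    have k1: "real k * g \<le> x - of_nat n * b" "x - of_nat n * b < (real k + 1) * g"
      unfolding rk using g by (simp_all add: floor_divide_lower floor_divide_upper)
    have "real k * g \<le> real n * g" using k1(1) that(2) by (simp add: g_def algebra_simps)
    then have kn: "k \<le> n" using g by simp
    have "of_nat (n - k) * b + of_nat k * a \<in> S" by (intro add mult ab)
    moreover have "of_nat (n - k) * b + of_nat k * a = of_nat n * b + real k * g"
      using kn by (simp add: of_nat_diff g_def algebra_simps)
    moreover have "\<bar>of_nat n * b + real k * g - x\<bar> < e"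
      using k1 g by (simp add: algebra_simps)
    ultimately show ?thesis by metis
  qed
  show ?thesis
  proof (cases "b = 0")
    case True
    show ?thesis
    proof (intro exI[of _ 0] allI impI)
      fix x :: real assume "0 \<le> x"
      obtain n where "x \<le> of_nat n * a"
        using ex_less_of_nat_mult[of a x] ab b0 by (metis True diff_zero less_eq_real_def)
      then show "\<exists>y\<in>S. \<bar>y - x\<bar> < e" using step[of n x] True \<open>0 \<le> x\<close> by simp
    qed
  next
    case False
    then have b: "0 < b" using b0 by simp
    \<comment> \<open>From \<open>n0\<close> on, \<open>n * a = n * b + n * g\<close> exceeds
      \<open>(n + 1) * b\<close>, so that consecutive stretches leave no gap.\<close>
    obtain n0 where n0: "b < of_nat n0 * g" using ex_less_of_nat_mult[of g b] g by blast
    show ?thesis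
    proof (intro exI[of _ "of_nat n0 * b"] allI impI)
      fix x :: real assume x: "of_nat n0 * b \<le> x"
      define n where "n = nat \<lfloor>x / b\<rfloor>"
      have x0: "0 \<le> x" using x b by (meson mult_nonneg_nonneg of_nat_0_le_iff order_trans less_imp_le)
      have rn: "real n = of_int \<lfloor>x / b\<rfloor>" unfolding n_def using x0 b by simp
      have n1: "real n * b \<le> x" "x < (real n + 1) * b"
        unfolding rn using b by (simp_all add: floor_divide_lower floor_divide_upper)
      have "real n0 * b < (real n + 1) * b" using x n1(2) by linarith
      then have "n0 \<le> n" using b by simp
      then have "real n0 * g \<le> real n * g" using g by simp
      then have "b < real n * g" using n0 by linarith
      then have "x \<le> real n * a" using n1(2) by (simp add: g_def algebra_simps)
      then show "\<exists>y\<in>S. \<bar>y - x\<bar> < e" using step[of n x] n1(1) by simp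
    qed
  qed
qed

section \<open>Supports of measures and reachable times\<close>

definition msupp :: "real measure \<Rightarrow> real set" where
  "msupp \<mu> = {y. \<forall>e>0. emeasure \<mu> {y - e<..<y + e} \<noteq> 0}"

text \<open>Sums of support points along paths of states. The support of a convolution is in general
  only the closure of such sums; working with the sums themselves turns the propagation of limits
  into a plain induction.\<close>

inductive reach :: "('s \<Rightarrow> 's \<Rightarrow> real measure) \<Rightarrow> 's \<Rightarrow> 's \<Rightarrow> real \<Rightarrow> bool" for q i where
  start: "reach q i i 0"
| extend: "reach q i j x \<Longrightarrow> y \<in> msupp (q j k) \<Longrightarrow> reach q i k (x + y)"

lemma reach_trans: "reach q j k y \<Longrightarrow> reach q i j x \<Longrightarrow> reach q i k (x + y)"
  by (induction rule: reach.induct) (auto simp: add.assoc[symmetric] intro: reach.extend)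

section \<open>Markov renewal equations\<close>

text \<open>The rows are probability measures split over the target states, with atoms at 0 allowed.
  Being non-lattice is required of the reachable return times, because asymptotic values propagate
  along exactly these.\<close>

locale markov_renewal =
  fixes q :: "'s::finite \<Rightarrow> 's \<Rightarrow> real measure"
  assumes sets_q[measurable_cong]: "sets (q i j) = sets borel"
    and nonneg: "AE y in q i j. 0 \<le> y"
    and total: "(\<Sum>j\<in>UNIV. emeasure (q i j) UNIV) = 1"
    and irreducible: "(i, j) \<in> {(a, b). emeasure (q a b) UNIV \<noteq> 0}\<^sup>*"
    and nonlattice: "0 < d \<Longrightarrow> \<exists>y. reach q i i y \<and> (\<forall>a::int. y \<noteq> d * of_int a)"
begin

lemma space_q[simp]: "space (q i j) = UNIV"
  using sets_eq_imp_space_eq[OF sets_q] by simp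

lemma emeasure_q_le: "emeasure (q i j) A \<le> 1"
proof -
  have "emeasure (q i j) A \<le> emeasure (q i j) UNIV" using emeasure_space[of "q i j" A] by simp
  also have "\<dots> \<le> (\<Sum>j\<in>UNIV. emeasure (q i j) UNIV)" by (rule member_le_sum) auto
  finally show ?thesis using total by simp
qed

sublocale q: finite_measure "q i j" for i j
  by standard (use emeasure_q_le[of i j UNIV] in \<open>auto simp: top_unique\<close>)

abbreviation P :: "'s \<Rightarrow> 's \<Rightarrow> real" where "P i j \<equiv> measure (q i j) UNIV"

lemma P_sum: "(\<Sum>j\<in>UNIV. P i j) = 1"
proof -
  have "ennreal (\<Sum>j\<in>UNIV. P i j) = 1"
    using total[of i] by (simp add: q.emeasure_eq_measure)
  then show ?thesis by simp
qed

text \<open>The functions live on the whole time line and take values in \<open>ennreal\<close>.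
  Thus \<open>K\<close> commutes with translations and convolutions in time, and sums and integrals
  may be exchanged before anything is known to be finite.\<close>

definition K :: "('s \<Rightarrow> real \<Rightarrow> ennreal) \<Rightarrow> 's \<Rightarrow> real \<Rightarrow> ennreal" where
  "K f i t = (\<Sum>j\<in>UNIV. \<integral>\<^sup>+y. f j (t - y) \<partial>q i j)"

text \<open>\<open>V f i t\<close> is the expected sum of \<open>f (X n) (t - S n)\<close> over the process started in \<open>i\<close>, where
  \<open>X n\<close> is the state entered at the \<open>n\<close>-th renewal epoch \<open>S n\<close>.\<close>
definition V :: "('s \<Rightarrow> real \<Rightarrow> ennreal) \<Rightarrow> 's \<Rightarrow> real \<Rightarrow> ennreal" where
  "V f i t = (\<Sum>n. (K ^^ n) f i t)"

definition bfun :: "('s \<Rightarrow> real \<Rightarrow> ennreal) \<Rightarrow> bool" where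
  "bfun f \<longleftrightarrow> (\<forall>i. f i \<in> borel_measurable borel)"

lemma bfunD: "bfun f \<Longrightarrow> f i \<in> borel_measurable borel"
  by (simp add: bfun_def)

lemma bfun_K: assumes "bfun f" shows "bfun (K f)"
proof -
  note [measurable] = bfunD[OF assms]
  have "K f i \<in> borel_measurable borel" for i
    unfolding K_def[abs_def] by measurable
  then show ?thesis by (simp add: bfun_def)
qed

lemma bfun_Kn: "bfun f \<Longrightarrow> bfun ((K ^^ n) f)"
  by (induction n) (auto intro: bfun_K)

lemma bfun_V: assumes "bfun f" shows "bfun (V f)"
proof -
    note [measurable] = bfunD[OF bfun_Kn[OF assms]]
  have "V f i \<in> borel_measurable borel" for i
    unfolding V_def[abs_def] by measurable
  then show ?thesis by (simp add: bfun_def)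
qed

lemma K_mono: "(\<And>j s. f j s \<le> g j s) \<Longrightarrow> K f i t \<le> K g i t"
  unfolding K_def by (intro sum_mono nn_integral_mono) auto

lemma Kn_mono: "(\<And>j s. f j s \<le> g j s) \<Longrightarrow> (K ^^ n) f i t \<le> (K ^^ n) g i t"
  by (induction n arbitrary: i t) (auto intro: K_mono)

lemma V_mono: "(\<And>j s. f j s \<le> g j s) \<Longrightarrow> V f i t \<le> V g i t"
  unfolding V_def by (intro suminf_le Kn_mono) auto

lemma K_suminf:
  assumes "\<And>n. bfun (f n)"
  shows "K (\<lambda>i t. \<Sum>n. f n i t) i t = (\<Sum>n. K (f n) i t)"
proof -
  note [measurable] = bfunD[OF assms]
  show ?thesis unfolding K_def by (simp add: nn_integral_suminf suminf_sum)
qed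

lemma K_add:
  assumes "bfun f" "bfun g"
  shows "K (\<lambda>i t. f i t + g i t) i t = K f i t + K g i t"
proof -
  note [measurable] = bfunD[OF assms(1)] bfunD[OF assms(2)]
  show ?thesis unfolding K_def by (simp add: nn_integral_add sum.distrib)
qed

lemma K_cmult:
  assumes "bfun f"
  shows "K (\<lambda>i t. c * f i t) i t = c * K f i t"
proof -
  note [measurable] = bfunD[OF assms]
  show ?thesis unfolding K_def by (simp add: nn_integral_cmult sum_distrib_left)
qed

lemma Kn_add:
  assumes "bfun f" "bfun g"
  shows "(K ^^ n) (\<lambda>i t. f i t + g i t) i t = (K ^^ n) f i t + (K ^^ n) g i t"
proof (induction n arbitrary: i t)
  case (Suc n)
  then have "(K ^^ n) (\<lambda>i t. f i t + g i t) = (\<lambda>i t. (K ^^ n) f i t + (K ^^ n) g i t)" by auto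
  then show ?case by (simp add: K_add bfun_Kn assms)
qed simp

lemma Kn_cmult:
  assumes "bfun f"
  shows "(K ^^ n) (\<lambda>i t. c * f i t) i t = c * (K ^^ n) f i t"
proof (induction n arbitrary: i t)
  case (Suc n)
  then have "(K ^^ n) (\<lambda>i t. c * f i t) = (\<lambda>i t. c * (K ^^ n) f i t)" by auto
  then show ?case by (simp add: K_cmult bfun_Kn assms)
qed simp

lemma V_add:
  assumes "bfun f" "bfun g"
  shows "V (\<lambda>i t. f i t + g i t) i t = V f i t + V g i t"
  unfolding V_def by (simp add: Kn_add assms suminf_add)

lemma V_cmult:
  assumes "bfun f"
  shows "V (\<lambda>i t. c * f i t) i t = c * V f i t"
  unfolding V_def by (simp add: Kn_cmult assms)

lemma V_sum:
  assumes "\<And>x. x \<in> X \<Longrightarrow> bfun (f x)" "finite X"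
  shows "V (\<lambda>i t. \<Sum>x\<in>X. f x i t) i t = (\<Sum>x\<in>X. V (f x) i t)"
  using assms(2,1)
proof (induction X rule: finite_induct)
  case empty
  then show ?case using V_cmult[of "\<lambda>_ _. 0" 0 i t] by (simp add: bfun_def)
next
  case (insert x X)
  have [simp]: "bfun (f y)" if "y \<in> X" for y using insert that by auto
  have "bfun (\<lambda>i t. \<Sum>x\<in>X. f x i t)"
    using insert.prems unfolding bfun_def by (auto intro!: borel_measurable_sum)
  then show ?case using insert by (simp add: V_add)
qed

lemma V_unfold:
  assumes "bfun f"
  shows "V f i t = f i t + K (V f) i t"
proof -
  have "V f i t = (\<Sum>n. (K ^^ (Suc n)) f i t) + (K ^^ 0) f i t"
    unfolding V_def by (subst suminf_offset[where i = "Suc 0"]) (auto simp: add.commute)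
  also have "(\<Sum>n. (K ^^ (Suc n)) f i t) = K (V f) i t"
    unfolding V_def[abs_def] by (subst K_suminf) (auto intro: bfun_Kn assms)
  finally show ?thesis by (simp add: add.commute)
qed

text \<open>\<open>V_unfold\<close> splits off the first step of the process, this equation the last
  one. The former makes renewal functions harmonic in the starting state, the latter makes them
  stationary in the target state.\<close>

lemma V_K: "V f i t = f i t + V (K f) i t"
proof -
  have "V f i t = (\<Sum>n. (K ^^ (Suc n)) f i t) + (K ^^ 0) f i t"
    unfolding V_def by (subst suminf_offset[where i = "Suc 0"]) (auto simp: add.commute)
  also have "(\<Sum>n. (K ^^ (Suc n)) f i t) = V (K f) i t"
    unfolding V_def by (simp add: funpow_swap1)
  finally show ?thesis by (simp add: add.commute)
qed

text \<open>Both operations are convolutions in time and commute by Tonelli. This passes on to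
  \<open>V\<close>, so that smoothing the argument of \<open>V\<close> means smoothing the renewal
  function; a translation is the case of a point mass.\<close>

lemma K_conv:
  assumes "bfun f" and "sigma_finite_measure \<mu>" and [measurable_cong]: "sets \<mu> = sets borel"
  shows "K (\<lambda>j t. \<integral>\<^sup>+s. f j (t - s) \<partial>\<mu>) i t = (\<integral>\<^sup>+s. K f i (t - s) \<partial>\<mu>)"
proof -
  note [measurable] = bfunD[OF assms(1)]
  interpret sigma_finite_measure \<mu> by fact
  have "(\<integral>\<^sup>+y. \<integral>\<^sup>+s. f j (t - y - s) \<partial>\<mu> \<partial>q i j) = (\<integral>\<^sup>+s. \<integral>\<^sup>+y. f j (t - s - y) \<partial>q i j \<partial>\<mu>)" for j
  proof -
    interpret pair_sigma_finite "q i j" \<mu> ..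
    show ?thesis
      by (subst Fubini'[symmetric]) (auto simp: algebra_simps)
  qed
  then show ?thesis unfolding K_def by (simp add: nn_integral_sum)
qed

lemma Kn_conv:
  assumes "bfun f" "sigma_finite_measure \<mu>" "sets \<mu> = sets borel"
  shows "(K ^^ n) (\<lambda>j t. \<integral>\<^sup>+s. f j (t - s) \<partial>\<mu>) i t = (\<integral>\<^sup>+s. (K ^^ n) f i (t - s) \<partial>\<mu>)"
proof (induction n arbitrary: i t)
  case (Suc n)
  then have "(K ^^ n) (\<lambda>j t. \<integral>\<^sup>+s. f j (t - s) \<partial>\<mu>) = (\<lambda>j t. \<integral>\<^sup>+s. (K ^^ n) f j (t - s) \<partial>\<mu>)" by auto
  then show ?case by (simp add: K_conv bfun_Kn assms)
qed simp

lemma V_conv: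
  assumes "bfun f" "sigma_finite_measure \<mu>" and [measurable_cong]: "sets \<mu> = sets borel"
  shows "V (\<lambda>j t. \<integral>\<^sup>+s. f j (t - s) \<partial>\<mu>) i t = (\<integral>\<^sup>+s. V f i (t - s) \<partial>\<mu>)"
proof -
  note [measurable] = bfunD[OF bfun_Kn[OF assms(1)]]
  show ?thesis unfolding V_def
    by (simp add: Kn_conv assms nn_integral_suminf)
qed

lemma V_shift:
  assumes "bfun f"
  shows "V (\<lambda>j t. f j (t - s)) i t = V f i (t - s)"
proof -
  note [measurable] = bfunD[OF assms] bfunD[OF bfun_V[OF assms]]
  interpret prob_space "return borel s :: real measure" by (rule prob_space_return) simp
  show ?thesis
    using V_conv[OF assms, of "return borel s" i t] by (simp add: nn_integral_return sigma_finite_measure_axioms)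
qed

text \<open>Causality: sojourns are almost surely nonnegative, so the value at time \<open>t\<close>
  sees the argument only up to \<open>t\<close>.\<close>

lemma K_local:
  assumes "\<And>j s. s \<le> t \<Longrightarrow> f j s = g j s"
  shows "K f i t = K g i t"
  unfolding K_def
proof (rule sum.cong[OF refl], rule nn_integral_cong_AE)
  fix j show "AE y in q i j. f j (t - y) = g j (t - y)"
    using nonneg[of i j] by eventually_elim (auto intro: assms)
qed

lemma Kn_local:
  assumes "\<And>j s. s \<le> t \<Longrightarrow> f j s = g j s"
  shows "s \<le> t \<Longrightarrow> (K ^^ n) f i s = (K ^^ n) g i s"
  by (induction n arbitrary: i s) (auto intro!: K_local assms)

end

lemma tendsto_0_of_suminf_finite:
  fixes f :: "nat \<Rightarrow> ennreal"
  assumes "(\<Sum>n. f n) \<noteq> \<top>"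
  shows "f \<longlonglongrightarrow> 0"
proof -
  have fin: "f n \<noteq> \<top>" for n
    using assms ennreal_suminf_lessD[of f \<top> n] by (auto simp: top.not_eq_extremum)
  then have f: "f n = ennreal (enn2real (f n))" for n
    using fin[of n] by (simp add: top.not_eq_extremum)
  have "(\<Sum>n. ennreal (enn2real (f n))) \<noteq> \<top>" using assms f by simp
  then have "summable (\<lambda>n. enn2real (f n))" by (intro summable_suminf_not_top) auto
  then have "(\<lambda>n. ennreal (enn2real (f n))) \<longlonglongrightarrow> ennreal 0"
    by (intro tendsto_ennrealI summable_LIMSEQ_zero)
  then show ?thesis using f by simp
qed

section \<open>Tails of the kernel and local finiteness of the renewal operator\<close>

context markov_renewal
begin

definition w :: "'s \<Rightarrow> real \<Rightarrow> ennreal" where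
  "w i t = indicator {0..} t * (\<Sum>k\<in>UNIV. emeasure (q i k) {t<..})"

abbreviation unit_step :: "'s \<Rightarrow> real \<Rightarrow> ennreal" where
  "unit_step \<equiv> (\<lambda>_. indicator {0..})"

lemma bfun_unit_step: "bfun unit_step" by (simp add: bfun_def)

lemma K_unit_step: "K unit_step i t = (\<Sum>k\<in>UNIV. emeasure (q i k) {..t})"
proof -
  have "(\<integral>\<^sup>+y. indicator {0..} (t - y) \<partial>q i k) = (\<integral>\<^sup>+y. indicator {..t} y \<partial>q i k)" for k
    by (intro nn_integral_cong) (auto simp: indicator_def)
  then show ?thesis unfolding K_def by (simp add: sets_q)
qed

lemma emeasure_q_neg: "t < 0 \<Longrightarrow> emeasure (q i k) {..t} = 0"
proof -
  assume t: "t < 0"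
  have "AE y in q i k. \<not> y \<le> t" using nonneg[of i k] by eventually_elim (use t in auto)
  then have "emeasure (q i k) {y \<in> space (q i k). y \<le> t} = 0" by (rule emeasure_eq_0_AE)
  then show ?thesis by (simp add: atMost_def)
qed

lemma w_plus_K_unit_step: "w i t + K unit_step i t = unit_step i t"
proof (cases "0 \<le> t")
  case True
  have "emeasure (q i k) {t<..} + emeasure (q i k) {..t} = emeasure (q i k) UNIV" for k
    by (subst plus_emeasure) (auto simp: sets_q intro!: arg_cong[where f = "emeasure _"])
  then show ?thesis
    using True total by (simp add: w_def K_unit_step sum.distrib[symmetric])
next
  case False
  then show ?thesis by (simp add: w_def K_unit_step emeasure_q_neg)
qed

lemma bfun_w: "bfun w"
proof -
  have "(\<lambda>t. emeasure (q i k) {t<..}) \<in> borel_measurable borel" for i k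
  proof -
    have "(\<integral>\<^sup>+y. indicator {0<..} (y - t) \<partial>q i k) = (\<integral>\<^sup>+y. indicator {t<..} y \<partial>q i k)" for t
      by (intro nn_integral_cong) (auto simp: indicator_def)
    then have "emeasure (q i k) {t<..} = (\<integral>\<^sup>+y. indicator {0<..} (y - t) \<partial>q i k)" for t
      by (simp add: sets_q)
    then show ?thesis by simp
  qed
  then show ?thesis unfolding bfun_def w_def[abs_def]
    by (intro allI borel_measurable_times_ennreal borel_measurable_sum) auto
qed

lemma w_le_unit_step: "w i t \<le> unit_step i t"
  using w_plus_K_unit_step[of i t] by (metis le_iff_add)

text \<open>A telescoping sum, as \<open>w\<close> is the unit step minus \<open>K\<close> of the
  unit step. The remainder is the probability that the \<open>N\<close>-th renewal epoch is not
  later than \<open>t\<close>.\<close>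

lemma sum_Kn_w: "(\<Sum>n<N. (K ^^ n) w i t) + (K ^^ N) unit_step i t = unit_step i t"
proof (induction N)
  case (Suc N)
  have "(K ^^ N) unit_step i t = (K ^^ N) (\<lambda>i t. w i t + K unit_step i t) i t"
    by (simp add: w_plus_K_unit_step)
  also have "\<dots> = (K ^^ N) w i t + (K ^^ Suc N) unit_step i t"
    by (subst Kn_add) (auto simp: bfun_w bfun_K bfun_unit_step funpow_swap1)
  finally show ?case using Suc by (simp add: add.assoc)
qed simp

text \<open>At this stage only the inequality is available: the vanishing of the remainder, which
  gives equality in \<open>V_w\<close>, rests on local finiteness, and that in turn is deduced from
  this bound.\<close>

lemma V_w_le: "V w i t \<le> unit_step i t"
  unfolding V_def suminf_eq_SUP
proof (rule SUP_least)
  fix N show "(\<Sum>n<N. (K ^^ n) w i t) \<le> unit_step i t"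
    using sum_Kn_w[where N = N and i = i and t = t] by (metis le_iff_add)
qed

definition Vbounded :: "('s \<Rightarrow> real \<Rightarrow> ennreal) \<Rightarrow> bool" where
  "Vbounded f \<longleftrightarrow> (\<exists>C::real. \<forall>i t. V f i t \<le> ennreal C)"

lemma Vbounded_mono: "Vbounded g \<Longrightarrow> (\<And>i t. f i t \<le> g i t) \<Longrightarrow> Vbounded f"
  unfolding Vbounded_def by (blast intro: order_trans[OF V_mono])

lemma Vbounded_add:
  assumes "Vbounded f" "Vbounded g" "bfun f" "bfun g"
  shows "Vbounded (\<lambda>i t. f i t + g i t)"
proof -
  obtain C D where "\<And>i t. V f i t \<le> ennreal C" "\<And>i t. V g i t \<le> ennreal D"
    using assms unfolding Vbounded_def by blast
  then have "V f i t + V g i t \<le> ennreal (max 0 C + max 0 D)" for i t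
    by (subst ennreal_plus) (auto intro!: add_mono intro: order_trans ennreal_leI)
  then have "\<forall>i t. V (\<lambda>i t. f i t + g i t) i t \<le> ennreal (max 0 C + max 0 D)"
    using assms by (simp only: V_add simp_thms)
  then show ?thesis unfolding Vbounded_def by blast
qed

lemma Vbounded_sum:
  assumes "\<And>x. x \<in> X \<Longrightarrow> bfun (f x)" "finite X" "\<And>x. x \<in> X \<Longrightarrow> Vbounded (f x)"
  shows "Vbounded (\<lambda>i t. \<Sum>x\<in>X. f x i t)"
  using assms(2,1,3)
proof (induction X rule: finite_induct)
  case empty
  have "V (\<lambda>i t. 0) i t = 0" for i t using V_cmult[of "\<lambda>_ _. 0" 0 i t] by (simp add: bfun_def)
  then show ?case by (auto simp: Vbounded_def)
next
  case (insert x X)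
  then have "bfun (\<lambda>i t. \<Sum>x\<in>X. f x i t)"
    unfolding bfun_def by (auto intro!: borel_measurable_sum)
  with insert have "Vbounded (\<lambda>i t. f x i t + (\<Sum>x\<in>X. f x i t))"
    by (intro Vbounded_add) simp_all
  then show ?case using insert.hyps by simp
qed

lemma Vbounded_cmult:
  assumes "Vbounded f" "bfun f"
  shows "Vbounded (\<lambda>i t. ennreal c * f i t)"
proof -
  obtain C where "\<And>i t. V f i t \<le> ennreal C" using assms unfolding Vbounded_def by blast
  then have "ennreal c * V f i t \<le> ennreal (c * max 0 C)" for i t
    by (subst ennreal_mult'') (auto intro!: mult_left_mono intro: order_trans ennreal_leI)
  then show ?thesis unfolding Vbounded_def using assms by (auto simp: V_cmult)
qed

lemma Vbounded_shift: "Vbounded f \<Longrightarrow> bfun f \<Longrightarrow> Vbounded (\<lambda>i t. f i (t - s))"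
  unfolding Vbounded_def by (auto simp: V_shift)

lemma Vbounded_shiftD:
  assumes "Vbounded (\<lambda>i t. f i (t - s))" "bfun f"
  shows "Vbounded f"
proof -
  have "bfun (\<lambda>i t. f i (t - s))" using bfunD[OF assms(2), measurable] unfolding bfun_def by (intro allI) measurable
  from Vbounded_shift[OF assms(1) this, of "- s"] show ?thesis by simp
qed

text \<open>Isolates one target state: \<open>V (only_at j f) i\<close> is the \<open>(i, j)\<close>
  entry of the renewal matrix convolved with \<open>f\<close>.\<close>

definition only_at :: "'s \<Rightarrow> (real \<Rightarrow> ennreal) \<Rightarrow> 's \<Rightarrow> real \<Rightarrow> ennreal" where
  "only_at j f k t = (if k = j then f t else 0)"

lemma bfun_on[intro]: "f \<in> borel_measurable borel \<Longrightarrow> bfun (only_at j f)"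
  unfolding bfun_def only_at_def[abs_def] by auto

lemma sum_on: "(\<Sum>j\<in>UNIV. only_at j (f j) i t) = f i t"
  by (simp add: only_at_def)

text \<open>If all sojourns vanished, every support would lie in \<open>{0}\<close> and 0 would be
  the only reachable time, which is a multiple of every \<open>d\<close>.\<close>

lemma exists_positive_sojourn: "\<exists>i j a. 0 < a \<and> emeasure (q i j) {a<..} \<noteq> 0"
proof (rule ccontr)
  assume "\<not> ?thesis"
  then have z: "emeasure (q i j) {a<..} = 0" if "0 < a" for i j a using that by blast
  have supp: "y = 0" if "y \<in> msupp (q i j)" for i j y
  proof (rule ccontr)
    assume "y \<noteq> 0"
    have "emeasure (q i j) {y - \<bar>y\<bar>/2<..<y + \<bar>y\<bar>/2} = 0"
    proof (cases "0 < y")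
      case True
      then have "{y - \<bar>y\<bar>/2<..<y + \<bar>y\<bar>/2} \<subseteq> {y/2<..}" by auto
      then show ?thesis using z[of "y/2" i j] True emeasure_mono[of _ "{y/2<..}" "q i j"] sets_q by fastforce
    next
      case False
      then have "{y - \<bar>y\<bar>/2<..<y + \<bar>y\<bar>/2} \<subseteq> {..y/2}" "y / 2 < 0" using \<open>y \<noteq> 0\<close> by auto
      then show ?thesis using emeasure_q_neg[of "y/2" i j] emeasure_mono[of _ "{..y/2}" "q i j"] sets_q by fastforce
    qed
    then show False using that \<open>y \<noteq> 0\<close> unfolding msupp_def by (auto dest!: spec[of _ "\<bar>y\<bar>/2"])
  qed
  have "y = 0" if "reach q i j y" for i j y
    using that by (induction rule: reach.induct) (auto dest: supp)
  then show False using nonlattice[of 1 undefined] by (metis mult_zero_right of_int_0 zero_less_one)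
qed

text \<open>Finitely many translates of \<open>[0, a]\<close> cover \<open>[0, L]\<close>, and the
  bound on \<open>V\<close> is uniform in time, hence invariant under translation.\<close>

lemma Vbounded_interval_extend:
  assumes "Vbounded (only_at j (indicator {0..a}))" "0 < a"
  shows "Vbounded (only_at j (indicator {0..L}))"
proof -
  have "Vbounded (only_at j (indicator {0..of_nat n * a}))" for n
  proof (induction n)
    case 0
    show ?case by (rule Vbounded_mono[OF assms(1)]) (use assms(2) in \<open>auto simp: only_at_def indicator_def\<close>)
  next
    case (Suc n)
    have "Vbounded (\<lambda>k t. only_at j (indicator {0..of_nat n * a}) k t
        + only_at j (indicator {0..a}) k (t - of_nat n * a))"
      by (intro Vbounded_add Suc Vbounded_shift assms(1)) (auto simp: bfun_def only_at_def[abs_def])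
    then show ?case
      by (rule Vbounded_mono) (auto simp: only_at_def indicator_def algebra_simps)
  qed
  moreover obtain n where "L < of_nat n * a" using ex_less_of_nat_mult[OF assms(2)] by blast
  ultimately show ?thesis
    by (intro Vbounded_mono[where g = "only_at j (indicator {0..of_nat n * a})" and f = "only_at j (indicator {0..L})"])
       (auto simp: only_at_def indicator_def)
qed

text \<open>A visit to \<open>j\<close> is followed, with a fixed positive probability, by a visit
  to \<open>k\<close> within \<open>n\<close> time units. Hence expected visits to \<open>j\<close>
  in a window are controlled by expected visits to \<open>k\<close> in a longer one.\<close>

lemma Vbounded_edge:
  assumes b: "\<And>L. Vbounded (only_at k (indicator {0..L}))" and e: "emeasure (q j k) UNIV \<noteq> 0"
  shows "Vbounded (only_at j (indicator {0..L}))"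
proof -
  have "\<exists>n::nat. emeasure (q j k) {..real n} \<noteq> 0"
  proof (rule ccontr)
    assume "\<not> ?thesis"
    then have "(\<Union>n::nat. {..real n}) \<in> null_sets (q j k)"
      by (intro null_sets_UN) (auto simp: null_sets_def sets_q)
    moreover have "(\<Union>n::nat. {..real n}) = UNIV" using real_arch_simple by auto
    ultimately show False using e by auto
  qed
  then obtain n :: nat where n: "emeasure (q j k) {..real n} \<noteq> 0" by blast
  define c where "c = measure (q j k) {..real n}"
  have c: "emeasure (q j k) {..real n} = ennreal c" unfolding c_def by (rule q.emeasure_eq_measure)
  have c0: "0 < c" using n c by (metis c_def ennreal_0 less_eq_real_def measure_nonneg)
  \<comment> \<open>Shifting the window by \<open>n\<close> guarantees
    \<open>0 \<le> t - y \<le> L + n\<close> for all sojourns \<open>y\<close> between 0 and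
    \<open>n\<close>, so that one interval at \<open>k\<close> serves for every \<open>t\<close> in
    the window.\<close>
  have "Vbounded (\<lambda>i t. only_at j (indicator {0..L}) i (t - real n))"
  proof (rule Vbounded_mono)
    let ?f = "only_at k (indicator {0..L + real n})"
    have "Vbounded (K ?f)"
    proof -
      have "V (K ?f) i t \<le> V ?f i t" for i t by (subst (2) V_K) (rule add_increasing, auto)
      then show ?thesis using b[of "L + real n"] unfolding Vbounded_def by (blast intro: order_trans)
    qed
    then show "Vbounded (\<lambda>i t. ennreal (1/c) * K ?f i t)"
      by (intro Vbounded_cmult bfun_K bfun_on) auto
    fix i t
    show "only_at j (indicator {0..L}) i (t - real n) \<le> ennreal (1/c) * K ?f i t"
    proof (cases "i = j \<and> real n \<le> t \<and> t \<le> L + real n")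
      case True
      have "ennreal c = (\<integral>\<^sup>+y. indicator {..real n} y \<partial>q j k)" using c by (simp add: sets_q)
      also have "\<dots> \<le> (\<integral>\<^sup>+y. ?f k (t - y) \<partial>q j k)"
        by (rule nn_integral_mono_AE) (use nonneg[of j k] True in \<open>auto simp: only_at_def indicator_def\<close>)
      also have "\<dots> \<le> K ?f j t" unfolding K_def by (rule member_le_sum) auto
      finally have "ennreal (1/c) * ennreal c \<le> ennreal (1/c) * K ?f j t" by (intro mult_left_mono) auto
      then show ?thesis using True c0 by (simp add: only_at_def ennreal_mult'[symmetric])
    qed (auto simp: only_at_def indicator_def)
  qed
  then show ?thesis by (rule Vbounded_shiftD[where f = "only_at j (indicator {0..L})" and s = "real n"]) auto
qed

text \<open>At a state that is held longer than \<open>a\<close> with probability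
  \<open>c > 0\<close>, the indicator of \<open>[0, a]\<close> is at most \<open>w / c\<close>, and
  \<open>V w \<le> 1\<close>. Irreducibility carries the bound backwards along edges to every other
  state.\<close>

lemma Vbounded_on: "Vbounded (only_at j (indicator {0..L}))"
proof -
  obtain i0 k a where a: "0 < a" "emeasure (q i0 k) {a<..} \<noteq> 0" using exists_positive_sojourn by blast
  define c where "c = measure (q i0 k) {a<..}"
  have c: "emeasure (q i0 k) {a<..} = ennreal c" unfolding c_def by (rule q.emeasure_eq_measure)
  have c0: "0 < c" using a c by (metis c_def ennreal_0 less_eq_real_def measure_nonneg)
  have Vw: "Vbounded w"
    unfolding Vbounded_def by (intro exI[of _ 1] allI order_trans[OF V_w_le]) (auto simp: indicator_def)
  have "Vbounded (only_at i0 (indicator {0..a}))"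
  proof (rule Vbounded_mono)
    show "Vbounded (\<lambda>i t. ennreal (1/c) * w i t)" by (intro Vbounded_cmult Vw bfun_w)
    fix i t
    show "only_at i0 (indicator {0..a}) i t \<le> ennreal (1/c) * w i t"
    proof (cases "i = i0 \<and> 0 \<le> t \<and> t \<le> a")
      case True
      have "ennreal c \<le> emeasure (q i0 k) {t<..}"
        unfolding c[symmetric] by (rule emeasure_mono) (use True in \<open>auto simp: sets_q\<close>)
      also have "\<dots> \<le> (\<Sum>k\<in>UNIV. emeasure (q i0 k) {t<..})" by (rule member_le_sum) auto
      finally have "ennreal c \<le> w i t" using True by (simp add: w_def)
      then have "ennreal (1/c) * ennreal c \<le> ennreal (1/c) * w i t" by (intro mult_left_mono) auto
      then show ?thesis using True c0 by (simp add: only_at_def ennreal_mult'[symmetric])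
    qed (auto simp: only_at_def indicator_def)
  qed
  then have base: "Vbounded (only_at i0 (indicator {0..L}))" for L
    by (rule Vbounded_interval_extend) fact
  have "\<forall>L. Vbounded (only_at j (indicator {0..L}))"
    using irreducible[of j i0]
  proof (induction rule: converse_rtrancl_induct)
    case base
    show ?case using \<open>\<And>L. Vbounded (only_at i0 (indicator {0..L}))\<close> by blast
  next
    case (step y z)
    then have "emeasure (q y z) UNIV \<noteq> 0" "\<And>L. Vbounded (only_at z (indicator {0..L}))" by auto
    then show ?case by (intro allI Vbounded_edge[of z y]) auto
  qed
  then show ?thesis by blast
qed

lemma Vbounded_interval: "Vbounded (\<lambda>_. indicator {0..L})"
proof -
  have "Vbounded (\<lambda>i t. \<Sum>j\<in>UNIV. only_at j (indicator {0..L}) i t)"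
    by (intro Vbounded_sum Vbounded_on) auto
  then show ?thesis by (simp add: sum_on)
qed

text \<open>By causality only the window \<open>[0, t]\<close> matters at time \<open>t\<close>, and
  for that window the iterates are the terms of a convergent series. So the process has no
  accumulation of renewal epochs, in spite of possible atoms at 0.\<close>

lemma Kn_unit_step_tendsto_0: "(\<lambda>n. (K ^^ n) unit_step i t) \<longlonglongrightarrow> 0"
proof -
  have "(K ^^ n) unit_step i t = (K ^^ n) (\<lambda>_. indicator {0..t}) i t" for n
    by (rule Kn_local[of t]) (auto simp: indicator_def)
  moreover have "(\<lambda>n. (K ^^ n) (\<lambda>_. indicator {0..t}) i t) \<longlonglongrightarrow> 0"
  proof (rule tendsto_0_of_suminf_finite)
    obtain C :: real where "\<And>i s. V (\<lambda>_. indicator {0..t}) i s \<le> ennreal C"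
      using Vbounded_interval[of t] unfolding Vbounded_def by blast
    from this[of i t] show "(\<Sum>n. (K ^^ n) (\<lambda>_. indicator {0..t}) i t) \<noteq> \<top>"
      unfolding V_def by (auto simp: top_unique)
  qed
  ultimately show ?thesis by simp
qed

text \<open>Every time \<open>t \<ge> 0\<close> lies in exactly one renewal interval, and
  \<open>V w i t\<close> is the expected number of intervals containing it.\<close>

lemma V_w: "V w i t = unit_step i t"
proof -
  have "(\<lambda>N. (\<Sum>n<N. (K ^^ n) w i t) + (K ^^ N) unit_step i t) \<longlonglongrightarrow> V w i t + 0"
    unfolding V_def by (intro tendsto_add summable_LIMSEQ Kn_unit_step_tendsto_0 summableI)
  then show ?thesis unfolding sum_Kn_w by (simp add: LIMSEQ_const_iff)
qed

text \<open>If \<open>D\<close> is asymptotically harmonic and asymptotically bounded by \<open>M\<close>, then being close to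
  \<open>M\<close> along a sequence propagates backwards along the supports of the kernel.\<close>
lemma approach_step:
  fixes D :: "'s \<Rightarrow> real \<Rightarrow> real"
  assumes [measurable]: "\<And>i. D i \<in> borel_measurable borel"
    and bounded: "\<And>i t. \<bar>D i t\<bar> \<le> B"
    and uc: "\<And>e. 0 < e \<Longrightarrow> \<exists>d>0. \<forall>i s t. \<bar>s - t\<bar> < d \<longrightarrow> \<bar>D i s - D i t\<bar> < e"
    and eq: "eventually (\<lambda>t. D i t = (\<Sum>j\<in>UNIV. \<integral>y. D j (t - y) \<partial>q i j)) at_top"
    and upper: "\<And>e. 0 < e \<Longrightarrow> \<exists>T. \<forall>t\<ge>T. \<forall>i. D i t \<le> M + e"
    and t: "filterlim t at_top sequentially" and lim: "(\<lambda>n. D i (t n)) \<longlonglongrightarrow> M"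
    and y: "y \<in> msupp (q i j)"
  shows "(\<lambda>n. D j (t n - y)) \<longlonglongrightarrow> M"
proof -
  have B0: "0 \<le> B" using bounded[of i 0] by linarith
  \<comment> \<open>The excess of \<open>D\<close> over \<open>M\<close>. It vanishes in the limit
    because \<open>M\<close> is an asymptotic upper bound, and
    \<open>\<bar>M - D\<bar> = (M - D) + 2 * neg\<close> turns convergence of the signed integrals
    into convergence in mean.\<close>
  define neg where "neg n k x = max 0 (D k (t n - x) - M)" for n k x
  have int: "integrable (q i k) (\<lambda>x. D k (s - x))" for k s
    by (rule q.integrable_const_bound[where B = B]) (use bounded in auto)
  have intM: "integrable (q i k) (\<lambda>x. M - D k (t n - x))" for k n
    using int by auto
  have negbound: "\<bar>neg n k x\<bar> \<le> B + \<bar>M\<bar>" for n k x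
    using bounded[of k "t n - x"] unfolding neg_def by linarith
  have [measurable]: "neg n k \<in> borel_measurable borel" for n k unfolding neg_def by measurable
  have intneg: "integrable (q i k) (neg n k)" for k n
    by (rule q.integrable_const_bound[where B = "B + \<bar>M\<bar>"]) (use negbound in auto)
  have neg0: "(\<lambda>n. \<integral>x. neg n k x \<partial>q i k) \<longlonglongrightarrow> (\<integral>x. 0 \<partial>q i k)" for k
  proof (rule integral_dominated_convergence[where w = "\<lambda>_. B + \<bar>M\<bar>"])
    show "AE x in q i k. (\<lambda>n. neg n k x) \<longlonglongrightarrow> 0"
    proof (rule AE_I2)
      fix x
      show "(\<lambda>n. neg n k x) \<longlonglongrightarrow> 0"
      proof (rule LIMSEQ_I)
        fix e :: real assume e: "0 < e"
        obtain T where T: "\<And>s. T \<le> s \<Longrightarrow> D k s \<le> M + e / 2" using upper[of "e / 2"] e by auto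
        have "eventually (\<lambda>n. T + x \<le> t n) sequentially"
          using t unfolding filterlim_at_top by blast
        then obtain N where N: "\<And>n. N \<le> n \<Longrightarrow> T + x \<le> t n" by (auto simp: eventually_sequentially)
        have "norm (neg n k x - 0) < e" if "N \<le> n" for n
          using T[of "t n - x"] N[OF that] e unfolding neg_def by auto
        then show "\<exists>N. \<forall>n\<ge>N. norm (neg n k x - 0) < e" by blast
      qed
    qed
  qed (use negbound in auto)
  have "(\<lambda>n. \<Sum>k\<in>UNIV. \<integral>x. M - D k (t n - x) \<partial>q i k) \<longlonglongrightarrow> M - M"
  proof (rule Lim_transform_eventually)
    show "(\<lambda>n. M - D i (t n)) \<longlonglongrightarrow> M - M" by (intro tendsto_intros lim)
    have "eventually (\<lambda>n. D i (t n) = (\<Sum>j\<in>UNIV. \<integral>y. D j (t n - y) \<partial>q i j)) sequentially"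
      using filterlim_iff[THEN iffD1, OF t] eq by blast
    then show "eventually (\<lambda>n. M - D i (t n) = (\<Sum>k\<in>UNIV. \<integral>x. M - D k (t n - x) \<partial>q i k)) sequentially"
      by eventually_elim
         (simp add: int Bochner_Integration.integral_diff sum_subtractf sum_distrib_right[symmetric] P_sum)
  qed
  then have "(\<lambda>n. (\<Sum>k\<in>UNIV. \<integral>x. M - D k (t n - x) \<partial>q i k) + 2 * (\<Sum>k\<in>UNIV. \<integral>x. neg n k x \<partial>q i k))
      \<longlonglongrightarrow> (M - M) + 2 * (\<Sum>k\<in>UNIV. \<integral>x. 0 \<partial>q i k)"
    by (intro tendsto_intros neg0)
  moreover have "(\<Sum>k\<in>UNIV. \<integral>x. M - D k (t n - x) \<partial>q i k) + 2 * (\<Sum>k\<in>UNIV. \<integral>x. neg n k x \<partial>q i k)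
     = (\<Sum>k\<in>UNIV. \<integral>x. \<bar>M - D k (t n - x)\<bar> \<partial>q i k)" for n
  proof -
    have "(\<integral>x. M - D k (t n - x) \<partial>q i k) + 2 * (\<integral>x. neg n k x \<partial>q i k) = (\<integral>x. \<bar>M - D k (t n - x)\<bar> \<partial>q i k)" for k
    proof -
      have "(\<integral>x. M - D k (t n - x) \<partial>q i k) + 2 * (\<integral>x. neg n k x \<partial>q i k)
        = (\<integral>x. (M - D k (t n - x)) + 2 * neg n k x \<partial>q i k)"
        by (subst Bochner_Integration.integral_add) (use intM intneg in auto)
      also have "\<dots> = (\<integral>x. \<bar>M - D k (t n - x)\<bar> \<partial>q i k)"
        by (rule Bochner_Integration.integral_cong) (auto simp: neg_def max_def abs_if)
      finally show ?thesis .
    qed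
    then show ?thesis by (simp add: sum.distrib[symmetric] sum_distrib_left)
  qed
  ultimately have abs0: "(\<lambda>n. \<Sum>k\<in>UNIV. \<integral>x. \<bar>M - D k (t n - x)\<bar> \<partial>q i k) \<longlonglongrightarrow> 0" by simp
  have abs_j: "(\<lambda>n. \<integral>x. \<bar>M - D j (t n - x)\<bar> \<partial>q i j) \<longlonglongrightarrow> 0"
  proof (rule tendsto_sandwich[OF _ _ tendsto_const abs0])
    show "eventually (\<lambda>n. (\<integral>x. \<bar>M - D j (t n - x)\<bar> \<partial>q i j) \<le> (\<Sum>k\<in>UNIV. \<integral>x. \<bar>M - D k (t n - x)\<bar> \<partial>q i k)) sequentially"
      by (intro always_eventually allI member_le_sum) auto
  qed auto
  show ?thesis
  proof (rule LIMSEQ_I)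
    fix e :: real assume e: "0 < e"
    obtain d where d: "0 < d" "\<And>k s s'. \<bar>s - s'\<bar> < d \<Longrightarrow> \<bar>D k s - D k s'\<bar> < e / 2"
      using uc[of "e / 2"] e by auto
    \<comment> \<open>A deviation of at least \<open>e\<close> at the point \<open>y\<close>
      persists, as at least \<open>e / 2\<close>, over the whole \<open>d\<close>-neighbourhood by
      uniform continuity. The latter has mass \<open>p > 0\<close>, so the mean deviation would stay
      above \<open>e / 2 * p\<close>.\<close>
    define p where "p = measure (q i j) {y - d<..<y + d}"
    have "emeasure (q i j) {y - d<..<y + d} \<noteq> 0" using y d unfolding msupp_def by blast
    then have p: "0 < p" unfolding p_def by (simp add: q.emeasure_eq_measure measure_le_0_iff less_le)
    obtain N where N: "\<And>n. N \<le> n \<Longrightarrow> \<bar>\<integral>x. \<bar>M - D j (t n - x)\<bar> \<partial>q i j\<bar> < e / 2 * p"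
      using LIMSEQ_D[OF abs_j, of "e / 2 * p"] e p by auto
    have "\<bar>D j (t n - y) - M\<bar> < e" if "N \<le> n" for n
    proof (rule ccontr)
      assume "\<not> ?thesis"
      then have far: "e \<le> \<bar>D j (t n - y) - M\<bar>" by simp
      have "(\<integral>x. e / 2 * indicator {y - d<..<y + d} x \<partial>q i j) \<le> (\<integral>x. \<bar>M - D j (t n - x)\<bar> \<partial>q i j)"
      proof (rule integral_mono)
        show "integrable (q i j) (\<lambda>x. e / 2 * indicator {y - d<..<y + d} x)"
          by (intro integrable_mult_right integrable_real_indicator) (auto simp: sets_q q.emeasure_eq_measure)
        show "integrable (q i j) (\<lambda>x. \<bar>M - D j (t n - x)\<bar>)" using intM by auto
        fix x
        show "e / 2 * indicator {y - d<..<y + d} x \<le> \<bar>M - D j (t n - x)\<bar>"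
        proof (cases "x \<in> {y - d<..<y + d}")
          case True
          then have "\<bar>D j (t n - x) - D j (t n - y)\<bar> < e / 2" by (intro d) auto
          then have "e / 2 \<le> \<bar>M - D j (t n - x)\<bar>" using far by linarith
          then show ?thesis using True by simp
        qed simp
      qed
      moreover have "(\<integral>x. e / 2 * indicator {y - d<..<y + d} x \<partial>q i j) = e / 2 * p"
        by (simp add: p_def)
      ultimately show False using N[OF that] by linarith
    qed
    then show "\<exists>N. \<forall>n\<ge>N. norm (D j (t n - y) - M) < e" by auto
  qed
qed

text \<open>The increments \<open>D\<close> of \<open>v\<close> over the step \<open>h\<close>
  satisfy the same eventual equation as \<open>v\<close>. A bounded function cannot have increments
  above \<open>M / 2\<close> at arbitrarily many consecutive points of a progression with step
  \<open>h\<close>, so their upper limit \<open>M\<close> cannot be positive.\<close>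

lemma limsup_difference_le_0:
  fixes v :: "'s \<Rightarrow> real \<Rightarrow> real"
  assumes meas[measurable]: "\<And>i. v i \<in> borel_measurable borel"
    and bounded: "\<And>i t. \<bar>v i t\<bar> \<le> B"
    and uc: "\<And>e. 0 < e \<Longrightarrow> \<exists>d>0. \<forall>i s t. \<bar>s - t\<bar> < d \<longrightarrow> \<bar>v i s - v i t\<bar> < e"
    and eq: "\<And>i. eventually (\<lambda>t. v i t = (\<Sum>j\<in>UNIV. \<integral>y. v j (t - y) \<partial>q i j)) at_top"
    and e: "0 < e"
  shows "\<exists>T. \<forall>t\<ge>T. \<forall>i. v i (t + h) - v i t \<le> e"
proof (rule ccontr)
  assume contra: "\<not> ?thesis"
  define D where "D i t = v i (t + h) - v i t" for i t
  have Dm[measurable]: "D i \<in> borel_measurable borel" for i unfolding D_def[abs_def] by measurable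
  have Db: "\<bar>D i t\<bar> \<le> 2 * B" for i t
    using bounded[of i "t + h"] bounded[of i t] unfolding D_def by linarith
  have Duc: "\<exists>d>0. \<forall>i s t. \<bar>s - t\<bar> < d \<longrightarrow> \<bar>D i s - D i t\<bar> < e" if e: "0 < e" for e
  proof -
    obtain d where d: "0 < d" "\<And>i s t. \<bar>s - t\<bar> < d \<Longrightarrow> \<bar>v i s - v i t\<bar> < e / 2"
      using uc[of "e / 2"] e by auto
    have "\<bar>D i s - D i t\<bar> < e" if st: "\<bar>s - t\<bar> < d" for i s t
    proof -
      have "\<bar>v i (s + h) - v i (t + h)\<bar> < e / 2" using st by (intro d) simp
      then show ?thesis using d(2)[OF st, of i] unfolding D_def by linarith
    qed
    then show ?thesis using d by blast
  qed
  have intv: "integrable (q i j) (\<lambda>y. v j (s - y))" for i j s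
    by (rule q.integrable_const_bound[where B = B]) (use bounded in auto)
  have Deq: "eventually (\<lambda>t. D i t = (\<Sum>j\<in>UNIV. \<integral>y. D j (t - y) \<partial>q i j)) at_top" for i
  proof -
    have "filterlim (\<lambda>t. t + h) at_top (at_top::real filter)"
      using filterlim_tendsto_add_at_top[OF tendsto_const[of h] filterlim_ident] by (simp add: add.commute)
    then have "eventually (\<lambda>t. v i (t + h) = (\<Sum>j\<in>UNIV. \<integral>y. v j (t + h - y) \<partial>q i j)) at_top"
      using eq[of i] unfolding filterlim_iff by blast
    with eq[of i] show ?thesis
    proof eventually_elim
      case (elim t)
      have "(\<integral>y. D j (t - y) \<partial>q i j) = (\<integral>y. v j (t + h - y) \<partial>q i j) - (\<integral>y. v j (t - y) \<partial>q i j)" for j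
        unfolding D_def by (subst Bochner_Integration.integral_diff[symmetric])
          (use intv[of i j "t + h"] intv[of i j t] in \<open>auto simp: algebra_simps\<close>)
      then show ?case using elim by (simp add: D_def sum_subtractf)
    qed
  qed
  \<comment> \<open>The infimum of the eventual upper bounds common to all states is the upper limit
    of \<open>D\<close>, taken jointly over states and times.\<close>
  define X where "X = {m. \<exists>T. \<forall>t\<ge>T. \<forall>i. D i t \<le> m}"
  have Xne: "X \<noteq> {}" using Db unfolding X_def by (blast intro: abs_le_D1)
  have X_lower: "- (2 * B) \<le> m" if mX: "m \<in> X" for m
  proof -
    obtain T where "\<forall>t\<ge>T. \<forall>i. D i t \<le> m" using mX unfolding X_def by blast
    then have "D undefined T \<le> m" by blast
    then show ?thesis using Db[of undefined T] by linarith
  qed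
  have bdd: "bdd_below X" using X_lower by (rule bdd_belowI)
  define M where "M = Inf X"
  have up: "\<exists>T. \<forall>t\<ge>T. \<forall>i. D i t \<le> M + e" if "0 < e" for e
  proof -
    have "Inf X < M + e" using that by (simp add: M_def)
    then obtain m where "m \<in> X" "m < M + e" using cInf_lessD[OF Xne] by blast
    then show ?thesis unfolding X_def mem_Collect_eq by (meson less_imp_le order_trans)
  qed
  have "e \<notin> X" using contra unfolding X_def D_def by blast
  have Me: "e \<le> M"
  proof (rule ccontr)
    assume "\<not> e \<le> M"
    then obtain T where "\<forall>t\<ge>T. \<forall>i. D i t \<le> M + (e - M)" using up[of "e - M"] by auto
    then have "\<forall>t\<ge>T. \<forall>i. D i t \<le> e" by simp
    then show False using \<open>e \<notin> X\<close> unfolding X_def by blast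
  qed
  then have M: "0 < M" using e by linarith
  \<comment> \<open>As there are finitely many states, the joint upper limit is approached along a
    single one: otherwise the smallest of the defects \<open>ee\<close> would improve the bound
    \<open>M\<close>.\<close>
  obtain i where i: "\<And>e T. 0 < e \<Longrightarrow> \<exists>t\<ge>T. M - e < D i t"
  proof -
    have "\<exists>i. \<forall>e>0. \<forall>T. \<exists>t\<ge>T. M - e < D i t"
    proof (rule ccontr)
      assume "\<not> ?thesis"
      then have "\<forall>i. \<exists>e T. 0 < e \<and> (\<forall>t\<ge>T. D i t \<le> M - e)" by (metis not_less)
      then obtain ee TT where *: "\<And>i. 0 < ee i" "\<And>i t. TT i \<le> t \<Longrightarrow> D i t \<le> M - ee i"
        by metis
      have "D i t \<le> M - Min (range ee)" if "Max (range TT) \<le> t" for i t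
      proof -
        have "TT i \<le> t" using that by (auto intro: order_trans[rotated])
        then have "D i t \<le> M - ee i" by (rule *)
        moreover have "Min (range ee) \<le> ee i" by auto
        ultimately show ?thesis by linarith
      qed
      then have "M - Min (range ee) \<in> X" unfolding X_def by blast
      then have "M \<le> M - Min (range ee)" unfolding M_def by (rule cInf_lower[OF _ bdd])
      moreover have "0 < Min (range ee)" using * by auto
      ultimately show False by linarith
    qed
    then show ?thesis using that by blast
  qed
  have "\<forall>n. \<exists>t. real n \<le> t \<and> M - 1 / real (Suc n) < D i t"
    using i by (metis of_nat_0_less_iff zero_less_Suc zero_less_divide_1_iff)
  then obtain t where t: "\<And>n. real n \<le> t n" "\<And>n. M - 1 / real (Suc n) < D i (t n)"
    by metis
  have t_top: "filterlim t at_top sequentially"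
    by (rule filterlim_at_top_mono[OF filterlim_real_sequentially]) (use t in auto)
  have lim: "(\<lambda>n. D i (t n)) \<longlonglongrightarrow> M"
  proof (rule LIMSEQ_I)
    fix e :: real assume e: "0 < e"
    obtain T where T: "\<And>s. T \<le> s \<Longrightarrow> D i s \<le> M + e / 2" using up[of "e / 2"] e by auto
    obtain N where N: "inverse (real (Suc N)) < e" using reals_Archimedean[OF e] by auto
    obtain N' where N': "T \<le> real N'" using real_arch_simple by blast
    have "norm (D i (t n) - M) < e" if "max N N' \<le> n" for n
    proof -
      have "D i (t n) \<le> M + e / 2"
        using T[of "t n"] t(1)[of n] N' that by (meson max.bounded_iff of_nat_le_iff order_trans)
      moreover have "1 / real (Suc n) \<le> inverse (real (Suc N))"
        using that by (simp add: field_simps)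
      ultimately show ?thesis using t(2)[of n] N e by (simp add: abs_less_iff)
    qed
    then show "\<exists>N. \<forall>n\<ge>N. norm (D i (t n) - M) < e" by blast
  qed
  have reach_lim: "(\<lambda>n. D j (t n - y)) \<longlonglongrightarrow> M" if "reach q i j y" for j y
    using that
  proof (induction rule: reach.induct)
    case start
    then show ?case using lim by simp
  next
    case (extend j x y k)
    have "filterlim (\<lambda>n. t n - x) at_top sequentially"
      using t_top filterlim_tendsto_add_at_top[OF tendsto_const[of "- x"] t_top] by (simp add: algebra_simps)
    from approach_step[OF Dm Db Duc Deq up this extend.IH extend.hyps(2)]
    show ?case by (simp add: algebra_simps)
  qed
  \<comment> \<open>Reachable times only come within \<open>d\<close> of a prescribed time. Of the
    value above \<open>3 / 4 * M\<close> at the reachable time, uniform continuity then gives up at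
    most \<open>M / 4\<close>, and \<open>M / 2\<close> remains.\<close>
  obtain d where d: "0 < d" "\<And>i s t. \<bar>s - t\<bar> < d \<Longrightarrow> \<bar>D i s - D i t\<bar> < M / 4"
    using Duc[of "M / 4"] M by auto
  have "\<exists>A. \<forall>x\<ge>A. \<exists>y\<in>Collect (reach q i i). \<bar>y - x\<bar> < d"
  proof (rule nonlattice_semigroup_asymptotically_dense[OF _ _ _ _ d(1)])
    show "0 \<le> x" if "x \<in> Collect (reach q i i)" for x
    proof -
      have "0 \<le> x" if "reach q i j x" for j x
        using that
      proof (induction rule: reach.induct)
        case (extend j x y k)
        have "0 \<le> y"
        proof (rule ccontr)
          assume y: "\<not> 0 \<le> y"
          have "emeasure (q j k) {y - (-y/2)<..<y + (-y/2)} \<le> emeasure (q j k) {..y/2}"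
            using y by (intro emeasure_mono) (auto simp: sets_q)
          also have "\<dots> = 0" using y by (intro emeasure_q_neg) auto
          finally show False using extend.hyps(2) y unfolding msupp_def by (auto dest!: spec[of _ "- y / 2"])
        qed
        then show ?case using extend by simp
      qed simp
      then show ?thesis using that by blast
    qed
    show "0 \<in> Collect (reach q i i)" by (auto intro: reach.start)
    show "x + y \<in> Collect (reach q i i)" if "x \<in> Collect (reach q i i)" "y \<in> Collect (reach q i i)" for x y
      using that by (auto intro: reach_trans)
    show "\<exists>x\<in>Collect (reach q i i). \<forall>a::int. x \<noteq> d * of_int a" if "0 < d" for d
      using nonlattice[OF that] by blast
  qed
  then obtain A where A: "\<And>x. A \<le> x \<Longrightarrow> \<exists>y. reach q i i y \<and> \<bar>y - x\<bar> < d" by auto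
  text \<open>Summing the increments over a long arithmetic progression contradicts boundedness.\<close>
  define L where "L = nat \<lceil>4 * B / M + 1\<rceil>"
  have L: "4 * B < real L * M" 
  proof -
    have "4 * B / M < real L" unfolding L_def by linarith
    then show ?thesis using M by (simp add: field_simps)
  qed
  \<comment> \<open>The extra \<open>L * \<bar>h\<bar>\<close> keeps \<open>A' + l * h\<close> above
    \<open>A\<close> for all \<open>l < L\<close>, whatever the sign of \<open>h\<close>.\<close>
  define A' where "A' = A + real L * \<bar>h\<bar>"
  have ev: "eventually (\<lambda>n. M / 2 < D i (t n - A' - real l * h)) sequentially" if "l < L" for l
  proof -
    have "A \<le> A' + real l * h"
    proof -
      have "real l * \<bar>h\<bar> \<le> real L * \<bar>h\<bar>" using that by (intro mult_right_mono) auto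
      moreover have "- (real l * \<bar>h\<bar>) \<le> real l * h" by (simp add: abs_if mult_left_mono)
      ultimately show ?thesis unfolding A'_def by linarith
    qed
    then obtain y where y: "reach q i i y" "\<bar>y - (A' + real l * h)\<bar> < d" using A by blast
    have "eventually (\<lambda>n. 3 / 4 * M < D i (t n - y)) sequentially"
      by (rule order_tendstoD(1)[OF reach_lim[OF y(1)]]) (use M in auto)
    then show ?thesis
    proof eventually_elim
      case (elim n)
      have "\<bar>D i (t n - A' - real l * h) - D i (t n - y)\<bar> < M / 4"
        using y(2) by (intro d) auto
      then show ?case using elim by linarith
    qed
  qed
  have "eventually (\<lambda>n. \<forall>l\<in>{..<L}. M / 2 < D i (t n - A' - real l * h)) sequentially"
    by (rule eventually_ball_finite) (use ev in auto)
  then have "\<exists>n. \<forall>l\<in>{..<L}. M / 2 < D i (t n - A' - real l * h)"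
    by (rule eventually_happens'[OF sequentially_bot])
  then obtain n where n: "\<And>l. l < L \<Longrightarrow> M / 2 < D i (t n - A' - real l * h)" by blast
  define f where "f l = v i (t n - A' + h - real l * h)" for l
  have "D i (t n - A' - real l * h) = f l - f (Suc l)" for l
    unfolding D_def f_def by (simp add: algebra_simps)
  then have "(\<Sum>l<L. D i (t n - A' - real l * h)) = f 0 - f L"
    by (simp add: sum_lessThan_telescope')
  moreover have "(\<Sum>l<L. M / 2) \<le> (\<Sum>l<L. D i (t n - A' - real l * h))"
    by (rule sum_mono) (use n in \<open>auto intro: less_imp_le\<close>)
  moreover have "f 0 - f L \<le> 2 * B"
    using bounded[of i "t n - A' + h - real 0 * h"] bounded[of i "t n - A' + h - real L * h"]
    unfolding f_def by linarith
  ultimately show False using L by (simp add: algebra_simps)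
qed

text \<open>The one-sided bound for the steps \<open>s\<close> and \<open>- s\<close> gives both
  signs; the second is used at the time \<open>t - s\<close>, which also tends to infinity.\<close>

theorem renewal_difference:
  fixes v :: "'s \<Rightarrow> real \<Rightarrow> real"
  assumes meas[measurable]: "\<And>i. v i \<in> borel_measurable borel"
    and bounded: "\<And>i t. \<bar>v i t\<bar> \<le> B"
    and uc: "\<And>e. 0 < e \<Longrightarrow> \<exists>d>0. \<forall>i s t. \<bar>s - t\<bar> < d \<longrightarrow> \<bar>v i s - v i t\<bar> < e"
    and eq: "\<And>i. eventually (\<lambda>t. v i t = (\<Sum>j\<in>UNIV. \<integral>y. v j (t - y) \<partial>q i j)) at_top"
  shows "((\<lambda>t. v i (t - s) - v i t) \<longlongrightarrow> 0) at_top"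
proof (rule tendstoI)
  fix e :: real assume e: "0 < e"
  then have e2: "0 < e / 2" by simp
  obtain T1 where T1: "\<forall>t\<ge>T1. \<forall>i. v i (t + (- s)) - v i t \<le> e / 2"
    using limsup_difference_le_0[OF assms e2, of "- s"] by blast
  obtain T2 where T2: "\<forall>t\<ge>T2. \<forall>i. v i (t + s) - v i t \<le> e / 2"
    using limsup_difference_le_0[OF assms e2, of s] by blast
  have "dist (v i (t - s) - v i t) 0 < e" if "max T1 (T2 + \<bar>s\<bar>) \<le> t" for t
  proof -
    have "v i (t - s) - v i t \<le> e / 2" using T1 that by auto
    moreover have "v i ((t - s) + s) - v i (t - s) \<le> e / 2"
      using that by (intro T2[rule_format]) auto
    ultimately show ?thesis using e by (simp add: dist_real_def abs_less_iff)
  qed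
  then show "eventually (\<lambda>t. dist (v i (t - s) - v i t) 0 < e) at_top"
    unfolding eventually_at_top_linorder by blast
qed

end

section \<open>The key renewal theorem\<close>

lemma stationary_sign:
  fixes P :: "'s::finite \<Rightarrow> 's \<Rightarrow> real" and x :: "'s \<Rightarrow> real"
  assumes P0: "\<And>i j. 0 \<le> P i j" and P1: "\<And>i. (\<Sum>j\<in>UNIV. P i j) = 1"
    and irred: "\<And>i j. (i, j) \<in> {(a, b). 0 < P a b}\<^sup>*"
    and x: "\<And>j. x j = (\<Sum>k\<in>UNIV. P k j * x k)"
  shows "(\<forall>j. 0 < x j) \<or> (\<forall>j. x j \<le> 0)"
proof -
  \<comment> \<open>Entrywise, \<open>\<bar>x\<bar>\<close> is at most its image under the
    transposed matrix, but both sides have the same total because the rows of \<open>P\<close> sum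
    to 1. Equality follows, and \<open>x + \<bar>x\<bar>\<close> is a nonnegative stationary vector,
    which by irreducibility is positive everywhere or zero everywhere.\<close>
  have le: "\<bar>x j\<bar> \<le> (\<Sum>k\<in>UNIV. P k j * \<bar>x k\<bar>)" for j
    using sum_abs[of "\<lambda>k. P k j * x k" UNIV] x[of j] P0 by (simp add: abs_mult)
  have sums: "(\<Sum>j\<in>UNIV. \<bar>x j\<bar>) = (\<Sum>j\<in>UNIV. \<Sum>k\<in>UNIV. P k j * \<bar>x k\<bar>)"
    by (subst sum.swap) (simp add: sum_distrib_right[symmetric] P1)
  have abs_eq: "\<bar>x j\<bar> = (\<Sum>k\<in>UNIV. P k j * \<bar>x k\<bar>)" for j
    by (rule sum_mono_inv[OF sums le]) auto
  define y where "y j = x j + \<bar>x j\<bar>" for j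
  have y: "y j = (\<Sum>k\<in>UNIV. P k j * y k)" for j
    unfolding y_def distrib_left sum.distrib using x[of j] abs_eq[of j] by linarith
  have y0: "0 \<le> y j" for j unfolding y_def by linarith
  show ?thesis
  proof (cases "\<exists>i. 0 < y i")
    case True
    then obtain i where i: "0 < y i" by blast
    have "0 < y j" for j
      using irred[of i j]
    proof (induction rule: rtrancl_induct)
      case (step a b)
      have "0 < P a b * y a" using step by auto
      also have "\<dots> \<le> (\<Sum>k\<in>UNIV. P k b * y k)" by (rule member_le_sum) (auto simp: P0 y0)
      finally show ?case using y[of b] by simp
    qed (rule i)
    then have pos: "0 < x j + \<bar>x j\<bar>" for j by (simp add: y_def)
    have "0 < x j" for j using pos[of j] by linarith
    then show ?thesis by blast
  next
    case False
    then have np: "\<not> 0 < x j + \<bar>x j\<bar>" for j by (simp add: y_def)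
    have "x j \<le> 0" for j using np[of j] by linarith
    then show ?thesis by blast
  qed
qed

text \<open>The normalisation rules out the second alternative of \<open>stationary_sign\<close>;
  the positivity of \<rho> is thus a consequence of its two defining equations.\<close>

lemma stationary_pos:
  fixes P :: "'s::finite \<Rightarrow> 's \<Rightarrow> real" and x :: "'s \<Rightarrow> real"
  assumes "\<And>i j. 0 \<le> P i j" "\<And>i. (\<Sum>j\<in>UNIV. P i j) = 1"
    and "\<And>i j. (i, j) \<in> {(a, b). 0 < P a b}\<^sup>*"
    and "\<And>j. x j = (\<Sum>k\<in>UNIV. P k j * x k)" and s: "(\<Sum>j\<in>UNIV. x j) = 1"
  shows "0 < x j"
proof -
  have "\<not> (\<forall>j. x j \<le> 0)"
    using sum_nonpos[of UNIV x] s by fastforce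
  then show ?thesis using stationary_sign[of P x] assms by blast
qed

text \<open>Uniqueness of the stationary distribution in quantitative form:
  \<open>x \<mapsto> x - x P\<close> is injective on the hyperplane of sum zero, hence bounded below
  there by finite dimension. It turns approximate stationarity into approximate proportionality to
  \<rho>.\<close>

lemma stationary_defect_bound:
  fixes P :: "'s::finite \<Rightarrow> 's \<Rightarrow> real"
  assumes P: "\<And>i j. 0 \<le> P i j" "\<And>i. (\<Sum>j\<in>UNIV. P i j) = 1"
    and irred: "\<And>i j. (i, j) \<in> {(a, b). 0 < P a b}\<^sup>*"
  shows "\<exists>C. \<forall>x j. (\<Sum>j\<in>UNIV. x j) = 0 \<longrightarrow>
           \<bar>x j\<bar> \<le> C * (\<Sum>j\<in>UNIV. \<bar>x j - (\<Sum>k\<in>UNIV. P k j * x k)\<bar>)"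
proof -
  define f :: "real ^ 's \<Rightarrow> real ^ 's" where "f x = (\<chi> j. x $ j - (\<Sum>k\<in>UNIV. P k j * x $ k))" for x
  define S :: "(real ^ 's) set" where "S = {x. (\<Sum>j\<in>UNIV. x $ j) = 0}"
  have lin: "linear f"
    by (rule linearI) (auto simp: f_def vec_eq_iff algebra_simps sum.distrib sum_distrib_left)
  have sub: "subspace S"
    by (auto simp: S_def subspace_def sum.distrib sum_distrib_left[symmetric])
  have "x = 0" if x: "x \<in> S" "f x = 0" for x
  proof -
    have st: "x $ j = (\<Sum>k\<in>UNIV. P k j * x $ k)" for j
    proof -
      have "f x $ j = 0" using x(2) by simp
      then show ?thesis unfolding f_def vec_lambda_beta by linarith
    qed
    have st': "- x $ j = (\<Sum>k\<in>UNIV. P k j * - x $ k)" for j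
      unfolding mult_minus_right sum_negf using st[of j] by linarith
    have s0: "(\<Sum>j\<in>UNIV. x $ j) = 0" using x by (simp add: S_def)
    have np: "\<not> (\<forall>j. 0 < x $ j)" "\<not> (\<forall>j. 0 < - x $ j)"
      using sum_pos[of UNIV "\<lambda>j. x $ j"] sum_pos[of UNIV "\<lambda>j. - x $ j"] s0 by (auto simp: sum_negf)
    have "\<forall>j. x $ j \<le> 0" using stationary_sign[of P "\<lambda>j. x $ j", OF P irred st] np by blast
    moreover have "\<forall>j. - x $ j \<le> 0" using stationary_sign[of P "\<lambda>j. - x $ j", OF P irred st'] np by blast
    ultimately show ?thesis by (auto simp: vec_eq_iff intro: antisym)
  qed
  then obtain e where e: "0 < e" "\<And>x. x \<in> S \<Longrightarrow> e * norm x \<le> norm (f x)"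
    using injective_imp_isometric[OF closed_subspace[OF sub] sub linear_conv_bounded_linear[THEN iffD1, OF lin]] by blast
  have "\<bar>x j\<bar> \<le> 1 / e * (\<Sum>j\<in>UNIV. \<bar>x j - (\<Sum>k\<in>UNIV. P k j * x k)\<bar>)" if "(\<Sum>j\<in>UNIV. x j) = 0" for x :: "'s \<Rightarrow> real" and j
  proof -
    let ?x = "(\<chi> j. x j) :: real ^ 's"
    have "e * \<bar>x j\<bar> \<le> e * norm ?x" using component_le_norm_cart[of ?x j] e by simp
    also have "\<dots> \<le> norm (f ?x)" using that by (intro e) (simp add: S_def)
    also have "\<dots> \<le> (\<Sum>j\<in>UNIV. \<bar>f ?x $ j\<bar>)" by (rule norm_le_l1_cart)
    finally show ?thesis using e by (simp add: f_def field_simps)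
  qed
  then show ?thesis by blast
qed

context markov_renewal
begin

lemma P_irreducible: "(i, j) \<in> {(a, b). 0 < P a b}\<^sup>*"
proof -
  have "{(a, b). emeasure (q a b) UNIV \<noteq> 0} = {(a, b). 0 < P a b}"
    by (auto simp: q.emeasure_eq_measure measure_le_0_iff less_le)
  then show ?thesis using irreducible by metis
qed

lemma exists_w_lower: "\<exists>j a c. 0 < a \<and> 0 < c \<and> (\<forall>t. 0 \<le> t \<and> t \<le> a \<longrightarrow> ennreal c \<le> w j t)"
proof -
  obtain i0 k a where a: "0 < a" "emeasure (q i0 k) {a<..} \<noteq> 0" using exists_positive_sojourn by blast
  define c where "c = measure (q i0 k) {a<..}"
  have c: "emeasure (q i0 k) {a<..} = ennreal c" unfolding c_def by (rule q.emeasure_eq_measure)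
  have c0: "0 < c" using a c by (metis c_def ennreal_0 less_eq_real_def measure_nonneg)
  have "ennreal c \<le> w i0 t" if "0 \<le> t" "t \<le> a" for t
  proof -
    have "ennreal c \<le> emeasure (q i0 k) {t<..}"
      unfolding c[symmetric] by (rule emeasure_mono) (use that in \<open>auto simp: sets_q\<close>)
    also have "\<dots> \<le> (\<Sum>k\<in>UNIV. emeasure (q i0 k) {t<..})" by (rule member_le_sum) auto
    finally show ?thesis using that by (simp add: w_def)
  qed
  then show ?thesis using a(1) c0 by blast
qed

lemma w_antimono: "0 \<le> s \<Longrightarrow> s \<le> t \<Longrightarrow> w j t \<le> w j s"
  unfolding w_def by (auto simp: indicator_def intro!: sum_mono emeasure_mono simp: sets_q)

lemma w_le_1: "w j t \<le> 1"
  using w_le_unit_step[of j t] by (auto simp: indicator_def split: if_splits intro: order_trans)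

lemma w_neg: "t < 0 \<Longrightarrow> w j t = 0"
  by (simp add: w_def)

end

text \<open>Smoothing with a Lipschitz bump makes the renewal functions uniformly continuous.\<close>
locale markov_renewal_bump = markov_renewal +
  fixes \<phi> :: "real \<Rightarrow> real" and eps :: real
  assumes phi_nonneg: "0 \<le> \<phi> t"
    and phi_lipschitz: "\<bar>\<phi> s - \<phi> t\<bar> \<le> \<bar>s - t\<bar>"
    and phi_support: "t \<le> 0 \<or> eps \<le> t \<Longrightarrow> \<phi> t = 0"
    and eps: "0 < eps" "eps \<le> 1"
begin

text \<open>The renewal matrix smoothed by \<phi>, row \<open>i\<close> and column \<open>j\<close>.
  By \<open>ennreal_a\<close> the passage to the reals loses nothing.\<close>

definition a :: "'a \<Rightarrow> 'a \<Rightarrow> real \<Rightarrow> real" where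
  "a i j t = enn2real (V (only_at j (\<lambda>t. ennreal (\<phi> t))) i t)"

lemma phi_le_1: "\<phi> t \<le> 1"
proof (cases "t \<le> 0 \<or> eps \<le> t")
  case False
  then show ?thesis using phi_lipschitz[of t 0] phi_support[of 0] eps by auto
qed (use phi_support in auto)

lemma phi_measurable[measurable]: "\<phi> \<in> borel_measurable borel"
proof (rule borel_measurable_continuous_onI)
  show "continuous_on UNIV \<phi>"
  proof (rule continuous_onI)
    fix x e :: real assume "0 < e"
    then show "\<exists>d>0. \<forall>x'\<in>UNIV. dist x' x < d \<longrightarrow> dist (\<phi> x') (\<phi> x) \<le> e"
      by (intro exI[of _ e]) (auto simp: dist_real_def intro!: order_trans[OF phi_lipschitz] intro: less_imp_le)
  qed
qed

lemma V_bound: obtains B where "\<And>i j t. V (only_at j (\<lambda>t. ennreal (\<phi> t))) i t \<le> ennreal B" "0 \<le> B"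
proof -
  obtain B where B: "\<And>i t. V (\<lambda>_. indicator {0..1}) i t \<le> ennreal B"
    using Vbounded_interval[of 1] unfolding Vbounded_def by blast
  have "V (only_at j (\<lambda>t. ennreal (\<phi> t))) i t \<le> ennreal (max 0 B)" for i j t
  proof -
    have "only_at j (\<lambda>t. ennreal (\<phi> t)) k s \<le> indicator {0..1} s" for k s
      using phi_le_1[of s] phi_support[of s] eps by (auto simp: only_at_def indicator_def)
    then have "V (only_at j (\<lambda>t. ennreal (\<phi> t))) i t \<le> V (\<lambda>_. indicator {0..1}) i t" by (rule V_mono)
    also have "\<dots> \<le> ennreal (max 0 B)" using B[of i t] by (rule order_trans) (auto intro: ennreal_leI)
    finally show ?thesis .
  qed
  then show ?thesis using that by fastforce
qed

lemma a_nonneg: "0 \<le> a i j t" by (simp add: a_def)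

lemma ennreal_a: "ennreal (a i j t) = V (only_at j (\<lambda>t. ennreal (\<phi> t))) i t"
proof -
  obtain B where "\<And>i j t. V (only_at j (\<lambda>t. ennreal (\<phi> t))) i t \<le> ennreal B" by (rule V_bound) blast
  then have "V (only_at j (\<lambda>t. ennreal (\<phi> t))) i t < \<top>" by (meson ennreal_less_top le_less_trans)
  then show ?thesis unfolding a_def by simp
qed

lemma bfun_on_phi: "bfun (only_at j (\<lambda>t. ennreal (\<phi> t)))" by (intro bfun_on) measurable

lemma a_measurable[measurable]: "a i j \<in> borel_measurable borel"
  unfolding a_def[abs_def] using bfunD[OF bfun_V[OF bfun_on_phi], measurable] by measurable

lemma a_bounded: "\<exists>B. \<forall>i j t. a i j t \<le> B"
proof -
  obtain B where B: "\<And>i j t. V (only_at j (\<lambda>t. ennreal (\<phi> t))) i t \<le> ennreal B" "0 \<le> B" by (rule V_bound) blast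
  have "a i j t \<le> B" for i j t using B(1)[of j i t] B(2) unfolding ennreal_a[symmetric] by simp
  then show ?thesis by blast
qed

text \<open>A translate of \<phi> differs from \<phi> by at most the shift times the indicator of a
  bounded window, and \<open>V\<close> of that indicator is bounded uniformly. So \<open>a\<close>
  is Lipschitz at small distances.\<close>

lemma a_uniformly_continuous:
  assumes e: "0 < e"
  shows "\<exists>d>0. \<forall>i s t. \<bar>s - t\<bar> < d \<longrightarrow> \<bar>a i j s - a i j t\<bar> < e"
proof -
  \<comment> \<open>The window is \<open>[-1, 2]\<close>, written as \<open>[0, 3]\<close> shifted
    by one; it contains the support of \<phi> with room to spare.\<close>
  have "Vbounded (\<lambda>k s. (\<lambda>_. indicator {0..3}) k (s - (-1)))"
    by (intro Vbounded_shift Vbounded_interval) (auto simp: bfun_def)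
  then obtain B0 where B0: "\<And>i t. V (\<lambda>k s. indicator {0..3} (s + 1)) i t \<le> ennreal B0"
    unfolding Vbounded_def by auto
  define B where "B = max 1 B0"
  have B: "V (\<lambda>k s. indicator {0..3} (s + 1)) i t \<le> ennreal B" for i t
    using B0[of i t] by (rule order_trans) (auto intro: ennreal_leI simp: B_def)
  have B1: "1 \<le> B" by (simp add: B_def)
  have one: "a i j s \<le> a i j t + \<bar>s - t\<bar> * B" if "\<bar>s - t\<bar> < 1" for i s t
  proof -
    define d where "d = s - t"
    have d1: "\<bar>d\<bar> < 1" using that by (simp add: d_def)
    have pt: "\<phi> r \<le> \<phi> (r - d) + \<bar>d\<bar> * indicator {0..3} (r + 1)" for r
    proof (cases "-1 \<le> r \<and> r \<le> 2")
      case True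
      then show ?thesis using phi_lipschitz[of r "r - d"] by (auto simp: indicator_def)
    next
      case False
      then have "\<phi> r = 0" using phi_support[of r] eps by auto
      then show ?thesis using phi_nonneg[of "r - d"] by (simp add: indicator_def)
    qed
    have "only_at j (\<lambda>t. ennreal (\<phi> t)) k r \<le> only_at j (\<lambda>t. ennreal (\<phi> t)) k (r - d) + ennreal \<bar>d\<bar> * indicator {0..3} (r + 1)" for k r
    proof (cases "k = j")
      case True
      have "ennreal (\<phi> r) \<le> ennreal (\<phi> (r - d) + \<bar>d\<bar> * indicator {0..3} (r + 1))" by (rule ennreal_leI[OF pt])
      also have "\<dots> = ennreal (\<phi> (r - d)) + ennreal \<bar>d\<bar> * indicator {0..3} (r + 1)"
        by (subst ennreal_plus) (auto simp: phi_nonneg indicator_def)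
      finally show ?thesis using True by (simp add: only_at_def)
    qed (simp add: only_at_def)
    then have "V (only_at j (\<lambda>t. ennreal (\<phi> t))) i s \<le> V (\<lambda>k r. only_at j (\<lambda>t. ennreal (\<phi> t)) k (r - d) + ennreal \<bar>d\<bar> * indicator {0..3} (r + 1)) i s"
      by (rule V_mono)
    also have "\<dots> = V (only_at j (\<lambda>t. ennreal (\<phi> t))) i (s - d) + ennreal \<bar>d\<bar> * V (\<lambda>k r. indicator {0..3} (r + 1)) i s"
    proof (subst V_add)
      show "bfun (\<lambda>k r. only_at j (\<lambda>t. ennreal (\<phi> t)) k (r - d))"
        by (auto simp: bfun_def only_at_def)
      show "bfun (\<lambda>k r. ennreal \<bar>d\<bar> * indicator {0..3} (r + 1))"
        unfolding bfun_def by (intro allI borel_measurable_times_ennreal) auto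
      show "V (\<lambda>k r. only_at j (\<lambda>t. ennreal (\<phi> t)) k (r - d)) i s + V (\<lambda>k r. ennreal \<bar>d\<bar> * indicator {0..3} (r + 1)) i s
        = V (only_at j (\<lambda>t. ennreal (\<phi> t))) i (s - d) + ennreal \<bar>d\<bar> * V (\<lambda>k r. indicator {0..3} (r + 1)) i s"
        by (subst V_shift[OF bfun_on_phi], subst V_cmult) (auto simp: bfun_def)
    qed
    also have "\<dots> \<le> ennreal (a i j t) + ennreal \<bar>d\<bar> * ennreal B"
      unfolding ennreal_a by (intro add_mono mult_left_mono B) (auto simp: d_def)
    also have "\<dots> = ennreal (a i j t + \<bar>d\<bar> * B)"
      using B1 by (simp add: ennreal_plus[symmetric] ennreal_mult[symmetric] a_nonneg del: ennreal_plus)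
    finally show ?thesis unfolding ennreal_a[symmetric] d_def
      using B1 by (subst (asm) ennreal_le_iff) (auto simp: a_nonneg)
  qed
  have "\<bar>a i j s - a i j t\<bar> < e" if st: "\<bar>s - t\<bar> < min 1 (e / B)" for i s t
  proof -
    have "\<bar>s - t\<bar> * B < e" using st B1 by (simp add: field_simps)
    then show ?thesis using one[of s t i] one[of t s i] st by (simp add: abs_minus_commute)
  qed
  moreover have "0 < min 1 (e / B)" using e B1 by simp
  ultimately show ?thesis by blast
qed

lemma a_integrable: "finite_measure \<mu> \<Longrightarrow> sets \<mu> = sets borel \<Longrightarrow> integrable \<mu> (\<lambda>y. a i j (t - y))"
proof -
  assume "finite_measure \<mu>" and [measurable_cong]: "sets \<mu> = sets borel"
  then interpret finite_measure \<mu> by simp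
  obtain B where "\<And>i j t. a i j t \<le> B" using a_bounded by blast
  then show ?thesis by (intro integrable_const_bound[where B = B]) (auto simp: a_nonneg)
qed

lemma nn_integral_a:
  assumes "finite_measure \<mu>" "sets \<mu> = sets borel"
  shows "(\<integral>\<^sup>+y. V (only_at j (\<lambda>t. ennreal (\<phi> t))) i (t - y) \<partial>\<mu>) = ennreal (\<integral>y. a i j (t - y) \<partial>\<mu>)"
  unfolding ennreal_a[symmetric]
  by (rule nn_integral_eq_integral[OF a_integrable[OF assms]]) (auto simp: a_nonneg)

text \<open>The inhomogeneous term of the renewal equation is \<phi> itself, which has disappeared
  by time 1 because \<open>eps \<le> 1\<close>.\<close>

lemma a_equation:
  assumes "1 < t"
  shows "a i j t = (\<Sum>k\<in>UNIV. \<integral>y. a k j (t - y) \<partial>q i k)"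
proof -
  have "ennreal (a i j t) = K (V (only_at j (\<lambda>t. ennreal (\<phi> t)))) i t"
    unfolding ennreal_a by (subst V_unfold[OF bfun_on_phi]) (use assms eps phi_support in \<open>auto simp: only_at_def\<close>)
  also have "\<dots> = (\<Sum>k\<in>UNIV. ennreal (\<integral>y. a k j (t - y) \<partial>q i k))"
    unfolding K_def by (simp add: nn_integral_a q.finite_measure_axioms sets_q)
  also have "\<dots> = ennreal (\<Sum>k\<in>UNIV. \<integral>y. a k j (t - y) \<partial>q i k)"
    by (rule sum_ennreal) (auto simp: a_nonneg)
  finally show ?thesis by (subst (asm) ennreal_inj) (auto simp: a_nonneg intro!: sum_nonneg)
qed

lemma a_difference: "((\<lambda>t. a i j (t - s) - a i j t) \<longlongrightarrow> 0) at_top"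
proof -
  obtain B where B: "\<And>i j t. a i j t \<le> B" using a_bounded by blast
  show ?thesis
  proof (rule renewal_difference[where v = "\<lambda>i. a i j" and B = B])
    show "\<bar>a i j t\<bar> \<le> B" for i t using B[of i j t] a_nonneg[of i j t] by simp
    show "eventually (\<lambda>t. a i j t = (\<Sum>k\<in>UNIV. \<integral>y. a k j (t - y) \<partial>q i k)) at_top" for i
      using eventually_gt_at_top[of 1] by eventually_elim (rule a_equation)
  qed (use a_uniformly_continuous in auto)
qed

text \<open>By \<open>a_difference\<close> and dominated convergence, averaging over a finite
  measure acts in the limit as multiplication by its total mass.\<close>

lemma a_convolution:
  assumes "finite_measure \<mu>" and s: "sets \<mu> = sets borel"
  shows "((\<lambda>t. (\<integral>s. a i j (t - s) \<partial>\<mu>) - measure \<mu> UNIV * a i j t) \<longlongrightarrow> 0) at_top"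
proof -
  interpret finite_measure \<mu> by fact
  note [measurable_cong] = s
  have sp: "space \<mu> = UNIV" using sets_eq_imp_space_eq[OF s] by simp
  obtain B where B: "\<And>i j t. a i j t \<le> B" using a_bounded by blast
  have "((\<lambda>t. \<integral>s. a i j (t - s) - a i j t \<partial>\<mu>) \<longlongrightarrow> (\<integral>s. 0 \<partial>\<mu>)) at_top"
  proof (rule integral_dominated_convergence_at_top[where w = "\<lambda>_. B"])
    show "eventually (\<lambda>t. AE s in \<mu>. norm (a i j (t - s) - a i j t) \<le> B) at_top"
    proof (intro always_eventually allI AE_I2)
      fix t s show "norm (a i j (t - s) - a i j t) \<le> B"
        using B[of i j t] B[of i j "t - s"] a_nonneg[of i j t] a_nonneg[of i j "t - s"] by simp
    qed
  qed (auto intro: a_difference)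
  then show ?thesis
    by (simp add: a_integrable[OF assms] Bochner_Integration.integral_diff sp)
qed

lemma V_on_conv:
  assumes "finite_measure \<mu>" "sets \<mu> = sets borel"
  shows "V (only_at j (\<lambda>t. \<integral>\<^sup>+s. ennreal (\<phi> (t - s)) \<partial>\<mu>)) i t = ennreal (\<integral>s. a i j (t - s) \<partial>\<mu>)"
proof -
  interpret finite_measure \<mu> by fact
  have "only_at j (\<lambda>t. \<integral>\<^sup>+s. ennreal (\<phi> (t - s)) \<partial>\<mu>) = (\<lambda>k t. \<integral>\<^sup>+s. only_at j (\<lambda>t. ennreal (\<phi> t)) k (t - s) \<partial>\<mu>)"
    by (auto simp: only_at_def fun_eq_iff)
  then show ?thesis
    using V_conv[OF bfun_on_phi _ assms(2)] nn_integral_a[OF assms] sigma_finite_measure_axioms by simp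
qed

text \<open>Splitting off the last step expresses column \<open>j\<close> by the columns
  \<open>k\<close> convolved with \<open>q k j\<close>, and such a convolution is asymptotically
  multiplication by \<open>P k j\<close>.\<close>

lemma a_stationary: "((\<lambda>t. a i j t - (\<Sum>k\<in>UNIV. P k j * a i k t)) \<longlongrightarrow> 0) at_top"
proof -
  have "a i j t = (\<Sum>k\<in>UNIV. \<integral>y. a i k (t - y) \<partial>q k j)" if "1 < t" for t
  proof -
    let ?f = "only_at j (\<lambda>t. ennreal (\<phi> t))"
    have "K ?f = (\<lambda>k t. \<Sum>k'\<in>UNIV. only_at k' (\<lambda>t. \<integral>\<^sup>+y. ennreal (\<phi> (t - y)) \<partial>q k' j) k t)"
    proof (intro ext)
      fix k t
      have "K ?f k t = (\<Sum>l\<in>UNIV. if l = j then (\<integral>\<^sup>+y. ennreal (\<phi> (t - y)) \<partial>q k l) else 0)"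
        unfolding K_def by (rule sum.cong) (auto simp: only_at_def)
      then show "K ?f k t = (\<Sum>k'\<in>UNIV. only_at k' (\<lambda>t. \<integral>\<^sup>+y. ennreal (\<phi> (t - y)) \<partial>q k' j) k t)"
        by (simp add: only_at_def)
    qed
    then have "V (K ?f) i t = (\<Sum>k\<in>UNIV. V (only_at k (\<lambda>t. \<integral>\<^sup>+y. ennreal (\<phi> (t - y)) \<partial>q k j)) i t)"
      by (simp only:) (rule V_sum; auto intro!: bfun_on)
    also have "\<dots> = (\<Sum>k\<in>UNIV. ennreal (\<integral>y. a i k (t - y) \<partial>q k j))"
      by (simp add: V_on_conv q.finite_measure_axioms sets_q)
    also have "\<dots> = ennreal (\<Sum>k\<in>UNIV. \<integral>y. a i k (t - y) \<partial>q k j)"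
      by (rule sum_ennreal) (auto simp: a_nonneg)
    finally have "ennreal (a i j t) = ennreal (\<Sum>k\<in>UNIV. \<integral>y. a i k (t - y) \<partial>q k j)"
      unfolding ennreal_a by (subst V_K) (use that eps phi_support in \<open>auto simp: only_at_def\<close>)
    then show ?thesis by (subst (asm) ennreal_inj) (auto simp: a_nonneg intro!: sum_nonneg)
  qed
  note eq = this
  have ev: "eventually (\<lambda>t. (\<Sum>k\<in>UNIV. (\<integral>y. a i k (t - y) \<partial>q k j) - P k j * a i k t)
      = a i j t - (\<Sum>k\<in>UNIV. P k j * a i k t)) at_top"
    using eventually_gt_at_top[of 1] by eventually_elim (simp only: sum_subtractf eq)
  have "((\<lambda>t. \<Sum>k\<in>UNIV. (\<integral>y. a i k (t - y) \<partial>q k j) - P k j * a i k t) \<longlongrightarrow> (\<Sum>k\<in>(UNIV::'a set). 0)) at_top"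
    by (intro tendsto_sum a_convolution q.finite_measure_axioms sets_q)
  then show ?thesis using Lim_transform_eventually[OF _ ev] by simp
qed

text \<open>The common amplitude of row \<open>i\<close>. Its own limit is not determined; it
  cancels when two functions are compared.\<close>

definition A :: "'a \<Rightarrow> real \<Rightarrow> real" where "A i t = (\<Sum>k\<in>UNIV. a i k t)"

text \<open>Subtracting \<open>\<rho> j * A i t\<close> makes the row sum zero and, \<rho> being
  stationary, does not alter the defect. The defect tends to 0 by \<open>a_stationary\<close>, and
  the defect bound applies.\<close>

lemma a_asymptotic:
  assumes \<rho>: "\<And>j. \<rho> j = (\<Sum>k\<in>UNIV. P k j * \<rho> k)" "(\<Sum>j\<in>UNIV. \<rho> j) = 1"
  shows "((\<lambda>t. a i j t - \<rho> j * A i t) \<longlongrightarrow> 0) at_top"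
proof -
  obtain C where C: "\<And>x j. (\<Sum>j\<in>UNIV. x j) = 0 \<Longrightarrow>
      \<bar>x j\<bar> \<le> C * (\<Sum>j\<in>UNIV. \<bar>x j - (\<Sum>k\<in>UNIV. P k j * x k)\<bar>)"
    using stationary_defect_bound[OF measure_nonneg P_sum P_irreducible] by blast
  have bound: "\<bar>a i j t - \<rho> j * A i t\<bar> \<le> C * (\<Sum>j\<in>UNIV. \<bar>a i j t - (\<Sum>k\<in>UNIV. P k j * a i k t)\<bar>)" for t
  proof -
    let ?x = "\<lambda>j. a i j t - \<rho> j * A i t"
    have "?x j - (\<Sum>k\<in>UNIV. P k j * ?x k) = a i j t - (\<Sum>k\<in>UNIV. P k j * a i k t)" for j
    proof -
      have "(\<Sum>k\<in>UNIV. P k j * ?x k) = (\<Sum>k\<in>UNIV. P k j * a i k t) - (\<Sum>k\<in>UNIV. P k j * \<rho> k) * A i t"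
        by (simp add: algebra_simps sum_subtractf sum_distrib_left)
      then show ?thesis using \<rho>(1)[of j] by simp
    qed
    moreover have "(\<Sum>j\<in>UNIV. ?x j) = 0"
      using \<rho>(2) by (simp add: sum_subtractf sum_distrib_right[symmetric] A_def)
    then have "\<bar>?x j\<bar> \<le> C * (\<Sum>j\<in>UNIV. \<bar>?x j - (\<Sum>k\<in>UNIV. P k j * ?x k)\<bar>)" by (rule C)
    ultimately show ?thesis by (simp only:)
  qed
  have "((\<lambda>t. C * (\<Sum>j\<in>UNIV. \<bar>a i j t - (\<Sum>k\<in>UNIV. P k j * a i k t)\<bar>)) \<longlongrightarrow> C * (\<Sum>j\<in>(UNIV::'a set). \<bar>0\<bar>)) at_top"
    by (intro tendsto_intros a_stationary)
  then have lim: "((\<lambda>t. C * (\<Sum>j\<in>UNIV. \<bar>a i j t - (\<Sum>k\<in>UNIV. P k j * a i k t)\<bar>)) \<longlongrightarrow> 0) at_top" by simp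
  show ?thesis by (rule Lim_null_comparison[OF _ lim]) (simp add: bound)
qed

text \<open>For a smoothed function, \<open>H\<close> enters the asymptotics only through its
  \<rho>-weighted integral, as a factor of the amplitude. Regarding \<open>H j\<close> as the
  density of a finite measure reduces this to \<open>a_convolution\<close>.\<close>

lemma V_conv_asymptotic:
  assumes \<rho>: "\<And>j. \<rho> j = (\<Sum>k\<in>UNIV. P k j * \<rho> k)" "(\<Sum>j\<in>UNIV. \<rho> j) = 1"
    and H: "\<And>j. integrable lborel (H j)" "\<And>j s. 0 \<le> H j s"
  obtains b where "\<And>t. V (\<lambda>j t. \<integral>\<^sup>+s. ennreal (\<phi> (t - s) * H j s) \<partial>lborel) i t = ennreal (b t)" "\<And>t. 0 \<le> b t"
    "((\<lambda>t. b t - (\<Sum>j\<in>UNIV. \<rho> j * (\<integral>s. H j s \<partial>lborel)) * A i t) \<longlongrightarrow> 0) at_top"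
proof -
  have [measurable]: "H j \<in> borel_measurable borel" for j using H(1)[of j] by auto
  define \<mu> where "\<mu> j = density lborel (\<lambda>s. ennreal (H j s))" for j
  have em: "emeasure (\<mu> j) UNIV = ennreal (\<integral>s. H j s \<partial>lborel)" for j
    unfolding \<mu>_def by (subst emeasure_density) (auto simp: nn_integral_eq_integral H)
  have fin: "finite_measure (\<mu> j)" for j
    by (rule finite_measureI) (use em in \<open>auto simp: \<mu>_def\<close>)
  have sets: "sets (\<mu> j) = sets borel" for j by (simp add: \<mu>_def)
  have m: "measure (\<mu> j) UNIV = (\<integral>s. H j s \<partial>lborel)" for j
    using em[of j] H(2) by (simp add: measure_def)
  define b where "b t = (\<Sum>j\<in>UNIV. \<integral>s. a i j (t - s) \<partial>\<mu> j)" for t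
  show ?thesis
  proof (rule that)
    fix t
    have "(\<lambda>j t. \<integral>\<^sup>+s. ennreal (\<phi> (t - s) * H j s) \<partial>lborel) = (\<lambda>k t. \<Sum>j\<in>UNIV. only_at j (\<lambda>t. \<integral>\<^sup>+s. ennreal (\<phi> (t - s)) \<partial>\<mu> j) k t)"
      by (intro ext) (simp add: only_at_def \<mu>_def nn_integral_density ennreal_mult' H phi_nonneg mult.commute)
    then have "V (\<lambda>j t. \<integral>\<^sup>+s. ennreal (\<phi> (t - s) * H j s) \<partial>lborel) i t = (\<Sum>j\<in>UNIV. V (only_at j (\<lambda>t. \<integral>\<^sup>+s. ennreal (\<phi> (t - s)) \<partial>\<mu> j)) i t)"
    proof (simp only:, intro V_sum bfun_on)
      fix j
      interpret finite_measure "\<mu> j" by (rule fin)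
      note [measurable_cong] = sets
      show "(\<lambda>t. \<integral>\<^sup>+s. ennreal (\<phi> (t - s)) \<partial>\<mu> j) \<in> borel_measurable borel" by measurable
    qed auto
    then show "V (\<lambda>j t. \<integral>\<^sup>+s. ennreal (\<phi> (t - s) * H j s) \<partial>lborel) i t = ennreal (b t)"
      unfolding b_def by (simp add: V_on_conv[OF fin sets] sum_ennreal a_nonneg)
    show "0 \<le> b t" unfolding b_def by (intro sum_nonneg) (auto simp: a_nonneg)
  next
    have "((\<lambda>t. \<Sum>j\<in>UNIV. ((\<integral>s. a i j (t - s) \<partial>\<mu> j) - measure (\<mu> j) UNIV * a i j t)
        + measure (\<mu> j) UNIV * (a i j t - \<rho> j * A i t)) \<longlongrightarrow> (\<Sum>j\<in>UNIV. 0 + measure (\<mu> j) UNIV * 0)) at_top"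
      by (intro tendsto_sum tendsto_add tendsto_mult tendsto_const a_convolution fin sets a_asymptotic \<rho>)
    moreover have "(\<Sum>j\<in>UNIV. ((\<integral>s. a i j (t - s) \<partial>\<mu> j) - measure (\<mu> j) UNIV * a i j t)
        + measure (\<mu> j) UNIV * (a i j t - \<rho> j * A i t)) = b t - (\<Sum>j\<in>UNIV. \<rho> j * (\<integral>s. H j s \<partial>lborel)) * A i t" for t
      unfolding b_def m sum_distrib_right sum_subtractf[symmetric]
      by (rule sum.cong) (auto simp: algebra_simps)
    ultimately show "((\<lambda>t. b t - (\<Sum>j\<in>UNIV. \<rho> j * (\<integral>s. H j s \<partial>lborel)) * A i t) \<longlongrightarrow> 0) at_top" by simp
  qed
qed

end

section \<open>The tails as real functions\<close>

context markov_renewal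
begin

definition wr :: "'s \<Rightarrow> real \<Rightarrow> real" where
  "wr j t = enn2real (w j t)"

lemma ennreal_wr: "ennreal (wr j t) = w j t"
  unfolding wr_def using w_le_1[of j t] by (simp add: le_less_trans)

lemma wr_nonneg: "0 \<le> wr j t" by (simp add: wr_def)

lemma wr_le_1: "wr j t \<le> 1"
  using w_le_1[of j t] unfolding ennreal_wr[symmetric] by simp

lemma wr_antimono: "0 \<le> s \<Longrightarrow> s \<le> t \<Longrightarrow> wr j t \<le> wr j s"
  using w_antimono[of s t j] unfolding ennreal_wr[symmetric] by (simp add: wr_nonneg)

lemma wr_neg: "t < 0 \<Longrightarrow> wr j t = 0" by (simp add: wr_def w_neg)

lemma wr_measurable[measurable]: "wr j \<in> borel_measurable borel"
  unfolding wr_def[abs_def] using bfunD[OF bfun_w, measurable] by measurable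

text \<open>The function \<open>wr j\<close> decreases from 0 on but may jump upwards at 0. So the
  discontinuities on the positive axis are countable, and 0 is excluded separately.\<close>

lemma AE_isCont_wr: "AE t in lborel. isCont (wr j) t"
proof -
  have "countable {t\<in>{0<..}. \<not> isCont (\<lambda>t. - wr j t) t}"
    by (rule mono_on_ctble_discont_open) (auto simp: mono_on_def intro: wr_antimono)
  then have "countable ({t\<in>{0<..}. \<not> isCont (\<lambda>t. - wr j t) t} \<union> {0})" by simp
  then have "AE t in lborel. t \<notin> {t\<in>{0<..}. \<not> isCont (\<lambda>t. - wr j t) t} \<union> {0}"
    by (intro AE_not_in countable_imp_null_set_lborel)
  then show ?thesis
  proof eventually_elim
    case (elim t)
    consider "0 < t" | "t < 0" using elim by fastforce
    then show ?case
    proof cases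
      case 1
      then have "isCont (\<lambda>t. - wr j t) t" using elim by auto
      from continuous_minus[OF this] show ?thesis by (simp only: minus_minus)
    next
      case 2
      have "eventually (\<lambda>s. wr j s = 0) (nhds t)"
        using 2 by (intro eventually_nhds[THEN iffD2] exI[of _ "{..<0}"]) (auto simp: wr_neg)
      then show ?thesis by (subst isCont_cong[where g = "\<lambda>_. 0"]) auto
    qed
  qed
qed

end

section \<open>Upper bounds by comparison with the tails\<close>

context markov_renewal_bump
begin

definition mass :: real where "mass = (\<integral>t. \<phi> t \<partial>lborel)"

lemma nn_integral_phi: "(\<integral>\<^sup>+s. ennreal (\<phi> (t - s)) \<partial>lborel) = ennreal mass"
proof -
  have "(\<integral>\<^sup>+s. ennreal (\<phi> s) \<partial>lborel) = (\<integral>\<^sup>+s. ennreal (\<phi> (t - s)) \<partial>lborel)"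
    using nn_integral_real_affine[of "\<lambda>s. ennreal (\<phi> s)" "-1" t] by simp
  moreover have "integrable lborel \<phi>"
  proof (rule Bochner_Integration.integrable_bound)
    show "integrable lborel (indicator {0..1} :: real \<Rightarrow> real)" by (intro integrable_real_indicator) auto
    show "AE t in lborel. norm (\<phi> t) \<le> norm (indicator {0..1} t :: real)"
      using phi_le_1 phi_nonneg phi_support eps by (intro AE_I2) (auto simp: indicator_def)
  qed auto
  ultimately show ?thesis
    unfolding mass_def by (simp add: nn_integral_eq_integral phi_nonneg)
qed

text \<open>Smoothing \<open>H\<close> gives a majorant of \<open>mass * f\<close>, and smoothing
  the tails shifted by \<open>eps\<close> gives a minorant of \<open>mass * w\<close>. Since
  \<open>V w \<le> 1\<close>, the second bounds the amplitude, and the first turns this into a bound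
  for \<open>V f\<close>. The shift costs at most \<open>eps\<close> in the denominator.\<close>

lemma V_upper:
  assumes \<rho>: "\<And>j. \<rho> j = (\<Sum>k\<in>UNIV. P k j * \<rho> k)" "(\<Sum>j\<in>UNIV. \<rho> j) = 1"
    and wint: "\<And>j. integrable lborel (wr j)"
    and mass: "0 < mass"
    and W: "eps < (\<Sum>j\<in>UNIV. \<rho> j * (\<integral>t. wr j t \<partial>lborel))"
    and f: "\<And>j. f j \<in> borel_measurable borel" "\<And>j t. 0 \<le> f j t" "\<And>j t. f j t \<le> wr j t"
    and H: "\<And>j. integrable lborel (H j)" "\<And>j s. 0 \<le> H j s"
           "\<And>j t s. s < t \<Longrightarrow> t < s + eps \<Longrightarrow> f j t \<le> H j s"
    and e: "0 < e"
  shows "eventually (\<lambda>t. enn2real (V (\<lambda>j t. ennreal (f j t)) i t) \<le>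
           (\<Sum>j\<in>UNIV. \<rho> j * (\<integral>s. H j s \<partial>lborel)) / ((\<Sum>j\<in>UNIV. \<rho> j * (\<integral>t. wr j t \<partial>lborel)) - eps) + e) at_top"
proof -
  note [measurable] = f(1)
  have [measurable]: "H j \<in> borel_measurable borel" for j using H(1)[of j] by auto
  have pos: "0 < \<rho> j" for j
    by (rule stationary_pos[OF measure_nonneg P_sum P_irreducible \<rho>])
  let ?W = "\<Sum>j\<in>UNIV. \<rho> j * (\<integral>t. wr j t \<partial>lborel)"
  \<comment> \<open>The bump lives on \<open>(0, eps)\<close>, so only \<open>s\<close> with
    \<open>s < r < s + eps\<close> contribute to the smoothed value at \<open>r\<close>. There
    monotonicity gives \<open>wr j (s + eps) \<le> wr j r\<close>.\<close>
  define G where "G j s = indicator {0..} s * wr j (s + eps)" for j s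
  have wint': "integrable lborel (\<lambda>s. wr j (s + eps))" for j
    using lborel_integrable_real_affine[OF wint[of j], of 1 eps] by (simp add: add.commute)
  have Gint: "integrable lborel (G j)" for j
    unfolding G_def by (rule Bochner_Integration.integrable_bound[OF wint'[of j]]) (auto simp: indicator_def)
  \<comment> \<open>What the shift cuts off is the integral of \<open>wr j\<close> over
    \<open>[0, eps)\<close>, which is at most \<open>eps\<close> because
    \<open>wr j \<le> 1\<close>.\<close>
  have G_ge: "(\<integral>t. wr j t \<partial>lborel) - eps \<le> (\<integral>s. G j s \<partial>lborel)" for j
  proof -
    have i1: "integrable lborel (\<lambda>s. indicator {0..<eps} s :: real)" using eps by (intro integrable_real_indicator) auto
    have i2: "integrable lborel (\<lambda>s. wr j s - indicator {0..<eps} s)" using i1 wint by auto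
    have "(\<integral>t. wr j t \<partial>lborel) - eps = (\<integral>s. wr j s - indicator {0..<eps} s \<partial>lborel)"
      using i1 wint eps by simp
    also have "\<dots> = (\<integral>s. wr j (eps + 1 * s) - indicator {0..<eps} (eps + 1 * s) \<partial>lborel)"
      by (subst lborel_integral_real_affine[where c = 1 and t = eps]) auto
    also have "\<dots> \<le> (\<integral>s. G j s \<partial>lborel)"
    proof (rule integral_mono[OF _ Gint])
      show "integrable lborel (\<lambda>s. wr j (eps + 1 * s) - indicator {0..<eps} (eps + 1 * s))"
        using lborel_integrable_real_affine[OF i2, of 1 eps] by simp
      fix s show "wr j (eps + 1 * s) - indicator {0..<eps} (eps + 1 * s) \<le> G j s"
        using wr_le_1[of j "eps + s"] wr_neg[of "eps + s" j] by (auto simp: G_def indicator_def add.commute)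
    qed
    finally show ?thesis .
  qed
  obtain b where b: "\<And>t. V (\<lambda>j t. \<integral>\<^sup>+s. ennreal (\<phi> (t - s) * G j s) \<partial>lborel) i t = ennreal (b t)" "\<And>t. 0 \<le> b t"
    "((\<lambda>t. b t - (\<Sum>j\<in>UNIV. \<rho> j * (\<integral>s. G j s \<partial>lborel)) * A i t) \<longlongrightarrow> 0) at_top"
    by (rule V_conv_asymptotic[where H = G, OF \<rho> Gint]) (auto simp: G_def wr_nonneg)
  obtain b' where b': "\<And>t. V (\<lambda>j t. \<integral>\<^sup>+s. ennreal (\<phi> (t - s) * H j s) \<partial>lborel) i t = ennreal (b' t)" "\<And>t. 0 \<le> b' t"
    "((\<lambda>t. b' t - (\<Sum>j\<in>UNIV. \<rho> j * (\<integral>s. H j s \<partial>lborel)) * A i t) \<longlongrightarrow> 0) at_top"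
    by (rule V_conv_asymptotic[where H = H, OF \<rho> H(1,2)]) auto
  have b_le: "b t \<le> mass" for t
  proof -
    have "(\<integral>\<^sup>+s. ennreal (\<phi> (r - s) * G j s) \<partial>lborel) \<le> ennreal mass * w j r" for j r
    proof -
      have "(\<integral>\<^sup>+s. ennreal (\<phi> (r - s) * G j s) \<partial>lborel) \<le> (\<integral>\<^sup>+s. ennreal (\<phi> (r - s)) * w j r \<partial>lborel)"
      proof (rule nn_integral_mono)
        fix s
        have "\<phi> (r - s) * G j s \<le> \<phi> (r - s) * wr j r"
        proof (cases "0 \<le> s \<and> 0 < r - s \<and> r - s < eps")
          case True
          then have "G j s \<le> wr j r" by (auto simp: G_def intro!: wr_antimono)
          then show ?thesis by (intro mult_left_mono phi_nonneg)
        next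
          case False
          then have "\<phi> (r - s) * G j s = 0" using phi_support[of "r - s"] by (auto simp: G_def)
          then show ?thesis using phi_nonneg wr_nonneg by (metis mult_nonneg_nonneg)
        qed
        then show "ennreal (\<phi> (r - s) * G j s) \<le> ennreal (\<phi> (r - s)) * w j r"
          unfolding ennreal_wr[symmetric] ennreal_mult[OF phi_nonneg wr_nonneg, symmetric] by (rule ennreal_leI)
      qed
      also have "\<dots> = ennreal mass * w j r"
        by (subst nn_integral_multc) (simp_all add: nn_integral_phi)
      finally show ?thesis .
    qed
    then have "ennreal (b t) \<le> V (\<lambda>j r. ennreal mass * w j r) i t"
      unfolding b(1)[symmetric] by (rule V_mono)
    also have "\<dots> = ennreal mass * V w i t" by (rule V_cmult[OF bfun_w])
    also have "\<dots> \<le> ennreal mass * 1" unfolding V_w by (intro mult_left_mono) (auto simp: indicator_def)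
    finally show ?thesis using mass by simp
  qed
  have b'_ge: "mass * enn2real (V (\<lambda>j t. ennreal (f j t)) i t) \<le> b' t" for t
  proof -
    have bf: "bfun (\<lambda>j t. ennreal (f j t))" by (simp add: bfun_def)
    have "ennreal mass * ennreal (f j r) \<le> (\<integral>\<^sup>+s. ennreal (\<phi> (r - s) * H j s) \<partial>lborel)" for j r
    proof -
      have "ennreal mass * ennreal (f j r) = (\<integral>\<^sup>+s. ennreal (\<phi> (r - s)) * ennreal (f j r) \<partial>lborel)"
        by (subst nn_integral_multc) (simp_all add: nn_integral_phi)
      also have "\<dots> \<le> (\<integral>\<^sup>+s. ennreal (\<phi> (r - s) * H j s) \<partial>lborel)"
      proof (rule nn_integral_mono)
        fix s
        have "\<phi> (r - s) * f j r \<le> \<phi> (r - s) * H j s"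
        proof (cases "0 < r - s \<and> r - s < eps")
          case True
          then show ?thesis by (intro mult_left_mono phi_nonneg H(3)) auto
        qed (use phi_support[of "r - s"] in auto)
        then show "ennreal (\<phi> (r - s)) * ennreal (f j r) \<le> ennreal (\<phi> (r - s) * H j s)"
          unfolding ennreal_mult[OF phi_nonneg f(2), symmetric] by (rule ennreal_leI)
      qed
      finally show ?thesis .
    qed
    then have "V (\<lambda>j r. ennreal mass * ennreal (f j r)) i t \<le> ennreal (b' t)"
      unfolding b'(1)[symmetric] by (rule V_mono)
    then have "ennreal mass * V (\<lambda>j t. ennreal (f j t)) i t \<le> ennreal (b' t)"
      by (simp only: V_cmult[OF bf])
    moreover have "V (\<lambda>j t. ennreal (f j t)) i t \<noteq> \<top>"
    proof -
      have "V (\<lambda>j t. ennreal (f j t)) i t \<le> V w i t"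
        by (rule V_mono) (use f(3) in \<open>auto simp: ennreal_wr[symmetric] intro: ennreal_leI\<close>)
      also have "\<dots> \<le> 1" unfolding V_w by (simp add: indicator_def)
      finally show ?thesis by (auto simp: top_unique)
    qed
    then have "V (\<lambda>j t. ennreal (f j t)) i t = ennreal (enn2real (V (\<lambda>j t. ennreal (f j t)) i t))"
      by (simp add: top.not_eq_extremum)
    ultimately have "ennreal (mass * enn2real (V (\<lambda>j t. ennreal (f j t)) i t)) \<le> ennreal (b' t)"
      using mass by (simp add: ennreal_mult)
    then show ?thesis using b'(2)[of t] by simp
  qed
  let ?H = "\<Sum>j\<in>UNIV. \<rho> j * (\<integral>s. H j s \<partial>lborel)"
  let ?G = "\<Sum>j\<in>UNIV. \<rho> j * (\<integral>s. G j s \<partial>lborel)"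
  have G_W: "?W - eps \<le> ?G"
  proof -
    have "?W - eps = (\<Sum>j\<in>UNIV. \<rho> j * ((\<integral>t. wr j t \<partial>lborel) - eps))"
      by (simp add: right_diff_distrib sum_subtractf sum_distrib_right[symmetric] \<rho>(2))
    also have "\<dots> \<le> ?G" by (intro sum_mono mult_left_mono G_ge less_imp_le pos)
    finally show ?thesis .
  qed
  have Gpos: "0 < ?G" using G_W W by linarith
  have H0: "0 \<le> ?H" by (intro sum_nonneg mult_nonneg_nonneg less_imp_le[OF pos] Bochner_Integration.integral_nonneg H)
  \<comment> \<open>The factor \<open>?H / ?G\<close> is chosen so that the two multiples of the
    unknown amplitude cancel.\<close>
  have "((\<lambda>t. (b' t - ?H * A i t) - ?H / ?G * (b t - ?G * A i t)) \<longlongrightarrow> 0 - ?H / ?G * 0) at_top"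
    by (intro tendsto_intros b b')
  then have "((\<lambda>t. b' t - ?H / ?G * b t) \<longlongrightarrow> 0) at_top"
    using Gpos by (simp add: right_diff_distrib)
  then have "eventually (\<lambda>t. b' t - ?H / ?G * b t < e * mass) at_top"
    by (rule order_tendstoD) (use e mass in simp)
  then show ?thesis
  proof eventually_elim
    case (elim t)
    have "mass * enn2real (V (\<lambda>j t. ennreal (f j t)) i t) \<le> ?H / ?G * b t + e * mass"
      using b'_ge[of t] elim by linarith
    also have "\<dots> \<le> ?H / ?G * mass + e * mass"
      using H0 Gpos b_le[of t] by (intro add_right_mono mult_left_mono) auto
    also have "\<dots> \<le> ?H / (?W - eps) * mass + e * mass"
      using H0 Gpos G_W W mass by (intro add_right_mono mult_right_mono divide_left_mono) auto
    also have "\<dots> = mass * (?H / (?W - eps) + e)" by (simp add: algebra_simps)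
    finally show ?case using mass by simp
  qed
qed

end

context markov_renewal
begin

lemma W_pos:
  assumes \<rho>: "\<And>j. 0 < \<rho> j" and wint: "\<And>j. integrable lborel (wr j)"
  shows "0 < (\<Sum>j\<in>UNIV. \<rho> j * (\<integral>t. wr j t \<partial>lborel))"
proof -
  obtain j a c where jac: "0 < a" "0 < c" "\<And>t. 0 \<le> t \<Longrightarrow> t \<le> a \<Longrightarrow> ennreal c \<le> w j t"
    using exists_w_lower by blast
  have "c * a = (\<integral>t. c * indicator {0..a} t \<partial>lborel)" using jac by simp
  also have "\<dots> \<le> (\<integral>t. wr j t \<partial>lborel)"
  proof (rule integral_mono[OF _ wint])
    show "integrable lborel (\<lambda>t. c * indicator {0..a} t)"
      by (intro integrable_mult_right integrable_real_indicator) (use jac in auto)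
    fix t show "c * indicator {0..a} t \<le> wr j t"
      using jac(3)[of t] by (auto simp: indicator_def ennreal_wr[symmetric] wr_nonneg)
  qed
  finally have "0 < (\<integral>t. wr j t \<partial>lborel)" using jac by (meson less_le_trans mult_pos_pos)
  then have "0 < \<rho> j * (\<integral>t. wr j t \<partial>lborel)" using \<rho> by simp
  also have "\<dots> \<le> (\<Sum>j\<in>UNIV. \<rho> j * (\<integral>t. wr j t \<partial>lborel))"
    by (rule member_le_sum) (auto intro!: mult_nonneg_nonneg less_imp_le[OF \<rho>] Bochner_Integration.integral_nonneg wr_nonneg)
  finally show ?thesis .
qed

text \<open>Almost everywhere continuity and the monotone integrable majorant \<open>wr\<close> take
  the place of direct Riemann integrability: suprema over shrinking windows converge to
  \<open>f\<close> almost everywhere and are dominated, so their integrals converge as well.\<close>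

lemma renewal_limsup:
  assumes \<rho>: "\<And>j. \<rho> j = (\<Sum>k\<in>UNIV. P k j * \<rho> k)" "(\<Sum>j\<in>UNIV. \<rho> j) = 1"
    and wint: "\<And>j. integrable lborel (wr j)"
    and f: "\<And>j. f j \<in> borel_measurable borel" "\<And>j t. 0 \<le> f j t" "\<And>j t. f j t \<le> wr j t"
           "\<And>j. AE t in lborel. isCont (f j) t"
    and e: "0 < e"
  shows "eventually (\<lambda>t. enn2real (V (\<lambda>j t. ennreal (f j t)) i t) \<le>
           (\<Sum>j\<in>UNIV. \<rho> j * (\<integral>t. f j t \<partial>lborel)) / (\<Sum>j\<in>UNIV. \<rho> j * (\<integral>t. wr j t \<partial>lborel)) + e) at_top"
proof -
  note [measurable] = f(1)
  let ?W = "\<Sum>j\<in>UNIV. \<rho> j * (\<integral>t. wr j t \<partial>lborel)"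
  have pos: "0 < \<rho> j" for j
    by (rule stationary_pos[OF measure_nonneg P_sum P_irreducible \<rho>])
  have W: "0 < ?W" by (rule W_pos[OF pos wint])
  have f1: "f j t \<le> 1" for j t using f(3)[of j t] wr_le_1[of j t] by linarith
  text \<open>The supremum is taken over an open interval, so that \<open>H\<close> is lower semicontinuous and
    hence measurable.\<close>
  define H where "H \<epsilon> j s = (SUP t\<in>{s<..<s + \<epsilon>}. f j t)" for \<epsilon> j and s :: real
  have bdd: "bdd_above (f j ` X)" for j X by (rule bdd_aboveI[of _ 1]) (use f1 in auto)
  have H_ge: "f j t \<le> H \<epsilon> j s" if "s < t" "t < s + \<epsilon>" for \<epsilon> j s t
    unfolding H_def by (rule cSUP_upper[OF _ bdd]) (use that in auto)
  have H_le: "H \<epsilon> j s \<le> c" if "0 < \<epsilon>" "\<And>t. s < t \<Longrightarrow> t < s + \<epsilon> \<Longrightarrow> f j t \<le> c" for \<epsilon> j s c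
    unfolding H_def by (rule cSUP_least) (use that in auto)
  have H_nonneg: "0 \<le> H \<epsilon> j s" if "0 < \<epsilon>" for \<epsilon> j s
    using H_ge[of s "s + \<epsilon> / 2" \<epsilon> j] f(2)[of j "s + \<epsilon> / 2"] that by auto
  have H_meas: "H \<epsilon> j \<in> borel_measurable borel" if "0 < \<epsilon>" for \<epsilon> j
  proof (rule borel_measurable_iff_greater[THEN iffD2], intro allI)
    fix c
    have "{s \<in> space borel. c < H \<epsilon> j s} = (\<Union>t\<in>{t. c < f j t}. {t - \<epsilon><..<t})"
    proof -
      have "c < H \<epsilon> j s \<longleftrightarrow> (\<exists>t\<in>{s<..<s + \<epsilon>}. c < f j t)" for s
        unfolding H_def by (rule less_cSUP_iff[OF _ bdd]) (use that in auto)
      then show ?thesis by (auto simp: algebra_simps)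
    qed
    then show "{s \<in> space borel. c < H \<epsilon> j s} \<in> sets borel" by (simp only:) (intro borel_open open_UN, auto)
  qed
  \<comment> \<open>To the right of 0 the window supremum is at most \<open>wr j s\<close> by
    monotonicity. The indicator accounts for windows that begin before 0 and reach beyond it; their
    length is at most 1.\<close>
  define D where "D j s = wr j s + indicator {-1..0} s" for j s
  have Dint: "integrable lborel (D j)" for j
    unfolding D_def by (intro Bochner_Integration.integrable_add wint integrable_real_indicator) auto
  have H_D: "H \<epsilon> j s \<le> D j s" if "0 < \<epsilon>" "\<epsilon> \<le> 1" for \<epsilon> j s
  proof (rule H_le[OF that(1)])
    fix t assume t: "s < t" "t < s + \<epsilon>"
    consider "0 \<le> s" | "s < 0" "0 \<le> t" | "t < 0" using t by linarith
    then show "f j t \<le> D j s"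
    proof cases
      case 1
      then have "f j t \<le> wr j s" using f(3)[of j t] wr_antimono[of s t j] t by simp
      also have "\<dots> \<le> D j s" by (simp add: D_def)
      finally show ?thesis .
    next
      case 2
      then show ?thesis using f1[of j t] t that wr_nonneg[of j s] by (simp add: D_def indicator_def)
    next
      case 3
      then have "f j t \<le> 0" using f(3)[of j t] wr_neg[of t j] by simp
      also have "0 \<le> D j s" by (simp add: D_def wr_nonneg)
      finally show ?thesis .
    qed
  qed
  define \<epsilon> where "\<epsilon> n = 1 / real (Suc n)" for n
  have eps_pos: "0 < \<epsilon> n" "\<epsilon> n \<le> 1" for n by (auto simp: \<epsilon>_def)
  have eps0: "\<epsilon> \<longlonglongrightarrow> 0" unfolding \<epsilon>_def[abs_def] using LIMSEQ_inverse_real_of_nat by (simp add: inverse_eq_divide)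
  have Hnorm: "norm (H (\<epsilon> n) j s) \<le> D j s" for n j s
    using H_D[OF eps_pos] H_nonneg[OF eps_pos(1)] by (simp add: abs_of_nonneg)
  then have "norm (H (\<epsilon> n) j s) \<le> norm (D j s)" for n j s
    by (rule order_trans) simp
  then have Hint: "integrable lborel (H (\<epsilon> n) j)" for n j
    by (intro Bochner_Integration.integrable_bound[OF Dint[of j]] AE_I2) (use H_meas[OF eps_pos(1)] in auto)
  have lim: "(\<lambda>n. \<integral>s. H (\<epsilon> n) j s \<partial>lborel) \<longlonglongrightarrow> (\<integral>s. f j s \<partial>lborel)" for j
  proof (rule integral_dominated_convergence[OF _ _ Dint])
    show "AE s in lborel. (\<lambda>n. H (\<epsilon> n) j s) \<longlonglongrightarrow> f j s"
      using f(4)[of j]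
    proof eventually_elim
      case (elim s)
      show ?case
      proof (rule LIMSEQ_I)
        fix r :: real assume r: "0 < r"
        then obtain d where d: "0 < d" "\<And>t. \<bar>t - s\<bar> < d \<Longrightarrow> \<bar>f j t - f j s\<bar> < r / 2"
          using elim unfolding continuous_at_eps_delta by (metis dist_real_def half_gt_zero)
        obtain N where N: "\<And>n. N \<le> n \<Longrightarrow> \<epsilon> n < d"
          using LIMSEQ_D[OF eps0 d(1)] eps_pos by (auto simp: abs_of_pos)
        have "norm (H (\<epsilon> n) j s - f j s) < r" if "N \<le> n" for n
        proof -
          have "H (\<epsilon> n) j s \<le> f j s + r / 2"
          proof (rule H_le[OF eps_pos(1)])
            fix t assume "s < t" "t < s + \<epsilon> n"
            then have "\<bar>f j t - f j s\<bar> < r / 2" using N[OF that] by (intro d) auto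
            then show "f j t \<le> f j s + r / 2" by linarith
          qed
          moreover have "f j s - r / 2 \<le> H (\<epsilon> n) j s"
          proof -
            have "\<bar>f j (s + \<epsilon> n / 2) - f j s\<bar> < r / 2" using N[OF that] eps_pos(1)[of n] by (intro d) auto
            moreover have "f j (s + \<epsilon> n / 2) \<le> H (\<epsilon> n) j s" using eps_pos(1)[of n] by (intro H_ge) auto
            ultimately show ?thesis by linarith
          qed
          ultimately show ?thesis using r by (simp add: abs_less_iff)
        qed
        then show "\<exists>N. \<forall>n\<ge>N. norm (H (\<epsilon> n) j s - f j s) < r" by blast
      qed
    qed
    show "AE s in lborel. norm (H (\<epsilon> n) j s) \<le> D j s" for n
      by (intro AE_I2 Hnorm)
  qed (use H_meas[OF eps_pos(1)] in auto)
  let ?L = "\<lambda>n. (\<Sum>j\<in>UNIV. \<rho> j * (\<integral>s. H (\<epsilon> n) j s \<partial>lborel)) / (?W - \<epsilon> n)"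
  have "?L \<longlonglongrightarrow> (\<Sum>j\<in>UNIV. \<rho> j * (\<integral>t. f j t \<partial>lborel)) / (?W - 0)"
    using W by (intro tendsto_intros lim eps0) auto
  then have "eventually (\<lambda>n. ?L n < (\<Sum>j\<in>UNIV. \<rho> j * (\<integral>t. f j t \<partial>lborel)) / ?W + e / 2) sequentially"
    by (intro order_tendstoD) (use e in auto)
  \<comment> \<open>The denominator \<open>?W - \<epsilon> n\<close> in \<open>V_upper\<close> has
    to be positive.\<close>
  moreover have "eventually (\<lambda>n. \<epsilon> n < ?W) sequentially" by (rule order_tendstoD(2)[OF eps0 W])
  ultimately have "eventually (\<lambda>n. ?L n < (\<Sum>j\<in>UNIV. \<rho> j * (\<integral>t. f j t \<partial>lborel)) / ?W + e / 2 \<and> \<epsilon> n < ?W) sequentially"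
    by (rule eventually_conj)
  then have "\<exists>n. ?L n < (\<Sum>j\<in>UNIV. \<rho> j * (\<integral>t. f j t \<partial>lborel)) / ?W + e / 2 \<and> \<epsilon> n < ?W"
    by (rule eventually_happens'[OF sequentially_bot])
  then obtain n where n: "?L n < (\<Sum>j\<in>UNIV. \<rho> j * (\<integral>t. f j t \<partial>lborel)) / ?W + e / 2" "\<epsilon> n < ?W" by blast
  \<comment> \<open>The tent over \<open>[0, \<epsilon> n]\<close> with slopes 1 and -1.\<close>
  define \<phi> where "\<phi> t = max 0 (min t (\<epsilon> n - t))" for t
  interpret markov_renewal_bump q \<phi> "\<epsilon> n"
    by standard (use eps_pos[of n] in \<open>auto simp: \<phi>_def max_def min_def abs_if\<close>)
  have "0 < mass"
  proof (rule ccontr)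
    assume "\<not> 0 < mass"
    then have "(\<integral>\<^sup>+s. ennreal (\<phi> (0 - s)) \<partial>lborel) = 0" using nn_integral_phi[of 0] by (simp add: ennreal_neg)
    then have "AE s in lborel. \<phi> (0 - s) = 0"
      by (subst (asm) nn_integral_0_iff_AE) (auto simp: phi_nonneg)
    then have "AE s in lborel. s \<notin> {- \<epsilon> n<..<0}" by eventually_elim (auto simp: \<phi>_def max_def min_def split: if_splits)
    then have "{- \<epsilon> n<..<0} \<in> null_sets lborel" by (subst (asm) AE_iff_null_sets[symmetric]) auto
    then show False using eps_pos[of n] by (auto simp: null_sets_def)
  qed
  have "eventually (\<lambda>t. enn2real (V (\<lambda>j t. ennreal (f j t)) i t) \<le> ?L n + e / 2) at_top"
    by (rule V_upper[OF \<rho> wint \<open>0 < mass\<close> n(2) f(1-3) Hint H_nonneg[OF eps_pos(1)] H_ge]) (use e in auto)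
  then show ?thesis by eventually_elim (use n(1) in linarith)
qed

theorem markov_renewal_limit:
  assumes \<rho>: "\<And>j. \<rho> j = (\<Sum>k\<in>UNIV. P k j * \<rho> k)" "(\<Sum>j\<in>UNIV. \<rho> j) = 1"
    and wint: "\<And>j. integrable lborel (wr j)"
    and f: "\<And>j. f j \<in> borel_measurable borel" "\<And>j t. 0 \<le> f j t" "\<And>j t. f j t \<le> wr j t"
           "\<And>j. AE t in lborel. isCont (f j) t"
  shows "((\<lambda>t. enn2real (V (\<lambda>j t. ennreal (f j t)) i t)) \<longlongrightarrow>
           (\<Sum>j\<in>UNIV. \<rho> j * (\<integral>t. f j t \<partial>lborel)) / (\<Sum>j\<in>UNIV. \<rho> j * (\<integral>t. wr j t \<partial>lborel))) at_top"
proof (rule tendstoI)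
  note [measurable] = f(1)
  fix e :: real assume e: "0 < e"
  let ?W = "\<Sum>j\<in>UNIV. \<rho> j * (\<integral>t. wr j t \<partial>lborel)"
  let ?F = "\<Sum>j\<in>UNIV. \<rho> j * (\<integral>t. f j t \<partial>lborel)"
  let ?g = "\<lambda>j t. wr j t - f j t"
  have pos: "0 < \<rho> j" for j
    by (rule stationary_pos[OF measure_nonneg P_sum P_irreducible \<rho>])
  have W: "0 < ?W" by (rule W_pos[OF pos wint])
  have fint: "integrable lborel (f j)" for j
    by (rule Bochner_Integration.integrable_bound[OF wint[of j]]) (use f(2,3) wr_nonneg in auto)
  have G: "(\<Sum>j\<in>UNIV. \<rho> j * (\<integral>t. ?g j t \<partial>lborel)) / ?W = 1 - ?F / ?W"
    using W by (simp add: fint wint right_diff_distrib sum_subtractf diff_divide_distrib)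
  have Vsum: "enn2real (V (\<lambda>j t. ennreal (f j t)) i t) + enn2real (V (\<lambda>j t. ennreal (?g j t)) i t) = 1"
    if "0 \<le> t" for t
  proof -
    have "V (\<lambda>j t. ennreal (f j t)) i t + V (\<lambda>j t. ennreal (?g j t)) i t = V w i t"
    proof (subst V_add[symmetric])
      have "ennreal (f j t) + ennreal (?g j t) = w j t" for j t
        using f(2,3)[of j t] by (simp add: ennreal_plus[symmetric] ennreal_wr del: ennreal_plus)
      then show "V (\<lambda>j t. ennreal (f j t) + ennreal (?g j t)) i t = V w i t" by simp
    qed (auto simp: bfun_def)
    also have "\<dots> = 1" using that by (simp add: V_w)
    finally have *: "V (\<lambda>j t. ennreal (f j t)) i t + V (\<lambda>j t. ennreal (?g j t)) i t = 1" .
    then have "V (\<lambda>j t. ennreal (f j t)) i t < \<top>" "V (\<lambda>j t. ennreal (?g j t)) i t < \<top>"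
      by (metis ennreal_add_eq_top ennreal_one_neq_top top.not_eq_extremum)+
    then have "enn2real (V (\<lambda>j t. ennreal (f j t)) i t + V (\<lambda>j t. ennreal (?g j t)) i t)
      = enn2real (V (\<lambda>j t. ennreal (f j t)) i t) + enn2real (V (\<lambda>j t. ennreal (?g j t)) i t)"
      by (rule enn2real_plus)
    then show ?thesis using * by simp
  qed
  have "eventually (\<lambda>t. enn2real (V (\<lambda>j t. ennreal (f j t)) i t) \<le> ?F / ?W + e / 2) at_top"
    by (rule renewal_limsup[OF \<rho> wint f]) (use e in auto)
  moreover have "eventually (\<lambda>t. enn2real (V (\<lambda>j t. ennreal (?g j t)) i t) \<le>
      (\<Sum>j\<in>UNIV. \<rho> j * (\<integral>t. ?g j t \<partial>lborel)) / ?W + e / 2) at_top"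
  proof (rule renewal_limsup[OF \<rho> wint])
    show "AE t in lborel. isCont (?g j) t" for j
      using AE_isCont_wr[of j] f(4)[of j] by eventually_elim (rule continuous_diff)
  qed (use f(2,3) e in auto)
  ultimately show "eventually (\<lambda>t. dist (enn2real (V (\<lambda>j t. ennreal (f j t)) i t)) (?F / ?W) < e) at_top"
    using eventually_ge_at_top[of 0]
  proof eventually_elim
    case (elim t)
    then show ?case using Vsum[of t] e unfolding G dist_real_def by linarith
  qed
qed

end

section \<open>Convolutions of defective distribution functions\<close>

lemma sub_distribution_functionD:
  assumes "sub_distribution_function A"
  shows "\<And>x y. x \<le> y \<Longrightarrow> A x \<le> A y" "\<And>t. continuous (at_right t) A" "\<And>t. t < 0 \<Longrightarrow> A t = 0" "\<And>t. 0 \<le> A t"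
proof -
  show *: "x \<le> y \<Longrightarrow> A x \<le> A y" for x y using assms by (auto simp: sub_distribution_function_def mono_def)
  show "continuous (at_right t) A" for t using assms by (auto simp: sub_distribution_function_def)
  show **: "t < 0 \<Longrightarrow> A t = 0" for t using assms by (auto simp: sub_distribution_function_def)
  show "0 \<le> A t" for t using *[of "min t (-1)" t] **[of "min t (-1)"] by simp
qed

text \<open>A function satisfying \<open>sub_distribution_function\<close> may still be unbounded;
  the limit at infinity is what makes its interval measure finite. The limit may be below 1, as for
  the single entries of a semi-Markov matrix.\<close>

definition finite_df :: "(real \<Rightarrow> real) \<Rightarrow> bool" where
  "finite_df A \<longleftrightarrow> sub_distribution_function A \<and> (\<exists>c. (A \<longlongrightarrow> c) at_top)"

lemma finite_dfD:
  assumes "finite_df A"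
  shows "\<And>x y. x \<le> y \<Longrightarrow> A x \<le> A y" "\<And>t. continuous (at_right t) A" "\<And>t. t < 0 \<Longrightarrow> A t = 0" "\<And>t. 0 \<le> A t"
  using assms sub_distribution_functionD unfolding finite_df_def by metis+

lemma finite_dfI_bounded:
  assumes "sub_distribution_function A" "\<And>t. A t \<le> C"
  shows "finite_df A"
proof -
  have "incseq (\<lambda>n. A (real n))"
    using sub_distribution_functionD(1)[OF assms(1)] by (auto simp: incseq_def)
  then obtain c where "(\<lambda>n. A (real n)) \<longlonglongrightarrow> c"
    using incseq_convergent[of "\<lambda>n. A (real n)" C] assms(2) by blast
  then have "(A \<longlongrightarrow> c) at_top"
    by (intro tendsto_at_topI_sequentially_real) (use assms(1) in \<open>auto simp: sub_distribution_function_def\<close>)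
  then show ?thesis using assms(1) by (auto simp: finite_df_def)
qed

lemma sub_distribution_function_at_bot: "sub_distribution_function A \<Longrightarrow> (A \<longlongrightarrow> 0) at_bot"
  by (rule tendsto_eventually)
     (auto simp: sub_distribution_function_def eventually_at_bot_linorder intro!: exI[of _ "-1"])

lemma
  assumes A: "sub_distribution_function A" and lim: "(A \<longlongrightarrow> c) at_top"
  shows finite_borel_measure_df: "finite_borel_measure (interval_measure A)"
    and measure_df_UNIV: "measure (interval_measure A) UNIV = c"
proof -
  have c0: "0 \<le> c"
    by (rule tendsto_lowerbound[OF lim]) (auto simp: sub_distribution_functionD[OF A] intro: always_eventually)
  note * = sub_distribution_functionD(1,2)[OF A] sub_distribution_function_at_bot[OF A] lim c0
  show "finite_borel_measure (interval_measure A)" by (rule finite_borel_measure_interval_measure[OF *])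
  have "emeasure (interval_measure A) UNIV = ennreal c" by (rule interval_measure_UNIV[OF *])
  then show "measure (interval_measure A) UNIV = c" using c0 by (simp add: measure_def)
qed

lemma finite_measure_df: "finite_df A \<Longrightarrow> finite_measure (interval_measure A)"
  using finite_borel_measure_df unfolding finite_df_def finite_borel_measure_def by blast

lemma cdf_df:
  assumes A: "finite_df A"
  shows "cdf (interval_measure A) = A"
proof
  fix y
  obtain c where c: "sub_distribution_function A" "(A \<longlongrightarrow> c) at_top" using A unfolding finite_df_def by blast
  interpret finite_borel_measure "interval_measure A" by (rule finite_borel_measure_df[OF c])
  have "eventually (\<lambda>n. cdf (interval_measure A) y - cdf (interval_measure A) (- real n) = A y) sequentially"
  proof (rule eventually_sequentiallyI)
    fix n assume n: "nat \<lceil>\<bar>y\<bar>\<rceil> + 1 \<le> n"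
    then have l: "- real n < y" "- real n < 0" by linarith+
    show "cdf (interval_measure A) y - cdf (interval_measure A) (- real n) = A y"
      using cdf_diff_eq[OF l(1)] measure_interval_measure_Ioc[of "- real n" y A] finite_dfD[OF A] l by simp
  qed
  then have "(\<lambda>n. cdf (interval_measure A) y - cdf (interval_measure A) (- real n)) \<longlonglongrightarrow> A y"
    by (rule tendsto_eventually)
  moreover have "(\<lambda>n. cdf (interval_measure A) y - cdf (interval_measure A) (- real n)) \<longlonglongrightarrow> cdf (interval_measure A) y - 0"
    by (intro tendsto_intros cdf_lim_neg_infty)
  ultimately show "cdf (interval_measure A) y = A y" using LIMSEQ_unique by fastforce
qed

lemma emeasure_df:
  assumes "finite_df A"
  shows "emeasure (interval_measure A) {..t} = ennreal (A t)"
proof -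
  interpret finite_measure "interval_measure A" by (rule finite_measure_df[OF assms])
  show ?thesis using cdf_df[OF assms] by (simp add: emeasure_eq_measure cdf_def fun_eq_iff)
qed

lemma AE_df_nonneg:
  assumes "finite_df A"
  shows "AE x in interval_measure A. 0 \<le> x"
proof -
  have "(\<Union>n. {..- 1 / real (Suc n)}) \<in> null_sets (interval_measure A)"
  proof (rule null_sets_UN)
    fix n
    have "A (- 1 / real (Suc n)) = 0" by (rule finite_dfD(3)[OF assms]) (simp add: field_simps)
    then show "{..- 1 / real (Suc n)} \<in> null_sets (interval_measure A)"
      by (simp add: null_sets_def emeasure_df[OF assms])
  qed
  moreover have "{x. \<not> 0 \<le> x} \<subseteq> (\<Union>n. {..- 1 / real (Suc n)})"
  proof
    fix x :: real assume "x \<in> {x. \<not> 0 \<le> x}"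
    then obtain n where "inverse (real (Suc n)) < - x" using reals_Archimedean[of "- x"] by auto
    then have "x \<le> - 1 / real (Suc n)" by (simp add: inverse_eq_divide)
    then show "x \<in> (\<Union>n. {..- 1 / real (Suc n)})" by blast
  qed
  ultimately show ?thesis by (intro AE_I'[where N = "\<Union>n. {..- 1 / real (Suc n)}"]) auto
qed

text \<open>On finite Borel measures carried by \<open>[0, \<infinity>)\<close>, taking the
  distribution function and taking the interval measure are inverse to each other. A distribution
  function may therefore be studied through a measure constructed independently.\<close>

lemma
  assumes "finite_borel_measure \<nu>" and nonneg: "AE x in \<nu>. 0 \<le> x"
  shows finite_df_cdf: "finite_df (cdf \<nu>)"
    and interval_measure_cdf: "interval_measure (cdf \<nu>) = \<nu>"
proof -
  interpret finite_borel_measure \<nu> by fact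
  have neg: "cdf \<nu> t = 0" if "t < 0" for t
  proof -
    have "AE x in \<nu>. \<not> x \<le> t" using nonneg by eventually_elim (use that in auto)
    then have "emeasure \<nu> {x \<in> space \<nu>. x \<le> t} = 0" by (rule emeasure_eq_0_AE)
    then show ?thesis by (simp add: cdf_def borel_UNIV measure_def atMost_def)
  qed
  have lim: "(cdf \<nu> \<longlongrightarrow> measure \<nu> UNIV) at_top" using cdf_lim_at_top by (simp add: borel_UNIV)
  show fd: "finite_df (cdf \<nu>)"
    using lim neg cdf_is_right_cont
    by (auto simp: finite_df_def sub_distribution_function_def mono_def intro: cdf_nondecreasing)
  show "interval_measure (cdf \<nu>) = \<nu>"
  proof (rule cdf_unique')
    show "finite_borel_measure (interval_measure (cdf \<nu>))"
      using fd finite_borel_measure_df unfolding finite_df_def by blast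
  qed (use assms cdf_df[OF fd] in auto)
qed

definition conv_measure :: "real measure \<Rightarrow> real measure \<Rightarrow> real measure" where
  "conv_measure \<mu> \<nu> = distr (\<mu> \<Otimes>\<^sub>M \<nu>) borel (\<lambda>(x, y). x + y)"

text \<open>The Stieltjes convolution is the distribution function of the image of the product
  measure under addition. Regularity, the iterated integral and the total mass are then read off
  from that image.\<close>

lemma
  assumes A: "finite_df A" and B: "finite_df B"
  shows finite_df_conv: "finite_df (stieltjes_conv A B)"
    and nn_integral_conv: "\<And>f. f \<in> borel_measurable borel \<Longrightarrow>
       (\<integral>\<^sup>+z. f z \<partial>interval_measure (stieltjes_conv A B)) = (\<integral>\<^sup>+x. \<integral>\<^sup>+y. f (x + y) \<partial>interval_measure B \<partial>interval_measure A)"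
    and measure_conv_UNIV: "measure (interval_measure (stieltjes_conv A B)) UNIV
       = measure (interval_measure A) UNIV * measure (interval_measure B) UNIV"
proof -
  let ?A = "interval_measure A" and ?B = "interval_measure B"
  interpret A: finite_measure ?A by (rule finite_measure_df[OF A])
  interpret B: finite_measure ?B by (rule finite_measure_df[OF B])
  interpret AB: finite_measure "?A \<Otimes>\<^sub>M ?B"
    by (rule finite_measure_pair_measure) (rule finite_measure_df A B)+
  have sp: "space (?A \<Otimes>\<^sub>M ?B) = UNIV" by (simp add: space_pair_measure)
  interpret C: finite_borel_measure "conv_measure ?A ?B"
    unfolding finite_borel_measure_def finite_borel_measure_axioms_def conv_measure_def
    by (auto intro!: AB.finite_measure_distr)
  have int: "(\<integral>\<^sup>+z. f z \<partial>conv_measure ?A ?B) = (\<integral>\<^sup>+x. \<integral>\<^sup>+y. f (x + y) \<partial>?B \<partial>?A)"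
    if [measurable]: "f \<in> borel_measurable borel" for f
    unfolding conv_measure_def
    by (subst nn_integral_distr) (simp_all add: B.nn_integral_fst[symmetric] case_prod_beta)
  have nonneg: "AE x in conv_measure ?A ?B. 0 \<le> x"
  proof -
    have "(\<integral>\<^sup>+z. indicator {..<0} z \<partial>conv_measure ?A ?B) = (\<integral>\<^sup>+x. \<integral>\<^sup>+y. indicator {..<0} (x + y) \<partial>?B \<partial>?A)"
      by (rule int) auto
    also have "\<dots> = (\<integral>\<^sup>+x. 0 \<partial>?A)"
    proof (rule nn_integral_cong_AE, use AE_df_nonneg[OF A] in eventually_elim)
      fix x :: real assume x: "0 \<le> x"
      have "(\<integral>\<^sup>+y. indicator {..<0} (x + y) \<partial>?B) = (\<integral>\<^sup>+y. 0 \<partial>?B)"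
        by (rule nn_integral_cong_AE, use AE_df_nonneg[OF B] in eventually_elim) (use x in auto)
      then show "(\<integral>\<^sup>+y. indicator {..<0} (x + y) \<partial>?B) = 0" by simp
    qed
    finally have "{..<0} \<in> null_sets (conv_measure ?A ?B)"
      by (simp add: null_sets_def C.M_is_borel)
    then show ?thesis by (intro AE_I'[where N = "{..<0}"]) (auto simp: C.borel_UNIV)
  qed
  have eq: "stieltjes_conv A B = cdf (conv_measure ?A ?B)"
  proof
    fix t
    have "ennreal (cdf (conv_measure ?A ?B) t) = (\<integral>\<^sup>+z. indicator {..t} z \<partial>conv_measure ?A ?B)"
      by (simp add: cdf_def C.emeasure_eq_measure C.M_is_borel)
    also have "\<dots> = (\<integral>\<^sup>+x. \<integral>\<^sup>+y. indicator {..t} (x + y) \<partial>?B \<partial>?A)" by (rule int) auto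
    also have "\<dots> = (\<integral>\<^sup>+x. ennreal (B (t - x)) \<partial>?A)"
    proof (rule nn_integral_cong)
      fix x
      have "(\<integral>\<^sup>+y. indicator {..t} (x + y) \<partial>?B) = (\<integral>\<^sup>+y. indicator {..t - x} y \<partial>?B)"
        by (rule nn_integral_cong) (auto simp: indicator_def)
      then show "(\<integral>\<^sup>+y. indicator {..t} (x + y) \<partial>?B) = ennreal (B (t - x))"
        by (simp add: emeasure_df[OF B])
    qed
    also have "\<dots> = ennreal (\<integral>x. B (t - x) \<partial>?A)"
    proof (rule nn_integral_eq_integral)
      have "B \<in> borel_measurable borel"
        by (rule borel_measurable_mono) (use finite_dfD[OF B] in \<open>auto simp: mono_def\<close>)
      note [measurable] = this
      obtain b where b: "(B \<longlongrightarrow> b) at_top" using B by (auto simp: finite_df_def)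
      have "B s \<le> b" for s
        by (rule tendsto_lowerbound[OF b])
           (auto simp: eventually_at_top_linorder intro!: exI[of _ s] finite_dfD(1)[OF B])
      then show "integrable ?A (\<lambda>x. B (t - x))"
        by (intro A.integrable_const_bound[where B = b]) (auto simp: finite_dfD(4)[OF B])
    qed (auto simp: finite_dfD(4)[OF B])
    finally show "stieltjes_conv A B t = cdf (conv_measure ?A ?B) t"
      unfolding stieltjes_conv_def
      by (subst (asm) ennreal_inj) (auto simp: C.cdf_nonneg finite_dfD(4)[OF B])
  qed
  show "finite_df (stieltjes_conv A B)"
    unfolding eq by (rule finite_df_cdf[OF C.finite_borel_measure_axioms nonneg])
  have im: "interval_measure (stieltjes_conv A B) = conv_measure ?A ?B"
    unfolding eq by (rule interval_measure_cdf[OF C.finite_borel_measure_axioms nonneg])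
  show "(\<integral>\<^sup>+z. f z \<partial>interval_measure (stieltjes_conv A B)) = (\<integral>\<^sup>+x. \<integral>\<^sup>+y. f (x + y) \<partial>?B \<partial>?A)"
    if "f \<in> borel_measurable borel" for f
    unfolding im by (rule int[OF that])
  have "emeasure (conv_measure ?A ?B) UNIV = emeasure ?A UNIV * emeasure ?B UNIV"
    using int[of "\<lambda>_. 1"] by (simp add: C.borel_UNIV[symmetric] C.M_is_borel mult.commute)
  then show "measure (interval_measure (stieltjes_conv A B)) UNIV = measure ?A UNIV * measure ?B UNIV"
    unfolding im by (simp add: measure_def enn2real_mult)
qed

lemma finite_df_sum:
  assumes "\<And>k. k \<in> I \<Longrightarrow> finite_df (A k)" "finite I"
  shows "finite_df (\<lambda>t. \<Sum>k\<in>I. A k t)"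
proof -
  have "\<forall>k\<in>I. \<exists>c. (A k \<longlongrightarrow> c) at_top" using assms by (auto simp: finite_df_def)
  then obtain c where "\<And>k. k \<in> I \<Longrightarrow> (A k \<longlongrightarrow> c k) at_top" by metis
  then have "((\<lambda>t. \<Sum>k\<in>I. A k t) \<longlongrightarrow> (\<Sum>k\<in>I. c k)) at_top" by (rule tendsto_sum)
  then show ?thesis
    using assms unfolding finite_df_def sub_distribution_function_def
    by (auto simp: mono_def intro!: sum_mono continuous_sum)
qed

lemma finite_df_kernel_power:
  assumes "\<And>i j. finite_df (Q i j)"
  shows "finite_df (kernel_power Q n i j)"
proof (induction n arbitrary: j)
  case 0
  have cont: "continuous (at_right t) (\<lambda>t. if 0 \<le> t then 1 else 0 :: real)" for t :: real
  proof -
    have "eventually (\<lambda>s. (if 0 \<le> s then 1 else 0 :: real) = (if 0 \<le> t then 1 else 0)) (at_right t)"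
    proof (cases "0 \<le> t")
      case True
      then show ?thesis by (auto simp: eventually_at_filter intro!: always_eventually)
    next
      case False
      then show ?thesis by (auto simp: eventually_at_right[of t 0] intro!: exI[of _ 0])
    qed
    then show ?thesis unfolding continuous_within by (rule tendsto_eventually)
  qed
  have "((\<lambda>t::real. if 0 \<le> t then 1 else 0 :: real) \<longlongrightarrow> 1) at_top"
    by (rule tendsto_eventually) (use eventually_ge_at_top[of "0::real"] in eventually_elim, simp)
  then have "finite_df (\<lambda>t. if 0 \<le> t then 1 else 0 :: real)"
    using cont by (auto simp: finite_df_def sub_distribution_function_def mono_def)
  moreover have "finite_df (\<lambda>t. 0)"
    by (auto simp: finite_df_def sub_distribution_function_def mono_def)
  moreover have "kernel_power Q 0 i j = (if i = j then (\<lambda>t. if 0 \<le> t then 1 else 0) else (\<lambda>t. 0))"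
    by (auto simp: fun_eq_iff)
  ultimately show ?case by (simp del: kernel_power.simps)
next
  case (Suc n)
  have "kernel_power Q (Suc n) i j = (\<lambda>t. \<Sum>k\<in>UNIV. stieltjes_conv (kernel_power Q n i k) (Q k j) t)"
    by (auto simp: fun_eq_iff)
  then show ?case by (simp only:) (intro finite_df_sum finite_df_conv Suc assms; simp)
qed

text \<open>The complement of the support is covered by the null intervals with rational endpoints,
  of which there are countably many.\<close>

lemma AE_msupp:
  assumes "finite_df A"
  shows "AE y in interval_measure A. y \<in> msupp (interval_measure A)"
proof -
  let ?\<mu> = "interval_measure A"
  let ?I = "{(a, b). a \<in> \<rat> \<and> b \<in> \<rat> \<and> emeasure ?\<mu> {a<..<b} = 0}"
  have "countable ?I" by (rule countable_subset[of _ "\<rat> \<times> \<rat>"]) (auto simp: countable_rat)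
  then have "(\<Union>(a, b)\<in>?I. {a<..<b}) \<in> null_sets ?\<mu>"
    by (rule null_sets_UN') (auto simp: null_sets_def)
  moreover have "{y. y \<notin> msupp ?\<mu>} \<subseteq> (\<Union>(a, b)\<in>?I. {a<..<b})"
  proof
    fix y assume "y \<in> {y. y \<notin> msupp ?\<mu>}"
    then obtain e where e: "0 < e" "emeasure ?\<mu> {y - e<..<y + e} = 0" by (auto simp: msupp_def)
    obtain a where a: "a \<in> \<rat>" "y - e < a" "a < y" using Rats_dense_in_real[of "y - e" y] e by auto
    obtain b where b: "b \<in> \<rat>" "y < b" "b < y + e" using Rats_dense_in_real[of y "y + e"] e by auto
    have "emeasure ?\<mu> {a<..<b} \<le> emeasure ?\<mu> {y - e<..<y + e}"
      by (rule emeasure_mono) (use a b in auto)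
    then have "(a, b) \<in> ?I" using a b e by auto
    then show "y \<in> (\<Union>(a, b)\<in>?I. {a<..<b})" using a b by force
  qed
  ultimately show ?thesis by (intro AE_I'[where N = "\<Union>(a, b)\<in>?I. {a<..<b}"]) auto
qed

text \<open>The same rational covering with half-open intervals, whose mass is an increment of
  \<open>A\<close>. This way a closed carrier is verified on the distribution function
  alone.\<close>

lemma AE_closed_df:
  assumes A: "finite_df A" and C: "closed C"
    and flat: "\<And>a b. a < b \<Longrightarrow> {a<..b} \<inter> C = {} \<Longrightarrow> A b = A a"
  shows "AE y in interval_measure A. y \<in> C"
proof -
  let ?\<mu> = "interval_measure A"
  let ?I = "{(a, b). a \<in> \<rat> \<and> b \<in> \<rat> \<and> a < b \<and> {a<..b} \<inter> C = {}}"
  have "countable ?I" by (rule countable_subset[of _ "\<rat> \<times> \<rat>"]) (auto simp: countable_rat)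
  then have "(\<Union>(a, b)\<in>?I. {a<..b}) \<in> null_sets ?\<mu>"
  proof (rule null_sets_UN', clarsimp)
    fix a b :: real assume "a < b" "{a<..b} \<inter> C = {}"
    then show "{a<..b} \<in> null_sets ?\<mu>"
      using emeasure_interval_measure_Ioc[of a b A] finite_dfD[OF A] flat[of a b] by (auto simp: null_sets_def)
  qed
  moreover have "{y. y \<notin> C} \<subseteq> (\<Union>(a, b)\<in>?I. {a<..b})"
  proof
    fix y assume "y \<in> {y. y \<notin> C}"
    then obtain e where e: "0 < e" "ball y e \<inter> C = {}"
      using C unfolding closed_def open_contains_ball by (metis ComplI Diff_disjoint Diff_eq disjoint_eq_subset_Compl inf_commute mem_Collect_eq)
    obtain a where a: "a \<in> \<rat>" "y - e < a" "a < y" using Rats_dense_in_real[of "y - e" y] e by auto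
    obtain b where b: "b \<in> \<rat>" "y < b" "b < y + e" using Rats_dense_in_real[of y "y + e"] e by auto
    have "{a<..b} \<subseteq> ball y e" using a b by (auto simp: dist_real_def)
    then have "(a, b) \<in> ?I" using a b e by auto
    then show "y \<in> (\<Union>(a, b)\<in>?I. {a<..b})" using a b by force
  qed
  ultimately show ?thesis by (intro AE_I'[where N = "\<Union>(a, b)\<in>?I. {a<..b}"]) auto
qed

text \<open>Connects the two forms of the non-lattice condition: a lattice containing all reachable
  times is closed, so it would carry all the kernel powers. The closure appears because the support
  of a convolution need not consist of sums of support points.\<close>

lemma AE_kernel_power_reach:
  assumes Q: "\<And>i j. finite_df (Q i j)"
  shows "AE x in interval_measure (kernel_power Q n i j).
    x \<in> closure {y. reach (\<lambda>i j. interval_measure (Q i j)) i j y}"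
proof (induction n arbitrary: j)
  let ?R = "\<lambda>j. {y. reach (\<lambda>i j. interval_measure (Q i j)) i j y}"
  case 0
  show ?case
  proof (rule AE_closed_df[OF finite_df_kernel_power[OF Q]])
    fix a b :: real assume ab: "a < b" "{a<..b} \<inter> closure (?R j) = {}"
    have "0 \<notin> {a<..b}" if "i = j"
      using ab(2) closure_subset[of "?R j"] that reach.start[of "\<lambda>i j. interval_measure (Q i j)" i] by blast
    then show "kernel_power Q 0 i j b = kernel_power Q 0 i j a" using ab by auto
  qed simp
next
  let ?q = "\<lambda>i j. interval_measure (Q i j)"
  let ?R = "\<lambda>j. {y. reach ?q i j y}"
  case (Suc n)
  show ?case
  proof (rule AE_closed_df[OF finite_df_kernel_power[OF Q]])
    fix a b :: real assume ab: "a < b" "{a<..b} \<inter> closure (?R j) = {}"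
    have "stieltjes_conv (kernel_power Q n i k) (Q k j) b = stieltjes_conv (kernel_power Q n i k) (Q k j) a" for k
      unfolding stieltjes_conv_def
    proof (rule integral_cong_AE)
      have [measurable]: "Q k j \<in> borel_measurable borel"
        by (rule borel_measurable_mono) (use finite_dfD[OF Q] in \<open>auto simp: mono_def\<close>)
      show "(\<lambda>x. Q k j (b - x)) \<in> borel_measurable (interval_measure (kernel_power Q n i k))"
        "(\<lambda>x. Q k j (a - x)) \<in> borel_measurable (interval_measure (kernel_power Q n i k))"
        by measurable
      show "AE x in interval_measure (kernel_power Q n i k). Q k j (b - x) = Q k j (a - x)"
        using Suc.IH[where j = k]
      proof eventually_elim
        case (elim x)
        show ?case
        proof (rule ccontr)
          \<comment> \<open>An increase over \<open>(a - x, b - x]\<close> puts mass there and hence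
            a support point \<open>y\<close>. As \<open>x\<close> is a limit of reachable times, so
            is \<open>x + y\<close>, which lies in \<open>(a, b]\<close> although that interval
            avoids the closure.\<close>
          assume neq: "Q k j (b - x) \<noteq> Q k j (a - x)"
          have "\<exists>y\<in>{a - x<..b - x}. y \<in> msupp (?q k j)"
          proof (rule ccontr)
            assume none: "\<not> ?thesis"
            have "AE y in ?q k j. y \<notin> {a - x<..b - x}"
              using AE_msupp[OF Q[of k j]] by eventually_elim (use none in blast)
            then have "{a - x<..b - x} \<in> null_sets (?q k j)" by (subst (asm) AE_iff_null_sets[symmetric]) auto
            then show False
              using emeasure_interval_measure_Ioc[of "a - x" "b - x" "Q k j"] finite_dfD(1,2)[OF Q[of k j]] ab neq
              by (auto simp: null_sets_def ennreal_eq_0_iff antisym)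
          qed
          then obtain y where y: "a - x < y" "y \<le> b - x" "y \<in> msupp (?q k j)" by auto
          obtain X where X: "\<And>n. X n \<in> ?R k" "X \<longlonglongrightarrow> x"
            using elim unfolding closure_sequential by blast
          have "X n + y \<in> ?R j" for n using X(1)[of n] y(3) by (auto intro: reach.extend)
          moreover have "(\<lambda>n. X n + y) \<longlonglongrightarrow> x + y" by (intro tendsto_intros X)
          ultimately have "x + y \<in> closure (?R j)"
            unfolding closure_sequential by (intro exI[of _ "\<lambda>n. X n + y"]) auto
          moreover have "x + y \<in> {a<..b}" using y by auto
          ultimately show False using ab(2) by blast
        qed
      qed
    qed
    then show "kernel_power Q (Suc n) i j b = kernel_power Q (Suc n) i j a" by simp
  qed simp
qed

section \<open>The kernel of the model with repairs\<close>

locale semi_markov_repair =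
  fixes T :: "'s::finite \<Rightarrow> 's \<Rightarrow> real \<Rightarrow> real" and U :: "'s \<Rightarrow> real \<Rightarrow> real" and Q
  assumes T: "semi_markov_matrix T" "irreducible_semi_markov T"
    and U: "\<And>j. distribution_function (U j)"
    and Q: "\<And>i j. Q i j = repair_kernel T U i j"
    and nonlattice_Q: "nonlattice_kernel Q"
begin

lemma T_df: "finite_df (T i j)"
proof (rule finite_dfI_bounded)
  show sub: "sub_distribution_function (T i j)" for i j using T(1) by (simp add: semi_markov_matrix_def)
  have lim: "((\<lambda>t. \<Sum>j\<in>UNIV. T i j t) \<longlongrightarrow> 1) at_top" using T(1) by (simp add: semi_markov_matrix_def)
  fix t
  have "(\<Sum>j\<in>UNIV. T i j t) \<le> 1"
    by (rule tendsto_lowerbound[OF lim])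
       (auto simp: eventually_at_top_linorder intro!: exI[of _ t] sum_mono sub_distribution_functionD(1)[OF sub])
  moreover have "T i j t \<le> (\<Sum>j\<in>UNIV. T i j t)"
    by (rule member_le_sum) (auto simp: sub_distribution_functionD(4)[OF sub])
  ultimately show "T i j t \<le> 1" by linarith
qed

lemma U_df: "finite_df (U j)"
  using U[of j] by (auto simp: distribution_function_def finite_df_def)

lemma U_UNIV: "measure (interval_measure (U j)) UNIV = 1"
  using U[of j] by (auto simp: distribution_function_def measure_df_UNIV)

lemma Q_df: "finite_df (Q i j)"
  unfolding Q repair_kernel_def by (intro finite_df_conv T_df U_df)

text \<open>Repair times are finite with probability 1, so repairs delay transitions but do not
  change the embedded chain; irreducibility and row sums carry over from \<open>T\<close> to
  \<open>Q\<close>.\<close>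

lemma Q_UNIV: "measure (interval_measure (Q i j)) UNIV = measure (interval_measure (T i j)) UNIV"
  unfolding Q repair_kernel_def by (simp add: measure_conv_UNIV T_df U_df U_UNIV)

lemma T_at_top: "(T i j \<longlongrightarrow> measure (interval_measure (T i j)) UNIV) at_top"
  using T_df[of i j] measure_df_UNIV unfolding finite_df_def by blast

lemma Q_at_top: "(Q i j \<longlongrightarrow> measure (interval_measure (Q i j)) UNIV) at_top"
  using Q_df[of i j] measure_df_UNIV unfolding finite_df_def by blast

lemma T_UNIV_sum: "(\<Sum>j\<in>UNIV. measure (interval_measure (T i j)) UNIV) = 1"
proof (rule tendsto_unique)
  show "((\<lambda>t. \<Sum>j\<in>UNIV. T i j t) \<longlongrightarrow> (\<Sum>j\<in>UNIV. measure (interval_measure (T i j)) UNIV)) at_top"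
    by (intro tendsto_sum T_at_top)
  show "((\<lambda>t. \<Sum>j\<in>UNIV. T i j t) \<longlongrightarrow> 1) at_top" using T(1) by (simp add: semi_markov_matrix_def)
qed simp

lemma closed_lattice: "closed {x::real. \<exists>a::int. x = d * of_int a}"
proof -
  have "closed ((\<lambda>x::real. d *\<^sub>R x) ` \<int>)" by (intro closed_scaling closed_Ints)
  moreover have "(\<lambda>x::real. d *\<^sub>R x) ` \<int> = {x::real. \<exists>a::int. x = d * of_int a}" by (auto elim!: Ints_cases)
  ultimately show ?thesis by simp
qed

sublocale markov_renewal "\<lambda>i j. interval_measure (Q i j)"
proof
  fix i j :: 's and d :: real
  show "sets (interval_measure (Q i j)) = sets borel" by simp
  show "AE y in interval_measure (Q i j). 0 \<le> y" by (rule AE_df_nonneg[OF Q_df])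
  interpret Q: finite_measure "interval_measure (Q i j)" for i j by (rule finite_measure_df[OF Q_df])
  have "(\<Sum>j\<in>UNIV. emeasure (interval_measure (Q i j)) UNIV) = ennreal (\<Sum>j\<in>UNIV. measure (interval_measure (Q i j)) UNIV)"
    by (simp add: Q.emeasure_eq_measure)
  then show "(\<Sum>j\<in>UNIV. emeasure (interval_measure (Q i j)) UNIV) = 1" by (simp add: Q_UNIV T_UNIV_sum)
  have "{(a, b). \<exists>t. T a b t > 0} \<subseteq> {(a, b). emeasure (interval_measure (Q a b)) UNIV \<noteq> 0}"
  proof clarsimp
    fix a b t assume "0 < T a b t" and z: "emeasure (interval_measure (Q a b)) UNIV = 0"
    moreover have "T a b t \<le> measure (interval_measure (T a b)) UNIV"
      by (rule tendsto_lowerbound[OF T_at_top])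
         (auto simp: eventually_at_top_linorder intro!: exI[of _ t] finite_dfD(1)[OF T_df])
    ultimately show False using z by (simp add: Q.emeasure_eq_measure Q_UNIV)
  qed
  then show "(i, j) \<in> {(a, b). emeasure (interval_measure (Q a b)) UNIV \<noteq> 0}\<^sup>*"
    using T(2) rtrancl_mono unfolding irreducible_semi_markov_def by blast
  assume d: "0 < d"
  show "\<exists>y. reach (\<lambda>i j. interval_measure (Q i j)) i i y \<and> (\<forall>a::int. y \<noteq> d * of_int a)"
  proof (rule ccontr)
    assume "\<not> ?thesis"
    then have "{y. reach (\<lambda>i j. interval_measure (Q i j)) i i y} \<subseteq> {x. \<exists>a::int. x = d * of_int a}" by blast
    then have cl: "closure {y. reach (\<lambda>i j. interval_measure (Q i j)) i i y} \<subseteq> {x. \<exists>a::int. x = d * of_int a}"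
      by (rule closure_minimal[OF _ closed_lattice])
    have "AE x in interval_measure (kernel_power Q n i i). \<exists>a::int. x = d * of_int a" for n
      using AE_kernel_power_reach[where Q = Q and n = n and i = i and j = i, OF Q_df]
      by eventually_elim (use cl in blast)
    then show False using nonlattice_Q d unfolding nonlattice_kernel_def by blast
  qed
qed

lemma wr_eq: "wr i t = indicator {0..} t * (1 - (\<Sum>j\<in>UNIV. Q i j t))"
proof (cases "0 \<le> t")
  case True
  have "ennreal (wr i t) + (\<Sum>k\<in>UNIV. emeasure (interval_measure (Q i k)) {..t}) = 1"
    using w_plus_K_unit_step[of i t] True by (simp add: ennreal_wr K_unit_step)
  also have "(\<Sum>k\<in>UNIV. emeasure (interval_measure (Q i k)) {..t}) = ennreal (\<Sum>k\<in>UNIV. Q i k t)"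
    by (simp add: emeasure_df[OF Q_df] sum_ennreal finite_dfD(4)[OF Q_df])
  finally have "ennreal (wr i t + (\<Sum>k\<in>UNIV. Q i k t)) = 1"
    by (subst ennreal_plus) (auto simp: wr_nonneg finite_dfD(4)[OF Q_df] intro!: sum_nonneg)
  then show ?thesis using True by simp
qed (simp add: wr_neg)

end

section \<open>The renewal structure of the process with catastrophes\<close>

lemma indep_elementsD:
  assumes "prob_space M" "indep_elements M N X N' Y" "S \<in> sets N" "S' \<in> sets N'"
  shows "measure M {\<omega> \<in> space M. X \<omega> \<in> S \<and> Y \<omega> \<in> S'}
    = measure M {\<omega> \<in> space M. X \<omega> \<in> S} * measure M {\<omega> \<in> space M. Y \<omega> \<in> S'}"
proof -
  interpret prob_space M by fact
  have "prob ((X -` S \<inter> space M) \<inter> (Y -` S' \<inter> space M)) = prob (X -` S \<inter> space M) * prob (Y -` S' \<inter> space M)"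
    using assms(2-) unfolding indep_elements_def by (intro indep_setD[where A = "sets (vimage_algebra (space M) X N)"])
      (auto intro: in_vimage_algebra)
  moreover have "(X -` S \<inter> space M) \<inter> (Y -` S' \<inter> space M) = {\<omega> \<in> space M. X \<omega> \<in> S \<and> Y \<omega> \<in> S'}"
    "X -` S \<inter> space M = {\<omega> \<in> space M. X \<omega> \<in> S}" "Y -` S' \<inter> space M = {\<omega> \<in> space M. Y \<omega> \<in> S'}" by auto
  ultimately show ?thesis by simp
qed

text \<open>Extends a product formula from rectangles to all measurable sets. The constant
  \<open>c\<close> carries the probability of conditions on further variables, which lets a joint
  law be built one coordinate at a time.\<close>

lemma emeasure_pair_lawI:
  assumes "finite_measure M" "finite_measure \<mu>" "finite_measure \<nu>"
    and X: "X \<in> measurable M M1" and Y: "Y \<in> measurable M M2"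
    and s: "sets \<mu> = sets M1" "sets \<nu> = sets M2"
    and eq: "\<And>A B. A \<in> sets M1 \<Longrightarrow> B \<in> sets M2 \<Longrightarrow>
        emeasure M {\<omega> \<in> space M. X \<omega> \<in> A \<and> Y \<omega> \<in> B} = ennreal c * (emeasure \<mu> A * emeasure \<nu> B)"
    and R: "R \<in> sets (M1 \<Otimes>\<^sub>M M2)"
  shows "emeasure M {\<omega> \<in> space M. (X \<omega>, Y \<omega>) \<in> R} = ennreal c * emeasure (\<mu> \<Otimes>\<^sub>M \<nu>) R"
proof -
  note [measurable] = X Y
  interpret M: finite_measure M by fact
  interpret mu: finite_measure \<mu> by fact
  interpret nu: finite_measure \<nu> by fact
  have sets_pair: "sets (\<mu> \<Otimes>\<^sub>M \<nu>) = sets (M1 \<Otimes>\<^sub>M M2)" by (intro sets_pair_measure_cong s)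
  define \<mu>' where "\<mu>' = density \<mu> (\<lambda>_. ennreal c)"
  have \<mu>': "emeasure \<mu>' A = ennreal c * emeasure \<mu> A" if "A \<in> sets M1" for A
    using that s unfolding \<mu>'_def by (subst emeasure_density) (auto simp: nn_integral_cmult)
  have fin': "finite_measure \<mu>'"
  proof (rule finite_measureI)
    have "space \<mu> \<in> sets M1" using s(1) by (metis sets.top)
    then show "emeasure \<mu>' (space \<mu>') \<noteq> \<infinity>"
      using \<mu>'[of "space \<mu>"] mu.emeasure_finite[of "space \<mu>"] by (simp add: \<mu>'_def ennreal_mult_eq_top_iff)
  qed
  then interpret mu': finite_measure \<mu>' .
  have "\<mu>' \<Otimes>\<^sub>M \<nu> = distr M (M1 \<Otimes>\<^sub>M M2) (\<lambda>\<omega>. (X \<omega>, Y \<omega>))"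
  proof (rule pair_measure_eqI)
    show "sigma_finite_measure \<mu>'" "sigma_finite_measure \<nu>"
      by (rule mu'.sigma_finite_measure_axioms nu.sigma_finite_measure_axioms)+
    show "sets (\<mu>' \<Otimes>\<^sub>M \<nu>) = sets (distr M (M1 \<Otimes>\<^sub>M M2) (\<lambda>\<omega>. (X \<omega>, Y \<omega>)))"
      unfolding sets_distr by (intro sets_pair_measure_cong) (auto simp: \<mu>'_def s)
    fix A B assume AB: "A \<in> sets \<mu>'" "B \<in> sets \<nu>"
    then have AB': "A \<in> sets M1" "B \<in> sets M2" by (auto simp: \<mu>'_def s)
    have "(\<lambda>\<omega>. (X \<omega>, Y \<omega>)) -` (A \<times> B) \<inter> space M = {\<omega> \<in> space M. X \<omega> \<in> A \<and> Y \<omega> \<in> B}" by auto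
    then show "emeasure \<mu>' A * emeasure \<nu> B = emeasure (distr M (M1 \<Otimes>\<^sub>M M2) (\<lambda>\<omega>. (X \<omega>, Y \<omega>))) (A \<times> B)"
      using AB' by (subst emeasure_distr) (auto simp: eq[OF AB'] \<mu>' mult.assoc)
  qed
  moreover have "(\<lambda>\<omega>. (X \<omega>, Y \<omega>)) -` R \<inter> space M = {\<omega> \<in> space M. (X \<omega>, Y \<omega>) \<in> R}" by auto
  ultimately have "emeasure (\<mu>' \<Otimes>\<^sub>M \<nu>) R = emeasure M {\<omega> \<in> space M. (X \<omega>, Y \<omega>) \<in> R}"
    using R by (simp only: emeasure_distr[OF measurable_Pair[OF X Y] R])
  moreover have "emeasure (\<mu>' \<Otimes>\<^sub>M \<nu>) R = ennreal c * emeasure (\<mu> \<Otimes>\<^sub>M \<nu>) R"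
  proof -
    have R1: "R \<in> sets (\<mu>' \<Otimes>\<^sub>M \<nu>)" "R \<in> sets (\<mu> \<Otimes>\<^sub>M \<nu>)"
      using R sets_pair_measure_cong[of \<mu>' \<mu> \<nu> \<nu>] sets_pair by (auto simp: \<mu>'_def)
    have [measurable]: "(\<lambda>x. emeasure \<nu> (Pair x -` R)) \<in> borel_measurable \<mu>"
      by (rule nu.measurable_emeasure_Pair[OF R1(2)])
    show ?thesis
      unfolding nu.emeasure_pair_measure_alt[OF R1(1)] nu.emeasure_pair_measure_alt[OF R1(2)]
      by (simp add: \<mu>'_def nn_integral_density nn_integral_cmult)
  qed
  ultimately show ?thesis by simp
qed

text \<open>Passes from distribution functions to Borel sets on an event \<open>D\<close>, by
  uniqueness of finite measures with a given distribution function.\<close>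

lemma emeasure_eq_atMostI:
  fixes Y :: "'w \<Rightarrow> real"
  assumes "finite_measure M" and \<nu>: "finite_measure \<nu>" "sets \<nu> = sets borel"
    and Y[measurable]: "Y \<in> borel_measurable M" and D[measurable]: "D \<in> sets M"
    and eq: "\<And>s. emeasure M {\<omega> \<in> D. Y \<omega> \<le> s} = ennreal c * emeasure \<nu> {..s}"
    and B: "B \<in> sets borel"
  shows "emeasure M {\<omega> \<in> D. Y \<omega> \<in> B} = ennreal c * emeasure \<nu> B"
proof -
  interpret M: finite_measure M by fact
  interpret nu: finite_measure \<nu> by fact
  define \<mu>1 where "\<mu>1 = distr (density M (indicator D)) borel Y"
  define \<mu>2 where "\<mu>2 = density \<nu> (\<lambda>_. ennreal c)"
  have e1: "emeasure \<mu>1 B = emeasure M {\<omega> \<in> D. Y \<omega> \<in> B}" if "B \<in> sets borel" for B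
  proof -
    have "D \<inter> (Y -` B \<inter> space M) = {\<omega> \<in> D. Y \<omega> \<in> B}" using sets.sets_into_space[OF D] by auto
    moreover have "emeasure (density M (indicator D)) (Y -` B \<inter> space M) = emeasure M (D \<inter> (Y -` B \<inter> space M))"
      using that by (intro emeasure_restricted) auto
    ultimately show ?thesis unfolding \<mu>1_def using that
      by (subst emeasure_distr) auto
  qed
  have e2: "emeasure \<mu>2 B = ennreal c * emeasure \<nu> B" if "B \<in> sets borel" for B
    using that \<nu>(2) unfolding \<mu>2_def by (subst emeasure_density) (auto simp: nn_integral_cmult)
  have "\<mu>1 = \<mu>2"
  proof (rule cdf_unique')
    have f1: "finite_measure \<mu>1"
      by (rule finite_measureI) (use e1[of UNIV] in \<open>auto simp: \<mu>1_def\<close>)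
    have f2: "finite_measure \<mu>2"
    proof (rule finite_measureI)
      have "space \<mu>2 = UNIV" using sets_eq_imp_space_eq[OF \<nu>(2)] by (simp add: \<mu>2_def)
      then show "emeasure \<mu>2 (space \<mu>2) \<noteq> \<infinity>" using e2[of UNIV] nu.emeasure_finite[of UNIV]
        by (simp add: ennreal_mult_eq_top_iff)
    qed
    show "finite_borel_measure \<mu>1" "finite_borel_measure \<mu>2"
      using f1 f2 \<nu>(2) by (auto simp: finite_borel_measure_def finite_borel_measure_axioms_def \<mu>1_def \<mu>2_def)
    show "cdf \<mu>1 = cdf \<mu>2"
      using eq e1 e2 by (auto simp: cdf_def measure_def)
  qed
  then show ?thesis using e1[OF B] e2[OF B] by simp
qed

section \<open>The probability space of the process with catastrophes\<close>

locale catastrophe_process = semi_markov_repair T U Q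
  for T :: "'s::finite \<Rightarrow> 's \<Rightarrow> real \<Rightarrow> real" and U Q +
  fixes M :: "'w measure" and nph :: "'r::finite \<Rightarrow> nat" and \<A> :: "'s \<Rightarrow> ('r, 'd::finite) queue_model"
    and i0 :: 's and k0 :: "'r \<Rightarrow> nat"
    and E :: "nat \<Rightarrow> 'w \<Rightarrow> 's" and \<tau> :: "nat \<Rightarrow> 'w \<Rightarrow> real"
    and R :: "nat \<times> 's \<Rightarrow> 'w \<Rightarrow> real" and Z :: "nat \<times> 's \<Rightarrow> 'w \<Rightarrow> ('r, 'd) queue_path"
  assumes process: "queue_with_catastrophes M T U nph \<A> i0 k0 E \<tau> R Z"
begin

sublocale prob_space M using process by (simp add: queue_with_catastrophes_def)

lemma E_measurable[measurable]: "E n \<in> measurable M (count_space UNIV)"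
  and tau_measurable[measurable]: "\<tau> n \<in> borel_measurable M"
  using process by (auto simp: queue_with_catastrophes_def semi_markov_started_in_def)

lemma R_measurable[measurable]: "R c \<in> borel_measurable M"
  and Z_measurable[measurable]: "Z c \<in> measurable M queue_space"
  using process unfolding queue_with_catastrophes_def indep_vars_def by (metis UNIV_I)+

lemma prob_environment:
  "prob {\<omega> \<in> space M. (\<forall>l\<le>N. E l \<omega> = x l) \<and> (\<forall>l<N. \<tau> l \<omega> \<le> t l)}
     = (if x 0 = i0 then \<Prod>l<N. T (x l) (x (Suc l)) (t l) else 0)"
  using process by (simp add: queue_with_catastrophes_def semi_markov_started_in_def)

lemma prob_R: "prob {\<omega> \<in> space M. R (n, j) \<omega> \<le> v} = U j v"
proof -
  have "emeasure (distr M borel (R (n, j))) {..v} = ennreal (U j v)"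
    using process emeasure_df[OF U_df] by (simp add: queue_with_catastrophes_def)
  then have "emeasure M (R (n, j) -` {..v} \<inter> space M) = ennreal (U j v)" by (simp add: emeasure_distr)
  moreover have "R (n, j) -` {..v} \<inter> space M = {\<omega> \<in> space M. R (n, j) \<omega> \<le> v}" by auto
  ultimately show ?thesis by (simp add: emeasure_eq_measure finite_dfD(4)[OF U_df])
qed

lemma prob_R_finite:
  assumes "finite J"
  shows "prob {\<omega> \<in> space M. \<forall>c\<in>J. R c \<omega> \<le> v c} = (\<Prod>c\<in>J. U (snd c) (v c))"
proof (cases "J = {}")
  case False
  have "prob (\<Inter>c\<in>J. R c -` {..v c} \<inter> space M) = (\<Prod>c\<in>J. prob (R c -` {..v c} \<inter> space M))"
    by (rule indep_varsD[where I = UNIV and M' = "\<lambda>_. borel"])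
       (use process False assms in \<open>auto simp: queue_with_catastrophes_def\<close>)
  moreover have "(\<Inter>c\<in>J. R c -` {..v c} \<inter> space M) = {\<omega> \<in> space M. \<forall>c\<in>J. R c \<omega> \<le> v c}" using False by auto
  moreover have "prob (R c -` {..v c} \<inter> space M) = U (snd c) (v c)" for c
    using prob_R[of "fst c" "snd c" "v c"] by (simp add: vimage_def Int_def conj_commute)
  ultimately show ?thesis by simp
qed (simp add: prob_space)

lemma prob_R_Z:
  assumes "finite J" "W \<in> sets queue_space"
  shows "prob {\<omega> \<in> space M. (\<forall>c\<in>J. R c \<omega> \<le> v c) \<and> Z c \<omega> \<in> W}
    = (\<Prod>c\<in>J. U (snd c) (v c)) * prob {\<omega> \<in> space M. Z c \<omega> \<in> W}"
proof -
  have ind: "indep_elements M (PiM UNIV (\<lambda>_. borel)) (\<lambda>\<omega> c. R c \<omega>) (PiM UNIV (\<lambda>_. queue_space)) (\<lambda>\<omega> c. Z c \<omega>)"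
    using process by (simp add: queue_with_catastrophes_def)
  have 1: "{f \<in> space (PiM UNIV (\<lambda>_. borel)). \<forall>c\<in>J. f c \<le> v c} \<in> sets (PiM UNIV (\<lambda>_. borel :: real measure))"
    using assms(1) by measurable
  have 2: "{f \<in> space (PiM UNIV (\<lambda>_. queue_space)). f c \<in> W} \<in> sets (PiM UNIV (\<lambda>_. queue_space :: ('r, 'd) queue_path measure))"
    using assms(2) by measurable
  have Zs: "Z c \<omega> \<in> space queue_space" if "\<omega> \<in> space M" for c \<omega>
    using measurable_space[OF Z_measurable that] .
  from indep_elementsD[OF prob_space_axioms ind 1 2] show ?thesis
    using Zs by (simp add: space_PiM PiE_UNIV_domain prob_R_finite[OF assms(1)] Pi_iff cong: conj_cong)
qed

lemma prob_all:
  assumes "finite J" "W \<in> sets queue_space"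
  shows "prob {\<omega> \<in> space M. ((\<forall>l\<le>N. E l \<omega> = x l) \<and> (\<forall>l<N. \<tau> l \<omega> \<le> t l)) \<and> (\<forall>c\<in>J. R c \<omega> \<le> v c) \<and> Z c \<omega> \<in> W}
    = (if x 0 = i0 then \<Prod>l<N. T (x l) (x (Suc l)) (t l) else 0) * (\<Prod>c\<in>J. U (snd c) (v c)) * prob {\<omega> \<in> space M. Z c \<omega> \<in> W}"
proof -
  let ?N1 = "PiM UNIV (\<lambda>_::nat. count_space (UNIV::'s set) \<Otimes>\<^sub>M (borel :: real measure))"
  let ?N2 = "PiM UNIV (\<lambda>_. borel :: real measure) \<Otimes>\<^sub>M PiM UNIV (\<lambda>_. queue_space :: ('r, 'd) queue_path measure)"
  have ind: "indep_elements M ?N1 (\<lambda>\<omega> n. (E n \<omega>, \<tau> n \<omega>)) ?N2 (\<lambda>\<omega>. (\<lambda>c. R c \<omega>, \<lambda>c. Z c \<omega>))"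
    using process by (simp add: queue_with_catastrophes_def)
  have 1: "{f \<in> space ?N1. (\<forall>l\<le>N. fst (f l) = x l) \<and> (\<forall>l<N. snd (f l) \<le> t l)} \<in> sets ?N1"
    by measurable
  have 2: "{p \<in> space ?N2. (\<forall>c\<in>J. fst p c \<le> v c) \<and> snd p c \<in> W} \<in> sets ?N2"
    using assms by measurable
  have Zs: "Z c \<omega> \<in> space queue_space" if "\<omega> \<in> space M" for c \<omega>
    using measurable_space[OF Z_measurable that] .
  from indep_elementsD[OF prob_space_axioms ind 1 2] show ?thesis
    using Zs by (simp add: space_PiM PiE_UNIV_domain space_pair_measure prob_environment prob_R_Z[OF assms] Pi_iff mult.assoc cong: conj_cong)
qed

section \<open>Histories at the beginning of an operating period\<close>

definition history_box :: "nat \<Rightarrow> (nat \<Rightarrow> 's) \<Rightarrow> (nat \<Rightarrow> real) \<Rightarrow> (nat \<times> 's \<Rightarrow> real) \<Rightarrow> 'w set" where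
  "history_box n x t v = {\<omega> \<in> space M. (\<forall>l\<le>n. E l \<omega> = x l) \<and> (\<forall>l<n. \<tau> l \<omega> \<le> t l) \<and> (\<forall>c\<in>{..<n} \<times> UNIV. R c \<omega> \<le> v c)}"

definition boxes :: "nat \<Rightarrow> 'w set set" where
  "boxes n = {history_box n x t v |x t v. True}"

text \<open>What is known when period \<open>n\<close> begins: the states up to \<open>n\<close>,
  but sojourns and repairs only before \<open>n\<close>. That suffices for the starting time and
  leaves out the sojourn, repair and queue of period \<open>n\<close>. Repair times for states that
  are not entered are included as well, so that boxes have product probabilities.\<close>

definition history :: "nat \<Rightarrow> 'w measure" where
  "history n = sigma (space M) (boxes n)"

lemma history_box_sets[measurable]: "history_box n x t v \<in> sets M"
  unfolding history_box_def by measurable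

lemma boxes_Pow: "boxes n \<subseteq> Pow (space M)"
  by (auto simp: boxes_def history_box_def)

lemma space_history[simp]: "space (history n) = space M"
  unfolding history_def by (rule space_measure_of[OF boxes_Pow])

lemma sets_history: "sets (history n) = sigma_sets (space M) (boxes n)"
  unfolding history_def by (rule sets_measure_of[OF boxes_Pow])

lemma sets_history_subset: "A \<in> sets (history n) \<Longrightarrow> A \<in> sets M"
proof -
  have "sigma_sets (space M) (boxes n) \<subseteq> sets M"
    by (rule sets.sigma_sets_subset) (auto simp: boxes_def)
  then show "A \<in> sets (history n) \<Longrightarrow> A \<in> sets M" by (auto simp: sets_history)
qed

text \<open>A countable cover of the space by generators, as required for uniqueness of measures;
  restricting the paths to \<open>{..n}\<close> and the bounds to integers makes it
  countable.\<close>

definition bounding_boxes :: "nat \<Rightarrow> 'w set set" where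
  "bounding_boxes n = (\<lambda>(x, N). history_box n x (\<lambda>_. real N) (\<lambda>_. real N)) ` ((\<Pi>\<^sub>E l\<in>{..n}. UNIV) \<times> (UNIV :: nat set))"

lemma countable_paths: "countable ((\<Pi>\<^sub>E l\<in>{..n::nat}. (UNIV :: 's set)) \<times> (UNIV :: nat set))"
  by (rule countable_SIGMA; simp add: countable_finite finite_PiE)

lemma history_bound: "\<exists>N. (\<forall>l<n. \<tau> l \<omega> \<le> real N) \<and> (\<forall>c\<in>{..<n} \<times> UNIV. R c \<omega> \<le> real N)"
proof -
  let ?S = "(\<lambda>l. \<tau> l \<omega>) ` {..<n} \<union> (\<lambda>c. R c \<omega>) ` ({..<n} \<times> (UNIV::'s set))"
  have fin: "finite ?S" by auto
  obtain N where "Max (insert 0 ?S) \<le> real N" using real_arch_simple by blast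
  then have "\<forall>s\<in>?S. s \<le> real N" using fin by (auto intro: order_trans[OF Max_ge])
  then show ?thesis by (intro exI[of _ N]) auto
qed

text \<open>A measurability criterion: events that are unions of boxes over the paths and integer bounds.\<close>
lemma history_setI:
  assumes S: "S \<subseteq> space M"
    and eq: "\<And>\<omega> N. \<omega> \<in> space M \<Longrightarrow> (\<forall>l<n. \<tau> l \<omega> \<le> real N) \<Longrightarrow> (\<forall>c\<in>{..<n} \<times> UNIV. R c \<omega> \<le> real N) \<Longrightarrow>
        \<omega> \<in> S \<longleftrightarrow> \<omega> \<in> history_box n (restrict (\<lambda>l. E l \<omega>) {..n}) (t N) (v N) \<and> restrict (\<lambda>l. E l \<omega>) {..n} \<in> X"
    and sub: "\<And>x N. x \<in> X \<Longrightarrow> x \<in> (\<Pi>\<^sub>E l\<in>{..n}. UNIV) \<Longrightarrow> history_box n x (t N) (v N) \<subseteq> S"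
  shows "S \<in> sets (history n)"
proof -
  have "S = (\<Union>(x, N)\<in>((\<Pi>\<^sub>E l\<in>{..n}. UNIV) \<inter> X) \<times> UNIV. history_box n x (t N) (v N))"
  proof (intro equalityI subsetI)
    fix \<omega> assume w: "\<omega> \<in> S"
    obtain N where N: "\<forall>l<n. \<tau> l \<omega> \<le> real N" "\<forall>c\<in>{..<n} \<times> UNIV. R c \<omega> \<le> real N"
      using history_bound by blast
    have "\<omega> \<in> history_box n (restrict (\<lambda>l. E l \<omega>) {..n}) (t N) (v N) \<and> restrict (\<lambda>l. E l \<omega>) {..n} \<in> X"
      using eq[OF _ N] w S by blast
    then show "\<omega> \<in> (\<Union>(x, N)\<in>((\<Pi>\<^sub>E l\<in>{..n}. UNIV) \<inter> X) \<times> UNIV. history_box n x (t N) (v N))"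
      by (intro UN_I[of "(restrict (\<lambda>l. E l \<omega>) {..n}, N)"]) auto
  qed (use sub in blast)
  also have "\<dots> \<in> sets (history n)"
  proof (intro sets.countable_UN')
    show "countable (((\<Pi>\<^sub>E l\<in>{..n}. UNIV) \<inter> X) \<times> (UNIV :: nat set))"
      by (rule countable_subset[OF _ countable_paths[of n]]) blast
  qed (auto simp: sets_history boxes_def)
  finally show ?thesis .
qed

lemma history_tau:
  assumes "l < n"
  shows "\<tau> l \<in> borel_measurable (history n)"
proof (rule borel_measurable_iff_le[THEN iffD2], intro allI)
  fix c
  show "{\<omega> \<in> space (history n). \<tau> l \<omega> \<le> c} \<in> sets (history n)"
    by (rule history_setI[where t = "\<lambda>N. (\<lambda>_. real N)(l := c)" and v = "\<lambda>N _. real N" and X = UNIV])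
       (use assms in \<open>auto simp: history_box_def\<close>)
qed

lemma history_R:
  assumes "l < n"
  shows "R (l, j) \<in> borel_measurable (history n)"
proof (rule borel_measurable_iff_le[THEN iffD2], intro allI)
  fix c
  show "{\<omega> \<in> space (history n). R (l, j) \<omega> \<le> c} \<in> sets (history n)"
    by (rule history_setI[where t = "\<lambda>N _. real N" and v = "\<lambda>N. (\<lambda>_. real N)((l, j) := c)" and X = UNIV])
       (use assms in \<open>auto simp: history_box_def\<close>)
qed

lemma history_E:
  assumes "l \<le> n"
  shows "E l \<in> measurable (history n) (count_space UNIV)"
proof (rule measurable_count_space_eq2[THEN iffD2], simp, intro conjI ballI)
  fix y :: 's
  have "{\<omega> \<in> space (history n). E l \<omega> = y} \<in> sets (history n)"
    by (rule history_setI[where t = "\<lambda>N _. real N" and v = "\<lambda>N _. real N" and X = "{x. x l = y}"])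
       (use assms in \<open>auto simp: history_box_def\<close>)
  then show "E l -` {y} \<inter> space (history n) \<in> sets (history n)"
    by (simp add: vimage_def Int_def conj_commute)
qed auto

lemma history_start: "operation_start E \<tau> R n \<in> borel_measurable (history n)"
proof -
  have "operation_start E \<tau> R l \<in> borel_measurable (history n)" if "l \<le> n" for l
    using that
  proof (induction l)
    case (Suc l)
    have [measurable]: "operation_start E \<tau> R l \<in> borel_measurable (history n)" "\<tau> l \<in> borel_measurable (history n)"
      "E (Suc l) \<in> measurable (history n) (count_space UNIV)" "\<And>j. R (l, j) \<in> borel_measurable (history n)"
      using Suc by (auto intro: history_tau history_R history_E)
    have "(\<lambda>\<omega>. R (l, E (Suc l) \<omega>) \<omega>) \<in> borel_measurable (history n)"
      by (rule measurable_compose_countable[where f = "\<lambda>j. R (l, j)" and g = "E (Suc l)"]) auto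
    then show ?case unfolding operation_start.simps[abs_def] by measurable
  next
    case 0
    have "operation_start E \<tau> R 0 = (\<lambda>_. 0)" by (rule ext) simp
    then show ?case by simp
  qed
  then show ?thesis by simp
qed

lemma start_measurable[measurable]: "operation_start E \<tau> R n \<in> borel_measurable M"
proof (rule measurableI)
  fix B :: "real set" assume "B \<in> sets borel"
  from sets_history_subset[OF measurable_sets[OF history_start[of n] this]]
  show "operation_start E \<tau> R n -` B \<inter> space M \<in> sets M" by (simp only: space_history)
qed simp

text \<open>Adding the next state, sojourn, repair and the current queue to a box produces a box one
  step longer, and \<open>prob_all\<close> gives both probabilities as products with all earlier
  factors in common.\<close>

lemma key_box:
  assumes "W \<in> sets queue_space"
  shows "prob {\<omega> \<in> history_box n x t v. E n \<omega> = j \<and> E (Suc n) \<omega> = k \<and> \<tau> n \<omega> \<le> s \<and> R (n, k) \<omega> \<le> d \<and> Z (n, j) \<omega> \<in> W}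
    = prob {\<omega> \<in> history_box n x t v. E n \<omega> = j} * (T j k s * U k d * prob {\<omega> \<in> space M. Z (n, j) \<omega> \<in> W})"
proof (cases "x n = j")
  case True
  define x' where "x' = x(Suc n := k)"
  define t' where "t' = t(n := s)"
  define J where "J = {..<n} \<times> (UNIV :: 's set)"
  define v' where "v' = v((n, k) := d)"
  have finJ: "finite J" by (simp add: J_def)
  have nk: "(n, k) \<notin> J" by (simp add: J_def)
  have "{\<omega> \<in> history_box n x t v. E n \<omega> = j \<and> E (Suc n) \<omega> = k \<and> \<tau> n \<omega> \<le> s \<and> R (n, k) \<omega> \<le> d \<and> Z (n, j) \<omega> \<in> W}
    = {\<omega> \<in> space M. ((\<forall>l\<le>Suc n. E l \<omega> = x' l) \<and> (\<forall>l<Suc n. \<tau> l \<omega> \<le> t' l)) \<and>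
        (\<forall>c\<in>insert (n, k) J. R c \<omega> \<le> v' c) \<and> Z (n, j) \<omega> \<in> W}"
  proof -
    have "(\<forall>l\<le>Suc n. E l \<omega> = x' l) \<longleftrightarrow> (\<forall>l\<le>n. E l \<omega> = x l) \<and> E (Suc n) \<omega> = k" for \<omega>
      by (auto simp: x'_def le_Suc_eq)
    moreover have "(\<forall>l<Suc n. \<tau> l \<omega> \<le> t' l) \<longleftrightarrow> (\<forall>l<n. \<tau> l \<omega> \<le> t l) \<and> \<tau> n \<omega> \<le> s" for \<omega>
      by (auto simp: t'_def less_Suc_eq)
    moreover have "(\<forall>c\<in>insert (n, k) J. R c \<omega> \<le> v' c) \<longleftrightarrow> R (n, k) \<omega> \<le> d \<and> (\<forall>c\<in>J. R c \<omega> \<le> v c)" for \<omega>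
      using nk by (auto simp: v'_def)
    ultimately show ?thesis using True unfolding history_box_def J_def[symmetric] by auto
  qed
  moreover have "{\<omega> \<in> history_box n x t v. E n \<omega> = j} = {\<omega> \<in> space M. ((\<forall>l\<le>n. E l \<omega> = x l) \<and> (\<forall>l<n. \<tau> l \<omega> \<le> t l)) \<and>
        (\<forall>c\<in>J. R c \<omega> \<le> v c) \<and> Z (n, j) \<omega> \<in> space queue_space}"
    using True measurable_space[OF Z_measurable] unfolding history_box_def J_def by auto
  moreover have "(\<Prod>c\<in>insert (n, k) J. U (snd c) (v' c)) = U k d * (\<Prod>c\<in>J. U (snd c) (v c))"
  proof -
    have "(\<Prod>c\<in>J. U (snd c) (v' c)) = (\<Prod>c\<in>J. U (snd c) (v c))"
      using nk by (intro prod.cong) (auto simp: v'_def)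
    then show ?thesis using finJ nk by (simp add: v'_def)
  qed
  moreover have "(\<Prod>l<Suc n. T (x' l) (x' (Suc l)) (t' l)) = (\<Prod>l<n. T (x l) (x (Suc l)) (t l)) * T j k s"
  proof -
    have "(\<Prod>l<n. T (x' l) (x' (Suc l)) (t' l)) = (\<Prod>l<n. T (x l) (x (Suc l)) (t l))"
      by (intro prod.cong) (auto simp: x'_def t'_def)
    then show ?thesis using True by (simp add: x'_def t'_def)
  qed
  moreover have "x' 0 = x 0" by (simp add: x'_def)
  moreover have "prob {\<omega> \<in> space M. Z (n, j) \<omega> \<in> space queue_space} = 1"
  proof -
    have "{\<omega> \<in> space M. Z (n, j) \<omega> \<in> space queue_space} = space M"
      using measurable_space[OF Z_measurable] by auto
    then show ?thesis by (simp add: prob_space)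
  qed
  ultimately show ?thesis
    using prob_all[OF _ assms, of "insert (n, k) J" "Suc n" x' t' v' "(n, j)"]
      prob_all[OF finJ sets.top, of n x t v "(n, j)"] finJ by simp
next
  case False
  then have "{\<omega> \<in> history_box n x t v. E n \<omega> = j \<and> E (Suc n) \<omega> = k \<and> \<tau> n \<omega> \<le> s \<and> R (n, k) \<omega> \<le> d \<and> Z (n, j) \<omega> \<in> W} = {}"
    "{\<omega> \<in> history_box n x t v. E n \<omega> = j} = {}" by (auto simp: history_box_def)
  then show ?thesis by (simp only: measure_empty mult_zero_left)
qed

lemma box_Int:
  "history_box n x t v \<inter> history_box n x' t' v' \<in> insert {} (boxes n)"
proof (cases "\<forall>l\<le>n. x l = x' l")
  case True
  then have "history_box n x t v \<inter> history_box n x' t' v' = history_box n x (\<lambda>l. min (t l) (t' l)) (\<lambda>c. min (v c) (v' c))"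
    by (auto simp: history_box_def)
  then show ?thesis unfolding boxes_def by blast
next
  case False
  then have "history_box n x t v \<inter> history_box n x' t' v' = {}" by (auto simp: history_box_def)
  then show ?thesis by blast
qed

text \<open>Regeneration: given the state \<open>j\<close>, the current period is independent of the
  history. Both sides are finite measures in \<open>C\<close>, and they agree on the boxes, which
  are stable under intersection.\<close>

lemma key:
  assumes W: "W \<in> sets queue_space" and C: "C \<in> sets (history n)"
  shows "emeasure M {\<omega> \<in> C. E n \<omega> = j \<and> E (Suc n) \<omega> = k \<and> \<tau> n \<omega> \<le> s \<and> R (n, k) \<omega> \<le> d \<and> Z (n, j) \<omega> \<in> W}
    = ennreal (T j k s * U k d * prob {\<omega> \<in> space M. Z (n, j) \<omega> \<in> W}) * emeasure M {\<omega> \<in> C. E n \<omega> = j}"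
proof -
  note [measurable] = W
  define c where "c = T j k s * U k d * prob {\<omega> \<in> space M. Z (n, j) \<omega> \<in> W}"
  have c0: "0 \<le> c" by (simp add: c_def finite_dfD(4)[OF T_df] finite_dfD(4)[OF U_df])
  define D1 where "D1 = {\<omega> \<in> space M. E n \<omega> = j \<and> E (Suc n) \<omega> = k \<and> \<tau> n \<omega> \<le> s \<and> R (n, k) \<omega> \<le> d \<and> Z (n, j) \<omega> \<in> W}"
  define D2 where "D2 = {\<omega> \<in> space M. E n \<omega> = j}"
  have [measurable]: "D1 \<in> sets M" "D2 \<in> sets M" unfolding D1_def D2_def by measurable
  have hist: "id \<in> measurable (density M f) (history n)" for f
    using sets_history_subset by (intro measurableI) auto
  \<comment> \<open>The image under the identity restricts a measure to the smaller \<sigma>-algebra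
    of the history, where the boxes generate.\<close>
  define \<mu>1 where "\<mu>1 = distr (density M (indicator D1)) (history n) id"
  define \<mu>2 where "\<mu>2 = distr (density M (\<lambda>\<omega>. ennreal c * indicator D2 \<omega>)) (history n) id"
  have e1: "emeasure \<mu>1 C = emeasure M (C \<inter> D1)" if "C \<in> sets (history n)" for C
  proof -
    have C: "C \<in> sets M" "C \<subseteq> space M"
      using that sets_history_subset sets.sets_into_space[OF that] by auto
    then have "emeasure \<mu>1 C = emeasure (density M (indicator D1)) C"
      unfolding \<mu>1_def using that by (subst emeasure_distr[OF hist]) (auto simp: Int_absorb2)
    also have "\<dots> = emeasure M (D1 \<inter> C)" by (rule emeasure_restricted) (use C in auto)
    finally show ?thesis by (simp add: Int_commute)
  qed
  have e2: "emeasure \<mu>2 C = ennreal c * emeasure M (C \<inter> D2)" if "C \<in> sets (history n)" for C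
  proof -
    have C[measurable]: "C \<in> sets M" and C': "C \<subseteq> space M"
      using that sets_history_subset sets.sets_into_space[OF that] by auto
    then have "emeasure \<mu>2 C = emeasure (density M (\<lambda>\<omega>. ennreal c * indicator D2 \<omega>)) C"
      unfolding \<mu>2_def using that by (subst emeasure_distr[OF hist]) (auto simp: Int_absorb2)
    also have "\<dots> = (\<integral>\<^sup>+\<omega>. ennreal c * indicator (C \<inter> D2) \<omega> \<partial>M)"
      by (subst emeasure_density) (auto intro!: nn_integral_cong simp: indicator_def)
    also have "\<dots> = ennreal c * emeasure M (C \<inter> D2)" by (simp add: nn_integral_cmult)
    finally show ?thesis .
  qed
  have "\<mu>1 = \<mu>2"
  proof (rule measure_eqI_generator_eq_countable[where \<Omega> = "space M" and E = "insert {} (boxes n)" and A = "bounding_boxes n"])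
    show "Int_stable (insert {} (boxes n))"
    proof (rule Int_stableI)
      fix a b assume ab: "a \<in> insert {} (boxes n)" "b \<in> insert {} (boxes n)"
      show "a \<inter> b \<in> insert {} (boxes n)"
      proof (cases "a = {} \<or> b = {}")
        case False
        then obtain x t v x' t' v' where "a = history_box n x t v" "b = history_box n x' t' v'"
          using ab unfolding boxes_def by blast
        then show ?thesis using box_Int by simp
      qed auto
    qed
    show "insert {} (boxes n) \<subseteq> Pow (space M)" using boxes_Pow by auto
    show "sets \<mu>1 = sigma_sets (space M) (insert {} (boxes n))" "sets \<mu>2 = sigma_sets (space M) (insert {} (boxes n))"
    proof -
      have "sigma_sets (space M) (insert {} (boxes n)) = sigma_sets (space M) (boxes n)"
        by (rule sigma_sets_eqI) (auto intro: sigma_sets.Empty sigma_sets.Basic)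
      then show "sets \<mu>1 = sigma_sets (space M) (insert {} (boxes n))" "sets \<mu>2 = sigma_sets (space M) (insert {} (boxes n))"
        by (simp_all add: \<mu>1_def \<mu>2_def sets_history)
    qed
    show "bounding_boxes n \<subseteq> insert {} (boxes n)" by (auto simp: bounding_boxes_def boxes_def)
    show "countable (bounding_boxes n)"
      unfolding bounding_boxes_def by (intro countable_image countable_paths)
    show "\<Union> (bounding_boxes n) = space M"
    proof (intro equalityI subsetI)
      fix \<omega> assume w: "\<omega> \<in> space M"
      obtain N where N: "\<forall>l<n. \<tau> l \<omega> \<le> real N" "\<forall>c\<in>{..<n} \<times> UNIV. R c \<omega> \<le> real N"
        using history_bound by blast
      then have "\<omega> \<in> history_box n (restrict (\<lambda>l. E l \<omega>) {..n}) (\<lambda>_. real N) (\<lambda>_. real N)"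
        using w by (auto simp: history_box_def)
      then show "\<omega> \<in> \<Union> (bounding_boxes n)"
        unfolding bounding_boxes_def by (intro UnionI[OF imageI[of "(restrict (\<lambda>l. E l \<omega>) {..n}, N)"]]) auto
    qed (auto simp: bounding_boxes_def history_box_def)
    fix X assume X: "X \<in> insert {} (boxes n)"
    show "emeasure \<mu>1 X = emeasure \<mu>2 X"
    proof (cases "X = {}")
      case False
      then obtain x t v where b: "X = history_box n x t v" using X by (auto simp: boxes_def)
      have Xs: "X \<in> sets (history n)" using X False by (auto simp: sets_history)
      have "X \<inter> D1 = {\<omega> \<in> history_box n x t v. E n \<omega> = j \<and> E (Suc n) \<omega> = k \<and> \<tau> n \<omega> \<le> s \<and> R (n, k) \<omega> \<le> d \<and> Z (n, j) \<omega> \<in> W}"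
        "X \<inter> D2 = {\<omega> \<in> history_box n x t v. E n \<omega> = j}"
        by (auto simp: b D1_def D2_def history_box_def)
      then have "prob (X \<inter> D1) = prob (X \<inter> D2) * c"
        using key_box[OF W, of n x t v j k s d] by (simp add: c_def)
      then show ?thesis
        unfolding e1[OF Xs] e2[OF Xs] emeasure_eq_measure
        using c0 by (simp add: ennreal_mult mult.commute)
    qed simp
  next
    fix a assume "a \<in> bounding_boxes n"
    then have "a \<in> sets (history n)" by (auto simp: sets_history bounding_boxes_def boxes_def)
    then show "emeasure \<mu>1 a \<noteq> \<infinity>" by (simp add: e1 emeasure_eq_measure)
  qed
  then have "emeasure M (C \<inter> D1) = ennreal c * emeasure M (C \<inter> D2)"
    using e1[OF C] e2[OF C] by simp
  moreover have "C \<inter> D1 = {\<omega> \<in> C. E n \<omega> = j \<and> E (Suc n) \<omega> = k \<and> \<tau> n \<omega> \<le> s \<and> R (n, k) \<omega> \<le> d \<and> Z (n, j) \<omega> \<in> W}"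
    "C \<inter> D2 = {\<omega> \<in> C. E n \<omega> = j}"
    using sets.sets_into_space[OF C] by (auto simp: D1_def D2_def)
  ultimately show ?thesis by (simp add: c_def)
qed

section \<open>The joint law of one operating period\<close>

abbreviation S :: "nat \<Rightarrow> 'w \<Rightarrow> real" where "S n \<equiv> operation_start E \<tau> R n"

text \<open>A defective law: its total mass is the probability of being in state \<open>j\<close> in
  period \<open>n\<close>.\<close>

definition start_law :: "nat \<Rightarrow> 's \<Rightarrow> real measure" where
  "start_law n j = distr (density M (indicator {\<omega> \<in> space M. E n \<omega> = j})) borel (S n)"

definition queue_law :: "nat \<Rightarrow> 's \<Rightarrow> ('r, 'd) queue_path measure" where
  "queue_law n j = distr M queue_space (Z (n, j))"

lemma sets_start_law[measurable_cong, simp]: "sets (start_law n j) = sets borel"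
  and sets_queue_law[measurable_cong, simp]: "sets (queue_law n j) = sets queue_space"
  by (simp_all add: start_law_def queue_law_def)

lemma emeasure_start_law:
  assumes [measurable]: "B \<in> sets borel"
  shows "emeasure (start_law n j) B = emeasure M {\<omega> \<in> space M. E n \<omega> = j \<and> S n \<omega> \<in> B}"
proof -
  have "emeasure (start_law n j) B = emeasure M ({\<omega> \<in> space M. E n \<omega> = j} \<inter> (S n -` B \<inter> space M))"
    unfolding start_law_def by (subst emeasure_distr) (auto intro!: emeasure_restricted)
  also have "{\<omega> \<in> space M. E n \<omega> = j} \<inter> (S n -` B \<inter> space M) = {\<omega> \<in> space M. E n \<omega> = j \<and> S n \<omega> \<in> B}" by auto
  finally show ?thesis .
qed

lemma emeasure_queue_law:
  assumes "W \<in> sets queue_space"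
  shows "emeasure (queue_law n j) W = emeasure M {\<omega> \<in> space M. Z (n, j) \<omega> \<in> W}"
proof -
  have "Z (n, j) -` W \<inter> space M = {\<omega> \<in> space M. Z (n, j) \<omega> \<in> W}" by auto
  then show ?thesis using assms unfolding queue_law_def by (subst emeasure_distr) auto
qed

lemma finite_start_law: "finite_measure (start_law n j)"
proof (rule finite_measureI)
  have "space (start_law n j) = UNIV" by (simp add: start_law_def)
  moreover have "(UNIV :: real set) \<in> sets borel" by simp
  ultimately show "emeasure (start_law n j) (space (start_law n j)) \<noteq> \<infinity>"
    by (simp add: emeasure_start_law emeasure_eq_measure)
qed

lemma prob_space_queue_law: "prob_space (queue_law n j)"
  unfolding queue_law_def by (rule prob_space_distr) measurable

lemma nn_integral_start_law:
  assumes [measurable]: "f \<in> borel_measurable borel"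
  shows "(\<integral>\<^sup>+s. f s \<partial>start_law n j) = (\<integral>\<^sup>+\<omega>. indicator {\<omega> \<in> space M. E n \<omega> = j} \<omega> * f (S n \<omega>) \<partial>M)"
  unfolding start_law_def by (subst nn_integral_distr) (auto simp: nn_integral_density)

abbreviation "QS \<equiv> queue_space :: ('r, 'd) queue_path measure"

abbreviation "joint_space \<equiv> (((borel :: real measure) \<Otimes>\<^sub>M QS) \<Otimes>\<^sub>M (borel :: real measure)) \<Otimes>\<^sub>M (borel :: real measure)"

text \<open>The coordinates are released one by one. With \<open>\<tau> n \<le> s\<close> and
  \<open>R (n, k) \<le> d\<close> still imposed, \<open>key\<close> gives the law of start and
  queue; then the sojourn and finally the repair pass from bounds to arbitrary Borel sets, each
  joining the product as a new factor.\<close>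

lemma joint_law:
  assumes B: "B \<in> sets joint_space"
  shows "emeasure M {\<omega> \<in> space M. E n \<omega> = j \<and> E (Suc n) \<omega> = k \<and> (((S n \<omega>, Z (n, j) \<omega>), \<tau> n \<omega>), R (n, k) \<omega>) \<in> B}
    = emeasure (((start_law n j \<Otimes>\<^sub>M queue_law n j) \<Otimes>\<^sub>M interval_measure (T j k)) \<Otimes>\<^sub>M interval_measure (U k)) B"
proof -
  interpret L: finite_measure "start_law n j" by (rule finite_start_law)
  interpret Q: prob_space "queue_law n j" by (rule prob_space_queue_law)
  interpret T: finite_measure "interval_measure (T j k)" by (rule finite_measure_df[OF T_df])
  interpret U: finite_measure "interval_measure (U k)" by (rule finite_measure_df[OF U_df])
  interpret LQ: finite_measure "start_law n j \<Otimes>\<^sub>M queue_law n j"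
    by (rule finite_measure_pair_measure) (rule L.finite_measure_axioms Q.finite_measure_axioms)+
  interpret LQT: finite_measure "(start_law n j \<Otimes>\<^sub>M queue_law n j) \<Otimes>\<^sub>M interval_measure (T j k)"
    by (rule finite_measure_pair_measure) (rule LQ.finite_measure_axioms T.finite_measure_axioms)+
  let ?D = "\<lambda>s d. {\<omega> \<in> space M. E n \<omega> = j \<and> E (Suc n) \<omega> = k \<and> \<tau> n \<omega> \<le> s \<and> R (n, k) \<omega> \<le> d}"
  have D1m: "?D s d \<in> sets M" for s d by measurable
  have D2m: "{\<omega> \<in> space M. E n \<omega> = j \<and> E (Suc n) \<omega> = k \<and> R (n, k) \<omega> \<le> d} \<in> sets M" for d by measurable
  have D3m: "{\<omega> \<in> space M. E n \<omega> = j \<and> E (Suc n) \<omega> = k} \<in> sets M" by measurable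
  have Sm: "S n \<in> measurable (density M f) borel" and Zm: "Z (n, j) \<in> measurable (density M f) QS"
    and taum: "\<tau> n \<in> measurable (density M f) borel" and Rm: "R (n, k) \<in> measurable (density M f) borel" for f
    by simp_all
  note SZm = measurable_Pair[OF Sm Zm]
  note SZtm = measurable_Pair[OF SZm taum]
  have s2: "sets (start_law n j \<Otimes>\<^sub>M queue_law n j) = sets ((borel :: real measure) \<Otimes>\<^sub>M QS)"
    by (intro sets_pair_measure_cong) simp_all
  have s3: "sets ((start_law n j \<Otimes>\<^sub>M queue_law n j) \<Otimes>\<^sub>M interval_measure (T j k))
      = sets (((borel :: real measure) \<Otimes>\<^sub>M QS) \<Otimes>\<^sub>M (borel :: real measure))"
    by (intro sets_pair_measure_cong s2) simp
  have restr: "finite_measure (density M (indicator D))" if "D \<in> sets M" for D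
    by (rule finite_measure_restricted[OF that])
  have edens: "emeasure (density M (indicator D)) {\<omega> \<in> space M. P \<omega>} = emeasure M {\<omega> \<in> D. P \<omega>}"
    if "D \<in> sets M" "{\<omega> \<in> space M. P \<omega>} \<in> sets M" for D P
  proof -
    have "D \<inter> {\<omega> \<in> space M. P \<omega>} = {\<omega> \<in> D. P \<omega>}" using sets.sets_into_space[OF that(1)] by auto
    then show ?thesis using emeasure_restricted[OF that] by simp
  qed
  have 1: "emeasure M {\<omega> \<in> ?D s d. (S n \<omega>, Z (n, j) \<omega>) \<in> B} = ennreal (T j k s * U k d) * emeasure (start_law n j \<Otimes>\<^sub>M queue_law n j) B"
    if B[measurable]: "B \<in> sets ((borel :: real measure) \<Otimes>\<^sub>M QS)" for B s d
  proof -
    have "emeasure (density M (indicator (?D s d))) {\<omega> \<in> space (density M (indicator (?D s d))). (S n \<omega>, Z (n, j) \<omega>) \<in> B}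
       = ennreal (T j k s * U k d) * emeasure (start_law n j \<Otimes>\<^sub>M queue_law n j) B"
    proof (rule emeasure_pair_lawI[OF restr[OF D1m] finite_start_law Q.finite_measure_axioms Sm Zm sets_start_law sets_queue_law _ B])
      fix A W assume A[measurable]: "A \<in> sets (borel :: real measure)" and W[measurable]: "W \<in> sets QS"
      have "emeasure (density M (indicator (?D s d))) {\<omega> \<in> space M. S n \<omega> \<in> A \<and> Z (n, j) \<omega> \<in> W}
        = emeasure M {\<omega> \<in> ?D s d. S n \<omega> \<in> A \<and> Z (n, j) \<omega> \<in> W}"
        by (rule edens) measurable
      also have "{\<omega> \<in> ?D s d. S n \<omega> \<in> A \<and> Z (n, j) \<omega> \<in> W} =
          {\<omega> \<in> {\<omega> \<in> space M. S n \<omega> \<in> A}. E n \<omega> = j \<and> E (Suc n) \<omega> = k \<and> \<tau> n \<omega> \<le> s \<and> R (n, k) \<omega> \<le> d \<and> Z (n, j) \<omega> \<in> W}"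
        by auto
      also have "emeasure M \<dots> = ennreal (T j k s * U k d * prob {\<omega> \<in> space M. Z (n, j) \<omega> \<in> W}) * emeasure M {\<omega> \<in> {\<omega> \<in> space M. S n \<omega> \<in> A}. E n \<omega> = j}"
      proof (rule key[OF W])
        have "S n -` A \<inter> space (history n) \<in> sets (history n)" by (rule measurable_sets[OF history_start A])
        then show "{\<omega> \<in> space M. S n \<omega> \<in> A} \<in> sets (history n)" by (simp add: vimage_def Int_def conj_commute)
      qed
      also have "{\<omega> \<in> {\<omega> \<in> space M. S n \<omega> \<in> A}. E n \<omega> = j} = {\<omega> \<in> space M. E n \<omega> = j \<and> S n \<omega> \<in> A}" by auto
      also have "ennreal (T j k s * U k d * prob {\<omega> \<in> space M. Z (n, j) \<omega> \<in> W})
         = ennreal (T j k s * U k d) * emeasure (queue_law n j) W"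
        by (simp add: emeasure_queue_law[OF W] emeasure_eq_measure ennreal_mult finite_dfD(4)[OF T_df] finite_dfD(4)[OF U_df])
      finally show "emeasure (density M (indicator (?D s d))) {\<omega> \<in> space (density M (indicator (?D s d))). S n \<omega> \<in> A \<and> Z (n, j) \<omega> \<in> W}
        = ennreal (T j k s * U k d) * (emeasure (start_law n j) A * emeasure (queue_law n j) W)"
        by (simp add: emeasure_start_law mult_ac)
    qed
    also have "emeasure (density M (indicator (?D s d))) {\<omega> \<in> space (density M (indicator (?D s d))). (S n \<omega>, Z (n, j) \<omega>) \<in> B}
       = emeasure M {\<omega> \<in> ?D s d. (S n \<omega>, Z (n, j) \<omega>) \<in> B}"
      unfolding space_density by (rule edens) measurable
    finally show ?thesis .
  qed
  let ?D2 = "\<lambda>d. {\<omega> \<in> space M. E n \<omega> = j \<and> E (Suc n) \<omega> = k \<and> R (n, k) \<omega> \<le> d}"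
  have 2: "emeasure M {\<omega> \<in> ?D2 d. ((S n \<omega>, Z (n, j) \<omega>), \<tau> n \<omega>) \<in> B}
     = ennreal (U k d) * emeasure ((start_law n j \<Otimes>\<^sub>M queue_law n j) \<Otimes>\<^sub>M interval_measure (T j k)) B"
    if B[measurable]: "B \<in> sets (((borel :: real measure) \<Otimes>\<^sub>M QS) \<Otimes>\<^sub>M (borel :: real measure))" for B d
  proof -
    have "emeasure (density M (indicator (?D2 d))) {\<omega> \<in> space (density M (indicator (?D2 d))). ((S n \<omega>, Z (n, j) \<omega>), \<tau> n \<omega>) \<in> B}
       = ennreal (U k d) * emeasure ((start_law n j \<Otimes>\<^sub>M queue_law n j) \<Otimes>\<^sub>M interval_measure (T j k)) B"
    proof (rule emeasure_pair_lawI[OF restr[OF D2m] LQ.finite_measure_axioms T.finite_measure_axioms SZm taum s2 sets_interval_measure _ B])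
      fix A C assume A[measurable]: "A \<in> sets ((borel :: real measure) \<Otimes>\<^sub>M QS)" and C[measurable]: "C \<in> sets (borel :: real measure)"
      have "emeasure (density M (indicator (?D2 d))) {\<omega> \<in> space M. (S n \<omega>, Z (n, j) \<omega>) \<in> A \<and> \<tau> n \<omega> \<in> C}
        = emeasure M {\<omega> \<in> ?D2 d. (S n \<omega>, Z (n, j) \<omega>) \<in> A \<and> \<tau> n \<omega> \<in> C}"
        by (rule edens) measurable
      also have "\<dots> = emeasure M {\<omega> \<in> {\<omega> \<in> ?D2 d. (S n \<omega>, Z (n, j) \<omega>) \<in> A}. \<tau> n \<omega> \<in> C}"
        by (rule arg_cong[where f = "emeasure M"]) auto
      also have "\<dots> = ennreal (U k d * measure (start_law n j \<Otimes>\<^sub>M queue_law n j) A) * emeasure (interval_measure (T j k)) C"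
      proof (rule emeasure_eq_atMostI[OF finite_measure_axioms T.finite_measure_axioms _ _ _ _ C])
        fix s
        have "{\<omega> \<in> {\<omega> \<in> ?D2 d. (S n \<omega>, Z (n, j) \<omega>) \<in> A}. \<tau> n \<omega> \<le> s} = {\<omega> \<in> ?D s d. (S n \<omega>, Z (n, j) \<omega>) \<in> A}" by auto
        then show "emeasure M {\<omega> \<in> {\<omega> \<in> ?D2 d. (S n \<omega>, Z (n, j) \<omega>) \<in> A}. \<tau> n \<omega> \<le> s}
          = ennreal (U k d * measure (start_law n j \<Otimes>\<^sub>M queue_law n j) A) * emeasure (interval_measure (T j k)) {..s}"
          using 1[OF A, of s d] by (simp add: emeasure_df[OF T_df] LQ.emeasure_eq_measure ennreal_mult finite_dfD(4)[OF T_df] finite_dfD(4)[OF U_df] mult_ac)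
        show "\<tau> n \<in> borel_measurable M" by measurable
        have "?D2 d \<inter> {\<omega> \<in> space M. (S n \<omega>, Z (n, j) \<omega>) \<in> A} \<in> sets M"
          by (intro sets.Int) measurable
        moreover have "?D2 d \<inter> {\<omega> \<in> space M. (S n \<omega>, Z (n, j) \<omega>) \<in> A} = {\<omega> \<in> ?D2 d. (S n \<omega>, Z (n, j) \<omega>) \<in> A}" by auto
        ultimately show "{\<omega> \<in> ?D2 d. (S n \<omega>, Z (n, j) \<omega>) \<in> A} \<in> sets M" by (simp only:)
      qed simp
      finally show "emeasure (density M (indicator (?D2 d))) {\<omega> \<in> space (density M (indicator (?D2 d))). (S n \<omega>, Z (n, j) \<omega>) \<in> A \<and> \<tau> n \<omega> \<in> C}
        = ennreal (U k d) * (emeasure (start_law n j \<Otimes>\<^sub>M queue_law n j) A * emeasure (interval_measure (T j k)) C)"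
        by (simp add: LQ.emeasure_eq_measure ennreal_mult finite_dfD(4)[OF U_df] mult_ac)
    qed
    also have "emeasure (density M (indicator (?D2 d))) {\<omega> \<in> space (density M (indicator (?D2 d))). ((S n \<omega>, Z (n, j) \<omega>), \<tau> n \<omega>) \<in> B}
       = emeasure M {\<omega> \<in> ?D2 d. ((S n \<omega>, Z (n, j) \<omega>), \<tau> n \<omega>) \<in> B}"
      unfolding space_density by (rule edens) measurable
    finally show ?thesis .
  qed
  note [measurable] = B
  let ?D3 = "{\<omega> \<in> space M. E n \<omega> = j \<and> E (Suc n) \<omega> = k}"
  have "emeasure (density M (indicator ?D3)) {\<omega> \<in> space (density M (indicator ?D3)). (((S n \<omega>, Z (n, j) \<omega>), \<tau> n \<omega>), R (n, k) \<omega>) \<in> B}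
     = ennreal 1 * emeasure (((start_law n j \<Otimes>\<^sub>M queue_law n j) \<Otimes>\<^sub>M interval_measure (T j k)) \<Otimes>\<^sub>M interval_measure (U k)) B"
  proof (rule emeasure_pair_lawI[OF restr[OF D3m] LQT.finite_measure_axioms U.finite_measure_axioms SZtm Rm s3 sets_interval_measure _ B])
    fix A C assume A[measurable]: "A \<in> sets (((borel :: real measure) \<Otimes>\<^sub>M QS) \<Otimes>\<^sub>M (borel :: real measure))" and C[measurable]: "C \<in> sets (borel :: real measure)"
    have "emeasure (density M (indicator ?D3)) {\<omega> \<in> space M. ((S n \<omega>, Z (n, j) \<omega>), \<tau> n \<omega>) \<in> A \<and> R (n, k) \<omega> \<in> C}
      = emeasure M {\<omega> \<in> ?D3. ((S n \<omega>, Z (n, j) \<omega>), \<tau> n \<omega>) \<in> A \<and> R (n, k) \<omega> \<in> C}"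
      by (rule edens) measurable
    also have "\<dots> = emeasure M {\<omega> \<in> {\<omega> \<in> ?D3. ((S n \<omega>, Z (n, j) \<omega>), \<tau> n \<omega>) \<in> A}. R (n, k) \<omega> \<in> C}"
      by (rule arg_cong[where f = "emeasure M"]) auto
    also have "\<dots> = ennreal (measure ((start_law n j \<Otimes>\<^sub>M queue_law n j) \<Otimes>\<^sub>M interval_measure (T j k)) A) * emeasure (interval_measure (U k)) C"
    proof (rule emeasure_eq_atMostI[OF finite_measure_axioms U.finite_measure_axioms _ _ _ _ C])
      fix d
      have "{\<omega> \<in> {\<omega> \<in> ?D3. ((S n \<omega>, Z (n, j) \<omega>), \<tau> n \<omega>) \<in> A}. R (n, k) \<omega> \<le> d} = {\<omega> \<in> ?D2 d. ((S n \<omega>, Z (n, j) \<omega>), \<tau> n \<omega>) \<in> A}" by auto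
      then show "emeasure M {\<omega> \<in> {\<omega> \<in> ?D3. ((S n \<omega>, Z (n, j) \<omega>), \<tau> n \<omega>) \<in> A}. R (n, k) \<omega> \<le> d}
        = ennreal (measure ((start_law n j \<Otimes>\<^sub>M queue_law n j) \<Otimes>\<^sub>M interval_measure (T j k)) A) * emeasure (interval_measure (U k)) {..d}"
        using 2[OF A, of d] by (simp add: emeasure_df[OF U_df] LQT.emeasure_eq_measure mult_ac)
      show "R (n, k) \<in> borel_measurable M" by measurable
      have "?D3 \<inter> {\<omega> \<in> space M. ((S n \<omega>, Z (n, j) \<omega>), \<tau> n \<omega>) \<in> A} \<in> sets M"
        by (intro sets.Int) measurable
      moreover have "?D3 \<inter> {\<omega> \<in> space M. ((S n \<omega>, Z (n, j) \<omega>), \<tau> n \<omega>) \<in> A} = {\<omega> \<in> ?D3. ((S n \<omega>, Z (n, j) \<omega>), \<tau> n \<omega>) \<in> A}" by auto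
      ultimately show "{\<omega> \<in> ?D3. ((S n \<omega>, Z (n, j) \<omega>), \<tau> n \<omega>) \<in> A} \<in> sets M" by (simp only:)
    qed simp
    finally show "emeasure (density M (indicator ?D3)) {\<omega> \<in> space (density M (indicator ?D3)). ((S n \<omega>, Z (n, j) \<omega>), \<tau> n \<omega>) \<in> A \<and> R (n, k) \<omega> \<in> C}
      = ennreal 1 * (emeasure ((start_law n j \<Otimes>\<^sub>M queue_law n j) \<Otimes>\<^sub>M interval_measure (T j k)) A * emeasure (interval_measure (U k)) C)"
      by (simp add: LQT.emeasure_eq_measure)
  qed
  also have "emeasure (density M (indicator ?D3)) {\<omega> \<in> space (density M (indicator ?D3)). (((S n \<omega>, Z (n, j) \<omega>), \<tau> n \<omega>), R (n, k) \<omega>) \<in> B}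
     = emeasure M {\<omega> \<in> ?D3. (((S n \<omega>, Z (n, j) \<omega>), \<tau> n \<omega>), R (n, k) \<omega>) \<in> B}"
    unfolding space_density by (rule edens) measurable
  also have "{\<omega> \<in> ?D3. (((S n \<omega>, Z (n, j) \<omega>), \<tau> n \<omega>), R (n, k) \<omega>) \<in> B}
    = {\<omega> \<in> space M. E n \<omega> = j \<and> E (Suc n) \<omega> = k \<and> (((S n \<omega>, Z (n, j) \<omega>), \<tau> n \<omega>), R (n, k) \<omega>) \<in> B}" by auto
  finally show ?thesis by simp
qed

lemma joint_integral:
  assumes f[measurable]: "f \<in> borel_measurable joint_space"
  shows "(\<integral>\<^sup>+\<omega>. indicator {\<omega> \<in> space M. E n \<omega> = j \<and> E (Suc n) \<omega> = k} \<omega> *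
      f (((S n \<omega>, Z (n, j) \<omega>), \<tau> n \<omega>), R (n, k) \<omega>) \<partial>M)
    = (\<integral>\<^sup>+s. \<integral>\<^sup>+z. \<integral>\<^sup>+y. \<integral>\<^sup>+r. f (((s, z), y), r) \<partial>interval_measure (U k)
        \<partial>interval_measure (T j k) \<partial>queue_law n j \<partial>start_law n j)"
proof -
  interpret L: finite_measure "start_law n j" by (rule finite_start_law)
  interpret Q: prob_space "queue_law n j" by (rule prob_space_queue_law)
  interpret T: finite_measure "interval_measure (T j k)" by (rule finite_measure_df[OF T_df])
  interpret U: finite_measure "interval_measure (U k)" by (rule finite_measure_df[OF U_df])
  let ?D = "{\<omega> \<in> space M. E n \<omega> = j \<and> E (Suc n) \<omega> = k}"
  let ?X = "\<lambda>\<omega>. (((S n \<omega>, Z (n, j) \<omega>), \<tau> n \<omega>), R (n, k) \<omega>)"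
  let ?N = "((start_law n j \<Otimes>\<^sub>M queue_law n j) \<Otimes>\<^sub>M interval_measure (T j k)) \<Otimes>\<^sub>M interval_measure (U k)"
  have sN: "sets ?N = sets joint_space" by (intro sets_pair_measure_cong) simp_all
  have [measurable]: "?D \<in> sets M" by measurable
  have X[measurable]: "?X \<in> measurable M joint_space" by measurable
  have Xd: "?X \<in> measurable (density M (indicator ?D)) joint_space" by simp
  have "distr (density M (indicator ?D)) joint_space ?X = ?N"
  proof (rule measure_eqI)
    fix B assume "B \<in> sets (distr (density M (indicator ?D)) joint_space ?X)"
    then have B: "B \<in> sets joint_space" by simp
    have "emeasure (distr (density M (indicator ?D)) joint_space ?X) B = emeasure (density M (indicator ?D)) (?X -` B \<inter> space M)"
      using emeasure_distr[OF Xd B] by simp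
    also have "\<dots> = emeasure M (?D \<inter> (?X -` B \<inter> space M))"
      by (rule emeasure_restricted) (use measurable_sets[OF X B] in auto)
    also have "?D \<inter> (?X -` B \<inter> space M) = {\<omega> \<in> space M. E n \<omega> = j \<and> E (Suc n) \<omega> = k \<and> ?X \<omega> \<in> B}" by auto
    also have "emeasure M \<dots> = emeasure ?N B" by (rule joint_law[OF B])
    finally show "emeasure (distr (density M (indicator ?D)) joint_space ?X) B = emeasure ?N B" .
  qed (simp add: sN)
  then have "(\<integral>\<^sup>+p. f p \<partial>?N) = (\<integral>\<^sup>+p. f p \<partial>distr (density M (indicator ?D)) joint_space ?X)" by simp
  also have "\<dots> = (\<integral>\<^sup>+\<omega>. f (?X \<omega>) \<partial>density M (indicator ?D))" by (rule nn_integral_distr[OF Xd]) simp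
  also have "\<dots> = (\<integral>\<^sup>+\<omega>. indicator ?D \<omega> * f (?X \<omega>) \<partial>M)" by (subst nn_integral_density) auto
  finally have eq: "(\<integral>\<^sup>+\<omega>. indicator ?D \<omega> * f (?X \<omega>) \<partial>M) = (\<integral>\<^sup>+p. f p \<partial>?N)" by simp
  have m1[measurable]: "f \<in> borel_measurable ?N" using f by (simp cong: measurable_cong_sets add: sN measurable_cong_sets[OF sN refl])
  have e1: "(\<integral>\<^sup>+p. f p \<partial>?N) = (\<integral>\<^sup>+p. \<integral>\<^sup>+r. f (p, r) \<partial>interval_measure (U k) \<partial>((start_law n j \<Otimes>\<^sub>M queue_law n j) \<Otimes>\<^sub>M interval_measure (T j k)))"
    by (rule U.nn_integral_fst[symmetric, OF m1])
  have m2: "(\<lambda>p. \<integral>\<^sup>+r. f (p, r) \<partial>interval_measure (U k)) \<in> borel_measurable ((start_law n j \<Otimes>\<^sub>M queue_law n j) \<Otimes>\<^sub>M interval_measure (T j k))"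
    by (rule U.borel_measurable_nn_integral_fst[OF m1])
  have e2: "(\<integral>\<^sup>+p. \<integral>\<^sup>+r. f (p, r) \<partial>interval_measure (U k) \<partial>((start_law n j \<Otimes>\<^sub>M queue_law n j) \<Otimes>\<^sub>M interval_measure (T j k))) = (\<integral>\<^sup>+p. \<integral>\<^sup>+y. \<integral>\<^sup>+r. f ((p, y), r) \<partial>interval_measure (U k) \<partial>interval_measure (T j k) \<partial>(start_law n j \<Otimes>\<^sub>M queue_law n j))"
    by (rule T.nn_integral_fst[symmetric, OF m2])
  have m3: "(\<lambda>p. \<integral>\<^sup>+y. \<integral>\<^sup>+r. f ((p, y), r) \<partial>interval_measure (U k) \<partial>interval_measure (T j k)) \<in> borel_measurable (start_law n j \<Otimes>\<^sub>M queue_law n j)"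
    by (rule T.borel_measurable_nn_integral_fst[OF m2])
  have e3: "(\<integral>\<^sup>+p. \<integral>\<^sup>+y. \<integral>\<^sup>+r. f ((p, y), r) \<partial>interval_measure (U k) \<partial>interval_measure (T j k) \<partial>(start_law n j \<Otimes>\<^sub>M queue_law n j))
    = (\<integral>\<^sup>+s. \<integral>\<^sup>+z. \<integral>\<^sup>+y. \<integral>\<^sup>+r. f (((s, z), y), r) \<partial>interval_measure (U k)
        \<partial>interval_measure (T j k) \<partial>queue_law n j \<partial>start_law n j)"
    by (rule Q.nn_integral_fst[symmetric, OF m3])
  show ?thesis using eq e1 e2 e3 by simp
qed

lemma sum_indicator_E:
  "(\<Sum>j\<in>UNIV. \<Sum>k\<in>UNIV. indicator {\<omega> \<in> space M. E n \<omega> = j \<and> E (Suc n) \<omega> = k} \<omega> * h j k) = (h (E n \<omega>) (E (Suc n) \<omega>) :: ennreal)"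
  if "\<omega> \<in> space M"
proof -
  have "(\<Sum>k\<in>UNIV. indicator {\<omega> \<in> space M. E n \<omega> = j \<and> E (Suc n) \<omega> = k} \<omega> * h j k)
     = (if j = E n \<omega> then h j (E (Suc n) \<omega>) else 0)" for j
  proof -
    have "(\<Sum>k\<in>UNIV. indicator {\<omega> \<in> space M. E n \<omega> = j \<and> E (Suc n) \<omega> = k} \<omega> * h j k)
      = (\<Sum>k\<in>UNIV. if k = E (Suc n) \<omega> then (if j = E n \<omega> then h j k else 0) else 0)"
      by (rule sum.cong) (use that in \<open>auto simp: indicator_def\<close>)
    then show ?thesis by simp
  qed
  then show ?thesis by simp
qed

text \<open>The analytic operator meets the process: the start of period \<open>n\<close> has the
  law of the \<open>n\<close>-th kernel power. The induction varies \<open>f\<close>, since removing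
  the last step replaces \<open>f\<close> by \<open>K f\<close>.\<close>

lemma nn_integral_start:
  assumes "bfun f"
  shows "(\<Sum>j\<in>UNIV. \<integral>\<^sup>+s. f j (t - s) \<partial>start_law n j) = (K ^^ n) f i0 t"
  using assms
proof (induction n arbitrary: f)
  case 0
  note [measurable] = bfunD[OF 0]
  have "(\<integral>\<^sup>+s. f j (t - s) \<partial>start_law 0 j) = (if j = i0 then f j t else 0)" for j
  proof -
    have "(\<integral>\<^sup>+s. f j (t - s) \<partial>start_law 0 j) = (\<integral>\<^sup>+\<omega>. f j t * indicator {\<omega> \<in> space M. E 0 \<omega> = j} \<omega> \<partial>M)"
      by (subst nn_integral_start_law) (auto simp: mult.commute)
    also have "\<dots> = f j t * emeasure M {\<omega> \<in> space M. E 0 \<omega> = j}" by (rule nn_integral_cmult_indicator) measurable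
    also have "emeasure M {\<omega> \<in> space M. E 0 \<omega> = j} = (if j = i0 then 1 else 0)"
      using prob_environment[of 0 "\<lambda>_. j" "\<lambda>_. 0"] by (simp add: emeasure_eq_measure)
    finally show ?thesis by simp
  qed
  then show ?case by simp
next
  case (Suc n)
  note [measurable] = bfunD[OF Suc.prems]
  have term_eq: "(\<integral>\<^sup>+\<omega>. indicator {\<omega> \<in> space M. E n \<omega> = j \<and> E (Suc n) \<omega> = k} \<omega> * f k (t - (S n \<omega> + \<tau> n \<omega> + R (n, k) \<omega>)) \<partial>M)
      = (\<integral>\<^sup>+s. \<integral>\<^sup>+z. f k (t - s - z) \<partial>interval_measure (Q j k) \<partial>start_law n j)" for j k
  proof -
    interpret Q: prob_space "queue_law n j" by (rule prob_space_queue_law)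
    have "(\<integral>\<^sup>+\<omega>. indicator {\<omega> \<in> space M. E n \<omega> = j \<and> E (Suc n) \<omega> = k} \<omega> * f k (t - (S n \<omega> + \<tau> n \<omega> + R (n, k) \<omega>)) \<partial>M)
      = (\<integral>\<^sup>+s. \<integral>\<^sup>+z. \<integral>\<^sup>+y. \<integral>\<^sup>+r. f k (t - (s + y + r)) \<partial>interval_measure (U k)
          \<partial>interval_measure (T j k) \<partial>queue_law n j \<partial>start_law n j)"
      using joint_integral[of "\<lambda>p. f k (t - (fst (fst (fst p)) + snd (fst p) + snd p))" n j k] by simp
    also have "\<dots> = (\<integral>\<^sup>+s. \<integral>\<^sup>+y. \<integral>\<^sup>+r. f k (t - (s + y + r)) \<partial>interval_measure (U k) \<partial>interval_measure (T j k) \<partial>start_law n j)"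
      by (simp add: Q.emeasure_space_1)
    also have "\<dots> = (\<integral>\<^sup>+s. \<integral>\<^sup>+z. f k (t - s - z) \<partial>interval_measure (Q j k) \<partial>start_law n j)"
    proof (rule nn_integral_cong)
      fix s
      have "(\<integral>\<^sup>+z. f k (t - s - z) \<partial>interval_measure (Q j k)) = (\<integral>\<^sup>+y. \<integral>\<^sup>+r. f k (t - s - (y + r)) \<partial>interval_measure (U k) \<partial>interval_measure (T j k))"
        unfolding Q repair_kernel_def by (rule nn_integral_conv[OF T_df U_df]) measurable
      then show "(\<integral>\<^sup>+y. \<integral>\<^sup>+r. f k (t - (s + y + r)) \<partial>interval_measure (U k) \<partial>interval_measure (T j k)) = (\<integral>\<^sup>+z. f k (t - s - z) \<partial>interval_measure (Q j k))"
        by (simp add: algebra_simps)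
    qed
    finally show ?thesis .
  qed
  have "(\<Sum>k\<in>UNIV. \<integral>\<^sup>+s. f k (t - s) \<partial>start_law (Suc n) k)
    = (\<Sum>k\<in>UNIV. \<integral>\<^sup>+\<omega>. indicator {\<omega> \<in> space M. E (Suc n) \<omega> = k} \<omega> * f k (t - S (Suc n) \<omega>) \<partial>M)"
    by (subst nn_integral_start_law) auto
  also have "\<dots> = (\<Sum>k\<in>UNIV. \<Sum>j\<in>UNIV. \<integral>\<^sup>+\<omega>. indicator {\<omega> \<in> space M. E n \<omega> = j \<and> E (Suc n) \<omega> = k} \<omega> * f k (t - (S n \<omega> + \<tau> n \<omega> + R (n, k) \<omega>)) \<partial>M)"
  proof (rule sum.cong[OF refl])
    fix k
    have "(\<Sum>j\<in>UNIV. \<integral>\<^sup>+\<omega>. indicator {\<omega> \<in> space M. E n \<omega> = j \<and> E (Suc n) \<omega> = k} \<omega> * f k (t - (S n \<omega> + \<tau> n \<omega> + R (n, k) \<omega>)) \<partial>M)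
      = (\<integral>\<^sup>+\<omega>. (\<Sum>j\<in>UNIV. indicator {\<omega> \<in> space M. E n \<omega> = j \<and> E (Suc n) \<omega> = k} \<omega> * f k (t - (S n \<omega> + \<tau> n \<omega> + R (n, k) \<omega>))) \<partial>M)"
      by (subst nn_integral_sum) auto
    also have "\<dots> = (\<integral>\<^sup>+\<omega>. indicator {\<omega> \<in> space M. E (Suc n) \<omega> = k} \<omega> * f k (t - S (Suc n) \<omega>) \<partial>M)"
    proof (rule nn_integral_cong)
      fix \<omega> assume w: "\<omega> \<in> space M"
      have "(\<Sum>j\<in>UNIV. indicator {\<omega> \<in> space M. E n \<omega> = j \<and> E (Suc n) \<omega> = k} \<omega> * f k (t - (S n \<omega> + \<tau> n \<omega> + R (n, k) \<omega>)))
        = (\<Sum>j\<in>UNIV. if j = E n \<omega> then indicator {\<omega> \<in> space M. E (Suc n) \<omega> = k} \<omega> * f k (t - (S n \<omega> + \<tau> n \<omega> + R (n, k) \<omega>)) else 0)"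
        by (rule sum.cong) (use w in \<open>auto simp: indicator_def\<close>)
      also have "\<dots> = indicator {\<omega> \<in> space M. E (Suc n) \<omega> = k} \<omega> * f k (t - (S n \<omega> + \<tau> n \<omega> + R (n, k) \<omega>))" by simp
      also have "\<dots> = indicator {\<omega> \<in> space M. E (Suc n) \<omega> = k} \<omega> * f k (t - S (Suc n) \<omega>)"
        by (auto simp: indicator_def)
      finally show "(\<Sum>j\<in>UNIV. indicator {\<omega> \<in> space M. E n \<omega> = j \<and> E (Suc n) \<omega> = k} \<omega> * f k (t - (S n \<omega> + \<tau> n \<omega> + R (n, k) \<omega>)))
        = indicator {\<omega> \<in> space M. E (Suc n) \<omega> = k} \<omega> * f k (t - S (Suc n) \<omega>)" .
    qed
    finally show "(\<integral>\<^sup>+\<omega>. indicator {\<omega> \<in> space M. E (Suc n) \<omega> = k} \<omega> * f k (t - S (Suc n) \<omega>) \<partial>M)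
      = (\<Sum>j\<in>UNIV. \<integral>\<^sup>+\<omega>. indicator {\<omega> \<in> space M. E n \<omega> = j \<and> E (Suc n) \<omega> = k} \<omega> * f k (t - (S n \<omega> + \<tau> n \<omega> + R (n, k) \<omega>)) \<partial>M)"
      by simp
  qed
  also have "\<dots> = (\<Sum>j\<in>UNIV. \<Sum>k\<in>UNIV. \<integral>\<^sup>+s. \<integral>\<^sup>+z. f k (t - s - z) \<partial>interval_measure (Q j k) \<partial>start_law n j)"
    unfolding term_eq by (rule sum.swap)
  also have "\<dots> = (\<Sum>j\<in>UNIV. \<integral>\<^sup>+s. K f j (t - s) \<partial>start_law n j)"
  proof -
    interpret Q: finite_measure "interval_measure (Q i j)" for i j by (rule finite_measure_df[OF Q_df])
    show ?thesis unfolding K_def by (subst nn_integral_sum) auto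
  qed
  also have "\<dots> = (K ^^ n) (K f) i0 t" by (rule Suc.IH[OF bfun_K[OF Suc.prems]])
  finally show ?case by (simp add: funpow_swap1)
qed

section \<open>The period in operation at a given time\<close>

lemma AE_tau_R_nonneg: "AE \<omega> in M. \<forall>n. 0 \<le> \<tau> n \<omega> \<and> (\<forall>j. 0 \<le> R (n, j) \<omega>)"
proof -
  have "AE \<omega> in M. 0 \<le> R (n, j) \<omega>" for n j
  proof -
    have "AE x in distr M borel (R (n, j)). 0 \<le> x"
    proof -
      have "distr M borel (R (n, j)) = interval_measure (U j)"
        using process unfolding queue_with_catastrophes_def by blast
      then show ?thesis using AE_df_nonneg[OF U_df] by (simp only:)
    qed
    then show ?thesis by (subst (asm) AE_distr_iff) auto
  qed
  moreover have "AE \<omega> in M. 0 \<le> \<tau> n \<omega>" for n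
  proof -
    \<comment> \<open>The sign of a sojourn time is known only through the functions
      \<open>T j k\<close>, so it is obtained on each event of two successive states and then summed
      over them.\<close>
    have z: "(\<integral>\<^sup>+\<omega>. indicator {\<omega> \<in> space M. E n \<omega> = j \<and> E (Suc n) \<omega> = k} \<omega> * indicator {..<0} (\<tau> n \<omega>) \<partial>M) = 0" for j k
    proof -
      have "(\<integral>\<^sup>+y. indicator {..<0} y * emeasure (interval_measure (U k)) UNIV \<partial>interval_measure (T j k)) = (\<integral>\<^sup>+y. 0 \<partial>interval_measure (T j k))"
        by (rule nn_integral_cong_AE) (use AE_df_nonneg[OF T_df] in \<open>eventually_elim, auto\<close>)
      then have "(\<integral>\<^sup>+s. \<integral>\<^sup>+z. \<integral>\<^sup>+y. \<integral>\<^sup>+r. indicator {..<0} y \<partial>interval_measure (U k)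
        \<partial>interval_measure (T j k) \<partial>queue_law n j \<partial>start_law n j) = 0" by simp
      then show ?thesis
        using joint_integral[of "\<lambda>p. indicator {..<0} (snd (fst p))" n j k] by simp
    qed
    have "(\<integral>\<^sup>+\<omega>. indicator {..<0} (\<tau> n \<omega>) \<partial>M) = (\<integral>\<^sup>+\<omega>. (\<Sum>j\<in>UNIV. \<Sum>k\<in>UNIV. indicator {\<omega> \<in> space M. E n \<omega> = j \<and> E (Suc n) \<omega> = k} \<omega> * indicator {..<0} (\<tau> n \<omega>)) \<partial>M)"
      by (rule nn_integral_cong) (simp only: sum_indicator_E)
    also have "\<dots> = 0" by (subst nn_integral_sum, simp, subst nn_integral_sum) (simp_all add: z)
    finally have "AE \<omega> in M. indicator {..<0} (\<tau> n \<omega>) = (0::ennreal)" by (subst (asm) nn_integral_0_iff_AE) auto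
    then show ?thesis by eventually_elim (auto simp: indicator_def split: if_splits)
  qed
  ultimately show ?thesis by (simp add: AE_all_countable)
qed

text \<open>The observable of the model with catastrophes for an arbitrary functional
  \<open>g\<close> of the queue; one computation then serves transforms and generating functions
  alike.\<close>

definition observed :: "(('r, 'd) queue_path \<Rightarrow> real \<Rightarrow> real) \<Rightarrow> real \<Rightarrow> 'w \<Rightarrow> real" where
  "observed g t \<omega> = (if \<exists>\<nu>. operating E \<tau> R t \<omega> \<nu>
      then let \<nu> = (LEAST \<nu>. operating E \<tau> R t \<omega> \<nu>) in g (Z (\<nu>, E \<nu> \<omega>) \<omega>) (t - S \<nu> \<omega>)
      else 0)"

text \<open>With nonnegative sojourns and repairs the half-open operating periods are disjoint. The
  least index in \<open>observed\<close> is then the only one, and the observable becomes a sum over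
  all periods.\<close>

lemma operating_unique:
  assumes nn: "\<forall>n. 0 \<le> \<tau> n \<omega> \<and> (\<forall>j. 0 \<le> R (n, j) \<omega>)"
    and "operating E \<tau> R t \<omega> n" "operating E \<tau> R t \<omega> m"
  shows "n = m"
proof -
  have step: "S n \<omega> + \<tau> n \<omega> \<le> S m \<omega>" if "n < m" for n m
    using that
  proof (induction m)
    case (Suc m)
    have "S m \<omega> + \<tau> m \<omega> \<le> S (Suc m) \<omega>" "0 \<le> \<tau> m \<omega>" using nn by auto
    then show ?case using Suc by (cases "n = m") auto
  qed simp
  show ?thesis
    using assms(2,3) step[of n m] step[of m n] unfolding operating_def by (cases n m rule: linorder_cases) auto
qed

lemma operating_measurable[measurable]: "Measurable.pred M (\<lambda>\<omega>. operating E \<tau> R t \<omega> n)"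
  unfolding operating_def by measurable

lemma observed_eq_suminf:
  assumes nn: "\<forall>n. 0 \<le> \<tau> n \<omega> \<and> (\<forall>j. 0 \<le> R (n, j) \<omega>)"
  shows "ennreal (observed g t \<omega>) = (\<Sum>n. if operating E \<tau> R t \<omega> n then ennreal (g (Z (n, E n \<omega>) \<omega>) (t - S n \<omega>)) else 0)"
proof (cases "\<exists>\<nu>. operating E \<tau> R t \<omega> \<nu>")
  case True
  then obtain \<nu> where \<nu>: "operating E \<tau> R t \<omega> \<nu>" by blast
  have uniq: "operating E \<tau> R t \<omega> n \<longleftrightarrow> n = \<nu>" for n using operating_unique[OF nn _ \<nu>] \<nu> by blast
  have least: "(LEAST \<nu>. operating E \<tau> R t \<omega> \<nu>) = \<nu>" unfolding uniq by (rule Least_equality) auto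
  have "(\<Sum>n. if operating E \<tau> R t \<omega> n then ennreal (g (Z (n, E n \<omega>) \<omega>) (t - S n \<omega>)) else 0)
    = (\<Sum>n\<in>{\<nu>}. if operating E \<tau> R t \<omega> n then ennreal (g (Z (n, E n \<omega>) \<omega>) (t - S n \<omega>)) else 0)"
    by (rule suminf_finite) (auto simp: uniq)
  then show ?thesis using True \<nu> by (simp add: observed_def least)
qed (simp add: observed_def)

text \<open>Given the start \<open>s\<close> of period \<open>n\<close>, the period is in operation
  at \<open>t\<close> iff its sojourn exceeds \<open>t - s \<ge> 0\<close>, and the queue is
  independent of this. The contribution of period \<open>n\<close> is therefore the
  \<open>n\<close>-th iterate of \<open>K\<close>. The law of the copies must not depend on
  \<open>n\<close> for the sum to be \<open>V\<close> of a single function.\<close>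

lemma expectation_observed:
  assumes g[measurable]: "(\<lambda>p. g (fst p) (snd p)) \<in> borel_measurable (queue_space \<Otimes>\<^sub>M borel)"
    and law: "\<And>n j. queue_law n j = \<Lambda> j"
  shows "(\<integral>\<^sup>+\<omega>. ennreal (observed g t \<omega>) \<partial>M) =
    V (\<lambda>j u. indicator {0..} u * (\<Sum>k\<in>UNIV. emeasure (interval_measure (T j k)) {u<..}) * (\<integral>\<^sup>+z. ennreal (g z u) \<partial>\<Lambda> j)) i0 t"
proof -
  define h where "h j u = indicator {0..} u * (\<Sum>k\<in>UNIV. emeasure (interval_measure (T j k)) {u<..}) * (\<integral>\<^sup>+z. ennreal (g z u) \<partial>\<Lambda> j)" for j u
  have ps: "prob_space (\<Lambda> j)" and sL[measurable_cong]: "sets (\<Lambda> j) = sets queue_space" for j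
    using prob_space_queue_law[of 0 j] sets_queue_law[of 0 j] law by simp_all
  have h_T: "(\<Sum>k\<in>UNIV. \<integral>\<^sup>+y. indicator {0..} u * indicator {u<..} y * c \<partial>interval_measure (T j k))
     = indicator {0..} u * (\<Sum>k\<in>UNIV. emeasure (interval_measure (T j k)) {u<..}) * c" for j u and c :: ennreal
  proof -
    have "(\<integral>\<^sup>+y. indicator {0..} u * indicator {u<..} y * c \<partial>interval_measure (T j k))
       = (\<integral>\<^sup>+y. (indicator {0..} u * c) * indicator {u<..} y \<partial>interval_measure (T j k))" for k
      by (rule nn_integral_cong) (simp add: mult_ac)
    also have "\<dots> k = (indicator {0..} u * c) * emeasure (interval_measure (T j k)) {u<..}" for k
      by (rule nn_integral_cmult_indicator) simp
    finally show ?thesis by (simp add: sum_distrib_left[symmetric] mult_ac)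
  qed
  have gm: "(\<lambda>u. \<integral>\<^sup>+z. ennreal (g z u) \<partial>\<Lambda> j) \<in> borel_measurable borel" for j
  proof -
    interpret Lam: prob_space "\<Lambda> j" by (rule ps)
    have "(\<lambda>p. (snd p, fst p)) \<in> measurable (borel \<Otimes>\<^sub>M \<Lambda> j) (queue_space \<Otimes>\<^sub>M borel)" by measurable
    from measurable_compose[OF this g]
    have "(\<lambda>p. g (snd p) (fst p)) \<in> borel_measurable (borel \<Otimes>\<^sub>M \<Lambda> j)" by simp
    note [measurable] = this
    show ?thesis by measurable
  qed
  have hb: "bfun h"
  proof -
    have "(\<lambda>u. emeasure (interval_measure (T j k)) {u<..}) \<in> borel_measurable borel" for j k
    proof -
      interpret Tjk: finite_measure "interval_measure (T j k)" by (rule finite_measure_df[OF T_df])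
      have "(\<integral>\<^sup>+y. indicator {0<..} (y - u) \<partial>interval_measure (T j k)) = (\<integral>\<^sup>+y. indicator {u<..} y \<partial>interval_measure (T j k))" for u
        by (intro nn_integral_cong) (auto simp: indicator_def)
      then have "emeasure (interval_measure (T j k)) {u<..} = (\<integral>\<^sup>+y. indicator {0<..} (y - u) \<partial>interval_measure (T j k))" for u
        by simp
      then show ?thesis by simp
    qed
    then show ?thesis unfolding bfun_def h_def[abs_def]
      by (intro allI borel_measurable_times_ennreal borel_measurable_sum gm) auto
  qed
  have term_n: "(\<integral>\<^sup>+\<omega>. (if operating E \<tau> R t \<omega> n then ennreal (g (Z (n, E n \<omega>) \<omega>) (t - S n \<omega>)) else 0) \<partial>M) = (K ^^ n) h i0 t" for n
  proof -
    let ?f = "\<lambda>j p. indicator {0..} (t - fst (fst (fst p))) * indicator {t - fst (fst (fst p))<..} (snd (fst p)) * ennreal (g (snd (fst (fst p))) (t - fst (fst (fst p))))"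
    have fm[measurable]: "(\<lambda>p. indicator {0..} (t - fst (fst (fst p))) * indicator {0<..} (snd (fst p) - (t - fst (fst (fst p)))) * ennreal (g (snd (fst (fst p))) (t - fst (fst (fst p))))) \<in> borel_measurable joint_space"
    proof -
      have [measurable]: "(\<lambda>p. g (snd (fst (fst p))) (t - fst (fst (fst p)))) \<in> borel_measurable joint_space"
        using measurable_compose[OF _ g, of "\<lambda>p. (snd (fst (fst p)), t - fst (fst (fst p)))" joint_space] by simp
      show ?thesis by measurable
    qed
    have ind: "(indicator {0<..} (y - u) :: ennreal) = indicator {u<..} y" for y u :: real by (auto simp: indicator_def)
    have one: "(\<integral>\<^sup>+\<omega>. indicator {\<omega> \<in> space M. E n \<omega> = j \<and> E (Suc n) \<omega> = k} \<omega> *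
        (if operating E \<tau> R t \<omega> n then ennreal (g (Z (n, j) \<omega>) (t - S n \<omega>)) else 0) \<partial>M)
      = (\<integral>\<^sup>+s. \<integral>\<^sup>+z. \<integral>\<^sup>+y. indicator {0..} (t - s) * indicator {t - s<..} y * ennreal (g z (t - s)) \<partial>interval_measure (T j k) \<partial>\<Lambda> j \<partial>start_law n j)" for j k
    proof -
      have U1: "emeasure (interval_measure (U k)) UNIV = 1"
      proof -
        interpret Uk: finite_measure "interval_measure (U k)" by (rule finite_measure_df[OF U_df])
        show ?thesis using U_UNIV[of k] by (simp add: Uk.emeasure_eq_measure)
      qed
      have "(\<integral>\<^sup>+\<omega>. indicator {\<omega> \<in> space M. E n \<omega> = j \<and> E (Suc n) \<omega> = k} \<omega> *
          (if operating E \<tau> R t \<omega> n then ennreal (g (Z (n, j) \<omega>) (t - S n \<omega>)) else 0) \<partial>M)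
        = (\<integral>\<^sup>+\<omega>. indicator {\<omega> \<in> space M. E n \<omega> = j \<and> E (Suc n) \<omega> = k} \<omega> *
          (indicator {0..} (t - S n \<omega>) * indicator {0<..} (\<tau> n \<omega> - (t - S n \<omega>)) * ennreal (g (Z (n, j) \<omega>) (t - S n \<omega>))) \<partial>M)"
        by (rule nn_integral_cong) (auto simp: indicator_def operating_def)
      also have "\<dots> = (\<integral>\<^sup>+s. \<integral>\<^sup>+z. \<integral>\<^sup>+y. indicator {0..} (t - s) * indicator {t - s<..} y * ennreal (g z (t - s)) \<partial>interval_measure (T j k) \<partial>\<Lambda> j \<partial>start_law n j)"
        using joint_integral[OF fm, of n j k] by (simp add: U1 law ind)
      finally show ?thesis .
    qed
    have "(\<integral>\<^sup>+\<omega>. (if operating E \<tau> R t \<omega> n then ennreal (g (Z (n, E n \<omega>) \<omega>) (t - S n \<omega>)) else 0) \<partial>M)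
      = (\<integral>\<^sup>+\<omega>. (\<Sum>j\<in>UNIV. \<Sum>k\<in>UNIV. indicator {\<omega> \<in> space M. E n \<omega> = j \<and> E (Suc n) \<omega> = k} \<omega> *
          (if operating E \<tau> R t \<omega> n then ennreal (g (Z (n, j) \<omega>) (t - S n \<omega>)) else 0)) \<partial>M)"
      by (rule nn_integral_cong) (simp only: sum_indicator_E)
    also have "\<dots> = (\<Sum>j\<in>UNIV. \<Sum>k\<in>UNIV. \<integral>\<^sup>+\<omega>. indicator {\<omega> \<in> space M. E n \<omega> = j \<and> E (Suc n) \<omega> = k} \<omega> *
          (if operating E \<tau> R t \<omega> n then ennreal (g (Z (n, j) \<omega>) (t - S n \<omega>)) else 0) \<partial>M)"
    proof -
      have [measurable]: "(\<lambda>\<omega>. g (Z (n, j) \<omega>) (t - S n \<omega>)) \<in> borel_measurable M" for j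
        using measurable_compose[OF _ g, of "\<lambda>\<omega>. (Z (n, j) \<omega>, t - S n \<omega>)" M] by simp
      show ?thesis by (subst nn_integral_sum, measurable, subst nn_integral_sum) measurable
    qed
    also have "\<dots> = (\<Sum>j\<in>UNIV. \<integral>\<^sup>+s. h j (t - s) \<partial>start_law n j)"
    proof (rule sum.cong[OF refl])
      fix j
      interpret L: finite_measure "start_law n j" by (rule finite_start_law)
      interpret P: prob_space "\<Lambda> j" by (rule ps)
      interpret T: finite_measure "interval_measure (T j k)" for k by (rule finite_measure_df[OF T_df])
      let ?t = "\<lambda>k s z. \<integral>\<^sup>+y. indicator {0..} (t - s) * indicator {t - s<..} y * ennreal (g z (t - s)) \<partial>interval_measure (T j k)"
      have gm'[measurable]: "(\<lambda>p. g (snd p) (t - fst p)) \<in> borel_measurable (start_law n j \<Otimes>\<^sub>M \<Lambda> j)"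
      proof -
        have "(\<lambda>p. (snd p, t - fst p)) \<in> measurable (start_law n j \<Otimes>\<^sub>M \<Lambda> j) (queue_space \<Otimes>\<^sub>M borel)" by measurable
        from measurable_compose[OF this g] show ?thesis by simp
      qed
      have tm: "(\<lambda>p. ?t k (fst p) (snd p)) \<in> borel_measurable (start_law n j \<Otimes>\<^sub>M \<Lambda> j)" for k
      proof -
        have "?t k s z = indicator {0..} (t - s) * emeasure (interval_measure (T j k)) {t - s<..} * ennreal (g z (t - s))" for s z
        proof -
          have "?t k s z = (\<integral>\<^sup>+y. (indicator {0..} (t - s) * ennreal (g z (t - s))) * indicator {t - s<..} y \<partial>interval_measure (T j k))"
            by (rule nn_integral_cong) (simp add: mult_ac)
          also have "\<dots> = (indicator {0..} (t - s) * ennreal (g z (t - s))) * emeasure (interval_measure (T j k)) {t - s<..}"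
            by (rule nn_integral_cmult_indicator) simp
          finally show ?thesis by (simp add: mult_ac)
        qed
        moreover have "(\<lambda>u. emeasure (interval_measure (T j k)) {u<..}) \<in> borel_measurable borel"
        proof -
          have "(\<integral>\<^sup>+y. indicator {0<..} (y - u) \<partial>interval_measure (T j k)) = (\<integral>\<^sup>+y. indicator {u<..} y \<partial>interval_measure (T j k))" for u
            by (intro nn_integral_cong) (auto simp: indicator_def)
          then have "emeasure (interval_measure (T j k)) {u<..} = (\<integral>\<^sup>+y. indicator {0<..} (y - u) \<partial>interval_measure (T j k))" for u
            by simp
          then show ?thesis by simp
        qed
        note this[measurable]
        ultimately show ?thesis by simp
      qed
      have tm1: "(\<lambda>z. ?t k s z) \<in> borel_measurable (\<Lambda> j)" if "s \<in> space (start_law n j)" for k s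
        using measurable_compose[OF measurable_Pair1'[OF that] tm] by simp
      have tm2: "(\<lambda>s. \<integral>\<^sup>+z. ?t k s z \<partial>\<Lambda> j) \<in> borel_measurable (start_law n j)" for k
        using P.borel_measurable_nn_integral_fst[OF tm] by simp
      have "(\<Sum>k\<in>UNIV. \<integral>\<^sup>+s. \<integral>\<^sup>+z. ?t k s z \<partial>\<Lambda> j \<partial>start_law n j) = (\<integral>\<^sup>+s. (\<Sum>k\<in>UNIV. \<integral>\<^sup>+z. ?t k s z \<partial>\<Lambda> j) \<partial>start_law n j)"
        by (rule nn_integral_sum[symmetric]) (rule tm2)
      also have "\<dots> = (\<integral>\<^sup>+s. \<integral>\<^sup>+z. (\<Sum>k\<in>UNIV. ?t k s z) \<partial>\<Lambda> j \<partial>start_law n j)"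
        by (rule nn_integral_cong, rule nn_integral_sum[symmetric], rule tm1)
      also have "\<dots> = (\<integral>\<^sup>+s. h j (t - s) \<partial>start_law n j)"
      proof (rule nn_integral_cong)
        fix s assume s: "s \<in> space (start_law n j)"
        have [measurable]: "(\<lambda>z. g z (t - s)) \<in> borel_measurable (\<Lambda> j)"
          using measurable_compose[OF measurable_Pair1'[OF s] gm'] by simp
        show "(\<integral>\<^sup>+z. (\<Sum>k\<in>UNIV. ?t k s z) \<partial>\<Lambda> j) = h j (t - s)"
          unfolding h_T h_def by (rule nn_integral_cmult) measurable
      qed
      finally show "(\<Sum>k\<in>UNIV. \<integral>\<^sup>+\<omega>. indicator {\<omega> \<in> space M. E n \<omega> = j \<and> E (Suc n) \<omega> = k} \<omega> *
          (if operating E \<tau> R t \<omega> n then ennreal (g (Z (n, j) \<omega>) (t - S n \<omega>)) else 0) \<partial>M) = (\<integral>\<^sup>+s. h j (t - s) \<partial>start_law n j)"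
        unfolding one .
    qed
    also have "\<dots> = (K ^^ n) h i0 t" by (rule nn_integral_start[OF hb])
    finally show ?thesis .
  qed
  have tmeas: "(\<lambda>\<omega>. if operating E \<tau> R t \<omega> n then ennreal (g (Z (n, E n \<omega>) \<omega>) (t - S n \<omega>)) else 0) \<in> borel_measurable M" for n
  proof -
    have "(\<lambda>\<omega>. g (Z (n, j) \<omega>) (t - S n \<omega>)) \<in> borel_measurable M" for j
      using measurable_compose[OF _ g, of "\<lambda>\<omega>. (Z (n, j) \<omega>, t - S n \<omega>)" M] by simp
    then have [measurable]: "(\<lambda>\<omega>. g (Z (n, E n \<omega>) \<omega>) (t - S n \<omega>)) \<in> borel_measurable M"
      by (intro measurable_compose_countable[where f = "\<lambda>j \<omega>. g (Z (n, j) \<omega>) (t - S n \<omega>)" and g = "E n"]) auto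
    show ?thesis by measurable
  qed
  have "(\<integral>\<^sup>+\<omega>. ennreal (observed g t \<omega>) \<partial>M) = (\<integral>\<^sup>+\<omega>. (\<Sum>n. if operating E \<tau> R t \<omega> n then ennreal (g (Z (n, E n \<omega>) \<omega>) (t - S n \<omega>)) else 0) \<partial>M)"
  proof (rule nn_integral_cong_AE)
    show "AE \<omega> in M. ennreal (observed g t \<omega>) = (\<Sum>n. if operating E \<tau> R t \<omega> n then ennreal (g (Z (n, E n \<omega>) \<omega>) (t - S n \<omega>)) else 0)"
      using AE_tau_R_nonneg by eventually_elim (rule observed_eq_suminf)
  qed
  also have "\<dots> = (\<Sum>n. (K ^^ n) h i0 t)"
    by (subst nn_integral_suminf[OF tmeas]) (simp add: term_n)
  finally show ?thesis unfolding V_def h_def .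
qed

end

section \<open>Observables of the queue\<close>

lemma space_map_space[simp]: "space map_space = UNIV"
  by (simp add: map_space_def space_PiM space_pair_measure)

lemma space_mark_space[simp]: "space mark_space = UNIV"
  by (simp add: mark_space_def space_pair_measure)

lemma space_queue_space[simp]: "space queue_space = UNIV"
  by (simp add: queue_space_def maps_space_def marks_space_def space_PiM space_pair_measure)

lemma map_coordinate: "(\<lambda>\<xi>. \<xi> n) \<in> measurable map_space (count_space UNIV \<Otimes>\<^sub>M borel \<Otimes>\<^sub>M count_space UNIV)"
  unfolding map_space_def by measurable

lemma map_measurable[measurable]:
  "(\<lambda>\<xi>. fst (\<xi> n)) \<in> measurable map_space (count_space UNIV)"
  "(\<lambda>\<xi>. holding \<xi> n) \<in> borel_measurable map_space"
  "(\<lambda>\<xi>. arrival_at \<xi> n) \<in> measurable map_space (count_space UNIV)"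
  using map_coordinate[of n, measurable] unfolding holding_def arrival_at_def by measurable

lemma epoch_measurable[measurable]: "(\<lambda>\<xi>. epoch \<xi> n) \<in> borel_measurable map_space"
  unfolding epoch_def by measurable

context
  fixes N :: "'x measure" and Z :: "'x \<Rightarrow> ('r::finite, 'd::finite) queue_path" and t :: "'x \<Rightarrow> real"
  assumes Z: "Z \<in> measurable N queue_space" and t[measurable]: "t \<in> borel_measurable N"
begin

lemma path_measurable: "(\<lambda>x. fst (Z x) r) \<in> measurable N map_space"
  using Z unfolding queue_space_def maps_space_def by measurable

lemma mark_measurable: "(\<lambda>x. snd (Z x) c) \<in> measurable N (borel \<Otimes>\<^sub>M borel \<Otimes>\<^sub>M borel)"
  using Z unfolding queue_space_def marks_space_def mark_space_def by measurable

lemma path_components[measurable]: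
  "(\<lambda>x. fst (fst (Z x) r n)) \<in> measurable N (count_space UNIV)"
  "(\<lambda>x. arrival_at (fst (Z x) r) n) \<in> measurable N (count_space UNIV)"
  "(\<lambda>x. epoch (fst (Z x) r) n) \<in> borel_measurable N"
  "(\<lambda>x. holding (fst (Z x) r) n) \<in> borel_measurable N"
  using path_measurable[of r, measurable] by measurable

lemma mark_components[measurable]:
  "(\<lambda>x. fst (snd (Z x) c)) \<in> borel_measurable N"
  "(\<lambda>x. fst (snd (snd (Z x) c))) \<in> borel_measurable N"
  "(\<lambda>x. snd (snd (snd (Z x) c))) \<in> borel_measurable N"
  using mark_measurable[of c, measurable] by measurable

lemma departure_measurable[measurable]:
  "(\<lambda>x. arrival_time (Z x) r n) \<in> borel_measurable N"
  "(\<lambda>x. departure_time (Z x) r n) \<in> borel_measurable N"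
  unfolding departure_time_def arrival_time_def by measurable

lemma customer_sets_measurable[measurable]:
  "Measurable.pred N (\<lambda>x. n \<in> in_service (Z x) (t x) r)"
  "Measurable.pred N (\<lambda>x. n \<in> served (Z x) (t x) r)"
  unfolding in_service_def served_def mem_Collect_eq by measurable

lemma counts_measurable[measurable]:
  "(\<lambda>x. in_service_count (Z x) (t x) r) \<in> measurable N (count_space UNIV)"
  "(\<lambda>x. served_count (Z x) (t x) r) \<in> measurable N (count_space UNIV)"
  unfolding in_service_count_def served_count_def
  by (rule measurable_card, use customer_sets_measurable in simp)+

lemma count_vectors_measurable[measurable]:
  "(\<lambda>x. in_service_count (Z x) (t x)) \<in> measurable N (count_space UNIV)"
  "(\<lambda>x. served_count (Z x) (t x)) \<in> measurable N (count_space UNIV)"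
proof -
  have *: "f \<in> measurable N (count_space UNIV)"
    if [measurable]: "\<And>r. (\<lambda>x. f x r) \<in> measurable N (count_space UNIV)" for f :: "'x \<Rightarrow> 'r \<Rightarrow> nat"
  proof -
    have "{x \<in> space N. \<forall>r. f x r = n r} \<in> sets N" for n by measurable
    then have "f -` {n} \<inter> space N \<in> sets N" for n
      by (simp add: vimage_def Int_def fun_eq_iff conj_commute)
    then show ?thesis by (simp add: measurable_count_space_eq2_countable)
  qed
  show "(\<lambda>x. in_service_count (Z x) (t x)) \<in> measurable N (count_space UNIV)"
    "(\<lambda>x. served_count (Z x) (t x)) \<in> measurable N (count_space UNIV)"
    by (rule *; measurable)+
qed

text \<open>A sum over an infinite set is 0 by convention, so finiteness of \<open>A x\<close> has
  to be tested by countably many conditions before the sum may be replaced by a series.\<close>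

lemma sum_random_set_measurable:
  fixes f :: "nat \<Rightarrow> 'x \<Rightarrow> real ^ 'd"
  assumes [measurable]: "\<And>n. Measurable.pred N (\<lambda>x. n \<in> A x)" "\<And>n. f n \<in> borel_measurable N"
  shows "(\<lambda>x. \<Sum>n\<in>A x. f n x) \<in> borel_measurable N"
proof -
  have "(\<Sum>n\<in>A x. f n x) = (if (\<exists>N. \<forall>n. N \<le> n \<longrightarrow> n \<notin> A x) then (\<Sum>n. if n \<in> A x then f n x else 0) else 0)" for x
  proof (cases "finite (A x)")
    case True
    then have "\<exists>N. \<forall>n. N \<le> n \<longrightarrow> n \<notin> A x"
      by (metis finite_nat_set_iff_bounded not_less)
    moreover have "(\<Sum>n. if n \<in> A x then f n x else 0) = (\<Sum>n\<in>A x. f n x)"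
      using True by (subst suminf_finite[of "A x"]) auto
    ultimately show ?thesis by simp
  next
    case False
    then have "\<not> (\<exists>N. \<forall>n. N \<le> n \<longrightarrow> n \<notin> A x)"
      by (metis finite_nat_set_iff_bounded not_le)
    then show ?thesis by (simp only: if_False sum.infinite[OF False])
  qed
  then show ?thesis by simp
qed

lemma resources_measurable[measurable]:
  "(\<lambda>x. resources_in_service (Z x) (t x)) \<in> borel_measurable N"
  "(\<lambda>x. resources_served (Z x) (t x)) \<in> borel_measurable N"
  unfolding resources_in_service_def resources_served_def
  by (intro borel_measurable_sum sum_random_set_measurable; measurable)+

lemma phase_measurable[measurable]: "(\<lambda>x. queue_phase (Z x) (t x)) \<in> measurable N (count_space UNIV)"
proof -
  have [measurable]: "(\<lambda>x. queue_phase (Z x) (t x) r) \<in> measurable N (count_space UNIV)" for r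
    unfolding queue_phase_def map_phase_def
    by (rule measurable_compose_countable[where f = "\<lambda>n x. fst (fst (Z x) r n)"]) measurable
  have "{x \<in> space N. \<forall>r. queue_phase (Z x) (t x) r = l r} \<in> sets N" for l by measurable
  then have "(\<lambda>x. queue_phase (Z x) (t x)) -` {l} \<inter> space N \<in> sets N" for l
    by (simp add: vimage_def Int_def fun_eq_iff conj_commute)
  then show ?thesis by (simp add: measurable_count_space_eq2_countable)
qed

end

section \<open>Weighted observables and regular paths\<close>

definition weighted_observable ::
  "(('r::finite \<Rightarrow> nat) \<Rightarrow> ('r \<Rightarrow> nat) \<Rightarrow> real) \<Rightarrow> real ^ 'd::finite \<Rightarrow> real ^ 'd \<Rightarrow> ('r \<Rightarrow> nat)
     \<Rightarrow> ('r, 'd) queue_path \<Rightarrow> real \<Rightarrow> real" where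
  "weighted_observable c s1 s2 l z t =
     (if queue_phase z t = l
      then c (in_service_count z t) (served_count z t) *
        exp (- (s1 \<bullet> resources_in_service z t) - s2 \<bullet> resources_served z t) else 0)"

lemma queue_observable_eq_weighted:
  "queue_observable n m s1 s2 l = weighted_observable (\<lambda>n' m'. if n' = n \<and> m' = m then 1 else 0) s1 s2 l"
  by (intro ext) (auto simp: queue_observable_def weighted_observable_def)

lemma weighted_observable_measurable:
  "(\<lambda>p. weighted_observable c s1 s2 l (fst p) (snd p)) \<in> borel_measurable (queue_space \<Otimes>\<^sub>M borel)"
proof -
  let ?N = "queue_space \<Otimes>\<^sub>M borel :: (('a, 'b) queue_path \<times> real) measure"
  have Z: "fst \<in> measurable ?N queue_space" and t: "snd \<in> borel_measurable ?N" by measurable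
  note [measurable] = count_vectors_measurable[OF Z t] resources_measurable[OF Z t] phase_measurable[OF Z t]
  have "(\<lambda>p. c (in_service_count (fst p) (snd p)) (served_count (fst p) (snd p))) \<in> borel_measurable ?N"
  proof -
    have "(\<lambda>p. c n (served_count (fst p) (snd p))) \<in> borel_measurable ?N" for n
      by (rule measurable_compose[OF count_vectors_measurable(2)[OF Z t]]) simp
    from measurable_compose_countable[OF this count_vectors_measurable(1)[OF Z t]] show ?thesis .
  qed
  note [measurable] = this
  show ?thesis unfolding weighted_observable_def by measurable
qed

text \<open>Divergence of the epochs leaves finitely many arrivals in bounded time, and nonnegative
  marks keep the exponents of the transform nonpositive and departures after arrivals.\<close>

definition regular_path :: "('r::finite, 'd::finite) queue_path \<Rightarrow> bool" where
  "regular_path z \<longleftrightarrow> (\<forall>r. filterlim (epoch (fst z r)) at_top sequentially) \<and>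
     (\<forall>c. 0 \<le> fst (snd z c) \<and> (\<forall>a. 0 \<le> fst (snd (snd z c)) $ a) \<and> (\<forall>a. 0 \<le> snd (snd (snd z c)) $ a))"

lemma weighted_observable_le_1:
  assumes z: "regular_path z" and c: "\<And>n m. 0 \<le> c n m" "\<And>n m. c n m \<le> 1"
    and s: "\<And>a. 0 \<le> s1 $ a" "\<And>a. 0 \<le> s2 $ a"
  shows "weighted_observable c s1 s2 l z t \<le> 1"
proof -
  have "0 \<le> resources_in_service z t $ a" "0 \<le> resources_served z t $ a" for a
    using z unfolding regular_path_def resources_in_service_def resources_served_def
    by (simp_all add: sum_component sum_nonneg)
  then have "0 \<le> s1 \<bullet> resources_in_service z t" "0 \<le> s2 \<bullet> resources_served z t"
    unfolding inner_vec_def using s by (auto intro!: sum_nonneg)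
  then have "exp (- (s1 \<bullet> resources_in_service z t) - s2 \<bullet> resources_served z t) \<le> 1" by simp
  then show ?thesis unfolding weighted_observable_def using c
    by (auto intro: mult_le_one)
qed

text \<open>Only finitely many epochs and departures precede \<open>u + 1\<close>, so the distance
  from \<open>u\<close> to all of them has a positive minimum, within which no comparison with an
  event time changes.\<close>

lemma weighted_observable_locally_constant:
  assumes z: "regular_path z" and u: "\<And>r n. epoch (fst z r) n \<noteq> u" "\<And>r n. departure_time z r n \<noteq> u"
  shows "\<exists>d>0. \<forall>t. \<bar>t - u\<bar> < d \<longrightarrow> weighted_observable c s1 s2 l z t = weighted_observable c s1 s2 l z u"
proof -
  have "\<exists>N. \<forall>n\<ge>N. u + 1 \<le> epoch (fst z r) n" for r
    using z unfolding regular_path_def filterlim_at_top eventually_sequentially by blast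
  then obtain N where N: "\<And>r n. N r \<le> n \<Longrightarrow> u + 1 \<le> epoch (fst z r) n" by metis
  \<comment> \<open>Customer \<open>n\<close> arrives at epoch \<open>Suc n\<close>, which is also
    beyond \<open>u + 1\<close>, and departs no earlier.\<close>
  have N': "u + 1 \<le> departure_time z r n" if "N r \<le> n" for r n
    using N[of r "Suc n"] that z unfolding departure_time_def arrival_time_def regular_path_def by (simp add: add_increasing2)
  define X where "X = (\<Union>r. (\<lambda>n. \<bar>epoch (fst z r) n - u\<bar>) ` {..<N r} \<union> (\<lambda>n. \<bar>departure_time z r n - u\<bar>) ` {..<N r})"
  have X: "finite X" "\<And>x. x \<in> X \<Longrightarrow> 0 < x" unfolding X_def using u by auto
  define d where "d = Min (insert 1 X)"
  have d: "0 < d" "d \<le> 1" "\<And>x. x \<in> X \<Longrightarrow> d \<le> x" unfolding d_def using X by auto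
  have e: "d \<le> \<bar>epoch (fst z r) n - u\<bar>" for r n
  proof (cases "n < N r")
    case True
    then show ?thesis by (intro d(3)) (auto simp: X_def)
  qed (use N[of r n] d(2) in auto)
  have p: "d \<le> \<bar>departure_time z r n - u\<bar>" for r n
  proof (cases "n < N r")
    case True
    then show ?thesis by (intro d(3)) (auto simp: X_def)
  qed (use N'[of r n] d(2) in auto)
  have "weighted_observable c s1 s2 l z t = weighted_observable c s1 s2 l z u" if t: "\<bar>t - u\<bar> < d" for t
  proof -
    have o1: "t < epoch (fst z r) n \<longleftrightarrow> u < epoch (fst z r) n" for r n using e[of r n] t by linarith
    have o2: "epoch (fst z r) n \<le> t \<longleftrightarrow> epoch (fst z r) n \<le> u" for r n using e[of r n] t by linarith
    have o3: "t \<le> departure_time z r n \<longleftrightarrow> u \<le> departure_time z r n" for r n using p[of r n] t by linarith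
    have o4: "departure_time z r n < t \<longleftrightarrow> departure_time z r n < u" for r n using p[of r n] t by linarith
    have 1: "in_service z t = in_service z u"
      by (intro ext) (simp add: in_service_def arrival_time_def o2 o3)
    have 2: "served z t = served z u" by (intro ext) (simp add: served_def o4)
    have 3: "queue_phase z t = queue_phase z u" by (intro ext) (simp add: queue_phase_def map_phase_def o1)
    have "in_service_count z t = in_service_count z u" "served_count z t = served_count z u"
      "resources_in_service z t = resources_in_service z u" "resources_served z t = resources_served z u"
      using 1 2 by (auto simp: in_service_count_def[abs_def] served_count_def[abs_def] resources_in_service_def resources_served_def)
    then show ?thesis using 3 by (simp add: weighted_observable_def)
  qed
  then show ?thesis using d(1) by blast
qed

lemma countable_UNIV_finite_times_nat: "countable (UNIV :: ('x::finite \<times> nat) set)"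
proof -
  have "countable ((UNIV :: 'x set) \<times> (UNIV :: nat set))"
    by (rule countable_SIGMA; simp add: countable_finite)
  then show ?thesis by (simp only: UNIV_Times_UNIV)
qed

text \<open>By Fubini, almost every fixed time is almost surely not a jump time; no information on the
  distribution of the jump times is needed.\<close>
lemma AE_isCont_expectation:
  fixes \<Lambda> :: "('r::finite, 'd::finite) queue_path measure"
  assumes "prob_space \<Lambda>" and s: "sets \<Lambda> = sets queue_space" and reg: "AE z in \<Lambda>. regular_path z"
    and c: "\<And>n m. 0 \<le> c n m" "\<And>n m. c n m \<le> 1"
    and s12: "\<And>a. 0 \<le> s1 $ a" "\<And>a. 0 \<le> s2 $ a"
  shows "AE u in lborel. isCont (\<lambda>u. \<integral>z. weighted_observable c s1 s2 l z u \<partial>\<Lambda>) u"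
proof -
  interpret prob_space \<Lambda> by fact
  interpret pair_sigma_finite \<Lambda> lborel ..
  note [measurable_cong] = s
  let ?J = "\<lambda>z u. \<forall>r n. epoch (fst z r) n \<noteq> u \<and> departure_time z r n \<noteq> u"
  have sp: "space \<Lambda> = UNIV" using sets_eq_imp_space_eq[OF s] by simp
  have Z: "fst \<in> measurable (\<Lambda> \<Otimes>\<^sub>M lborel) queue_space" by measurable
  note [measurable] = path_components(3)[OF Z] departure_measurable(2)[OF Z]
  have "AE z in \<Lambda>. AE u in lborel. ?J z u"
  proof (rule AE_I2)
    fix z :: "('r, 'd) queue_path"
    have "countable (range (\<lambda>(r, n). epoch (fst z r) n) \<union> range (\<lambda>(r, n). departure_time z r n))"
      by (intro countable_Un countable_image countable_UNIV_finite_times_nat)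
    then have "AE u in lborel. u \<notin> range (\<lambda>(r, n). epoch (fst z r) n) \<union> range (\<lambda>(r, n). departure_time z r n)"
      by (intro AE_not_in countable_imp_null_set_lborel)
    then show "AE u in lborel. ?J z u" by eventually_elim force
  qed
  then have "AE u in lborel. AE z in \<Lambda>. ?J z u"
  proof (subst AE_commute[symmetric])
    show "{x \<in> space (\<Lambda> \<Otimes>\<^sub>M lborel). ?J (fst x) (snd x)} \<in> sets (\<Lambda> \<Otimes>\<^sub>M lborel)" by measurable
  qed
  then show ?thesis
  proof eventually_elim
    case (elim u)
    have m: "(\<lambda>z. weighted_observable c s1 s2 l z t) \<in> borel_measurable \<Lambda>" for t
    proof -
      have "(\<lambda>z. (z, t)) \<in> measurable \<Lambda> (queue_space \<Otimes>\<^sub>M borel)" by measurable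
      from measurable_compose[OF this weighted_observable_measurable[of c s1 s2 l]] show ?thesis by simp
    qed
    show ?case unfolding continuous_at_sequentially comp_def
    proof (intro allI impI)
      fix x assume x: "x \<longlonglongrightarrow> u"
      show "(\<lambda>n. \<integral>z. weighted_observable c s1 s2 l z (x n) \<partial>\<Lambda>) \<longlonglongrightarrow> (\<integral>z. weighted_observable c s1 s2 l z u \<partial>\<Lambda>)"
      proof (rule integral_dominated_convergence[where w = "\<lambda>_. 1"])
        show "AE z in \<Lambda>. (\<lambda>n. weighted_observable c s1 s2 l z (x n)) \<longlonglongrightarrow> weighted_observable c s1 s2 l z u"
          using reg elim
        proof eventually_elim
          case (elim z)
          obtain d where d: "0 < d" "\<And>t. \<bar>t - u\<bar> < d \<Longrightarrow> weighted_observable c s1 s2 l z t = weighted_observable c s1 s2 l z u"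
            using weighted_observable_locally_constant[OF elim(1), of u c s1 s2 l] elim(2) by blast
          have "eventually (\<lambda>n. \<bar>x n - u\<bar> < d) sequentially"
            using x d(1) by (auto simp: tendsto_iff dist_real_def)
          then show ?case by (intro tendsto_eventually) (auto elim!: eventually_mono intro: d(2))
        qed
        show "AE z in \<Lambda>. norm (weighted_observable c s1 s2 l z (x n)) \<le> 1" for n
          using reg
        proof eventually_elim
          case (elim z)
          have "0 \<le> weighted_observable c s1 s2 l z (x n)" using c by (simp add: weighted_observable_def)
          then show ?case using weighted_observable_le_1[OF elim c s12] by simp
        qed
      qed (use m in auto)
    qed
  qed
qed

section \<open>Cylinder events of arrival paths\<close>

definition cylinder :: "nat \<Rightarrow> (nat \<Rightarrow> nat) \<Rightarrow> (nat \<Rightarrow> bool) \<Rightarrow> (nat \<Rightarrow> real) \<Rightarrow> map_path set" where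
  "cylinder N x e h = {\<xi>. (\<forall>l\<le>N. fst (\<xi> l) = x l) \<and> (\<forall>l<N. h l < holding \<xi> l \<and> arrival_at \<xi> l = e l)}"

lemma cylinder_sets[measurable]: "cylinder N x e h \<in> sets map_space"
proof -
  have "{\<xi> \<in> space map_space. (\<forall>l\<le>N. fst (\<xi> l) = x l) \<and> (\<forall>l<N. h l < holding \<xi> l \<and> arrival_at \<xi> l = e l)} \<in> sets map_space"
    by measurable
  then show ?thesis by (simp add: cylinder_def)
qed

definition cylinders :: "map_path set set" where
  "cylinders = insert {} {cylinder N x e h |N x e h. True}"

text \<open>When two cylinders meet, any common path supplies consistent phases and arrival flags up
  to the greater length, and the thresholds combine by maximum. Disjoint cylinders are the reason
  for including the empty set.\<close>

lemma cylinders_Int_stable: "Int_stable cylinders"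
proof (rule Int_stableI)
  fix A B assume "A \<in> cylinders" "B \<in> cylinders"
  show "A \<inter> B \<in> cylinders"
  proof (cases "A = {} \<or> B = {} \<or> A \<inter> B = {}")
    case False
    then obtain N x e h N' x' e' h' where A: "A = cylinder N x e h" and B: "B = cylinder N' x' e' h'"
      using \<open>A \<in> cylinders\<close> \<open>B \<in> cylinders\<close> unfolding cylinders_def by blast
    obtain \<xi> where \<xi>: "\<xi> \<in> A" "\<xi> \<in> B" using False by blast
    define x'' where "x'' l = fst (\<xi> l)" for l
    define e'' where "e'' l = arrival_at \<xi> l" for l
    define h'' where "h'' l = (if l < N then (if l < N' then max (h l) (h' l) else h l) else h' l)" for l
    have "A \<inter> B = cylinder (max N N') x'' e'' h''"
    proof (intro equalityI subsetI)
      fix \<zeta> assume "\<zeta> \<in> A \<inter> B"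
      then show "\<zeta> \<in> cylinder (max N N') x'' e'' h''"
        using \<xi> unfolding A B cylinder_def x''_def e''_def h''_def by (auto simp: le_max_iff_disj less_max_iff_disj)
    next
      fix \<zeta> assume \<zeta>: "\<zeta> \<in> cylinder (max N N') x'' e'' h''"
      then show "\<zeta> \<in> A \<inter> B"
        using \<xi> unfolding A B cylinder_def x''_def e''_def h''_def
        by (auto simp: le_max_iff_disj less_max_iff_disj split: if_splits)
    qed
    then show ?thesis unfolding cylinders_def by blast
  qed (auto simp: cylinders_def)
qed

section \<open>Uniqueness of the laws of the arrival processes and of the queue\<close>

text \<open>Finite paths are coded by lists, which makes the unions below countable.\<close>
lemma cylinder_cover:
  assumes "m \<le> N"
  shows "\<exists>xs es k. length xs = Suc N \<and> length es = N \<and> xs ! m = fst (\<xi> m) \<and> (\<forall>l<N. es ! l = arrival_at \<xi> l) \<and>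
    (\<forall>l<N. - real k < holding \<xi> l) \<and> \<xi> \<in> cylinder N ((!) xs) ((!) es) (\<lambda>_. - real k)"
proof -
  obtain k where "Max (insert 0 ((\<lambda>l. - holding \<xi> l) ` {..<N})) < real k" using reals_Archimedean2 by blast
  then have k: "\<forall>l<N. - real k < holding \<xi> l" by (auto simp: minus_less_iff)
  define xs where "xs = map (\<lambda>l. fst (\<xi> l)) [0..<Suc N]"
  define es where "es = map (arrival_at \<xi>) [0..<N]"
  have xs: "xs ! l = fst (\<xi> l)" if "l \<le> N" for l
    using that unfolding xs_def by (subst nth_map) (auto simp del: upt_Suc)
  have es: "es ! l = arrival_at \<xi> l" if "l < N" for l using that by (simp add: es_def)
  show ?thesis
    by (intro exI[of _ xs] exI[of _ es] exI[of _ k])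
       (use assms k xs es in \<open>auto simp: cylinder_def xs_def[symmetric] simp del: upt_Suc, auto simp: xs_def es_def\<close>)
qed

text \<open>A cylinder bounds every holding time from below, so a condition on one coordinate alone
  is a countable union over the other phases and flags and over thresholds \<open>- k\<close>.
  Negative thresholds are unavoidable since paths in the space may have negative holding
  times.\<close>

lemma sets_map_space: "sets map_space = sigma_sets UNIV cylinders"
proof
  show "sigma_sets UNIV cylinders \<subseteq> sets map_space"
  proof -
    have "cylinders \<subseteq> sets map_space" by (auto simp: cylinders_def)
    from sets.sigma_sets_subset[OF this] show ?thesis by simp
  qed
  let ?G = "sigma UNIV cylinders"
  have setsG: "sets ?G = sigma_sets UNIV cylinders" and spG: "space ?G = UNIV"
    by (auto simp: space_measure_of_conv)
  have cylG: "cylinder N x e h \<in> sets ?G" for N x e h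
    unfolding setsG by (rule sigma_sets.Basic) (auto simp: cylinders_def)
  have union: "(\<Union>p\<in>I. cylinder N ((!) (fst p)) ((!) (fst (snd p))) (h (snd (snd p)))) \<in> sets ?G"
    for I :: "(nat list \<times> bool list \<times> nat) set" and N h
    by (intro sets.countable_UN' image_subsetI cylG countableI_type)
  have phase: "(\<lambda>\<xi>. fst (\<xi> n)) \<in> measurable ?G (count_space UNIV)" for n
  proof -
    have "(\<lambda>\<xi>. fst (\<xi> n)) -` {a} \<inter> space ?G \<in> sets ?G" for a
    proof -
      have "(\<lambda>\<xi>. fst (\<xi> n)) -` {a} \<inter> space ?G = (\<Union>p\<in>{p. fst p ! n = a}. cylinder n ((!) (fst p)) ((!) (fst (snd p))) (\<lambda>_. - real (snd (snd p))))"
      proof (intro equalityI subsetI)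
        fix \<xi> :: map_path assume "\<xi> \<in> (\<lambda>\<xi>. fst (\<xi> n)) -` {a} \<inter> space ?G"
        then have a: "fst (\<xi> n) = a" by simp
        obtain xs es k where "xs ! n = fst (\<xi> n)" "\<xi> \<in> cylinder n ((!) xs) ((!) es) (\<lambda>_. - real k)"
          using cylinder_cover[of n n \<xi>] by blast
        then show "\<xi> \<in> (\<Union>p\<in>{p. fst p ! n = a}. cylinder n ((!) (fst p)) ((!) (fst (snd p))) (\<lambda>_. - real (snd (snd p))))"
          using a by (intro UN_I[of "(xs, es, k)"]) auto
      qed (auto simp: cylinder_def spG)
      then show ?thesis using union[where h = "\<lambda>k _. - real k"] by simp
    qed
    then show ?thesis by (simp add: measurable_count_space_eq2_countable spG)
  qed
  have arrival: "(\<lambda>\<xi>. arrival_at \<xi> n) \<in> measurable ?G (count_space UNIV)" for n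
  proof -
    have "(\<lambda>\<xi>. arrival_at \<xi> n) -` {a} \<inter> space ?G \<in> sets ?G" for a
    proof -
      have "(\<lambda>\<xi>. arrival_at \<xi> n) -` {a} \<inter> space ?G = (\<Union>p\<in>{p. fst (snd p) ! n = a}. cylinder (Suc n) ((!) (fst p)) ((!) (fst (snd p))) (\<lambda>_. - real (snd (snd p))))"
      proof (intro equalityI subsetI)
        fix \<xi> :: map_path assume "\<xi> \<in> (\<lambda>\<xi>. arrival_at \<xi> n) -` {a} \<inter> space ?G"
        then have a: "arrival_at \<xi> n = a" by simp
        obtain xs es k where "es ! n = arrival_at \<xi> n" "\<xi> \<in> cylinder (Suc n) ((!) xs) ((!) es) (\<lambda>_. - real k)"
          using cylinder_cover[of n "Suc n" \<xi>] by auto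
        then show "\<xi> \<in> (\<Union>p\<in>{p. fst (snd p) ! n = a}. cylinder (Suc n) ((!) (fst p)) ((!) (fst (snd p))) (\<lambda>_. - real (snd (snd p))))"
          using a by (intro UN_I[of "(xs, es, k)"]) auto
      qed (auto simp: cylinder_def spG)
      then show ?thesis using union[where h = "\<lambda>k _. - real k"] by simp
    qed
    then show ?thesis by (simp add: measurable_count_space_eq2_countable spG)
  qed
  have hold: "(\<lambda>\<xi>. holding \<xi> n) \<in> borel_measurable ?G" for n
  proof (rule borel_measurable_iff_greater[THEN iffD2], intro allI)
    fix c
    have "{\<xi> \<in> space ?G. c < holding \<xi> n} = (\<Union>p\<in>UNIV. cylinder (Suc n) ((!) (fst p)) ((!) (fst (snd p))) ((\<lambda>_. - real (snd (snd p)))(n := c)))"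
    proof (intro equalityI subsetI)
      fix \<xi> :: map_path assume "\<xi> \<in> {\<xi> \<in> space ?G. c < holding \<xi> n}"
      then have c: "c < holding \<xi> n" by simp
      obtain xs es k where "\<xi> \<in> cylinder (Suc n) ((!) xs) ((!) es) (\<lambda>_. - real k)"
        using cylinder_cover[of n "Suc n" \<xi>] by auto
      then show "\<xi> \<in> (\<Union>p\<in>UNIV. cylinder (Suc n) ((!) (fst p)) ((!) (fst (snd p))) ((\<lambda>_. - real (snd (snd p)))(n := c)))"
        using c by (intro UN_I[of "(xs, es, k)"]) (auto simp: cylinder_def)
    qed (auto simp: cylinder_def spG)
    then show "{\<xi> \<in> space ?G. c < holding \<xi> n} \<in> sets ?G"
      using union[where h = "\<lambda>k. (\<lambda>_. - real k)(n := c)"] by simp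
  qed
  have "(\<lambda>\<xi>. \<xi> n) \<in> measurable ?G (count_space UNIV \<Otimes>\<^sub>M borel \<Otimes>\<^sub>M count_space UNIV)" for n
  proof -
    have "(\<lambda>\<xi>. (fst (\<xi> n), holding \<xi> n, arrival_at \<xi> n)) \<in> measurable ?G (count_space UNIV \<Otimes>\<^sub>M borel \<Otimes>\<^sub>M count_space UNIV)"
      by (intro measurable_Pair phase hold arrival)
    then show ?thesis by (simp add: holding_def arrival_at_def)
  qed
  then have id: "(\<lambda>\<xi>. \<xi>) \<in> measurable ?G map_space"
    unfolding map_space_def by (intro measurable_PiM_single') (auto simp: space_pair_measure)
  show "sets map_space \<subseteq> sigma_sets UNIV cylinders"
  proof
    fix A assume "A \<in> sets map_space"
    from measurable_sets[OF id this] show "A \<in> sigma_sets UNIV cylinders" by (simp add: setsG spG)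
  qed
qed

section \<open>Paths of a Markov arrival process: regularity and law\<close>

locale markov_arrival = prob_space M
  for M :: "'w measure" and m D0 D1 x0 and \<xi> :: "'w \<Rightarrow> map_path" +
  assumes parameters: "MAP_parameters m D0 D1" and started: "MAP_started_in M m D0 D1 x0 \<xi>" and x0: "x0 < m"
begin

lemma xi_measurable[measurable]: "\<xi> \<in> measurable M map_space"
  using started by (simp add: MAP_started_in_def)

abbreviation jump where "jump \<equiv> MAP_jump_prob D0 D1"

lemma D0_neg: "x < m \<Longrightarrow> D0 x x < 0"
  using parameters by (simp add: MAP_parameters_def)

lemma jump_sum: "x < m \<Longrightarrow> (\<Sum>y<m. jump x True y + jump x False y) = 1"
proof -
  assume x: "x < m"
  have "(\<Sum>y<m. jump x True y + jump x False y) = (\<Sum>y<m. D1 x y + (if x = y then 0 else D0 x y)) / (- D0 x x)"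
    unfolding sum_divide_distrib by (rule sum.cong) (auto simp: MAP_jump_prob_def add_divide_distrib diff_divide_distrib)
  also have "(\<Sum>y<m. D1 x y + (if x = y then 0 else D0 x y)) = (\<Sum>y<m. D0 x y + D1 x y) - (\<Sum>y<m. if y = x then D0 x x else 0)"
    by (subst sum_subtractf[symmetric], rule sum.cong) auto
  also have "\<dots> = - D0 x x" using x parameters by (simp add: MAP_parameters_def)
  finally show ?thesis using D0_neg[OF x] by simp
qed

lemma prob_cylinder:
  assumes "\<And>l. l \<le> N \<Longrightarrow> x l < m" "\<And>l. l < N \<Longrightarrow> 0 \<le> h l"
  shows "prob {\<omega> \<in> space M. \<xi> \<omega> \<in> cylinder N x e h}
    = (if x 0 = x0 then \<Prod>l<N. exp (D0 (x l) (x l) * h l) * jump (x l) (e l) (x (Suc l)) else 0)"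
  using started assms unfolding MAP_started_in_def cylinder_def mem_Collect_eq by blast

text \<open>The prescribed probabilities concern phases below \<open>m\<close> and nonnegative
  thresholds only. Since the jump probabilities sum to 1, the admissible one-step extensions already
  exhaust the mass of a cylinder, and other phases or nonpositive holding times have probability
  0.\<close>

lemma AE_cylinder_step:
  assumes x: "\<And>l. l \<le> N \<Longrightarrow> x l < m"
  shows "AE \<omega> in M. \<xi> \<omega> \<in> cylinder N x e (\<lambda>_. 0) \<longrightarrow> fst (\<xi> \<omega> (Suc N)) < m \<and> 0 < holding (\<xi> \<omega>) N"
proof -
  define B where "B = {\<omega> \<in> space M. \<xi> \<omega> \<in> cylinder N x e (\<lambda>_. 0)}"
  define C where "C p = {\<omega> \<in> space M. \<xi> \<omega> \<in> cylinder (Suc N) (x(Suc N := fst p)) (e(N := snd p)) (\<lambda>_. 0)}" for p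
  let ?I = "{..<m} \<times> (UNIV :: bool set)"
  have [measurable]: "B \<in> sets M" "C p \<in> sets M" for p unfolding B_def C_def by measurable
  have CB: "C p \<subseteq> B" for p unfolding C_def B_def cylinder_def by auto
  have disj: "disjoint_family_on C ?I"
    unfolding disjoint_family_on_def C_def cylinder_def by (auto simp: prod_eq_iff)
  have pC: "prob (C p) = prob B * jump (x N) (snd p) (fst p)" if "p \<in> ?I" for p
  proof -
    have "(\<Prod>l<N. exp (D0 ((x(Suc N := fst p)) l) ((x(Suc N := fst p)) l) * 0) * jump ((x(Suc N := fst p)) l) ((e(N := snd p)) l) ((x(Suc N := fst p)) (Suc l)))
       = (\<Prod>l<N. exp (D0 (x l) (x l) * 0) * jump (x l) (e l) (x (Suc l)))"
      by (rule prod.cong) auto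
    then show ?thesis unfolding C_def B_def
      by (subst prob_cylinder, use that x in \<open>force simp: le_Suc_eq\<close>, simp, subst prob_cylinder, use x in auto)
  qed
  have "prob (\<Union>p\<in>?I. C p) = (\<Sum>p\<in>?I. prob (C p))"
    by (rule finite_measure_finite_Union) (use disj in auto)
  also have "\<dots> = (\<Sum>p\<in>?I. prob B * jump (x N) (snd p) (fst p))" by (rule sum.cong[OF refl pC])
  also have "\<dots> = prob B * (\<Sum>y<m. \<Sum>b\<in>UNIV. jump (x N) b y)"
    by (simp add: sum.cartesian_product sum_distrib_left case_prod_beta)
  also have "\<dots> = prob B" using jump_sum[OF x[of N]] by (simp add: UNIV_bool add.commute)
  finally have eq: "prob (\<Union>p\<in>?I. C p) = prob B" .
  have "prob (B - (\<Union>p\<in>?I. C p)) = prob B - prob (\<Union>p\<in>?I. C p)"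
    by (rule finite_measure_Diff) (use CB in auto)
  then have "emeasure M (B - (\<Union>p\<in>?I. C p)) = 0" using eq by (simp add: emeasure_eq_measure)
  then have "B - (\<Union>p\<in>?I. C p) \<in> null_sets M" by (simp add: null_sets_def sets.Diff sets.finite_UN)
  then have "AE \<omega> in M. \<omega> \<notin> B - (\<Union>p\<in>?I. C p)" by (rule AE_not_in)
  moreover have "AE \<omega> in M. \<omega> \<in> space M" by simp
  ultimately show ?thesis
    by eventually_elim (auto simp: B_def C_def cylinder_def)
qed

lemma AE_regular: "AE \<omega> in M. \<forall>n. fst (\<xi> \<omega> n) < m \<and> 0 < holding (\<xi> \<omega>) n"
proof -
  have 0: "AE \<omega> in M. fst (\<xi> \<omega> 0) = x0"
  proof -
    have "prob {\<omega> \<in> space M. \<xi> \<omega> \<in> cylinder 0 (\<lambda>_. x0) (\<lambda>_. True) (\<lambda>_. 0)} = 1"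
      by (subst prob_cylinder) (use x0 in auto)
    then have "AE \<omega> in M. \<omega> \<in> {\<omega> \<in> space M. \<xi> \<omega> \<in> cylinder 0 (\<lambda>_. x0) (\<lambda>_. True) (\<lambda>_. 0)}"
      by (rule AE_prob_1)
    then show ?thesis by eventually_elim (auto simp: cylinder_def)
  qed
  \<comment> \<open>Finite paths are quantified as lists, so that there are countably many
    exceptional sets.\<close>
  have step: "AE \<omega> in M. \<forall>N xs es. (\<forall>l\<le>N. (xs::nat list) ! l < m) \<longrightarrow>
      \<xi> \<omega> \<in> cylinder N ((!) xs) ((!) (es::bool list)) (\<lambda>_. 0) \<longrightarrow> fst (\<xi> \<omega> (Suc N)) < m \<and> 0 < holding (\<xi> \<omega>) N"
  proof (unfold AE_all_countable, intro allI)
    fix N and xs :: "nat list" and es :: "bool list"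
    show "AE \<omega> in M. (\<forall>l\<le>N. xs ! l < m) \<longrightarrow>
      \<xi> \<omega> \<in> cylinder N ((!) xs) ((!) es) (\<lambda>_. 0) \<longrightarrow> fst (\<xi> \<omega> (Suc N)) < m \<and> 0 < holding (\<xi> \<omega>) N"
      using AE_cylinder_step[of N "(!) xs" "(!) es"] by (cases "\<forall>l\<le>N. xs ! l < m") auto
  qed
  from 0 step show ?thesis
  proof eventually_elim
    case (elim \<omega>)
    have "(\<forall>l\<le>N. fst (\<xi> \<omega> l) < m) \<and> (\<forall>l<N. 0 < holding (\<xi> \<omega>) l)" for N
    proof (induction N)
      case 0
      then show ?case using elim x0 by simp
    next
      case (Suc N)
      define xs where "xs = map (\<lambda>l. fst (\<xi> \<omega> l)) [0..<Suc N]"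
      define es where "es = map (arrival_at (\<xi> \<omega>)) [0..<N]"
      have xs: "xs ! l = fst (\<xi> \<omega> l)" if "l \<le> N" for l
        using that unfolding xs_def by (subst nth_map) (auto simp del: upt_Suc)
      have es: "es ! l = arrival_at (\<xi> \<omega>) l" if "l < N" for l using that by (simp add: es_def)
      have "\<xi> \<omega> \<in> cylinder N ((!) xs) ((!) es) (\<lambda>_. 0)" using Suc by (auto simp: cylinder_def xs es)
      moreover have "\<forall>l\<le>N. xs ! l < m" using Suc xs by auto
      ultimately have "fst (\<xi> \<omega> (Suc N)) < m \<and> 0 < holding (\<xi> \<omega>) N" using elim(2) by blast
      then show ?case using Suc by (auto simp: le_Suc_eq less_Suc_eq)
    qed
    then show ?case by blast
  qed
qed

text \<open>Cylinders only prescribe lower bounds. An upper bound by 1 is a difference of two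
  cylinders, and raising one threshold from 0 to 1 multiplies the probability by an exponential
  factor.\<close>

lemma prob_cylinder_short:
  assumes x: "\<And>l. l \<le> N \<Longrightarrow> x l < m" and L: "finite L" "L \<subseteq> {..<N}"
    and h: "\<And>l. l < N \<Longrightarrow> 0 \<le> h l" "\<And>l. l \<in> L \<Longrightarrow> h l = 0"
  shows "prob {\<omega> \<in> space M. \<xi> \<omega> \<in> cylinder N x e h \<and> (\<forall>l\<in>L. holding (\<xi> \<omega>) l \<le> 1)}
    = prob {\<omega> \<in> space M. \<xi> \<omega> \<in> cylinder N x e h} * (\<Prod>l\<in>L. 1 - exp (D0 (x l) (x l)))"
  using L h
proof (induction L arbitrary: h rule: finite_induct)
  case (insert a L)
  let ?A = "{\<omega> \<in> space M. \<xi> \<omega> \<in> cylinder N x e h \<and> (\<forall>l\<in>L. holding (\<xi> \<omega>) l \<le> 1)}"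
  let ?B = "{\<omega> \<in> space M. \<xi> \<omega> \<in> cylinder N x e (h(a := 1)) \<and> (\<forall>l\<in>L. holding (\<xi> \<omega>) l \<le> 1)}"
  have aN: "a < N" and ha: "h a = 0" using insert by auto
  have [measurable]: "?A \<in> sets M" "?B \<in> sets M" using insert(1) by measurable
  have BA: "?B \<subseteq> ?A" using ha by (auto simp: cylinder_def split: if_splits)
  have "{\<omega> \<in> space M. \<xi> \<omega> \<in> cylinder N x e h \<and> (\<forall>l\<in>insert a L. holding (\<xi> \<omega>) l \<le> 1)} = ?A - ?B"
    using aN ha by (auto simp: cylinder_def split: if_splits)
  then have "prob {\<omega> \<in> space M. \<xi> \<omega> \<in> cylinder N x e h \<and> (\<forall>l\<in>insert a L. holding (\<xi> \<omega>) l \<le> 1)} = prob ?A - prob ?B"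
    using finite_measure_Diff[of ?A ?B] BA by simp
  also have "prob ?A = prob {\<omega> \<in> space M. \<xi> \<omega> \<in> cylinder N x e h} * (\<Prod>l\<in>L. 1 - exp (D0 (x l) (x l)))"
    by (rule insert.IH) (use insert in auto)
  also have "prob ?B = prob {\<omega> \<in> space M. \<xi> \<omega> \<in> cylinder N x e (h(a := 1))} * (\<Prod>l\<in>L. 1 - exp (D0 (x l) (x l)))"
    by (rule insert.IH) (use insert in auto)
  also have "prob {\<omega> \<in> space M. \<xi> \<omega> \<in> cylinder N x e (h(a := 1))} = exp (D0 (x a) (x a)) * prob {\<omega> \<in> space M. \<xi> \<omega> \<in> cylinder N x e h}"
  proof -
    have "(\<Prod>l<N. exp (D0 (x l) (x l) * (h(a := 1)) l) * jump (x l) (e l) (x (Suc l)))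
      = exp (D0 (x a) (x a)) * (\<Prod>l<N. exp (D0 (x l) (x l) * h l) * jump (x l) (e l) (x (Suc l)))"
    proof -
      have "(\<Prod>l\<in>{..<N} - {a}. exp (D0 (x l) (x l) * (h(a := 1)) l) * jump (x l) (e l) (x (Suc l)))
         = (\<Prod>l\<in>{..<N} - {a}. exp (D0 (x l) (x l) * h l) * jump (x l) (e l) (x (Suc l)))"
        by (rule prod.cong) auto
      then show ?thesis
        using aN ha by (simp add: prod.remove[of "{..<N}" a])
    qed
    moreover have "prob {\<omega> \<in> space M. \<xi> \<omega> \<in> cylinder N x e (h(a := 1))}
      = (if x 0 = x0 then \<Prod>l<N. exp (D0 (x l) (x l) * (h(a := 1)) l) * jump (x l) (e l) (x (Suc l)) else 0)"
      by (rule prob_cylinder) (use x insert.prems in auto)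
    moreover have "prob {\<omega> \<in> space M. \<xi> \<omega> \<in> cylinder N x e h}
      = (if x 0 = x0 then \<Prod>l<N. exp (D0 (x l) (x l) * h l) * jump (x l) (e l) (x (Suc l)) else 0)"
      by (rule prob_cylinder) (use x insert.prems in auto)
    ultimately show ?thesis by simp
  qed
  finally show ?case using insert by (simp add: algebra_simps)
qed simp

text \<open>With finitely many phases, the probability of a holding time of at most 1 is bounded
  away from 1. Summing over the disjoint cylinders of all phase and flag sequences makes the bound
  independent of the path.\<close>

lemma prob_all_short: "\<exists>p<1. 0 \<le> p \<and> (\<forall>a N. a \<le> N \<longrightarrow> prob {\<omega> \<in> space M. \<forall>l\<in>{a..<N}. holding (\<xi> \<omega>) l \<le> 1} \<le> p ^ (N - a))"
proof -
  define p where "p = Max ((\<lambda>x. 1 - exp (D0 x x)) ` {..<m})"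
  have ne: "{..<m} \<noteq> {}" using x0 by auto
  have p_ge: "1 - exp (D0 x x) \<le> p" if "x < m" for x unfolding p_def using that by auto
  have "p \<in> (\<lambda>x. 1 - exp (D0 x x)) ` {..<m}" unfolding p_def using ne by (intro Max_in) auto
  then obtain x where "p = 1 - exp (D0 x x)" "x < m" by auto
  then have p: "p < 1" "0 \<le> p" using D0_neg[of x] by auto
  have "prob {\<omega> \<in> space M. \<forall>l\<in>{a..<N}. holding (\<xi> \<omega>) l \<le> 1} \<le> p ^ (N - a)" if "a \<le> N" for a N
  proof -
    let ?I = "{xs. set xs \<subseteq> {..<m} \<and> length xs = Suc N} \<times> {es. set es \<subseteq> (UNIV :: bool set) \<and> length es = N}"
    define C where "C q = {\<omega> \<in> space M. \<xi> \<omega> \<in> cylinder N ((!) (fst q)) ((!) (snd q)) (\<lambda>_. 0)}" for q :: "nat list \<times> bool list"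
    define S where "S = {\<omega> \<in> space M. \<forall>l\<in>{a..<N}. holding (\<xi> \<omega>) l \<le> 1}"
    have [measurable]: "C q \<in> sets M" "S \<in> sets M" for q unfolding C_def S_def by measurable
    have fin: "finite ?I" by (intro finite_cartesian_product finite_lists_length_eq) auto
    have disj: "disjoint_family_on C ?I"
    proof -
      have "q = q'" if "q \<in> ?I" "q' \<in> ?I" "\<omega> \<in> C q" "\<omega> \<in> C q'" for q q' \<omega>
      proof (rule prod_eqI)
        show "fst q = fst q'" using that by (intro nth_equalityI) (auto simp: C_def cylinder_def less_Suc_eq_le)
        show "snd q = snd q'" using that by (intro nth_equalityI) (auto simp: C_def cylinder_def)
      qed
      then show ?thesis unfolding disjoint_family_on_def by blast
    qed
    have "AE \<omega> in M. \<omega> \<in> (\<Union>q\<in>?I. C q)"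
      using AE_regular AE_space
    proof eventually_elim
      case (elim \<omega>)
      define xs where "xs = map (\<lambda>l. fst (\<xi> \<omega> l)) [0..<Suc N]"
      define es where "es = map (arrival_at (\<xi> \<omega>)) [0..<N]"
      have xs: "xs ! l = fst (\<xi> \<omega> l)" if "l \<le> N" for l
        using that unfolding xs_def by (subst nth_map) (auto simp del: upt_Suc)
      have es: "es ! l = arrival_at (\<xi> \<omega>) l" if "l < N" for l using that by (simp add: es_def)
      have "\<omega> \<in> C (xs, es)" using elim by (auto simp: C_def cylinder_def xs es)
      moreover have "(xs, es) \<in> ?I" using elim by (auto simp: xs_def es_def)
      ultimately show ?case by blast
    qed
    then have "prob S = prob (\<Union>q\<in>?I. C q \<inter> S)"
      by (intro finite_measure_eq_AE) (auto intro!: sets.finite_UN fin)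
    also have "\<dots> = (\<Sum>q\<in>?I. prob (C q \<inter> S))"
    proof (rule finite_measure_finite_Union[OF fin])
      show "disjoint_family_on (\<lambda>q. C q \<inter> S) ?I" using disj unfolding disjoint_family_on_def by blast
    qed auto
    also have "\<dots> \<le> (\<Sum>q\<in>?I. prob (C q) * p ^ (N - a))"
    proof (rule sum_mono)
      fix q assume q: "q \<in> ?I"
      then have x: "fst q ! l < m" if "l \<le> N" for l using that by (auto simp: less_Suc_eq_le subset_iff)
      have "prob (C q \<inter> S) = prob {\<omega> \<in> space M. \<xi> \<omega> \<in> cylinder N ((!) (fst q)) ((!) (snd q)) (\<lambda>_. 0) \<and> (\<forall>l\<in>{a..<N}. holding (\<xi> \<omega>) l \<le> 1)}"
        by (rule arg_cong[where f = prob]) (auto simp: C_def S_def)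
      also have "\<dots> = prob (C q) * (\<Prod>l\<in>{a..<N}. 1 - exp (D0 (fst q ! l) (fst q ! l)))"
        unfolding C_def by (rule prob_cylinder_short) (use x in auto)
      also have "\<dots> \<le> prob (C q) * (\<Prod>l\<in>{a..<N}. p)"
        using x D0_neg p_ge by (intro mult_left_mono prod_mono) (auto intro: less_imp_le)
      finally show "prob (C q \<inter> S) \<le> prob (C q) * p ^ (N - a)" by simp
    qed
    also have "\<dots> = prob (\<Union>q\<in>?I. C q) * p ^ (N - a)"
      unfolding sum_distrib_right[symmetric]
      by (subst finite_measure_finite_Union[OF fin]) (use disj in auto)
    also have "\<dots> \<le> 1 * p ^ (N - a)" using p by (intro mult_right_mono) auto
    finally show ?thesis by (simp add: S_def)
  qed
  then show ?thesis using p by blast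
qed

text \<open>Non-explosion: a final stretch of short holding times has probability below every power
  of \<open>p\<close>, so infinitely many holding times exceed 1.\<close>

lemma AE_epoch_at_top: "AE \<omega> in M. filterlim (epoch (\<xi> \<omega>)) at_top sequentially"
proof -
  obtain p where p: "p < 1" "0 \<le> p" and bound: "\<And>a N. a \<le> N \<Longrightarrow> prob {\<omega> \<in> space M. \<forall>l\<in>{a..<N}. holding (\<xi> \<omega>) l \<le> 1} \<le> p ^ (N - a)"
    using prob_all_short by blast
  have "AE \<omega> in M. \<exists>l\<ge>a. 1 < holding (\<xi> \<omega>) l" for a
  proof -
    let ?S = "{\<omega> \<in> space M. \<forall>l\<ge>a. holding (\<xi> \<omega>) l \<le> 1}"
    have [measurable]: "?S \<in> sets M" by measurable
    have "prob ?S \<le> p ^ k" for k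
    proof -
      have "prob ?S \<le> prob {\<omega> \<in> space M. \<forall>l\<in>{a..<a + k}. holding (\<xi> \<omega>) l \<le> 1}"
        by (rule finite_measure_mono) auto
      also have "\<dots> \<le> p ^ k" using bound[of a "a + k"] by simp
      finally show ?thesis .
    qed
    moreover have "(\<lambda>k. p ^ k) \<longlonglongrightarrow> 0" using p by (intro LIMSEQ_power_zero) auto
    ultimately have "prob ?S \<le> 0" by (intro LIMSEQ_le_const[of "\<lambda>k. p ^ k" 0]) auto
    then have "emeasure M ?S = 0" by (simp add: emeasure_eq_measure measure_le_0_iff)
    then have "?S \<in> null_sets M" by (simp add: null_sets_def)
    then have "AE \<omega> in M. \<omega> \<notin> ?S" by (rule AE_not_in)
    then show ?thesis using AE_space by eventually_elim (auto simp: not_le)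
  qed
  then have "AE \<omega> in M. \<forall>a. \<exists>l\<ge>a. 1 < holding (\<xi> \<omega>) l" by (simp add: AE_all_countable)
  with AE_regular show ?thesis
  proof eventually_elim
    case (elim \<omega>)
    have mono: "epoch (\<xi> \<omega>) a \<le> epoch (\<xi> \<omega>) b" if "a \<le> b" for a b
      unfolding epoch_def by (rule sum_mono2) (use that elim in \<open>auto intro: less_imp_le\<close>)
    have "\<exists>n. real k \<le> epoch (\<xi> \<omega>) n" for k
    proof (induction k)
      case 0
      show ?case by (rule exI[of _ 0]) (simp add: epoch_def)
    next
      case (Suc k)
      then obtain n where n: "real k \<le> epoch (\<xi> \<omega>) n" by blast
      obtain l where l: "n \<le> l" "1 < holding (\<xi> \<omega>) l" using elim by blast
      have "epoch (\<xi> \<omega>) (Suc l) = epoch (\<xi> \<omega>) l + holding (\<xi> \<omega>) l" by (simp add: epoch_def)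
      then have "real (Suc k) \<le> epoch (\<xi> \<omega>) (Suc l)" using n l mono[of n l] by simp
      then show ?case by blast
    qed
    then show ?case
      unfolding filterlim_at_top eventually_sequentially
      by (meson mono order_trans real_arch_simple)
  qed
qed

text \<open>Completes the prescription to all cylinders: holding times are almost surely positive,
  so negative thresholds act as 0, and forbidden phases have probability 0. Only then is the law
  known on the whole generator.\<close>

lemma prob_cylinder_any:
  "prob {\<omega> \<in> space M. \<xi> \<omega> \<in> cylinder N x e h}
    = (if (\<forall>l\<le>N. x l < m) \<and> x 0 = x0
       then \<Prod>l<N. exp (D0 (x l) (x l) * max 0 (h l)) * jump (x l) (e l) (x (Suc l)) else 0)"
proof (cases "\<forall>l\<le>N. x l < m")
  case True
  have "prob {\<omega> \<in> space M. \<xi> \<omega> \<in> cylinder N x e h} = prob {\<omega> \<in> space M. \<xi> \<omega> \<in> cylinder N x e (\<lambda>l. max 0 (h l))}"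
  proof (rule finite_measure_eq_AE)
    show "AE \<omega> in M. (\<omega> \<in> {\<omega> \<in> space M. \<xi> \<omega> \<in> cylinder N x e h}) = (\<omega> \<in> {\<omega> \<in> space M. \<xi> \<omega> \<in> cylinder N x e (\<lambda>l. max 0 (h l))})"
      using AE_regular by eventually_elim (auto simp: cylinder_def)
  qed measurable
  then show ?thesis using True by (subst (asm) (2) prob_cylinder) auto
next
  case False
  have "prob {\<omega> \<in> space M. \<xi> \<omega> \<in> cylinder N x e h} = prob {}"
  proof (rule finite_measure_eq_AE)
    show "AE \<omega> in M. (\<omega> \<in> {\<omega> \<in> space M. \<xi> \<omega> \<in> cylinder N x e h}) = (\<omega> \<in> {})"
      using AE_regular by eventually_elim (use False in \<open>auto simp: cylinder_def; metis\<close>)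
  qed measurable
  then show ?thesis using False by auto
qed

end

text \<open>Bridges the different probability spaces. Cylinders of length 0 impose no condition on
  holding times, and those of all initial phases form a countable cover.\<close>

lemma MAP_law_unique:
  assumes "markov_arrival M m D0 D1 x0 \<xi>" "markov_arrival M' m D0 D1 x0 \<xi>'"
  shows "distr M map_space \<xi> = distr M' map_space \<xi>'"
proof -
  interpret A: markov_arrival M m D0 D1 x0 \<xi> by fact
  interpret B: markov_arrival M' m D0 D1 x0 \<xi>' by fact
  have eA: "emeasure (distr M map_space \<xi>) (cylinder N x e h) = ennreal (A.prob {\<omega> \<in> space M. \<xi> \<omega> \<in> cylinder N x e h})" for N x e h
    by (subst emeasure_distr) (auto simp: A.emeasure_eq_measure vimage_def Int_def conj_commute)
  have eB: "emeasure (distr M' map_space \<xi>') (cylinder N x e h) = ennreal (B.prob {\<omega> \<in> space M'. \<xi>' \<omega> \<in> cylinder N x e h})" for N x e h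
    by (subst emeasure_distr) (auto simp: B.emeasure_eq_measure vimage_def Int_def conj_commute)
  show ?thesis
  proof (rule measure_eqI_generator_eq_countable[where \<Omega> = UNIV and E = cylinders
        and A = "range (\<lambda>a. cylinder 0 (\<lambda>_. a) (\<lambda>_. True) (\<lambda>_. 0))"])
    fix X assume "X \<in> cylinders"
    then consider "X = {}" | N x e h where "X = cylinder N x e h" by (auto simp: cylinders_def)
    then show "emeasure (distr M map_space \<xi>) X = emeasure (distr M' map_space \<xi>') X"
      by cases (auto simp: eA eB A.prob_cylinder_any B.prob_cylinder_any)
  next
    show "\<Union> (range (\<lambda>a. cylinder 0 (\<lambda>_. a) (\<lambda>_. True) (\<lambda>_. 0))) = UNIV" by (auto simp: cylinder_def)
    show "range (\<lambda>a. cylinder 0 (\<lambda>_. a) (\<lambda>_. True) (\<lambda>_. 0)) \<subseteq> cylinders" by (auto simp: cylinders_def)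
    show "emeasure (distr M map_space \<xi>) a \<noteq> \<infinity>" if "a \<in> range (\<lambda>a. cylinder 0 (\<lambda>_. a) (\<lambda>_. True) (\<lambda>_. 0))" for a
      using that by (auto simp: eA)
  qed (simp_all add: cylinders_Int_stable sets_map_space)
qed

text \<open>The assumptions fix the law of each mark and the independence of paths and marks, both
  among themselves and from each other. The law of the whole queue is thus a product in which only
  the path laws remain to be identified.\<close>

lemma
  fixes Z :: "'w \<Rightarrow> ('r::finite, 'd::finite) queue_path"
  assumes Z: "queue_without_catastrophes M m A k Z" and A: "valid_queue_model m A" and k: "k \<in> phases m"
  shows queue_markov_arrival: "markov_arrival M (m r) (rate0 A r) (rate1 A r) (k r) (\<lambda>\<omega>. fst (Z \<omega>) r)"
    and queue_Z_measurable: "Z \<in> measurable M queue_space"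
    and queue_law_product: "distr M queue_space Z =
      PiM UNIV (\<lambda>r. distr M map_space (\<lambda>\<omega>. fst (Z \<omega>) r)) \<Otimes>\<^sub>M
      PiM UNIV (\<lambda>(r, n). interval_measure (service_df A r) \<Otimes>\<^sub>M resource_law A r \<Otimes>\<^sub>M departure_law A r)"
proof -
  interpret prob_space M using Z by (simp add: queue_without_catastrophes_def)
  show "markov_arrival M (m r) (rate0 A r) (rate1 A r) (k r) (\<lambda>\<omega>. fst (Z \<omega>) r)" for r
    using Z A k prob_space_axioms
    by (auto simp: markov_arrival_def markov_arrival_axioms_def queue_without_catastrophes_def valid_queue_model_def phases_def)
  have ind: "indep_elements M maps_space (\<lambda>\<omega>. fst (Z \<omega>)) marks_space (\<lambda>\<omega>. snd (Z \<omega>))"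
    using Z by (simp add: queue_without_catastrophes_def)
  then have m1[measurable]: "(\<lambda>\<omega>. fst (Z \<omega>)) \<in> measurable M maps_space" and m2[measurable]: "(\<lambda>\<omega>. snd (Z \<omega>)) \<in> measurable M marks_space"
    by (auto simp: indep_elements_def)
  have Zm: "(\<lambda>\<omega>. (fst (Z \<omega>), snd (Z \<omega>))) \<in> measurable M queue_space"
    unfolding queue_space_def by measurable
  then show "Z \<in> measurable M queue_space" by simp
  have d1: "distr M maps_space (\<lambda>\<omega>. fst (Z \<omega>)) = PiM UNIV (\<lambda>r. distr M map_space (\<lambda>\<omega>. fst (Z \<omega>) r))"
  proof -
    have "indep_vars (\<lambda>_. map_space) (\<lambda>r \<omega>. fst (Z \<omega>) r) UNIV"
      using Z by (simp add: queue_without_catastrophes_def)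
    moreover from this have "\<And>r. random_variable map_space (\<lambda>\<omega>. fst (Z \<omega>) r)" by (simp add: indep_vars_def2)
    ultimately show ?thesis
      by (subst (asm) indep_vars_iff_distr_eq_PiM) (auto simp: maps_space_def restrict_UNIV)
  qed
  have d2: "distr M marks_space (\<lambda>\<omega>. snd (Z \<omega>)) = PiM UNIV (\<lambda>(r, n). interval_measure (service_df A r) \<Otimes>\<^sub>M resource_law A r \<Otimes>\<^sub>M departure_law A r)"
  proof -
    have "indep_vars (\<lambda>_. mark_space) (\<lambda>c \<omega>. snd (Z \<omega>) c) UNIV"
      using Z by (simp add: queue_without_catastrophes_def)
    moreover from this have "\<And>c. random_variable mark_space (\<lambda>\<omega>. snd (Z \<omega>) c)" unfolding indep_vars_def2 by blast
    ultimately have "distr M (PiM UNIV (\<lambda>_. mark_space)) (\<lambda>\<omega> c. snd (Z \<omega>) c) = PiM UNIV (\<lambda>c. distr M mark_space (\<lambda>\<omega>. snd (Z \<omega>) c))"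
      by (subst (asm) indep_vars_iff_distr_eq_PiM) (auto simp: restrict_UNIV)
    also have "(\<lambda>c. distr M mark_space (\<lambda>\<omega>. snd (Z \<omega>) c)) = (\<lambda>(r, n). interval_measure (service_df A r) \<Otimes>\<^sub>M resource_law A r \<Otimes>\<^sub>M departure_law A r)"
      using Z by (auto simp: queue_without_catastrophes_def fun_eq_iff)
    finally show ?thesis by (simp add: marks_space_def)
  qed
  interpret D1: prob_space "distr M maps_space (\<lambda>\<omega>. fst (Z \<omega>))" by (rule prob_space_distr) measurable
  interpret D2: prob_space "distr M marks_space (\<lambda>\<omega>. snd (Z \<omega>))" by (rule prob_space_distr) measurable
  have "distr M maps_space (\<lambda>\<omega>. fst (Z \<omega>)) \<Otimes>\<^sub>M distr M marks_space (\<lambda>\<omega>. snd (Z \<omega>)) = distr M queue_space Z"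
  proof (rule pair_measure_eqI)
    show "sigma_finite_measure (distr M maps_space (\<lambda>\<omega>. fst (Z \<omega>)))" "sigma_finite_measure (distr M marks_space (\<lambda>\<omega>. snd (Z \<omega>)))" ..
    show "sets (distr M maps_space (\<lambda>\<omega>. fst (Z \<omega>)) \<Otimes>\<^sub>M distr M marks_space (\<lambda>\<omega>. snd (Z \<omega>))) = sets (distr M queue_space Z)"
      unfolding sets_distr queue_space_def by (intro sets_pair_measure_cong) simp_all
    fix B C assume "B \<in> sets (distr M maps_space (\<lambda>\<omega>. fst (Z \<omega>)))" "C \<in> sets (distr M marks_space (\<lambda>\<omega>. snd (Z \<omega>)))"
    then have B: "B \<in> sets maps_space" and C: "C \<in> sets marks_space" by auto
    have BC: "B \<times> C \<in> sets queue_space" unfolding queue_space_def using B C by auto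
    have "emeasure (distr M queue_space Z) (B \<times> C) = emeasure M (Z -` (B \<times> C) \<inter> space M)"
      using Zm BC by (simp add: emeasure_distr)
    also have "Z -` (B \<times> C) \<inter> space M = {\<omega> \<in> space M. fst (Z \<omega>) \<in> B \<and> snd (Z \<omega>) \<in> C}" by (auto simp: mem_Times_iff)
    also have "emeasure M \<dots> = emeasure M {\<omega> \<in> space M. fst (Z \<omega>) \<in> B} * emeasure M {\<omega> \<in> space M. snd (Z \<omega>) \<in> C}"
      unfolding emeasure_eq_measure indep_elementsD[OF prob_space_axioms ind B C] by (simp add: ennreal_mult)
    finally show "emeasure (distr M maps_space (\<lambda>\<omega>. fst (Z \<omega>))) B * emeasure (distr M marks_space (\<lambda>\<omega>. snd (Z \<omega>))) C
      = emeasure (distr M queue_space Z) (B \<times> C)"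
      using B C by (simp add: emeasure_distr vimage_def Int_def conj_commute)
  qed
  then show "distr M queue_space Z =
      PiM UNIV (\<lambda>r. distr M map_space (\<lambda>\<omega>. fst (Z \<omega>) r)) \<Otimes>\<^sub>M
      PiM UNIV (\<lambda>(r, n). interval_measure (service_df A r) \<Otimes>\<^sub>M resource_law A r \<Otimes>\<^sub>M departure_law A r)"
    unfolding d1 d2 by simp
qed

lemma queue_law_unique:
  fixes Z :: "'w \<Rightarrow> ('r::finite, 'd::finite) queue_path" and Z' :: "'v \<Rightarrow> ('r, 'd) queue_path"
  assumes "queue_without_catastrophes M m A k Z" "queue_without_catastrophes M' m A k Z'"
    and "valid_queue_model m A" "k \<in> phases m"
  shows "distr M queue_space Z = distr M' queue_space Z'"
proof -
  have "distr M map_space (\<lambda>\<omega>. fst (Z \<omega>) r) = distr M' map_space (\<lambda>\<omega>. fst (Z' \<omega>) r)" for r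
    by (rule MAP_law_unique[OF queue_markov_arrival[OF assms(1,3,4)] queue_markov_arrival[OF assms(2,3,4)]])
  then show ?thesis
    unfolding queue_law_product[OF assms(1,3,4)] queue_law_product[OF assms(2,3,4)] by simp
qed

lemma AE_regular_path:
  fixes Z :: "'w \<Rightarrow> ('r::finite, 'd::finite) queue_path"
  assumes Z: "queue_without_catastrophes M m A k Z" and A: "valid_queue_model m A" and k: "k \<in> phases m"
  shows "AE \<omega> in M. regular_path (Z \<omega>)"
proof -
  interpret prob_space M using Z by (simp add: queue_without_catastrophes_def)
  have "AE \<omega> in M. filterlim (epoch (fst (Z \<omega>) r)) at_top sequentially" for r
    by (rule markov_arrival.AE_epoch_at_top[OF queue_markov_arrival[OF Z A k]])
  then have 1: "AE \<omega> in M. \<forall>r\<in>UNIV. filterlim (epoch (fst (Z \<omega>) r)) at_top sequentially"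
    by (subst AE_finite_all) auto
  have "AE \<omega> in M. 0 \<le> fst (snd (Z \<omega>) (r, n)) \<and> (\<forall>a. 0 \<le> fst (snd (snd (Z \<omega>) (r, n))) $ a) \<and> (\<forall>a. 0 \<le> snd (snd (snd (Z \<omega>) (r, n))) $ a)" for r n
  proof -
    have df: "finite_df (service_df A r)" and dl: "(service_df A r \<longlongrightarrow> 1) at_top"
      and C: "prob_space (resource_law A r)" "sets (resource_law A r) = sets borel" "AE x in resource_law A r. \<forall>a. 0 \<le> x $ a"
      and G: "prob_space (departure_law A r)" "sets (departure_law A r) = sets borel" "AE x in departure_law A r. \<forall>a. 0 \<le> x $ a"
      using A by (auto simp: valid_queue_model_def distribution_function_def resource_distribution_def finite_df_def)
    interpret C: prob_space "resource_law A r" by fact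
    interpret G: prob_space "departure_law A r" by fact
    interpret S: finite_measure "interval_measure (service_df A r)" by (rule finite_measure_df[OF df])
    interpret CG: pair_sigma_finite "resource_law A r" "departure_law A r" ..
    interpret SCG: pair_sigma_finite "interval_measure (service_df A r)" "resource_law A r \<Otimes>\<^sub>M departure_law A r" ..
    note [measurable_cong] = C(2) G(2)
    have comp[measurable]: "(\<lambda>x::real ^ 'd. x $ a) \<in> borel_measurable borel" for a
      by (intro borel_measurable_continuous_onI continuous_intros)
    have cg: "AE p in resource_law A r \<Otimes>\<^sub>M departure_law A r. (\<forall>a. 0 \<le> fst p $ a) \<and> (\<forall>a. 0 \<le> snd p $ a)"
    proof (rule CG.AE_pair_measure)
      show "AE x in resource_law A r. AE y in departure_law A r. (\<forall>a. 0 \<le> fst (x, y) $ a) \<and> (\<forall>a. 0 \<le> snd (x, y) $ a)"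
        using C(3)
      proof eventually_elim
        case (elim x)
        show ?case using G(3) by eventually_elim (use elim in simp)
      qed
    qed measurable
    have ae: "AE p in interval_measure (service_df A r) \<Otimes>\<^sub>M resource_law A r \<Otimes>\<^sub>M departure_law A r.
        0 \<le> fst p \<and> (\<forall>a. 0 \<le> fst (snd p) $ a) \<and> (\<forall>a. 0 \<le> snd (snd p) $ a)"
    proof (rule SCG.AE_pair_measure)
      show "AE x in interval_measure (service_df A r). AE y in resource_law A r \<Otimes>\<^sub>M departure_law A r.
          0 \<le> fst (x, y) \<and> (\<forall>a. 0 \<le> fst (snd (x, y)) $ a) \<and> (\<forall>a. 0 \<le> snd (snd (x, y)) $ a)"
        using AE_df_nonneg[OF df]
      proof eventually_elim
        case (elim x)
        show ?case using cg by eventually_elim (use elim in simp)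
      qed
    qed measurable
    have law: "distr M mark_space (\<lambda>\<omega>. snd (Z \<omega>) (r, n)) = interval_measure (service_df A r) \<Otimes>\<^sub>M resource_law A r \<Otimes>\<^sub>M departure_law A r"
      using Z by (simp add: queue_without_catastrophes_def)
    have meas: "(\<lambda>\<omega>. snd (Z \<omega>) (r, n)) \<in> measurable M mark_space"
      using mark_measurable[OF queue_Z_measurable[OF Z A k]] by (simp add: mark_space_def)
    show ?thesis by (rule AE_distrD[OF meas ae[folded law]])
  qed
  then have "AE \<omega> in M. \<forall>r\<in>UNIV. \<forall>n. 0 \<le> fst (snd (Z \<omega>) (r, n)) \<and> (\<forall>a. 0 \<le> fst (snd (snd (Z \<omega>) (r, n))) $ a) \<and> (\<forall>a. 0 \<le> snd (snd (snd (Z \<omega>) (r, n))) $ a)"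
    by (subst AE_finite_all) (auto simp: AE_all_countable)
  with 1 show ?thesis
    by eventually_elim (auto simp: regular_path_def)
qed

section \<open>Limits of the transforms\<close>

lemma multi_power_norm_le_1: "(\<And>r. norm (z r) \<le> 1) \<Longrightarrow> norm (multi_power z n) \<le> 1"
  unfolding multi_power_def prod_norm[symmetric]
  by (rule prod_le_1) (auto simp: norm_power intro: power_le_one)

text \<open>Exchanges the sum over \<open>(n, m)\<close> with the expectation. The assumption
  \<open>lin\<close> says that at each point a single pair contributes, so the absolute sum is
  bounded by the observable of weight 1. Splitting the monomials into real and imaginary parts
  returns to real weights.\<close>

lemma generating_function_expectation:
  fixes obs :: "(('r::finite \<Rightarrow> nat) \<Rightarrow> ('r \<Rightarrow> nat) \<Rightarrow> real) \<Rightarrow> 'w \<Rightarrow> real"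
  assumes "prob_space M" and meas: "\<And>c. obs c \<in> borel_measurable M"
    and lin: "\<And>\<omega>. \<exists>n m y. \<forall>c. obs c \<omega> = c n m * y" and bound: "AE \<omega> in M. \<bar>obs (\<lambda>_ _. 1) \<omega>\<bar> \<le> 1"
    and z: "\<And>r. norm (z1 r) \<le> 1" "\<And>r. norm (z2 r) \<le> 1"
  defines "W n m \<equiv> multi_power z1 n * multi_power z2 m"
  shows "generating_function (\<lambda>n m. \<integral>\<omega>. obs (\<lambda>n' m'. if n' = n \<and> m' = m then 1 else 0) \<omega> \<partial>M) z1 z2
     = complex_of_real (\<integral>\<omega>. obs (\<lambda>n m. Re (W n m)) \<omega> \<partial>M) + \<i> * complex_of_real (\<integral>\<omega>. obs (\<lambda>n m. Im (W n m)) \<omega> \<partial>M)"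
proof -
  interpret prob_space M by fact
  let ?\<delta> = "\<lambda>p n' m'. if n' = fst p \<and> m' = snd p then 1 else 0 :: real"
  let ?C = "count_space UNIV :: (('r \<Rightarrow> nat) \<times> ('r \<Rightarrow> nat)) measure"
  let ?f = "\<lambda>\<omega> p. W (fst p) (snd p) * complex_of_real (obs (?\<delta> p) \<omega>)"
  interpret C: sigma_finite_measure ?C by (rule sigma_finite_measure_count_space_countable) simp
  interpret pair_sigma_finite M ?C ..
  have Wn: "norm (W n m) \<le> 1" for n m
    unfolding W_def norm_mult using multi_power_norm_le_1[of z1] multi_power_norm_le_1[of z2] z
    by (intro mult_le_one) auto
  have point: "\<exists>n m y. (\<forall>c. obs c \<omega> = c n m * y) \<and> (\<forall>p. obs (?\<delta> p) \<omega> = (if p = (n, m) then y else 0))" for \<omega>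
  proof -
    obtain n m y where "\<forall>c. obs c \<omega> = c n m * y" using lin by blast
    then show ?thesis by (intro exI[of _ n] exI[of _ m] exI[of _ y]) (auto simp: prod_eq_iff)
  qed
  have has1: "has_bochner_integral ?C (\<lambda>p. if p = (n, m) then a else 0) a" for n m and a :: "'b :: {banach, second_countable_topology}"
  proof -
    have "has_bochner_integral ?C (\<lambda>p. indicator {(n, m)} p *\<^sub>R a) (measure ?C {(n, m)} *\<^sub>R a)"
      by (rule has_bochner_integral_indicator) auto
    moreover have "(\<lambda>p. indicator {(n, m)} p *\<^sub>R a) = (\<lambda>p. if p = (n, m) then a else 0)"
      by (auto simp: indicator_def)
    ultimately show ?thesis by (simp add: measure_count_space)
  qed
  \<comment> \<open>At a fixed point the sum over \<open>p\<close> has one nonzero term. The norm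
    therefore commutes with the sum, and Fubini's integrability condition reduces to the bound on
    the observable.\<close>
  have inner: "integrable ?C (?f \<omega>)" "(\<integral>p. ?f \<omega> p \<partial>?C) = complex_of_real (obs (\<lambda>n m. Re (W n m)) \<omega>) + \<i> * complex_of_real (obs (\<lambda>n m. Im (W n m)) \<omega>)"
    "(\<integral>p. norm (?f \<omega> p) \<partial>?C) = norm (\<integral>p. ?f \<omega> p \<partial>?C)" 
    "norm (\<integral>p. ?f \<omega> p \<partial>?C) \<le> \<bar>obs (\<lambda>_ _. 1) \<omega>\<bar>" for \<omega>
  proof -
    obtain n m y where y: "\<And>c. obs c \<omega> = c n m * y" "\<And>p. obs (?\<delta> p) \<omega> = (if p = (n, m) then y else 0)"
      using point[of \<omega>] by blast
    have f: "?f \<omega> = (\<lambda>p. if p = (n, m) then W n m * complex_of_real y else 0)" by (auto simp: y)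
    have nf: "(\<lambda>p. norm (?f \<omega> p)) = (\<lambda>p. if p = (n, m) then norm (W n m * complex_of_real y) else 0)" by (auto simp: y)
    show "integrable ?C (?f \<omega>)" unfolding f using has1 by (rule integrable.intros)
    have I: "(\<integral>p. ?f \<omega> p \<partial>?C) = W n m * complex_of_real y"
      unfolding f by (rule has_bochner_integral_integral_eq[OF has1])
    show "(\<integral>p. ?f \<omega> p \<partial>?C) = complex_of_real (obs (\<lambda>n m. Re (W n m)) \<omega>) + \<i> * complex_of_real (obs (\<lambda>n m. Im (W n m)) \<omega>)"
      unfolding I unfolding y(1) by (simp add: complex_eq_iff)
    have "(\<integral>p. norm (?f \<omega> p) \<partial>?C) = norm (W n m * complex_of_real y)"
      unfolding nf by (rule has_bochner_integral_integral_eq[OF has1])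
    then show "(\<integral>p. norm (?f \<omega> p) \<partial>?C) = norm (\<integral>p. ?f \<omega> p \<partial>?C)" unfolding I .
    show "norm (\<integral>p. ?f \<omega> p \<partial>?C) \<le> \<bar>obs (\<lambda>_ _. 1) \<omega>\<bar>"
      unfolding I unfolding y(1) using Wn[of n m] by (simp add: norm_mult mult_left_le_one_le)
  qed
  have fm: "(\<lambda>(\<omega>, p). ?f \<omega> p) \<in> borel_measurable (M \<Otimes>\<^sub>M ?C)"
  proof -
    note [measurable] = meas
    have "(\<lambda>x. ?f (fst x) p) \<in> borel_measurable (M \<Otimes>\<^sub>M ?C)" for p by measurable
    then have "(\<lambda>x. ?f (fst x) (snd x)) \<in> borel_measurable (M \<Otimes>\<^sub>M ?C)"
      by (rule measurable_compose_countable) simp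
    then show ?thesis by (simp add: case_prod_beta)
  qed
  have obs_int: "integrable M (obs c)" if c: "\<And>n m. \<bar>c n m\<bar> \<le> 1" for c
  proof (rule integrable_const_bound[where B = 1])
    show "AE \<omega> in M. norm (obs c \<omega>) \<le> 1"
      using bound
    proof eventually_elim
      case (elim \<omega>)
      obtain n m y where y: "\<And>c. obs c \<omega> = c n m * y" using lin[of \<omega>] by blast
      have "\<bar>c n m\<bar> * \<bar>y\<bar> \<le> 1 * 1" using c elim y by (intro mult_mono) auto
      then show ?case by (simp add: y abs_mult)
    qed
  qed (rule meas)
  have cRe: "\<bar>Re (W n m)\<bar> \<le> 1" and cIm: "\<bar>Im (W n m)\<bar> \<le> 1" for n m
    using Wn[of n m] abs_Re_le_cmod[of "W n m"] abs_Im_le_cmod[of "W n m"] by linarith+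
  have intf: "integrable (M \<Otimes>\<^sub>M ?C) (\<lambda>(\<omega>, p). ?f \<omega> p)"
  proof (rule Fubini_integrable[OF fm])
    have inner_meas: "(\<lambda>\<omega>. \<integral>p. ?f \<omega> p \<partial>?C) \<in> borel_measurable M"
      unfolding inner(2) using meas by measurable
    have "integrable M (\<lambda>\<omega>. norm (\<integral>p. ?f \<omega> p \<partial>?C))"
    proof (rule integrable_const_bound[where B = 1])
      show "(\<lambda>\<omega>. norm (\<integral>p. ?f \<omega> p \<partial>?C)) \<in> borel_measurable M"
        by (rule measurable_compose[OF inner_meas]) simp
      show "AE \<omega> in M. norm (norm (\<integral>p. ?f \<omega> p \<partial>?C)) \<le> 1"
        using bound
      proof eventually_elim
        case (elim \<omega>)
        then show ?case using inner(4)[of \<omega>] by simp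
      qed
    qed
    then show "integrable M (\<lambda>\<omega>. \<integral>p. norm ((\<lambda>(\<omega>, p). ?f \<omega> p) (\<omega>, p)) \<partial>?C)"
      by (simp only: prod.case inner(3))
    show "AE \<omega> in M. integrable ?C (\<lambda>p. (\<lambda>(\<omega>, p). ?f \<omega> p) (\<omega>, p))"
      using inner(1) by simp
  qed
  have "(\<integral>p. (\<integral>\<omega>. ?f \<omega> p \<partial>M) \<partial>?C) = (\<integral>\<omega>. (\<integral>p. ?f \<omega> p \<partial>?C) \<partial>M)"
    by (rule Fubini_integral[OF intf])
  also have "\<dots> = complex_of_real (\<integral>\<omega>. obs (\<lambda>n m. Re (W n m)) \<omega> \<partial>M) + \<i> * complex_of_real (\<integral>\<omega>. obs (\<lambda>n m. Im (W n m)) \<omega> \<partial>M)"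
    unfolding inner(2)
    by (subst Bochner_Integration.integral_add) (auto intro!: integrable_of_real obs_int cRe cIm)
  finally have 1: "(\<integral>p. (\<integral>\<omega>. ?f \<omega> p \<partial>M) \<partial>?C) = complex_of_real (\<integral>\<omega>. obs (\<lambda>n m. Re (W n m)) \<omega> \<partial>M) + \<i> * complex_of_real (\<integral>\<omega>. obs (\<lambda>n m. Im (W n m)) \<omega> \<partial>M)" .
  \<comment> \<open>Integrability for the counting measure is absolute summability, which identifies
    the integral with the unordered infinite sum of \<open>generating_function\<close>.\<close>
  have "integrable ?C (\<lambda>p. \<integral>\<omega>. ?f \<omega> p \<partial>M)" by (rule integrable_snd[OF intf])
  then have "Infinite_Set_Sum.abs_summable_on (\<lambda>p. \<integral>\<omega>. ?f \<omega> p \<partial>M) UNIV"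
    by (simp add: Infinite_Set_Sum.abs_summable_on_def)
  from infsetsum_infsum[OF this]
  have 2: "(\<integral>p. (\<integral>\<omega>. ?f \<omega> p \<partial>M) \<partial>?C) = (\<Sum>\<^sub>\<infinity>p\<in>UNIV. \<integral>\<omega>. ?f \<omega> p \<partial>M)" by (simp add: infsetsum_def)
  show ?thesis
    unfolding generating_function_def 1[symmetric] 2
    by (rule infsum_cong) (auto simp: W_def)
qed

text \<open>A nonnegative repair time only delays the next start. Consequently the tail of the
  operating time lies below \<open>wr\<close>, the majorant in the renewal theorem.\<close>

lemma (in semi_markov_repair) Q_le_T: "Q i j t \<le> T i j t"
proof -
  interpret U: prob_space "interval_measure (U j)"
  proof
    interpret finite_measure "interval_measure (U j)" by (rule finite_measure_df[OF U_df])
    show "emeasure (interval_measure (U j)) (space (interval_measure (U j))) = 1"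
      using U_UNIV[of j] by (simp add: emeasure_eq_measure)
  qed
  have "ennreal (Q i j t) = (\<integral>\<^sup>+z. indicator {..t} z \<partial>interval_measure (Q i j))"
    by (simp add: emeasure_df[OF Q_df])
  also have "\<dots> = (\<integral>\<^sup>+x. \<integral>\<^sup>+y. indicator {..t} (x + y) \<partial>interval_measure (U j) \<partial>interval_measure (T i j))"
    unfolding Q repair_kernel_def by (rule nn_integral_conv[OF T_df U_df]) auto
  also have "\<dots> \<le> (\<integral>\<^sup>+x. \<integral>\<^sup>+y. indicator {..t} x \<partial>interval_measure (U j) \<partial>interval_measure (T i j))"
  proof (rule nn_integral_mono, rule nn_integral_mono_AE)
    fix x show "AE y in interval_measure (U j). (indicator {..t} (x + y) :: ennreal) \<le> indicator {..t} x"
      using AE_df_nonneg[OF U_df] by eventually_elim (auto simp: indicator_def)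
  qed
  also have "\<dots> = ennreal (T i j t)"
    using U.emeasure_space_1 by (simp add: emeasure_df[OF T_df])
  finally show ?thesis by (simp add: finite_dfD(4)[OF T_df])
qed

lemma (in semi_markov_repair) emeasure_T_tail:
  "(\<Sum>k\<in>UNIV. emeasure (interval_measure (T j k)) {t<..}) = ennreal (1 - sojourn_df T j t)"
proof -
  interpret T: finite_measure "interval_measure (T j k)" for k by (rule finite_measure_df[OF T_df])
  have "emeasure (interval_measure (T j k)) {t<..} = ennreal (measure (interval_measure (T j k)) UNIV - T j k t)" for k
  proof -
    have "measure (interval_measure (T j k)) {t<..} = measure (interval_measure (T j k)) UNIV - measure (interval_measure (T j k)) {..t}"
      using T.finite_measure_compl[of "{..t}" k] by (simp add: Compl_eq_Diff_UNIV[symmetric])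
    moreover have "measure (interval_measure (T j k)) {..t} = T j k t"
      using emeasure_df[OF T_df, of j k t] by (simp add: measure_def finite_dfD(4)[OF T_df])
    ultimately show ?thesis by (simp add: T.emeasure_eq_measure)
  qed
  moreover have "0 \<le> measure (interval_measure (T j k)) UNIV - T j k t" for k
  proof -
    have "T j k t = measure (interval_measure (T j k)) {..t}"
      using emeasure_df[OF T_df, of j k t] by (simp add: measure_def finite_dfD(4)[OF T_df])
    then show ?thesis using T.finite_measure_mono[of "{..t}" UNIV k] by simp
  qed
  ultimately show ?thesis
    by (simp add: sum_ennreal sum_subtractf T_UNIV_sum sojourn_df_def)
qed

lemma (in semi_markov_repair) sojourn_df_facts:
  "mono (sojourn_df T j)" "0 \<le> sojourn_df T j t" "sojourn_df T j t \<le> 1"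
proof -
  show "mono (sojourn_df T j)"
    by (auto simp: mono_def sojourn_df_def intro!: sum_mono finite_dfD(1)[OF T_df])
  show "0 \<le> sojourn_df T j t" by (auto simp: sojourn_df_def intro!: sum_nonneg finite_dfD(4)[OF T_df])
  have "T j k t \<le> measure (interval_measure (T j k)) UNIV" for k
    by (rule tendsto_lowerbound[OF T_at_top])
       (auto simp: eventually_at_top_linorder intro!: exI[of _ t] finite_dfD(1)[OF T_df])
  then have "sojourn_df T j t \<le> (\<Sum>k\<in>UNIV. measure (interval_measure (T j k)) UNIV)"
    unfolding sojourn_df_def by (rule sum_mono)
  then show "sojourn_df T j t \<le> 1" by (simp add: T_UNIV_sum)
qed

section \<open>Limits for weighted observables\<close>

context catastrophe_process
begin

lemma transform_eq_observed:
  "transform_with_catastrophes M E \<tau> R Z n m s1 s2 t l =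
    (\<integral>\<omega>. observed (weighted_observable (\<lambda>n' m'. if n' = n \<and> m' = m then 1 else 0) s1 s2 l) t \<omega> \<partial>M)"
  unfolding transform_with_catastrophes_def catastrophe_observable_def[abs_def] observed_def[abs_def]
    queue_observable_eq_weighted by simp

lemma observed_measurable:
  assumes g: "(\<lambda>p. g (fst p) (snd p)) \<in> borel_measurable (queue_space \<Otimes>\<^sub>M borel)"
  shows "observed g t \<in> borel_measurable M"
proof -
  have "(\<lambda>\<omega>. g (Z (n, j) \<omega>) (t - S n \<omega>)) \<in> borel_measurable M" for n j
    using measurable_compose[OF _ g, of "\<lambda>\<omega>. (Z (n, j) \<omega>, t - S n \<omega>)" M] by simp
  then have "(\<lambda>\<omega>. g (Z (n, E n \<omega>) \<omega>) (t - S n \<omega>)) \<in> borel_measurable M" for n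
    by (intro measurable_compose_countable[where f = "\<lambda>j \<omega>. g (Z (n, j) \<omega>) (t - S n \<omega>)" and g = "E n"]) auto
  then have [measurable]: "(\<lambda>\<omega>. g (Z (LEAST \<nu>. operating E \<tau> R t \<omega> \<nu>, E (LEAST \<nu>. operating E \<tau> R t \<omega> \<nu>) \<omega>) \<omega>)
      (t - S (LEAST \<nu>. operating E \<tau> R t \<omega> \<nu>) \<omega>)) \<in> borel_measurable M"
    by (rule measurable_compose_countable[where f = "\<lambda>n \<omega>. g (Z (n, E n \<omega>) \<omega>) (t - S n \<omega>)"]) measurable
  show ?thesis unfolding observed_def[abs_def] Let_def by measurable
qed

text \<open>At most one queue is in operation, so a single pair of count vectors is seen, and it
  does not depend on the weight.\<close>

lemma observed_linear:
  "\<exists>n m y. \<forall>c. observed (weighted_observable c s1 s2 l) t \<omega> = c n m * y"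
proof (cases "\<exists>\<nu>. operating E \<tau> R t \<omega> \<nu>")
  case True
  define \<nu> where "\<nu> = (LEAST \<nu>. operating E \<tau> R t \<omega> \<nu>)"
  let ?z = "Z (\<nu>, E \<nu> \<omega>) \<omega>" and ?u = "t - S \<nu> \<omega>"
  have "observed (weighted_observable c s1 s2 l) t \<omega> = weighted_observable c s1 s2 l ?z ?u" for c
    using True by (simp add: observed_def \<nu>_def Let_def)
  then show ?thesis
    by (intro exI[of _ "in_service_count ?z ?u"] exI[of _ "served_count ?z ?u"]
        exI[of _ "weighted_observable (\<lambda>_ _. 1) s1 s2 l ?z ?u"]) (simp add: weighted_observable_def)
qed (auto simp: observed_def intro: exI[of _ 0])

lemma AE_observed_bound:
  assumes A: "\<And>j. valid_queue_model nph (\<A> j)" and k: "k0 \<in> phases nph"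
    and s: "\<And>a. 0 \<le> s1 $ a" "\<And>a. 0 \<le> s2 $ a"
  shows "AE \<omega> in M. \<bar>observed (weighted_observable (\<lambda>_ _. 1) s1 s2 l) t \<omega>\<bar> \<le> 1"
proof -
  have "AE \<omega> in M. regular_path (Z (n, j) \<omega>)" for n j
    by (rule AE_regular_path[OF _ A k]) (use process in \<open>auto simp: queue_with_catastrophes_def\<close>)
  then have "AE \<omega> in M. \<forall>j\<in>UNIV. \<forall>n. regular_path (Z (n, j) \<omega>)"
    by (subst AE_finite_all) (auto simp: AE_all_countable)
  then show ?thesis
  proof eventually_elim
    case (elim \<omega>)
    have "weighted_observable (\<lambda>_ _. 1) s1 s2 l (Z (n, j) \<omega>) u \<le> 1" for n j u
      by (rule weighted_observable_le_1) (use elim s in auto)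
    moreover have "0 \<le> weighted_observable (\<lambda>_ _. 1) s1 s2 l z u" for z :: "('r, 'd) queue_path" and u
      by (simp add: weighted_observable_def)
    ultimately show ?case by (simp add: observed_def Let_def abs_of_nonneg)
  qed
qed

text \<open>The limit is for a fixed initial environment state, on which its value does not depend.
  The bounds on \<open>f\<close> are exported too, since they give integrability and cover the case
  of a vanishing mean.\<close>

theorem weighted_limit:
  fixes c :: "('r \<Rightarrow> nat) \<Rightarrow> ('r \<Rightarrow> nat) \<Rightarrow> real" and s1 s2 :: "real ^ 'd" and l :: "'r \<Rightarrow> nat"
  assumes A: "\<And>j. valid_queue_model nph (\<A> j)" and k: "k0 \<in> phases nph"
    and law: "\<And>n j. queue_law n j = \<Lambda> j" and reg: "\<And>j. AE z in \<Lambda> j. regular_path z"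
    and \<rho>: "\<And>j. \<rho> j = (\<Sum>k\<in>UNIV. P k j * \<rho> k)" "(\<Sum>j\<in>UNIV. \<rho> j) = 1"
    and wint: "\<And>j. integrable lborel (wr j)"
    and c: "\<And>n m. 0 \<le> c n m" "\<And>n m. c n m \<le> 1"
    and s: "\<And>a. 0 \<le> s1 $ a" "\<And>a. 0 \<le> s2 $ a"
  defines "f \<equiv> \<lambda>j u. indicator {0..} u * ((1 - sojourn_df T j u) * (\<integral>z. weighted_observable c s1 s2 l z u \<partial>\<Lambda> j))"
  shows "((\<lambda>t. \<integral>\<omega>. observed (weighted_observable c s1 s2 l) t \<omega> \<partial>M) \<longlongrightarrow>
      (\<Sum>j\<in>UNIV. \<rho> j * (\<integral>u. f j u \<partial>lborel)) / (\<Sum>j\<in>UNIV. \<rho> j * (\<integral>u. wr j u \<partial>lborel))) at_top"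
    and "\<And>j u. 0 \<le> f j u" "\<And>j u. f j u \<le> wr j u" "\<And>j. f j \<in> borel_measurable borel"
proof -
  have ps: "prob_space (\<Lambda> j)" and sL[measurable_cong]: "sets (\<Lambda> j) = sets queue_space" for j
    using prob_space_queue_law[of 0 j] sets_queue_law[of 0 j] law by simp_all
  define h where "h j u = (\<integral>z. weighted_observable c s1 s2 l z u \<partial>\<Lambda> j)" for j u
  have w0: "0 \<le> weighted_observable c s1 s2 l z u" for z :: "('r, 'd) queue_path" and u
    using c by (simp add: weighted_observable_def)
  have w1: "AE z in \<Lambda> j. weighted_observable c s1 s2 l z u \<le> 1" for j u
    using reg[of j] by eventually_elim (rule weighted_observable_le_1[OF _ c s])
  have wm: "(\<lambda>z. weighted_observable c s1 s2 l z u) \<in> borel_measurable (\<Lambda> j)" for j u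
  proof -
    have "(\<lambda>z. (z, u)) \<in> measurable (\<Lambda> j) (queue_space \<Otimes>\<^sub>M borel)" by measurable
    from measurable_compose[OF this weighted_observable_measurable[of c s1 s2 l]] show ?thesis by simp
  qed
  have h01: "0 \<le> h j u" "h j u \<le> 1" and hnn: "(\<integral>\<^sup>+z. ennreal (weighted_observable c s1 s2 l z u) \<partial>\<Lambda> j) = ennreal (h j u)" for j u
  proof -
    interpret L: prob_space "\<Lambda> j" by (rule ps)
    have int: "integrable (\<Lambda> j) (\<lambda>z. weighted_observable c s1 s2 l z u)"
    proof (rule L.integrable_const_bound[where B = 1])
      show "AE z in \<Lambda> j. norm (weighted_observable c s1 s2 l z u) \<le> 1"
        using w1 by eventually_elim (simp add: w0)
    qed (rule wm)
    show "0 \<le> h j u" unfolding h_def by (rule Bochner_Integration.integral_nonneg) (rule w0)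
    show "h j u \<le> 1" unfolding h_def by (rule L.integral_le_const[OF int w1])
    show "(\<integral>\<^sup>+z. ennreal (weighted_observable c s1 s2 l z u) \<partial>\<Lambda> j) = ennreal (h j u)"
      unfolding h_def by (rule nn_integral_eq_integral[OF int]) (simp add: w0)
  qed
  have hm[measurable]: "h j \<in> borel_measurable borel" for j
  proof -
    interpret L: prob_space "\<Lambda> j" by (rule ps)
    have "(\<lambda>p. (snd p, fst p)) \<in> measurable (borel \<Otimes>\<^sub>M \<Lambda> j) (queue_space \<Otimes>\<^sub>M borel)" by measurable
    from measurable_compose[OF this weighted_observable_measurable[of c s1 s2 l]]
    have "(\<lambda>p. weighted_observable c s1 s2 l (snd p) (fst p)) \<in> borel_measurable (borel \<Otimes>\<^sub>M \<Lambda> j)" by simp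
    note [measurable] = this
    show ?thesis unfolding h_def[abs_def] by (rule L.borel_measurable_lebesgue_integral) (simp add: case_prod_beta)
  qed
  have f_eq: "f j u = indicator {0..} u * ((1 - sojourn_df T j u) * h j u)" for j u by (simp add: f_def h_def)
  have Fm[measurable]: "sojourn_df T j \<in> borel_measurable borel" for j
    by (rule borel_measurable_mono[OF sojourn_df_facts(1)])
  show f0: "0 \<le> f j u" for j u
    unfolding f_eq using h01 sojourn_df_facts(3)[of j u] by simp
  show fw: "f j u \<le> wr j u" for j u
  proof -
    have "(\<Sum>k\<in>UNIV. Q j k u) \<le> sojourn_df T j u"
      unfolding sojourn_df_def by (intro sum_mono Q_le_T)
    moreover have "(1 - sojourn_df T j u) * h j u \<le> 1 - sojourn_df T j u"
      using h01[of j u] sojourn_df_facts(3)[of j u] by (intro mult_left_le) auto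
    ultimately have "(1 - sojourn_df T j u) * h j u \<le> 1 - (\<Sum>k\<in>UNIV. Q j k u)" by linarith
    then show ?thesis unfolding f_eq wr_eq by (intro mult_left_mono) (auto simp: indicator_def)
  qed
  show fm: "f j \<in> borel_measurable borel" for j
    unfolding f_eq[abs_def] by measurable
  \<comment> \<open>Three sources of discontinuity are discarded: the null set for the expectation
    \<open>h\<close>, the countably many jumps of the sojourn distribution, and the cut at
    0.\<close>
  have fc: "AE u in lborel. isCont (f j) u" for j
  proof -
    have "AE u in lborel. isCont (h j) u"
      unfolding h_def[abs_def] by (rule AE_isCont_expectation[OF ps sL reg c s])
    moreover have "AE u in lborel. u \<notin> {u. \<not> isCont (sojourn_df T j) u} \<union> {0}"
      by (intro AE_not_in countable_imp_null_set_lborel countable_Un mono_ctble_discont[OF sojourn_df_facts(1)]) simp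
    ultimately show ?thesis
    proof eventually_elim
      case (elim u)
      consider "0 < u" | "u < 0" using elim by fastforce
      then show ?case
      proof cases
        case 1
        have "eventually (\<lambda>v. f j v = (1 - sojourn_df T j v) * h j v) (nhds u)"
          using 1 by (intro eventually_nhds[THEN iffD2] exI[of _ "{0<..}"]) (auto simp: f_eq)
        moreover have "isCont (\<lambda>v. (1 - sojourn_df T j v) * h j v) u"
          using elim by (intro continuous_intros) auto
        ultimately show ?thesis by (subst isCont_cong)
      next
        case 2
        have "eventually (\<lambda>v. f j v = 0) (nhds u)"
          using 2 by (intro eventually_nhds[THEN iffD2] exI[of _ "{..<0}"]) (auto simp: f_eq)
        then show ?thesis by (subst isCont_cong[where g = "\<lambda>_. 0"]) auto
      qed
    qed
  qed
  have "(\<integral>\<omega>. observed (weighted_observable c s1 s2 l) t \<omega> \<partial>M) = enn2real (V (\<lambda>j u. ennreal (f j u)) i0 t)" for t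
  proof -
    have "(\<integral>\<omega>. observed (weighted_observable c s1 s2 l) t \<omega> \<partial>M) = enn2real (\<integral>\<^sup>+\<omega>. ennreal (observed (weighted_observable c s1 s2 l) t \<omega>) \<partial>M)"
      by (rule integral_eq_nn_integral[OF observed_measurable[OF weighted_observable_measurable]])
         (auto simp: observed_def Let_def w0)
    also have "\<dots> = enn2real (V (\<lambda>j u. indicator {0..} u * (\<Sum>k\<in>UNIV. emeasure (interval_measure (T j k)) {u<..}) * (\<integral>\<^sup>+z. ennreal (weighted_observable c s1 s2 l z u) \<partial>\<Lambda> j)) i0 t)"
      by (subst expectation_observed[OF weighted_observable_measurable law]) simp
    also have "(\<lambda>j u. indicator {0..} u * (\<Sum>k\<in>UNIV. emeasure (interval_measure (T j k)) {u<..}) * (\<integral>\<^sup>+z. ennreal (weighted_observable c s1 s2 l z u) \<partial>\<Lambda> j)) = (\<lambda>j u. ennreal (f j u))"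
      using h01 sojourn_df_facts(3)
      by (intro ext) (auto simp: emeasure_T_tail hnn f_eq indicator_def ennreal_mult)
    finally show ?thesis .
  qed
  then show "((\<lambda>t. \<integral>\<omega>. observed (weighted_observable c s1 s2 l) t \<omega> \<partial>M) \<longlongrightarrow>
      (\<Sum>j\<in>UNIV. \<rho> j * (\<integral>u. f j u \<partial>lborel)) / (\<Sum>j\<in>UNIV. \<rho> j * (\<integral>u. wr j u \<partial>lborel))) at_top"
    using markov_renewal_limit[OF \<rho> wint fm f0 fw fc, of i0] by simp
qed

end

lemma integrable_weighted_observable:
  fixes M :: "('r::finite, 'd::finite) queue_path measure" and c :: "('r \<Rightarrow> nat) \<Rightarrow> ('r \<Rightarrow> nat) \<Rightarrow> real" and s1 s2 :: "real ^ 'd"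
  assumes "prob_space M" and sets: "sets M = sets queue_space" and reg: "AE z in M. regular_path z"
    and c: "\<And>n m. \<bar>c n m\<bar> \<le> 1" and s: "\<And>a. 0 \<le> s1 $ a" "\<And>a. 0 \<le> s2 $ a"
  shows "integrable M (\<lambda>z. weighted_observable c s1 s2 l z u)"
proof -
  interpret prob_space M by fact
  note [measurable_cong] = sets
  have "(\<lambda>z. (z, u)) \<in> measurable M (queue_space \<Otimes>\<^sub>M borel)" by measurable
  from measurable_compose[OF this weighted_observable_measurable[of c s1 s2 l]]
  have meas: "(\<lambda>z. weighted_observable c s1 s2 l z u) \<in> borel_measurable M" by simp
  have "AE z in M. norm (weighted_observable c s1 s2 l z u) \<le> 1"
    using reg
  proof eventually_elim
    case (elim z)
    have "norm (weighted_observable c s1 s2 l z u) = weighted_observable (\<lambda>n m. \<bar>c n m\<bar>) s1 s2 l z u"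
      by (simp add: weighted_observable_def abs_mult)
    also have "\<dots> \<le> 1" by (rule weighted_observable_le_1[OF elim _ _ s]) (use c in auto)
    finally show ?case .
  qed
  then show ?thesis by (intro integrable_const_bound[OF _ meas])
qed

lemma weighted_observable_diff:
  "weighted_observable (\<lambda>n m. c n m - c' n m) s1 s2 l z t
     = weighted_observable c s1 s2 l z t - weighted_observable c' s1 s2 l z t"
  by (simp add: weighted_observable_def algebra_simps)

lemma regular_path_measurable: "{z \<in> space queue_space. regular_path z} \<in> sets queue_space"
proof -
  \<comment> \<open>Integer thresholds turn divergence into countably many conditions.\<close>
  have lim: "filterlim f at_top sequentially \<longleftrightarrow> (\<forall>K::nat. \<exists>N::nat. \<forall>n. N \<le> n \<longrightarrow> real K \<le> f n)" for f :: "nat \<Rightarrow> real"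
  proof
    assume "filterlim f at_top sequentially"
    then show "\<forall>K::nat. \<exists>N::nat. \<forall>n. N \<le> n \<longrightarrow> real K \<le> f n"
      by (auto simp: filterlim_at_top eventually_sequentially)
  next
    assume *: "\<forall>K::nat. \<exists>N::nat. \<forall>n. N \<le> n \<longrightarrow> real K \<le> f n"
    show "filterlim f at_top sequentially"
      unfolding filterlim_at_top
    proof
      fix x
      obtain K :: nat where K: "x \<le> real K" using real_arch_simple by blast
      obtain N where "\<forall>n. N \<le> n \<longrightarrow> real K \<le> f n" using * by blast
      then show "\<forall>\<^sub>F n in sequentially. x \<le> f n"
        using K unfolding eventually_sequentially by (intro exI[of _ N]) (auto intro: order_trans)
    qed
  qed
  have id: "(\<lambda>z. z) \<in> measurable queue_space queue_space" by simp
  have [measurable]: "(\<lambda>x::real ^ 'd. x $ a) \<in> borel_measurable borel" for a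
    by (intro borel_measurable_continuous_onI continuous_intros)
  note [measurable] = path_components(3)[OF id] mark_components[OF id]
  show ?thesis unfolding regular_path_def lim by measurable
qed

text \<open>The initial state and phase select the measure \<open>P i k\<close>, so one family of
  random elements serves all initial conditions; \<open>k\<close> is the row and \<open>l\<close>
  the column of the matrices. The assumption \<open>finite_mean\<close> makes the tails integrable,
  and \<open>nonlattice\<close> excludes periodic behaviour in \<open>t\<close>.\<close>

theorem theorem5:
  fixes T :: "'s::finite \<Rightarrow> 's \<Rightarrow> real \<Rightarrow> real"
    and U :: "'s \<Rightarrow> real \<Rightarrow> real"
    and Q :: "'s \<Rightarrow> 's \<Rightarrow> real \<Rightarrow> real"
    and F :: "'s \<Rightarrow> real \<Rightarrow> real"
    and p0 \<eta> \<rho> q :: "'s \<Rightarrow> real"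
    and p :: "'s \<Rightarrow> 's \<Rightarrow> real"
    and nph :: "'r::finite \<Rightarrow> nat"
    and A :: "'s \<Rightarrow> ('r, 'd::finite) queue_model"
    and P :: "'s \<Rightarrow> ('r \<Rightarrow> nat) \<Rightarrow> 'w measure"
    and E :: "nat \<Rightarrow> 'w \<Rightarrow> 's"
    and \<tau> :: "nat \<Rightarrow> 'w \<Rightarrow> real"
    and V :: "nat \<times> 's \<Rightarrow> 'w \<Rightarrow> real"
    and Z :: "nat \<times> 's \<Rightarrow> 'w \<Rightarrow> ('r, 'd) queue_path"
    and Pbar :: "'s \<Rightarrow> ('r \<Rightarrow> nat) \<Rightarrow> 'v measure"
    and Zbar :: "'v \<Rightarrow> ('r, 'd) queue_path"
  assumes T: "semi_markov_matrix T" "irreducible_semi_markov T"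
    and p0: "\<And>i. 0 \<le> p0 i" "(\<Sum>i\<in>UNIV. p0 i) = 1"
    and U: "\<And>j. distribution_function (U j)"
           "\<And>j. integrable (interval_measure (U j)) (\<lambda>x. x)"
    and A: "\<And>i. valid_queue_model nph (A i)"
    and Q: "\<And>i j. Q i j = repair_kernel T U i j"
    and F: "\<And>j. F j = sojourn_df T j"
    and p: "\<And>r i. (Q r i \<longlongrightarrow> p r i) at_top"
    and \<rho>: "\<And>i. \<rho> i = (\<Sum>r\<in>UNIV. p r i * \<rho> r)" "(\<Sum>r\<in>UNIV. \<rho> r) = 1"
    and \<eta>: "\<And>i. \<eta> i = (LBINT u:{0..}. 1 - (\<Sum>j\<in>UNIV. Q i j u))"
    and q: "\<And>i. q i = \<eta> i * \<rho> i / (\<Sum>r\<in>UNIV. \<eta> r * \<rho> r)"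
    and finite_mean: "\<And>i. set_integrable lborel {0..} (\<lambda>u. 1 - (\<Sum>j\<in>UNIV. Q i j u))"
    and nonlattice: "nonlattice_kernel Q"
    and with_catastrophes:
      "\<And>i k. k \<in> phases nph \<Longrightarrow> queue_with_catastrophes (P i k) T U nph A i k E \<tau> V Z"
    and without_catastrophes:
      "\<And>i k. k \<in> phases nph \<Longrightarrow> queue_without_catastrophes (Pbar i k) nph (A i) k Zbar"
  shows "(\<Sum>r\<in>UNIV. q r) = 1 \<and>
    (\<forall>k\<in>phases nph. \<forall>l\<in>phases nph. \<forall>s1 s2. (\<forall>a. 0 \<le> s1 $ a \<and> 0 \<le> s2 $ a) \<longrightarrow>
      (\<forall>n m.
        ((\<lambda>t. \<Sum>i\<in>UNIV. p0 i * transform_with_catastrophes (P i k) E \<tau> V Z n m s1 s2 t l)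
          \<longlongrightarrow> (\<Sum>j\<in>UNIV. q j / \<eta> j *
                (LBINT u:{0..}. (1 - F j u) *
                   transform_without_catastrophes (Pbar j k) Zbar n m s1 s2 u l))) at_top) \<and>
      (\<forall>z1 z2. (\<forall>r. norm (z1 r) \<le> 1 \<and> norm (z2 r) \<le> 1) \<longrightarrow>
        ((\<lambda>t. \<Sum>i\<in>UNIV. complex_of_real (p0 i) *
             generating_function
               (\<lambda>n m. transform_with_catastrophes (P i k) E \<tau> V Z n m s1 s2 t l) z1 z2)
          \<longlongrightarrow> (\<Sum>j\<in>UNIV. complex_of_real (q j / \<eta> j) *
                (LBINT u:{0..}. complex_of_real (1 - F j u) *
                   generating_function
                     (\<lambda>n m. transform_without_catastrophes (Pbar j k) Zbar n m s1 s2 u l) z1 z2)))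
          at_top))"
proof -
  interpret R: semi_markov_repair T U Q
    by standard (use T U(1) Q nonlattice in auto)
  have p_eq: "measure (interval_measure (Q r i)) UNIV = p r i" for r i
    by (rule tendsto_unique[OF _ R.Q_at_top p]) simp
  have \<rho>': "\<rho> j = (\<Sum>k\<in>UNIV. measure (interval_measure (Q k j)) UNIV * \<rho> k)" for j
    unfolding p_eq by (rule \<rho>(1))
  have \<rho>_pos: "0 < \<rho> j" for j
    by (rule stationary_pos[OF measure_nonneg R.P_sum R.P_irreducible \<rho>' \<rho>(2)])
  have wr_set: "R.wr i = (\<lambda>u. indicator {0..} u *\<^sub>R (1 - (\<Sum>j\<in>UNIV. Q i j u)))" for i
    by (auto simp: R.wr_eq)
  have wint: "integrable lborel (R.wr i)" for i
    using finite_mean[of i] unfolding set_integrable_def wr_set .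
  have \<eta>_wr: "\<eta> i = (\<integral>u. R.wr i u \<partial>lborel)" for i
    unfolding \<eta> set_lebesgue_integral_def wr_set ..
  define W where "W = (\<Sum>r\<in>UNIV. \<eta> r * \<rho> r)"
  have W: "W = (\<Sum>j\<in>UNIV. \<rho> j * (\<integral>u. R.wr j u \<partial>lborel))"
    unfolding W_def \<eta>_wr by (simp add: mult.commute)
  have W_pos: "0 < W" unfolding W by (rule R.W_pos[OF \<rho>_pos wint])
  have q_sum: "(\<Sum>r\<in>UNIV. q r) = 1"
    using W_pos unfolding q W_def[symmetric] sum_divide_distrib[symmetric] by simp
  text \<open>If \<open>\<eta> j = 0\<close> then \<open>q j / \<eta> j\<close> is the junk value \<open>0\<close>, but then the integral vanishes as well.\<close>
  have coefficient: "\<rho> j / W * I = q j / \<eta> j * I" if "\<eta> j = 0 \<longrightarrow> I = 0" for j I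
    using that by (cases "\<eta> j = 0") (simp_all add: q W_def[symmetric])
  have limits: "(\<forall>n m.
        ((\<lambda>t. \<Sum>i\<in>UNIV. p0 i * transform_with_catastrophes (P i k) E \<tau> V Z n m s1 s2 t l)
          \<longlongrightarrow> (\<Sum>j\<in>UNIV. q j / \<eta> j *
                (LBINT u:{0..}. (1 - F j u) *
                   transform_without_catastrophes (Pbar j k) Zbar n m s1 s2 u l))) at_top) \<and>
      (\<forall>z1 z2. (\<forall>r. norm (z1 r) \<le> 1 \<and> norm (z2 r) \<le> 1) \<longrightarrow>
        ((\<lambda>t. \<Sum>i\<in>UNIV. complex_of_real (p0 i) *
             generating_function
               (\<lambda>n m. transform_with_catastrophes (P i k) E \<tau> V Z n m s1 s2 t l) z1 z2)
          \<longlongrightarrow> (\<Sum>j\<in>UNIV. complex_of_real (q j / \<eta> j) *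
                (LBINT u:{0..}. complex_of_real (1 - F j u) *
                   generating_function
                     (\<lambda>n m. transform_without_catastrophes (Pbar j k) Zbar n m s1 s2 u l) z1 z2)))
          at_top)"
    if k: "k \<in> phases nph" and s: "\<And>a. 0 \<le> s1 $ a" "\<And>a. 0 \<le> s2 $ a"
    for k l :: "'r \<Rightarrow> nat" and s1 s2 :: "real ^ 'd"
  proof -
    \<comment> \<open>One interpretation for all initial states at once, since the limit mixes them
      with the weights \<open>p0\<close>.\<close>
    interpret C: catastrophe_process T U Q "P i k" nph A i k E \<tau> V Z for i
      by (intro catastrophe_process.intro R.semi_markov_repair_axioms catastrophe_process_axioms.intro with_catastrophes[OF k])
    let ?g = "\<lambda>c. weighted_observable c s1 s2 l"
    define \<Lambda> where "\<Lambda> j = distr (Pbar j k) queue_space Zbar" for j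
    \<comment> \<open>Every copy, in every period and for every initial state, has the law of the
      reference queue for its environment state. This is where the transforms without catastrophes
      enter the limit.\<close>
    have law: "C.queue_law i n j = \<Lambda> j" for i n j
      unfolding C.queue_law_def \<Lambda>_def
      by (rule queue_law_unique[OF _ without_catastrophes[OF k] A k])
        (use with_catastrophes[OF k, of i] in \<open>auto simp: queue_with_catastrophes_def\<close>)
    have Zm[measurable]: "Zbar \<in> measurable (Pbar j k) queue_space" for j
      by (rule queue_Z_measurable[OF without_catastrophes[OF k] A k])
    have Pbar: "prob_space (Pbar j k)" for j
      using without_catastrophes[OF k] by (simp add: queue_without_catastrophes_def)
    have \<Lambda>_prob: "prob_space (\<Lambda> j)" for j
      unfolding \<Lambda>_def by (rule prob_space.prob_space_distr[OF Pbar Zm])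
    have \<Lambda>_sets: "sets (\<Lambda> j) = sets queue_space" for j by (simp add: \<Lambda>_def)
    have regbar: "AE \<omega> in Pbar j k. regular_path (Zbar \<omega>)" for j
      by (rule AE_regular_path[OF without_catastrophes[OF k] A k])
    have reg: "AE z in \<Lambda> j. regular_path z" for j
      unfolding \<Lambda>_def by (subst AE_distr_iff[OF Zm regular_path_measurable]) (rule regbar)
    have gm: "(\<lambda>z. ?g c z u) \<in> borel_measurable queue_space" for c u
    proof -
      have "(\<lambda>z. (z, u)) \<in> measurable queue_space (queue_space \<Otimes>\<^sub>M borel)" by measurable
      from measurable_compose[OF this weighted_observable_measurable[of c s1 s2 l]] show ?thesis by simp
    qed
    define h where "h c j u = (\<integral>\<omega>. ?g c (Zbar \<omega>) u \<partial>Pbar j k)" for c j u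
    have h_\<Lambda>: "(\<integral>z. ?g c z u \<partial>\<Lambda> j) = h c j u" for c j u
      unfolding \<Lambda>_def h_def by (rule integral_distr[OF Zm gm])
    define f where "f c j u = indicator {0..} u * ((1 - F j u) * h c j u)" for c j u
    define D where "D c t = (\<Sum>i\<in>UNIV. p0 i * (\<integral>\<omega>. C.observed (?g c) t \<omega> \<partial>P i k))" for c t
    define L where "L c = (\<Sum>j\<in>UNIV. q j / \<eta> j * (\<integral>u. f c j u \<partial>lborel))" for c

    have nonneg_weight: "(D c \<longlongrightarrow> L c) at_top" "\<And>j. integrable lborel (f c j)"
      if c: "\<And>n m. 0 \<le> c n m" "\<And>n m. c n m \<le> 1" for c
    proof -
      note lim = C.weighted_limit[where c = c and l = l, OF A k law reg \<rho>' \<rho>(2) wint c s, unfolded h_\<Lambda> F[symmetric] f_def[symmetric] W[symmetric]]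
      have f: "0 \<le> f c j u" "f c j u \<le> R.wr j u" "f c j \<in> borel_measurable borel" for j u
        using lim(2-4) unfolding f_def .
      show int: "integrable lborel (f c j)" for j
        by (rule Bochner_Integration.integrable_bound[OF wint[of j]]) (use f R.wr_nonneg in auto)
      have zero: "\<eta> j = 0 \<longrightarrow> (\<integral>u. f c j u \<partial>lborel) = 0" for j
      proof
        assume "\<eta> j = 0"
        then have "(\<integral>u. f c j u \<partial>lborel) \<le> 0"
          using integral_mono[OF int wint f(2), of j] by (simp add: \<eta>_wr)
        moreover have "0 \<le> (\<integral>u. f c j u \<partial>lborel)" using f(1) by simp
        ultimately show "(\<integral>u. f c j u \<partial>lborel) = 0" by linarith
      qed
      \<comment> \<open>The limit is the same for each initial state \<open>i\<close>, so averaging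
        with \<open>p0\<close>, which sums to 1, leaves it unchanged.\<close>
      have "(D c \<longlongrightarrow> (\<Sum>i\<in>UNIV. p0 i * ((\<Sum>j\<in>UNIV. \<rho> j * (\<integral>u. f c j u \<partial>lborel)) / W))) at_top"
        unfolding D_def[abs_def] by (intro tendsto_intros lim(1))
      also have "(\<Sum>i\<in>UNIV. p0 i * ((\<Sum>j\<in>UNIV. \<rho> j * (\<integral>u. f c j u \<partial>lborel)) / W)) = L c"
        unfolding sum_distrib_right[symmetric] p0(2) L_def
        by (simp only: coefficient[OF zero, symmetric]) (simp add: sum_divide_distrib)
      finally show "(D c \<longlongrightarrow> L c) at_top" .
    qed

    \<comment> \<open>The renewal theorem concerns nonnegative functions, whereas real and imaginary
      parts of the monomials change sign. Positive and negative parts are treated separately; both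
      have values between 0 and 1.\<close>
    have weight: "(D c \<longlongrightarrow> L c) at_top" "\<And>j. integrable lborel (f c j)"
      if c: "\<And>n m. \<bar>c n m\<bar> \<le> 1" for c
    proof -
      let ?p = "\<lambda>n m. max 0 (c n m)" and ?n = "\<lambda>n m. max 0 (- c n m)"
      have pn: "c = (\<lambda>n m. ?p n m - ?n n m)" by (auto intro!: ext)
      have bounds: "0 \<le> ?p n m" "?p n m \<le> 1" "0 \<le> ?n n m" "?n n m \<le> 1"
        "\<bar>?p n m\<bar> \<le> 1" "\<bar>?n n m\<bar> \<le> 1" for n m
        using c[of n m] by auto
      have h: "h c j u = h ?p j u - h ?n j u" for j u
        unfolding h_\<Lambda>[symmetric]
        by (subst pn, unfold weighted_observable_diff)
          (intro Bochner_Integration.integral_diff integrable_weighted_observable[OF \<Lambda>_prob \<Lambda>_sets reg _ s] bounds)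
      have f: "f c j u = f ?p j u - f ?n j u" for j u
        unfolding f_def h by (simp add: algebra_simps)
      note int = nonneg_weight(2)[OF bounds(1,2)] nonneg_weight(2)[OF bounds(3,4)]
      show "integrable lborel (f c j)" for j
        unfolding f[abs_def] by (intro Bochner_Integration.integrable_diff int)
      have L: "L c = L ?p - L ?n"
        unfolding L_def f by (simp add: Bochner_Integration.integral_diff[OF int] right_diff_distrib sum_subtractf)
      \<comment> \<open>Integrability is required to split the expectation; it holds because a
        weight bounded by 1 only scales the bounded observable of weight 1.\<close>
      have obs: "integrable (P i k) (C.observed (?g c) t)" if c: "\<And>n m. \<bar>c n m\<bar> \<le> 1" for c i t
      proof (rule C.integrable_const_bound[where B = 1])
        show "AE \<omega> in P i k. norm (C.observed (?g c) t \<omega>) \<le> 1"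
          using C.AE_observed_bound[OF A k s, where i = i and l = l and t = t]
        proof eventually_elim
          case (elim \<omega>)
          obtain n m y where y: "\<And>c. C.observed (?g c) t \<omega> = c n m * y" using C.observed_linear by blast
          have "\<bar>c n m\<bar> * \<bar>y\<bar> \<le> 1 * 1" using c elim y by (intro mult_mono) auto
          then show ?case by (simp add: y abs_mult)
        qed
      qed (rule C.observed_measurable[OF weighted_observable_measurable])
      have "(\<integral>\<omega>. C.observed (?g c) t \<omega> \<partial>P i k)
          = (\<integral>\<omega>. C.observed (?g ?p) t \<omega> \<partial>P i k) - (\<integral>\<omega>. C.observed (?g ?n) t \<omega> \<partial>P i k)" for i t
      proof -
        have "C.observed (?g c) t \<omega> = C.observed (?g ?p) t \<omega> - C.observed (?g ?n) t \<omega>" for \<omega>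
          by (subst pn) (simp add: C.observed_def weighted_observable_diff Let_def)
        then show ?thesis
          using Bochner_Integration.integral_diff[OF obs[OF bounds(5)] obs[OF bounds(6)]] by simp
      qed
      then have D: "D c t = D ?p t - D ?n t" for t
        unfolding D_def by (simp add: right_diff_distrib sum_subtractf)
      show "(D c \<longlongrightarrow> L c) at_top"
        unfolding D[abs_def] L by (intro tendsto_diff nonneg_weight(1) bounds)
    qed

    show ?thesis
    proof (intro conjI allI impI)
      fix n m :: "'r \<Rightarrow> nat"
      let ?c = "\<lambda>n' m'. if n' = n \<and> m' = m then 1 else 0 :: real"
      have "(D ?c \<longlongrightarrow> L ?c) at_top" by (rule weight(1)) simp
      then show "((\<lambda>t. \<Sum>i\<in>UNIV. p0 i * transform_with_catastrophes (P i k) E \<tau> V Z n m s1 s2 t l)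
          \<longlongrightarrow> (\<Sum>j\<in>UNIV. q j / \<eta> j *
                (LBINT u:{0..}. (1 - F j u) *
                   transform_without_catastrophes (Pbar j k) Zbar n m s1 s2 u l))) at_top"
        unfolding D_def[abs_def] L_def C.transform_eq_observed f_def h_def
          queue_observable_eq_weighted transform_without_catastrophes_def
          set_lebesgue_integral_def real_scaleR_def .
    next
      fix z1 z2 :: "'r \<Rightarrow> complex"
      assume z: "\<forall>r. norm (z1 r) \<le> 1 \<and> norm (z2 r) \<le> 1"
      let ?re = "\<lambda>n m. Re (multi_power z1 n * multi_power z2 m)"
      let ?im = "\<lambda>n m. Im (multi_power z1 n * multi_power z2 m)"
      have norm: "norm (multi_power z1 n * multi_power z2 m) \<le> 1" for n m
        unfolding norm_mult using multi_power_norm_le_1[of z1] multi_power_norm_le_1[of z2] z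
        by (intro mult_le_one) auto
      have re: "\<bar>?re n m\<bar> \<le> 1" and im: "\<bar>?im n m\<bar> \<le> 1" for n m
        using norm[of n m] abs_Re_le_cmod[of "multi_power z1 n * multi_power z2 m"]
          abs_Im_le_cmod[of "multi_power z1 n * multi_power z2 m"] by linarith+
      have "generating_function (\<lambda>n m. transform_with_catastrophes (P i k) E \<tau> V Z n m s1 s2 t l) z1 z2
          = complex_of_real (\<integral>\<omega>. C.observed (?g ?re) t \<omega> \<partial>P i k)
            + \<i> * complex_of_real (\<integral>\<omega>. C.observed (?g ?im) t \<omega> \<partial>P i k)" for i t
        unfolding C.transform_eq_observed
        by (rule generating_function_expectation[where obs = "\<lambda>c. C.observed (?g c) t"])
          (use z in \<open>auto intro!: C.prob_space_axioms C.observed_measurable weighted_observable_measurable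
            C.observed_linear C.AE_observed_bound A k s\<close>)
      then have with_eq: "(\<Sum>i\<in>UNIV. complex_of_real (p0 i) *
             generating_function (\<lambda>n m. transform_with_catastrophes (P i k) E \<tau> V Z n m s1 s2 t l) z1 z2)
          = complex_of_real (D ?re t) + \<i> * complex_of_real (D ?im t)" for t
        by (simp add: D_def sum.distrib sum_distrib_left algebra_simps)
      have without: "generating_function (\<lambda>n m. transform_without_catastrophes (Pbar j k) Zbar n m s1 s2 u l) z1 z2
          = complex_of_real (h ?re j u) + \<i> * complex_of_real (h ?im j u)" for j u
        unfolding transform_without_catastrophes_def queue_observable_eq_weighted h_def
      proof (rule generating_function_expectation[where obs = "\<lambda>c \<omega>. ?g c (Zbar \<omega>) u"])
        show "\<exists>n m y. \<forall>c. ?g c (Zbar \<omega>) u = c n m * y" for \<omega>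
          by (intro exI[of _ "in_service_count (Zbar \<omega>) u"] exI[of _ "served_count (Zbar \<omega>) u"]
              exI[of _ "?g (\<lambda>_ _. 1) (Zbar \<omega>) u"]) (simp add: weighted_observable_def)
        show "AE \<omega> in Pbar j k. \<bar>?g (\<lambda>_ _. 1) (Zbar \<omega>) u\<bar> \<le> 1"
          using regbar
        proof eventually_elim
          case (elim \<omega>)
          have "?g (\<lambda>_ _. 1) (Zbar \<omega>) u \<le> 1" by (rule weighted_observable_le_1[OF elim _ _ s]) auto
          then show ?case by (simp add: weighted_observable_def)
        qed
      qed (use z Pbar measurable_compose[OF Zm gm] in auto)
      have "(LBINT u:{0..}. complex_of_real (1 - F j u) *
                   generating_function (\<lambda>n m. transform_without_catastrophes (Pbar j k) Zbar n m s1 s2 u l) z1 z2)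
          = complex_of_real (\<integral>u. f ?re j u \<partial>lborel) + \<i> * complex_of_real (\<integral>u. f ?im j u \<partial>lborel)" for j
      proof -
        have "(LBINT u:{0..}. complex_of_real (1 - F j u) *
                   generating_function (\<lambda>n m. transform_without_catastrophes (Pbar j k) Zbar n m s1 s2 u l) z1 z2)
            = (\<integral>u. complex_of_real (f ?re j u) + \<i> * complex_of_real (f ?im j u) \<partial>lborel)"
          unfolding set_lebesgue_integral_def without f_def
          by (intro Bochner_Integration.integral_cong refl) (simp add: indicator_def algebra_simps)
        also have "\<dots> = (\<integral>u. complex_of_real (f ?re j u) \<partial>lborel) + \<i> * (\<integral>u. complex_of_real (f ?im j u) \<partial>lborel)"
          by (subst Bochner_Integration.integral_add)
            (intro integrable_mult_right integrable_of_real weight(2)[OF re] weight(2)[OF im]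
              | simp only: integral_mult_right_zero)+
        finally show ?thesis by simp
      qed
      then have without_eq: "(\<Sum>j\<in>UNIV. complex_of_real (q j / \<eta> j) *
                (LBINT u:{0..}. complex_of_real (1 - F j u) *
                   generating_function (\<lambda>n m. transform_without_catastrophes (Pbar j k) Zbar n m s1 s2 u l) z1 z2))
          = complex_of_real (L ?re) + \<i> * complex_of_real (L ?im)"
        by (simp add: L_def sum.distrib sum_distrib_left algebra_simps)
      show "((\<lambda>t. \<Sum>i\<in>UNIV. complex_of_real (p0 i) *
             generating_function
               (\<lambda>n m. transform_with_catastrophes (P i k) E \<tau> V Z n m s1 s2 t l) z1 z2)
          \<longlongrightarrow> (\<Sum>j\<in>UNIV. complex_of_real (q j / \<eta> j) *
                (LBINT u:{0..}. complex_of_real (1 - F j u) *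
                   generating_function
                     (\<lambda>n m. transform_without_catastrophes (Pbar j k) Zbar n m s1 s2 u l) z1 z2)))
          at_top"
        unfolding with_eq without_eq by (intro tendsto_intros weight(1) re im)
    qed
  qed
  show ?thesis using q_sum limits by blast
qed

end
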